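(* Let $\mathfrak g$ be a (complex) simple Lie algebra with Killing form $(\cdot,\cdot)$, $\mathfrak h\subset\mathfrak g$ a Cartan subalgebra with inclusion $i:\mathfrak h\to\mathfrak g$, and let $r$ be a classical dynamical $r$-matrix with spectral parameter associated with $\mathfrak h\subset\mathfrak g$. Equip $T^*\mathfrak h^*\times\mathfrak g^*$ with the product of the canonical cotangent symplectic structure on $T^*\mathfrak h^*$ and the plus Lie-Poisson structure on $\mathfrak g^*$, and equip $T\mathfrak h^*\times L\mathfrak g$ with the Lie-Poisson structure of the Lie algebroid $T^*\mathfrak h^*\times L\mathfrak g^*$ determined by the operator $R$ associated with $r$ (see context). Then the map $$\rho:T^*\mathfrak h^*\times\mathfrak g^*\to T\mathfrak h^*\times L\mathfrak g,\qquad (q,p,\xi)\mapsto\big(q,\,-i^*\xi,\,p+r_-^\#(q)\xi\big),\qquad q\in\mathfrak h^*,\ p\in\mathfrak h,\ \xi\in\mathfrak g^*,$$ (defined for $q$ at which $r$ is defined) is a Poisson map, where $r_-^\#(q):\mathfrak g^*\to L\mathfrak g$ is defined by $$\big((r_-^\#(q)\xi)(z),\eta\big)=\big(r(q,z),\eta\otimes\xi\big)\qquad\text{for all }\xi,\eta\in\mathfrak g^*.$$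
   Context: The Killing form is used to identify $\mathfrak g^*\cong\mathfrak g$, $\mathfrak h^*\cong\mathfrak h$, with $(a\otimes b,c\otimes d)=(a,c)(b,d)$ and $(a\otimes b,\xi\otimes1)=(a,\xi)b$. A classical dynamical $r$-matrix with spectral parameter associated with $\mathfrak h\subset\mathfrak g$ is a meromorphic function $r:\mathfrak h^*\times\mathbb C\to\mathfrak g\otimes\mathfrak g$ satisfying: (a) zero weight condition $[h\otimes1+1\otimes h,r(q,z)]=0$ for $h\in\mathfrak h$; (b) generalized unitarity $r^{12}(q,z)+r^{21}(q,-z)=0$; (c) residue condition $\mathrm{Res}_{z=0}r(q,z)=\Omega$, the Casimir element in $(S^2\mathfrak g)^{\mathfrak g}$ of the Killing form; (d) the classical dynamical Yang-Baxter equation $$\mathrm{Alt}(d_{\mathfrak h}r)+[r^{12}(q,z_{1,2}),r^{13}(q,z_{1,3})]+[r^{12}(q,z_{1,2}),r^{23}(q,z_{2,3})]+[r^{13}(q,z_{1,3}),r^{23}(q,z_{2,3})]=0,$$ with $z_{i,j}=z_i-z_j$ and $\mathrm{Alt}(d_{\mathfrak h}r)=\sum_i\big(h_i^{(1)}\partial_ir^{23}(q,z_{2,3})+h_i^{(2)}\partial_ir^{31}(q,z_{3,1})+h_i^{(3)}\partial_ir^{12}(q,z_{1,2})\big)$, where $(h_i)$ is an orthonormal basis of $\mathfrak h$ and $\partial_i$ the derivative along the corresponding coordinate of $q\in\mathfrak h^*\cong\mathfrak h$. $L\mathfrak g$ is the Lie algebra of Laurent series $\sum_{n\ge-N}\xi_nz^n$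 with coefficients in $\mathfrak g$ converging in some annulus $0<|z|<\epsilon$ (depending on the series). $L\mathfrak g^*$ (restricted dual) is the same with coefficients in $\mathfrak g^*$, paired with $L\mathfrak g$ by $\langle\xi,X\rangle=\frac1{2\pi i}\oint\langle\xi(z),X(z)\rangle dz$ over a small circle around $0$. $\mathfrak h\subset L\mathfrak g$ as constants, so there is also a restriction map $L\mathfrak g^*\to\mathfrak h^*$ (transpose of this inclusion), again denoted $i^*$; on $\mathfrak g^*$, $i^*:\mathfrak g^*\to\mathfrak h^*$ is the transpose of $i:\mathfrak h\to\mathfrak g$. For $x\in L\mathfrak g$, $\langle ad_x^*\xi,y\rangle=\langle\xi,[x,y]\rangle$. The operator $R:\mathfrak h^*\to\mathcal L(L\mathfrak g^*,L\mathfrak g)$ is $(R_q\xi)(z)=\mathrm{p.v.}\frac1{2\pi i}\oint_C(r(q,w-z),\xi(w)\otimes1)dw$, where $0<|z|<\frac12r_0$ ($r_0>0$ such that $r(q,\cdot)$ has no pole in $|z|<r_0$ other than $0$, and $|z|$ in the annulus of convergence of $\xi$), and $C$ is the positively oriented circle of radius $|z|$ centred at $0$. Lie algebroid $T^*\mathfrak h^*\times L\mathfrak g^*\to\mathfrak h^*$ (fibre $\mathfrak h\oplus L\mathfrak g^*$): anchor $a_*(q,p,\xi)=i^*\xi$; for constant sections $\xi,\eta\in L\mathfrak g^*$, constant 1-forms $h\in\mathfrak h$, and $\omega,\theta\in\Omega^1(\mathfrak h^* )$, $$[\omega,\theta]=0,\quad[h,\xi]=ad_h^*\xi,\quad[\xi,\eta]=d(R\xi,\eta)-ad^*_{R\xi}\eta+ad^*_{R\eta}\xi,$$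 where $d(R\xi,\eta)$ is the differential of $q\mapsto\langle\eta,R_q\xi\rangle$; extended by skew-symmetry and the Leibniz rule $[s,ft]=f[s,t]+(a_*(s)f)t$. Lie-Poisson structure on the dual bundle $T\mathfrak h^*\times L\mathfrak g$: with $l_s$ the fibrewise linear function given by a section $s$, $\{l_s,l_t\}=l_{[s,t]}$, $\{l_s,f\}=a_*(s)f$, $\{f,g\}=0$ for functions $f,g$ of $q$. $\rho$ being Poisson means $\{F\circ\rho,K\circ\rho\}=\{F,K\}\circ\rho$ for $F,K$ in the algebra generated by functions of $q$ and the $l_s$. Conventions on $T^*\mathfrak h^*\times\mathfrak g^*$: in coordinates $p_i,q_j$ with respect to an orthonormal basis of $\mathfrak h$, $\{p_i,q_j\}=\delta_{ij}$, $\{p_i,p_j\}=\{q_i,q_j\}=0$; for $x,y\in\mathfrak g$ viewed as linear functions on $\mathfrak g^*$, $\{x,y\}(\xi)=\langle\xi,[x,y]\rangle$; $p,q$ Poisson commute with functions on $\mathfrak g^*$. *)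

theory Defs
  imports "HOL-Complex_Analysis.Complex_Analysis"
begin

text \<open>
  The Lie algebra \<open>g\<close> has \<open>complex ^ 'n\<close> as underlying vector space (i.e. a linear basis
  \<open>axis a 1\<close> of \<open>g\<close> is chosen) and an arbitrary Lie bracket \<open>br\<close>. Throughout, \<open>g*\<close> is identified
  with \<open>g\<close> and \<open>h*\<close> with \<open>h\<close> by the Killing form; elements of \<open>h\<close> and \<open>h*\<close> are given by their
  coordinates in \<open>complex ^ 'l\<close> with respect to an orthonormal basis \<open>e\<close> of \<open>h\<close>.
\<close>

type_synonym 'n bracket = "complex ^ 'n \<Rightarrow> complex ^ 'n \<Rightarrow> complex ^ 'n"

definition lie_algebra :: "'n::finite bracket \<Rightarrow> bool" where
  "lie_algebra br \<longleftrightarrow>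
     (\<forall>x. Vector_Spaces.linear (*s) (*s) (br x)) \<and>
     (\<forall>y. Vector_Spaces.linear (*s) (*s) (\<lambda>x. br x y)) \<and>
     (\<forall>x. br x x = 0) \<and>
     (\<forall>x y z. br x (br y z) + br y (br z x) + br z (br x y) = 0)"

definition simple_lie_algebra :: "'n::finite bracket \<Rightarrow> bool" where
  "simple_lie_algebra br \<longleftrightarrow> lie_algebra br \<and> (\<exists>x y. br x y \<noteq> 0) \<and>
     (\<forall>I. vec.subspace I \<and> (\<forall>x. \<forall>y\<in>I. br x y \<in> I) \<longrightarrow> I = {0} \<or> I = UNIV)"

definition killing :: "'n::finite bracket \<Rightarrow> complex ^ 'n \<Rightarrow> complex ^ 'n \<Rightarrow> complex" where
  "killing br x y = trace (matrix (br x) ** matrix (br y))"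

text \<open>The definition of Cartan subalgebras of complex semisimple Lie algebras: a self-centralizing
  abelian subalgebra all of whose elements act diagonalizably in the adjoint representation.\<close>

definition cartan_subalgebra :: "'n::finite bracket \<Rightarrow> (complex ^ 'n) set \<Rightarrow> bool" where
  "cartan_subalgebra br h \<longleftrightarrow> vec.subspace h \<and>
     (\<forall>x\<in>h. \<forall>y\<in>h. br x y = 0) \<and>
     (\<forall>x. (\<forall>y\<in>h. br y x = 0) \<longrightarrow> x \<in> h) \<and>
     (\<forall>y\<in>h. vec.span {x. \<exists>c. br y x = c *s x} = UNIV)"

definition orthonormal_basis ::
  "'n::finite bracket \<Rightarrow> (complex ^ 'n) set \<Rightarrow> ('l::finite \<Rightarrow> complex ^ 'n) \<Rightarrow> bool" where
  "orthonormal_basis br h e \<longleftrightarrow>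
     (\<forall>i j. killing br (e i) (e j) = (if i = j then 1 else 0)) \<and> vec.span (range e) = h"

definition incl :: "('l::finite \<Rightarrow> complex ^ 'n) \<Rightarrow> complex ^ 'l \<Rightarrow> complex ^ 'n" where
  "incl e p = (\<Sum>i\<in>UNIV. p $ i *s e i)"

text \<open>The transpose \<open>i*\<close> of the inclusion: \<open>\<langle>i* \<xi>, e i\<rangle> = (\<xi>, e i)\<close>.\<close>

definition restr :: "'n::finite bracket \<Rightarrow> ('l::finite \<Rightarrow> complex ^ 'n) \<Rightarrow> complex ^ 'n \<Rightarrow> complex ^ 'l" where
  "restr br e \<xi> = (\<chi> i. killing br \<xi> (e i))"

text \<open>For open \<open>S\<close>: complex Frechet differentiability, where \<open>scl\<close> is the complex scalar
  multiplication of the domain.\<close>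

definition holomorphic_wrt ::
  "(complex \<Rightarrow> 'a \<Rightarrow> 'a) \<Rightarrow> ('a::real_normed_vector \<Rightarrow> complex) \<Rightarrow> 'a set \<Rightarrow> bool" where
  "holomorphic_wrt scl f S \<longleftrightarrow>
     (\<forall>x\<in>S. \<exists>f'. (f has_derivative f') (at x) \<and> (\<forall>c v. f' (scl c v) = c * f' v))"

definition scale2 :: "complex \<Rightarrow> (complex ^ 'l) \<times> complex \<Rightarrow> (complex ^ 'l) \<times> complex" where
  "scale2 c = (\<lambda>(q, z). (c *s q, c * z))"

definition scale3 ::
  "complex \<Rightarrow> (complex ^ 'l) \<times> (complex ^ 'l) \<times> (complex ^ 'n) \<Rightarrow> (complex ^ 'l) \<times> (complex ^ 'l) \<times> (complex ^ 'n)" where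
  "scale3 c = (\<lambda>(q, p, \<xi>). (c *s q, c *s p, c *s \<xi>))"

text \<open>Local quotients of holomorphic functions. The value of \<open>f\<close> where the denominator vanishes is
  unconstrained, so all identities between meromorphic functions are stated on regular points.\<close>

definition meromorphic_wrt ::
  "(complex \<Rightarrow> 'a \<Rightarrow> 'a) \<Rightarrow> ('a::real_normed_vector \<Rightarrow> complex) \<Rightarrow> bool" where
  "meromorphic_wrt scl f \<longleftrightarrow>
     (\<forall>x. \<exists>U N D. open U \<and> x \<in> U \<and> holomorphic_wrt scl N U \<and> holomorphic_wrt scl D U \<and>
        (\<forall>W. open W \<and> W \<subseteq> U \<and> W \<noteq> {} \<longrightarrow> (\<exists>y\<in>W. D y \<noteq> 0)) \<and>
        (\<forall>y\<in>U. D y \<noteq> 0 \<longrightarrow> f y = N y / D y))"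

definition pderiv_at :: "'l::finite \<Rightarrow> (complex ^ 'l \<Rightarrow> complex) \<Rightarrow> complex ^ 'l \<Rightarrow> complex" where
  "pderiv_at i f q = deriv (\<lambda>t. f (q + axis i t)) 0"

text \<open>\<open>T :: complex ^ 'n ^ 'n\<close> stands for the sum of \<open>T $ a $ b\<close> times \<open>axis a 1 \<otimes> axis b 1\<close>; elements
  of the triple tensor product are given by their coefficients as functions of three indices.\<close>

definition tpair :: "'n::finite bracket \<Rightarrow> complex ^ 'n ^ 'n \<Rightarrow> complex ^ 'n \<Rightarrow> complex ^ 'n \<Rightarrow> complex" where
  "tpair br T \<xi> \<eta> =
     (\<Sum>a\<in>UNIV. \<Sum>b\<in>UNIV. T $ a $ b * killing br (axis a 1) \<xi> * killing br (axis b 1) \<eta>)"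

text \<open>\<open>(T, \<xi> \<otimes> 1)\<close>, where \<open>(a \<otimes> b, \<xi> \<otimes> 1) = (a, \<xi>) b\<close>.\<close>

definition contract1 :: "'n::finite bracket \<Rightarrow> complex ^ 'n ^ 'n \<Rightarrow> complex ^ 'n \<Rightarrow> complex ^ 'n" where
  "contract1 br T \<xi> = (\<chi> b. \<Sum>a\<in>UNIV. T $ a $ b * killing br (axis a 1) \<xi>)"

text \<open>The coefficients of the Casimir element form the inverse of the Gram matrix of the Killing
  form.\<close>

definition casimir :: "'n::finite bracket \<Rightarrow> complex ^ 'n ^ 'n" where
  "casimir br = matrix_inv (\<chi> a b. killing br (axis a 1) (axis b 1))"

text \<open>\<open>[x \<otimes> 1 + 1 \<otimes> x, T]\<close>\<close>

definition weight_action :: "'n::finite bracket \<Rightarrow> complex ^ 'n \<Rightarrow> complex ^ 'n ^ 'n \<Rightarrow> complex ^ 'n ^ 'n" where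
  "weight_action br x T =
     (\<chi> a b. (\<Sum>i\<in>UNIV. T $ i $ b * br x (axis i 1) $ a) + (\<Sum>j\<in>UNIV. T $ a $ j * br x (axis j 1) $ b))"

text \<open>The coefficients at \<open>(a, b, c)\<close> of \<open>[S\<^sup>1\<^sup>2, T\<^sup>1\<^sup>3]\<close>, \<open>[S\<^sup>1\<^sup>2, T\<^sup>2\<^sup>3]\<close> and \<open>[S\<^sup>1\<^sup>3, T\<^sup>2\<^sup>3]\<close>.\<close>

definition bracket_12_13 where
  "bracket_12_13 (br :: 'n::finite bracket) (S :: complex ^ 'n ^ 'n) (T :: complex ^ 'n ^ 'n) a b c =
     (\<Sum>i\<in>UNIV. \<Sum>j\<in>UNIV. S $ i $ b * T $ j $ c * br (axis i 1) (axis j 1) $ a)"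

definition bracket_12_23 where
  "bracket_12_23 (br :: 'n::finite bracket) (S :: complex ^ 'n ^ 'n) (T :: complex ^ 'n ^ 'n) a b c =
     (\<Sum>i\<in>UNIV. \<Sum>j\<in>UNIV. S $ a $ i * T $ j $ c * br (axis i 1) (axis j 1) $ b)"

definition bracket_13_23 where
  "bracket_13_23 (br :: 'n::finite bracket) (S :: complex ^ 'n ^ 'n) (T :: complex ^ 'n ^ 'n) a b c =
     (\<Sum>i\<in>UNIV. \<Sum>j\<in>UNIV. S $ a $ i * T $ b $ j * br (axis i 1) (axis j 1) $ c)"

type_synonym ('l, 'n) rmat = "(complex ^ 'l) \<times> complex \<Rightarrow> complex ^ 'n ^ 'n"

text \<open>The coefficient at \<open>(a, b, c)\<close> of \<open>Alt(d r)\<close>; note that \<open>T\<^sup>3\<^sup>1\<close> has coefficient \<open>T $ c $ a\<close>.\<close>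

definition alt_d where
  "alt_d (e :: 'l::finite \<Rightarrow> complex ^ 'n) (r :: ('l, 'n::finite) rmat) q z1 z2 z3 a b c =
     (\<Sum>i\<in>UNIV.
        e i $ a * pderiv_at i (\<lambda>q'. r (q', z2 - z3) $ b $ c) q +
        e i $ b * pderiv_at i (\<lambda>q'. r (q', z3 - z1) $ c $ a) q +
        e i $ c * pderiv_at i (\<lambda>q'. r (q', z1 - z2) $ a $ b) q)"

definition regular_points :: "('l::finite, 'n::finite) rmat \<Rightarrow> ((complex ^ 'l) \<times> complex) set" where
  "regular_points r =
     {x. \<exists>U. open U \<and> x \<in> U \<and> (\<forall>a b. holomorphic_wrt scale2 (\<lambda>y. r y $ a $ b) U)}"

text \<open>The points \<open>q\<close> at which \<open>r\<close> is defined: in a neighbourhood of \<open>(q, 0)\<close>, all poles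
  of \<open>r\<close> lie on \<open>z = 0\<close>.\<close>

definition r_domain :: "('l::finite, 'n::finite) rmat \<Rightarrow> (complex ^ 'l) set" where
  "r_domain r =
     {q. \<exists>U. open U \<and> (q, 0) \<in> U \<and> (\<forall>q' z. (q', z) \<in> U \<and> z \<noteq> 0 \<longrightarrow> (q', z) \<in> regular_points r)}"

definition dynamical_r_matrix ::
  "'n::finite bracket \<Rightarrow> (complex ^ 'n) set \<Rightarrow> ('l::finite \<Rightarrow> complex ^ 'n) \<Rightarrow> ('l, 'n) rmat \<Rightarrow> bool" where
  "dynamical_r_matrix br h e r \<longleftrightarrow>
     (\<forall>a b. meromorphic_wrt scale2 (\<lambda>x. r x $ a $ b)) \<and>
     (\<forall>x\<in>regular_points r. \<forall>y\<in>h. weight_action br y (r x) = 0) \<and>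
     (\<forall>q z. (q, z) \<in> regular_points r \<and> (q, - z) \<in> regular_points r \<longrightarrow>
        r (q, z) + transpose (r (q, - z)) = 0) \<and>
     (\<forall>q\<in>r_domain r. \<forall>a b. residue (\<lambda>z. r (q, z) $ a $ b) 0 = casimir br $ a $ b) \<and>
     (\<forall>q z1 z2 z3.
        (q, z1 - z2) \<in> regular_points r \<and> (q, z1 - z3) \<in> regular_points r \<and>
        (q, z2 - z3) \<in> regular_points r \<and> (q, z3 - z1) \<in> regular_points r \<longrightarrow>
        (\<forall>a b c.
           alt_d e r q z1 z2 z3 a b c +
           bracket_12_13 br (r (q, z1 - z2)) (r (q, z1 - z3)) a b c +
           bracket_12_23 br (r (q, z1 - z2)) (r (q, z2 - z3)) a b c +
           bracket_13_23 br (r (q, z1 - z3)) (r (q, z2 - z3)) a b c = 0))"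

type_synonym 'n loop = "complex fls ^ 'n"

text \<open>Both \<open>Lg\<close> and its restricted dual, as \<open>g* = g\<close>.\<close>

definition loop_alg :: "'n::finite loop set" where
  "loop_alg = {X. \<forall>a. fls_conv_radius (X $ a) > 0}"

definition leval :: "'n::finite loop \<Rightarrow> complex \<Rightarrow> complex ^ 'n" where
  "leval X z = (\<chi> a. eval_fls (X $ a) z)"

definition lconst :: "complex ^ 'n \<Rightarrow> 'n::finite loop" where
  "lconst x = (\<chi> a. fls_const (x $ a))"

definition lbracket :: "'n::finite bracket \<Rightarrow> 'n loop \<Rightarrow> 'n loop \<Rightarrow> 'n loop" where
  "lbracket br X Y =
     (\<chi> c. \<Sum>a\<in>UNIV. \<Sum>b\<in>UNIV. X $ a * Y $ b * fls_const (br (axis a 1) (axis b 1) $ c))"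

text \<open>\<^const>\<open>residue\<close> is by definition the normalized contour integral over small circles.\<close>

definition lpair :: "'n::finite bracket \<Rightarrow> 'n loop \<Rightarrow> 'n loop \<Rightarrow> complex" where
  "lpair br \<xi> X = residue (\<lambda>z. killing br (leval \<xi> z) (leval X z)) 0"

definition lrestr :: "'n::finite bracket \<Rightarrow> ('l::finite \<Rightarrow> complex ^ 'n) \<Rightarrow> 'n loop \<Rightarrow> complex ^ 'l" where
  "lrestr br e \<xi> = (\<chi> i. lpair br \<xi> (lconst (e i)))"

definition adstar :: "'n::finite bracket \<Rightarrow> 'n loop \<Rightarrow> 'n loop \<Rightarrow> 'n loop" where
  "adstar br X \<xi> =
     (THE \<zeta>. \<zeta> \<in> loop_alg \<and> (\<forall>Y\<in>loop_alg. lpair br \<zeta> Y = lpair br \<xi> (lbracket br X Y)))"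

text \<open>Principal value over the circle through \<open>z\<close> centred at \<open>0\<close>; an arc symmetric about the point
  \<open>z\<close> is cut out.\<close>

definition pv_circle :: "(complex \<Rightarrow> complex) \<Rightarrow> complex \<Rightarrow> complex" where
  "pv_circle f z =
     Lim (at_right 0)
       (\<lambda>\<delta>. contour_integral (part_circlepath 0 (norm z) (Arg z + \<delta>) (Arg z + 2 * pi - \<delta>)) f)"

definition R_op ::
  "'n::finite bracket \<Rightarrow> ('l::finite, 'n) rmat \<Rightarrow> complex ^ 'l \<Rightarrow> 'n loop \<Rightarrow> 'n loop" where
  "R_op br r q \<xi> =
     (THE X. X \<in> loop_alg \<and>
        (\<exists>\<epsilon>>0. \<forall>z. 0 < norm z \<and> norm z < \<epsilon> \<longrightarrow>
           leval X z =
             (\<chi> b. 1 / (2 * pi * \<i>) * pv_circle (\<lambda>w. contract1 br (r (q, w - z)) (leval \<xi> w) $ b) z)))"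

definition r_minus ::
  "'n::finite bracket \<Rightarrow> ('l::finite, 'n) rmat \<Rightarrow> complex ^ 'l \<Rightarrow> complex ^ 'n \<Rightarrow> 'n loop" where
  "r_minus br r q \<xi> =
     (THE X. X \<in> loop_alg \<and>
        (\<exists>\<epsilon>>0. \<forall>z. 0 < norm z \<and> norm z < \<epsilon> \<longrightarrow>
           (\<forall>\<eta>. killing br (leval X z) \<eta> = tpair br (r (q, z)) \<eta> \<xi>)))"

text \<open>The fibre is \<open>h \<oplus> Lg*\<close>. The sections considered are the combinations of constant sections with
  holomorphic coefficients, to which the bracket of constant sections extends by the Leibniz rule.
  The bracket \<open>[s, t] = u\<close> is given by its graph. Its values need not lie in this module: the loop
  part of \<open>[\<xi>, \<eta>]\<close> depends on \<open>q\<close> through \<open>R\<close>.\<close>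

type_synonym ('l, 'n) fibre = "(complex ^ 'l) \<times> 'n loop"

type_synonym ('l, 'n) sect = "complex ^ 'l \<Rightarrow> ('l, 'n) fibre"

definition fscale :: "complex \<Rightarrow> ('l::finite, 'n::finite) fibre \<Rightarrow> ('l, 'n) fibre" where
  "fscale c = (\<lambda>(p, \<xi>). (c *s p, fls_const c *s \<xi>))"

inductive_set sections :: "(complex ^ 'l) set \<Rightarrow> ('l::finite, 'n::finite) sect set"
  for V :: "(complex ^ 'l) set" where
  const: "\<xi> \<in> loop_alg \<Longrightarrow> (\<lambda>q. (p, \<xi>)) \<in> sections V"
| add: "s \<in> sections V \<Longrightarrow> t \<in> sections V \<Longrightarrow> (\<lambda>q. s q + t q) \<in> sections V"
| scale: "holomorphic_wrt (*s) f V \<Longrightarrow> s \<in> sections V \<Longrightarrow> (\<lambda>q. fscale (f q) (s q)) \<in> sections V"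

text \<open>The derivative \<open>a(s) f\<close> of \<open>f\<close> along the image of \<open>s\<close> under the anchor.\<close>

definition anchor ::
  "'n::finite bracket \<Rightarrow> ('l::finite \<Rightarrow> complex ^ 'n) \<Rightarrow> ('l, 'n) sect \<Rightarrow> (complex ^ 'l \<Rightarrow> complex) \<Rightarrow>
   complex ^ 'l \<Rightarrow> complex" where
  "anchor br e s f q = (\<Sum>i\<in>UNIV. lrestr br e (snd (s q)) $ i * pderiv_at i f q)"

inductive algebroid_bracket ::
  "'n::finite bracket \<Rightarrow> ('l::finite \<Rightarrow> complex ^ 'n) \<Rightarrow> ('l, 'n) rmat \<Rightarrow> (complex ^ 'l) set \<Rightarrow>
   ('l, 'n) sect \<Rightarrow> ('l, 'n) sect \<Rightarrow> ('l, 'n) sect \<Rightarrow> bool"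
  for br :: "'n bracket" and e :: "'l \<Rightarrow> complex ^ 'n" and r :: "('l, 'n) rmat"
    and V :: "(complex ^ 'l) set" where
  forms:
    "(\<forall>i. holomorphic_wrt (*s) (\<lambda>q. \<omega> q $ i) V) \<Longrightarrow> (\<forall>i. holomorphic_wrt (*s) (\<lambda>q. \<theta> q $ i) V) \<Longrightarrow>
     algebroid_bracket br e r V (\<lambda>q. (\<omega> q, 0)) (\<lambda>q. (\<theta> q, 0)) (\<lambda>q. 0)"
| form_loop:
    "\<xi> \<in> loop_alg \<Longrightarrow>
     algebroid_bracket br e r V (\<lambda>q. (p, 0)) (\<lambda>q. (0, \<xi>)) (\<lambda>q. (0, adstar br (lconst (incl e p)) \<xi>))"
| loops:
    "\<xi> \<in> loop_alg \<Longrightarrow> \<eta> \<in> loop_alg \<Longrightarrow>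
     algebroid_bracket br e r V (\<lambda>q. (0, \<xi>)) (\<lambda>q. (0, \<eta>))
       (\<lambda>q. (\<chi> i. pderiv_at i (\<lambda>q'. lpair br \<eta> (R_op br r q' \<xi>)) q,
             - adstar br (R_op br r q \<xi>) \<eta> + adstar br (R_op br r q \<eta>) \<xi>))"
| skew:
    "algebroid_bracket br e r V s t u \<Longrightarrow> algebroid_bracket br e r V t s (\<lambda>q. - u q)"
| add:
    "algebroid_bracket br e r V s t u \<Longrightarrow> algebroid_bracket br e r V s t' u' \<Longrightarrow>
     algebroid_bracket br e r V s (\<lambda>q. t q + t' q) (\<lambda>q. u q + u' q)"
| leibniz:
    "algebroid_bracket br e r V s t u \<Longrightarrow> holomorphic_wrt (*s) f V \<Longrightarrow>
     algebroid_bracket br e r V s (\<lambda>q. fscale (f q) (t q))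
       (\<lambda>q. fscale (f q) (u q) + fscale (anchor br e s f q) (t q))"

type_synonym ('l, 'n) target = "(complex ^ 'l) \<times> (complex ^ 'l) \<times> 'n loop"

definition lin_fun ::
  "'n::finite bracket \<Rightarrow> ('l::finite, 'n) sect \<Rightarrow> ('l, 'n) target \<Rightarrow> complex" where
  "lin_fun br s = (\<lambda>(q, y, X). (\<Sum>i\<in>UNIV. fst (s q) $ i * y $ i) + lpair br (snd (s q)) X)"

inductive_set poly_functions ::
  "'n::finite bracket \<Rightarrow> (complex ^ 'l) set \<Rightarrow> (('l::finite, 'n) target \<Rightarrow> complex) set"
  for br :: "'n bracket" and V :: "(complex ^ 'l) set" where
  base: "holomorphic_wrt (*s) f V \<Longrightarrow> (\<lambda>x. f (fst x)) \<in> poly_functions br V"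
| lin: "s \<in> sections V \<Longrightarrow> lin_fun br s \<in> poly_functions br V"
| add: "F \<in> poly_functions br V \<Longrightarrow> K \<in> poly_functions br V \<Longrightarrow> (\<lambda>x. F x + K x) \<in> poly_functions br V"
| mult: "F \<in> poly_functions br V \<Longrightarrow> K \<in> poly_functions br V \<Longrightarrow> (\<lambda>x. F x * K x) \<in> poly_functions br V"

text \<open>The graph of the Poisson bracket: \<open>{F, K} = G\<close>.\<close>

inductive lie_poisson ::
  "'n::finite bracket \<Rightarrow> ('l::finite \<Rightarrow> complex ^ 'n) \<Rightarrow> ('l, 'n) rmat \<Rightarrow> (complex ^ 'l) set \<Rightarrow>
   (('l, 'n) target \<Rightarrow> complex) \<Rightarrow> (('l, 'n) target \<Rightarrow> complex) \<Rightarrow> (('l, 'n) target \<Rightarrow> complex) \<Rightarrow> bool"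
  for br :: "'n bracket" and e :: "'l \<Rightarrow> complex ^ 'n" and r :: "('l, 'n) rmat"
    and V :: "(complex ^ 'l) set" where
  lin_lin:
    "s \<in> sections V \<Longrightarrow> t \<in> sections V \<Longrightarrow> algebroid_bracket br e r V s t u \<Longrightarrow>
     lie_poisson br e r V (lin_fun br s) (lin_fun br t) (lin_fun br u)"
| lin_base:
    "s \<in> sections V \<Longrightarrow> holomorphic_wrt (*s) f V \<Longrightarrow>
     lie_poisson br e r V (lin_fun br s) (\<lambda>x. f (fst x)) (\<lambda>x. anchor br e s f (fst x))"
| base_base:
    "holomorphic_wrt (*s) f V \<Longrightarrow> holomorphic_wrt (*s) g V \<Longrightarrow>
     lie_poisson br e r V (\<lambda>x. f (fst x)) (\<lambda>x. g (fst x)) (\<lambda>x. 0)"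
| skew:
    "lie_poisson br e r V F K G \<Longrightarrow> lie_poisson br e r V K F (\<lambda>x. - G x)"
| add:
    "lie_poisson br e r V F K G \<Longrightarrow> lie_poisson br e r V F K' G' \<Longrightarrow>
     lie_poisson br e r V F (\<lambda>x. K x + K' x) (\<lambda>x. G x + G' x)"
| mult:
    "lie_poisson br e r V F K G \<Longrightarrow> lie_poisson br e r V F K' G' \<Longrightarrow>
     lie_poisson br e r V F (\<lambda>x. K x * K' x) (\<lambda>x. G x * K' x + K x * G' x)"

type_synonym ('l, 'n) source = "(complex ^ 'l) \<times> (complex ^ 'l) \<times> (complex ^ 'n)"

text \<open>The differential at \<open>\<xi>\<close> of a function on \<open>g*\<close>, as an element of \<open>g\<close>.\<close>

definition kgrad :: "'n::finite bracket \<Rightarrow> (complex ^ 'n \<Rightarrow> complex) \<Rightarrow> complex ^ 'n \<Rightarrow> complex ^ 'n" where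
  "kgrad br A \<xi> = (THE x. \<forall>\<eta>. killing br \<eta> x = deriv (\<lambda>t. A (\<xi> + t *s \<eta>)) 0)"

definition source_bracket ::
  "'n::finite bracket \<Rightarrow> (('l::finite, 'n) source \<Rightarrow> complex) \<Rightarrow> (('l, 'n) source \<Rightarrow> complex) \<Rightarrow>
   ('l, 'n) source \<Rightarrow> complex" where
  "source_bracket br A B = (\<lambda>(q, p, \<xi>).
     (\<Sum>i\<in>UNIV.
        pderiv_at i (\<lambda>p'. A (q, p', \<xi>)) p * pderiv_at i (\<lambda>q'. B (q', p, \<xi>)) q -
        pderiv_at i (\<lambda>q'. A (q', p, \<xi>)) q * pderiv_at i (\<lambda>p'. B (q, p', \<xi>)) p) +
     killing br \<xi> (br (kgrad br (\<lambda>\<xi>'. A (q, p, \<xi>')) \<xi>) (kgrad br (\<lambda>\<xi>'. B (q, p, \<xi>')) \<xi>)))"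

definition rho ::
  "'n::finite bracket \<Rightarrow> ('l::finite \<Rightarrow> complex ^ 'n) \<Rightarrow> ('l, 'n) rmat \<Rightarrow> ('l, 'n) source \<Rightarrow> ('l, 'n) target" where
  "rho br e r = (\<lambda>(q, p, \<xi>). (q, - restr br e \<xi>, lconst (incl e p) + r_minus br r q \<xi>))"

text \<open>\<open>\<phi> : M \<rightarrow> N\<close> is Poisson: \<open>H\<close> is the set of functions on which the bracket \<open>pb\<close> of \<open>M\<close> acts, \<open>A\<close> the
  algebra of test functions on \<open>N\<close>, and \<open>P\<close> the graph of their Poisson bracket.\<close>

definition poisson_map ::
  "'a set \<Rightarrow> ('a \<Rightarrow> complex) set \<Rightarrow> (('a \<Rightarrow> complex) \<Rightarrow> ('a \<Rightarrow> complex) \<Rightarrow> 'a \<Rightarrow> complex) \<Rightarrow>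
   'b set \<Rightarrow> ('b \<Rightarrow> complex) set \<Rightarrow> (('b \<Rightarrow> complex) \<Rightarrow> ('b \<Rightarrow> complex) \<Rightarrow> ('b \<Rightarrow> complex) \<Rightarrow> bool) \<Rightarrow>
   ('a \<Rightarrow> 'b) \<Rightarrow> bool" where
  "poisson_map M H pb N A P \<phi> \<longleftrightarrow>
     \<phi> ` M \<subseteq> N \<and>
     (\<forall>F\<in>A. F \<circ> \<phi> \<in> H) \<and>
     (\<forall>F\<in>A. \<forall>K\<in>A. (\<exists>G. P F K G) \<and>
        (\<forall>G. P F K G \<longrightarrow> (\<forall>x\<in>M. pb (F \<circ> \<phi>) (K \<circ> \<phi>) x = G (\<phi> x))))"

end

theory Submission
  imports Defs
begin

text \<open>
  The bracket of the pullbacks of linear functions is a derivation in each section, so only constant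
  sections matter. Write \<open>Q\<close> for the operator \<open>R - 1 / 2\<close>, i.e. \<open>R\<close> with the contour moved into
  \<open>\<bar>w\<bar> < \<bar>z\<bar>\<close>. The pullback of the linear function of a loop \<open>\<alpha>\<close> is \<open>(p, i* \<alpha>) + (\<xi>, Q \<alpha> 0)\<close>, and for
  two loops \<open>\<alpha>\<close>, \<open>\<eta>\<close> the claim is the dynamical Yang--Baxter equation at \<open>(w, z, 0)\<close>, paired with
  \<open>\<alpha> w \<otimes> \<eta> z \<otimes> \<xi>\<close> and integrated over two circles \<open>\<bar>w\<bar> < \<bar>z\<bar>\<close>; the circles that occur with
  \<open>\<bar>w\<bar> > \<bar>z\<bar>\<close> are moved across the pole at \<open>w = z\<close>, whose residue is the Casimir element.

  All of this requires the pole of \<open>r\<close> at \<open>z = 0\<close> to be simple. At generic \<open>q\<close> this follows from the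
  Yang--Baxter equation: the leading coefficient of a pole of higher order would produce an abelian
  ideal. The remaining \<open>q\<close> are reached by density.
\<close>

section \<open>The Killing form and contractions\<close>

text \<open>The residue condition fixes only the coefficient of \<open>1/z\<close> and leaves room
  for higher poles, for which neither the principal value nor the step across \<open>w = z\<close>
  makes sense. A local quotient \<open>N / D\<close> gives no immediate bound on the pole order at a
  prescribed \<open>q\<close>, since the order of vanishing of \<open>D\<close> in \<open>z\<close>
  may jump. Hence the detour through an unspecified open set of \<open>q\<close>: some bound holds
  there, it descends to one, and the closure argument returns to the given point.

  A one-sided contour gives Q, which is not skew; the principal value divides the residue at
  \<open>w = z\<close> evenly and makes R skew. This matters for the quadratic terms: one of them
  appears as Q of the bracket of \<open>r_minus\<close> with \<alpha>, and only skewness turns it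
  into a term with R applied to \<eta>, the two halves cancelling. R and Q have the same derivative
  in \<open>q\<close>. The variable \<open>p\<close> enters through constants in \<open>h\<close>,
  where zero weight and commutativity of \<open>h\<close> dispose of it.

  Both brackets on the target are relations generated by rules, so the final comparison is an
  induction over these rules, carrying the holomorphy that the derivation property on the source
  requires.\<close>

definition contract2 :: "'n::finite bracket \<Rightarrow> complex ^ 'n ^ 'n \<Rightarrow> complex ^ 'n \<Rightarrow> complex ^ 'n" where
  "contract2 br T \<eta> = (\<chi> a. \<Sum>b\<in>UNIV. T $ a $ b * killing br (axis b 1) \<eta>)"

lemma vec_eq_sum_axis: "(x :: complex ^ 'n::finite) = (\<Sum>a\<in>UNIV. x $ a *s axis a 1)"
  by (simp add: vec_eq_iff axis_def if_distrib cong: if_cong)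

locale lie =
  fixes br :: "complex ^ 'n::finite \<Rightarrow> complex ^ 'n \<Rightarrow> complex ^ 'n"
  assumes lie: "lie_algebra br"
begin

abbreviation "K \<equiv> killing br"

lemma lin_br: "Vector_Spaces.linear (*s) (*s) (br x)" "Vector_Spaces.linear (*s) (*s) (\<lambda>x. br x y)"
  using lie by (auto simp: lie_algebra_def)

lemma br_add_right: "br x (y + z) = br x y + br x z"
  and br_scale_right: "br x (c *s y) = c *s br x y"
  and br_add_left: "br (x + y) z = br x z + br y z"
  and br_scale_left: "br (c *s x) z = c *s br x z"
  using vec.linear_add[OF lin_br(1)] vec.linear_scale[OF lin_br(1)]
    vec.linear_add[OF lin_br(2)] vec.linear_scale[OF lin_br(2)] by blast+

lemma br_self: "br x x = 0"
  and jacobi: "br x (br y z) + br y (br z x) + br z (br x y) = 0"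
  using lie by (auto simp: lie_algebra_def)

lemma br_0_left [simp]: "br 0 y = 0" and br_0_right [simp]: "br x 0 = 0"
  using br_scale_left[of 0 0 y] br_scale_right[of x 0 0] by auto

lemma br_skew: "br x y = - br y x"
proof -
  have "br (x + y) (x + y) = br x x + br y x + (br x y + br y y)"
    by (simp only: br_add_left br_add_right)
  then have "br x y + br y x = 0"
    unfolding br_self by (simp add: add.commute)
  then show ?thesis
    by (simp only: eq_neg_iff_add_eq_0)
qed

lemma br_minus_left: "br (- x) y = - br x y" and br_minus_right: "br x (- y) = - br x y"
  using br_scale_left[of "-1" x y] br_scale_right[of x "-1" y] by (simp_all add: vec_eq_iff)

lemma br_sum_left: "br (sum f A) y = (\<Sum>a\<in>A. br (f a) y)"
  and br_sum_right: "br y (sum f A) = (\<Sum>a\<in>A. br y (f a))"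
  by (induction A rule: infinite_finite_induct; simp add: br_add_left br_add_right)+

text \<open>Structure constants: in this form limits, holomorphy and Laurent expansions pass through
  the bracket one coordinate at a time.\<close>

lemma br_expand:
  "br x y $ c = (\<Sum>a\<in>UNIV. \<Sum>b\<in>UNIV. x $ a * y $ b * br (axis a 1) (axis b 1) $ c)"
proof -
  have l: "br x y = (\<Sum>a\<in>UNIV. x $ a *s br (axis a 1) y)" for y
    using arg_cong[OF vec_eq_sum_axis[of x], of "\<lambda>x. br x y"] by (simp add: br_sum_left br_scale_left)
  have r: "br u y = (\<Sum>b\<in>UNIV. y $ b *s br u (axis b 1))" for u
    using arg_cong[OF vec_eq_sum_axis[of y], of "br u"] by (simp add: br_sum_right br_scale_right)
  have "br x y = (\<Sum>a\<in>UNIV. x $ a *s (\<Sum>b\<in>UNIV. y $ b *s br (axis a 1) (axis b 1)))"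
    by (subst l, subst r) (rule refl)
  then show ?thesis
    by (simp add: sum_distrib_left mult.assoc)
qed

lemma br_jacobi_comm: "br (br x y) z = br x (br y z) - br y (br x z)"
proof -
  have "br (br x y) z = - br z (br x y)" by (rule br_skew)
  also have "\<dots> = br x (br y z) + br y (br z x)"
    using jacobi[of x y z] by (metis add.inverse_unique add.inverse_inverse)
  also have "br y (br z x) = - br y (br x z)"
    by (subst br_skew[of z x]) (simp add: br_minus_right)
  finally show ?thesis by simp
qed

lemma matrix_br_vec: "matrix (br x) *v y = br x y"
  using matrix_works[OF lin_br(1)] .

lemma matrix_br_br: "matrix (br (br x y)) = matrix (br x) ** matrix (br y) - matrix (br y) ** matrix (br x)"
proof -
  have "(matrix (br x) ** matrix (br y) - matrix (br y) ** matrix (br x)) *v z = matrix (br (br x y)) *v z" for z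
    by (simp only: matrix_br_vec matrix_vector_mult_diff_rdistrib matrix_vector_mul_assoc[symmetric] br_jacobi_comm)
  then show ?thesis
    by (metis matrix_eq)
qed

lemma K_eq: "K x y = (\<Sum>i\<in>UNIV. \<Sum>j\<in>UNIV. br x (axis j 1) $ i * br y (axis i 1) $ j)"
  by (simp add: killing_def trace_def matrix_matrix_mult_def matrix_def)

lemma K_add_left: "K (x + y) z = K x z + K y z"
  and K_add_right: "K z (x + y) = K z x + K z y"
  and K_scale_left: "K (c *s x) z = c * K x z"
  and K_scale_right: "K z (c *s x) = c * K z x"
  by (simp_all add: K_eq br_add_left br_scale_left algebra_simps sum.distrib sum_distrib_left)

lemma K_sym: "K x y = K y x"
  unfolding killing_def by (rule trace_mul_sym)

lemma K_0 [simp]: "K 0 y = 0" "K y 0 = 0"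
  using K_scale_left[of 0 0 y] K_scale_right[of y 0 0] by auto

lemma K_minus_left: "K (- x) y = - K x y" and K_minus_right: "K y (- x) = - K y x"
  using K_scale_left[of "-1" x y] K_scale_right[of y "-1" x] by (simp_all add: vec_eq_iff)

lemma K_diff_left: "K (x - z) y = K x y - K z y" and K_diff_right: "K y (x - z) = K y x - K y z"
  using K_add_left[of x "-z" y] K_add_right[of y x "-z"] by (simp_all add: K_minus_left K_minus_right)

lemma K_sum_left: "K (sum f A) y = (\<Sum>a\<in>A. K (f a) y)"
  and K_sum_right: "K y (sum f A) = (\<Sum>a\<in>A. K y (f a))"
  by (induction A rule: infinite_finite_induct; simp add: K_add_left K_add_right)+

lemma K_expand_left: "K x y = (\<Sum>a\<in>UNIV. x $ a * K (axis a 1) y)"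
  by (subst vec_eq_sum_axis[of x]) (simp add: K_sum_left K_scale_left)

text \<open>\<open>ad\<close> is a representation, so both sides are traces of triple products of
  matrices; they agree because the trace is cyclic.\<close>

lemma K_inv: "K (br x y) z = K x (br y z)"
proof -
  define X where "X = matrix (br x)"
  define Y where "Y = matrix (br y)"
  define Z where "Z = matrix (br z)"
  have "trace ((X ** Y) ** Z - (Y ** X) ** Z) = trace (X ** (Y ** Z) - X ** (Z ** Y))"
    using trace_mul_sym[of Y "X ** Z"] by (simp add: trace_sub matrix_mul_assoc)
  moreover have "(X ** Y - Y ** X) ** Z = (X ** Y) ** Z - (Y ** X) ** Z"
    "X ** (Y ** Z - Z ** Y) = X ** (Y ** Z) - X ** (Z ** Y)"
    by (simp_all add: matrix_matrix_mult_def vec_eq_iff algebra_simps sum_subtractf)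
  ultimately show ?thesis
    by (simp add: killing_def matrix_br_br X_def Y_def Z_def)
qed

lemma K_rot: "K x (br y z) = K z (br x y)"
  by (metis K_inv K_sym)

lemma K_swap: "K x (br y z) = - K y (br x z)"
  by (metis K_inv K_sym br_skew K_minus_right)

lemma contract1_nth: "contract1 br T x $ b = (\<Sum>a\<in>UNIV. T $ a $ b * K (axis a 1) x)"
  and contract2_nth: "contract2 br T x $ a = (\<Sum>b\<in>UNIV. T $ a $ b * K (axis b 1) x)"
  by (simp_all add: contract1_def contract2_def)

lemma contract2_linear:
  "contract2 br (S + T) x = contract2 br S x + contract2 br T x"
  "contract2 br T (x + y) = contract2 br T x + contract2 br T y"
  "contract2 br T (c *s x) = c *s contract2 br T x"
  by (simp_all add: vec_eq_iff contract2_nth algebra_simps sum.distrib K_add_right K_scale_right sum_distrib_left)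

lemma tpair_contract1: "tpair br T x y = K (contract1 br T x) y"
proof -
  have "K (contract1 br T x) y = (\<Sum>b\<in>UNIV. (\<Sum>a\<in>UNIV. T $ a $ b * K (axis a 1) x) * K (axis b 1) y)"
    by (subst K_expand_left) (simp add: contract1_nth)
  also have "\<dots> = (\<Sum>b\<in>UNIV. \<Sum>a\<in>UNIV. T $ a $ b * K (axis a 1) x * K (axis b 1) y)"
    by (simp add: sum_distrib_right)
  also have "\<dots> = tpair br T x y"
    unfolding tpair_def by (rule sum.swap)
  finally show ?thesis ..
qed

lemma tpair_contract2: "tpair br T x y = K (contract2 br T y) x"
proof -
  have "K (contract2 br T y) x = (\<Sum>a\<in>UNIV. (\<Sum>b\<in>UNIV. T $ a $ b * K (axis b 1) y) * K (axis a 1) x)"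
    by (subst K_expand_left) (simp add: contract2_nth)
  then show ?thesis by (simp add: tpair_def sum_distrib_right sum_distrib_left mult_ac)
qed

lemma tpair_transpose: "tpair br (transpose T) x y = tpair br T y x"
  unfolding tpair_def transpose_def by (subst sum.swap) (simp add: mult_ac)

lemma tpair_linear:
  "tpair br (S + T) x y = tpair br S x y + tpair br T x y"
  "tpair br (- T) x y = - tpair br T x y"
  "tpair br T (x + x') y = tpair br T x y + tpair br T x' y"
  "tpair br T x (y + y') = tpair br T x y + tpair br T x y'"
  "tpair br T (c *s x) y = c * tpair br T x y"
  "tpair br T x (c *s y) = c * tpair br T x y"
  by (simp_all add: tpair_def K_add_right K_scale_right algebra_simps sum.distrib sum_distrib_left sum_negf)

lemma sum_rot3: "(\<Sum>i\<in>A. \<Sum>j\<in>B. \<Sum>k\<in>C. f i j k) = (\<Sum>k\<in>C. \<Sum>i\<in>A. \<Sum>j\<in>B. (f i j k :: complex))"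
proof -
  have "(\<Sum>i\<in>A. \<Sum>j\<in>B. \<Sum>k\<in>C. f i j k) = (\<Sum>i\<in>A. \<Sum>k\<in>C. \<Sum>j\<in>B. f i j k)"
    by (intro sum.cong refl sum.swap)
  also have "\<dots> = (\<Sum>k\<in>C. \<Sum>i\<in>A. \<Sum>j\<in>B. f i j k)"
    by (rule sum.swap)
  finally show ?thesis .
qed

lemma sum_swap_pairs:
  "(\<Sum>i\<in>A. \<Sum>j\<in>B. \<Sum>k\<in>C. \<Sum>l\<in>D. f i j k l) = (\<Sum>k\<in>C. \<Sum>l\<in>D. \<Sum>i\<in>A. \<Sum>j\<in>B. (f i j k l :: complex))"
  by (subst sum_rot3) (intro sum.cong refl sum_rot3)

lemma K_br_expand:
  "K (br u v) x = (\<Sum>a\<in>UNIV. \<Sum>i\<in>UNIV. \<Sum>j\<in>UNIV. u $ i * v $ j * br (axis i 1) (axis j 1) $ a * K (axis a 1) x)"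
  by (subst K_expand_left, subst br_expand) (simp add: sum_distrib_right)

text \<open>Contracting the two legs that are not shared leaves a single bracket in g on the shared
  one. With its two companions this turns the Yang--Baxter equation in the triple tensor product
  into a scalar identity that can be integrated against loops.\<close>

lemma pair_bracket_12_13:
  "(\<Sum>a\<in>UNIV. \<Sum>b\<in>UNIV. \<Sum>c\<in>UNIV. bracket_12_13 br S T a b c * (K (axis a 1) x * K (axis b 1) y * K (axis c 1) \<xi>))
   = K x (br (contract2 br S y) (contract2 br T \<xi>))" (is "?lhs = _")
proof -
  have "K x (br (contract2 br S y) (contract2 br T \<xi>)) = (\<Sum>a\<in>UNIV. \<Sum>i\<in>UNIV. \<Sum>j\<in>UNIV. \<Sum>b\<in>UNIV. \<Sum>c\<in>UNIV.
      S $ i $ b * K (axis b 1) y * (T $ j $ c * K (axis c 1) \<xi>) * br (axis i 1) (axis j 1) $ a * K (axis a 1) x)"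
    by (subst K_sym, subst K_br_expand) (simp only: contract2_nth sum_product, simp only: sum_distrib_right)
  also have "\<dots> = (\<Sum>a\<in>UNIV. \<Sum>b\<in>UNIV. \<Sum>c\<in>UNIV. \<Sum>i\<in>UNIV. \<Sum>j\<in>UNIV.
      S $ i $ b * K (axis b 1) y * (T $ j $ c * K (axis c 1) \<xi>) * br (axis i 1) (axis j 1) $ a * K (axis a 1) x)"
    by (intro sum.cong refl sum_swap_pairs)
  also have "\<dots> = ?lhs"
    by (simp only: bracket_12_13_def sum_distrib_right) (intro sum.cong refl, simp only: mult_ac)
  finally show ?thesis ..
qed

lemma pair_bracket_12_23:
  "(\<Sum>a\<in>UNIV. \<Sum>b\<in>UNIV. \<Sum>c\<in>UNIV. bracket_12_23 br S T a b c * (K (axis a 1) x * K (axis b 1) y * K (axis c 1) \<xi>))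
   = K y (br (contract1 br S x) (contract2 br T \<xi>))" (is "?lhs = _")
proof -
  have "K y (br (contract1 br S x) (contract2 br T \<xi>)) = (\<Sum>b\<in>UNIV. \<Sum>i\<in>UNIV. \<Sum>j\<in>UNIV. \<Sum>a\<in>UNIV. \<Sum>c\<in>UNIV.
      S $ a $ i * K (axis a 1) x * (T $ j $ c * K (axis c 1) \<xi>) * br (axis i 1) (axis j 1) $ b * K (axis b 1) y)"
    by (subst K_sym, subst K_br_expand) (simp only: contract1_nth contract2_nth sum_product, simp only: sum_distrib_right)
  also have "\<dots> = (\<Sum>b\<in>UNIV. \<Sum>a\<in>UNIV. \<Sum>c\<in>UNIV. \<Sum>i\<in>UNIV. \<Sum>j\<in>UNIV.
      S $ a $ i * K (axis a 1) x * (T $ j $ c * K (axis c 1) \<xi>) * br (axis i 1) (axis j 1) $ b * K (axis b 1) y)"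
    by (intro sum.cong refl sum_swap_pairs)
  also have "\<dots> = (\<Sum>a\<in>UNIV. \<Sum>b\<in>UNIV. \<Sum>c\<in>UNIV. \<Sum>i\<in>UNIV. \<Sum>j\<in>UNIV.
      S $ a $ i * K (axis a 1) x * (T $ j $ c * K (axis c 1) \<xi>) * br (axis i 1) (axis j 1) $ b * K (axis b 1) y)"
    by (rule sum.swap)
  also have "\<dots> = ?lhs"
    by (simp only: bracket_12_23_def sum_distrib_right) (intro sum.cong refl, simp only: mult_ac)
  finally show ?thesis ..
qed

lemma pair_bracket_13_23:
  "(\<Sum>a\<in>UNIV. \<Sum>b\<in>UNIV. \<Sum>c\<in>UNIV. bracket_13_23 br S T a b c * (K (axis a 1) x * K (axis b 1) y * K (axis c 1) \<xi>))
   = K \<xi> (br (contract1 br S x) (contract1 br T y))" (is "?lhs = _")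
proof -
  have "K \<xi> (br (contract1 br S x) (contract1 br T y)) = (\<Sum>c\<in>UNIV. \<Sum>i\<in>UNIV. \<Sum>j\<in>UNIV. \<Sum>a\<in>UNIV. \<Sum>b\<in>UNIV.
      S $ a $ i * K (axis a 1) x * (T $ b $ j * K (axis b 1) y) * br (axis i 1) (axis j 1) $ c * K (axis c 1) \<xi>)"
    by (subst K_sym, subst K_br_expand) (simp only: contract1_nth sum_product, simp only: sum_distrib_right)
  also have "\<dots> = (\<Sum>c\<in>UNIV. \<Sum>a\<in>UNIV. \<Sum>b\<in>UNIV. \<Sum>i\<in>UNIV. \<Sum>j\<in>UNIV.
      S $ a $ i * K (axis a 1) x * (T $ b $ j * K (axis b 1) y) * br (axis i 1) (axis j 1) $ c * K (axis c 1) \<xi>)"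
    by (intro sum.cong refl sum_swap_pairs)
  also have "\<dots> = (\<Sum>a\<in>UNIV. \<Sum>b\<in>UNIV. \<Sum>c\<in>UNIV. \<Sum>i\<in>UNIV. \<Sum>j\<in>UNIV.
      S $ a $ i * K (axis a 1) x * (T $ b $ j * K (axis b 1) y) * br (axis i 1) (axis j 1) $ c * K (axis c 1) \<xi>)"
    by (rule sum_rot3[symmetric])
  also have "\<dots> = ?lhs"
    by (simp only: bracket_13_23_def sum_distrib_right) (intro sum.cong refl, simp only: mult_ac)
  finally show ?thesis ..
qed

lemma contract1_weight:
  assumes "weight_action br h T = 0"
  shows "contract1 br T (br h x) = br h (contract1 br T x)"
proof -
  have w: "(\<Sum>i\<in>UNIV. T $ i $ b * br h (axis i 1) $ a) = - (\<Sum>j\<in>UNIV. T $ a $ j * br h (axis j 1) $ b)" for a b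
    using assms by (simp add: weight_action_def vec_eq_iff eq_neg_iff_add_eq_0)
  have "K (axis a 1) (br h x) = - K (br h (axis a 1)) x" for a
    by (metis K_inv K_sym K_swap)
  then have K_ax: "K (axis a 1) (br h x) = - (\<Sum>c\<in>UNIV. br h (axis a 1) $ c * K (axis c 1) x)" for a
    by (metis K_expand_left)
  have br_ax: "br h y $ b = (\<Sum>j\<in>UNIV. y $ j * br h (axis j 1) $ b)" for y b
  proof -
    have "br h y = br h (\<Sum>a\<in>UNIV. y $ a *s axis a 1)"
      by (simp flip: vec_eq_sum_axis)
    then show ?thesis by (simp add: br_sum_right br_scale_right)
  qed
  have "contract1 br T (br h x) $ b = br h (contract1 br T x) $ b" for b
  proof -
    have "contract1 br T (br h x) $ b = - (\<Sum>a\<in>UNIV. \<Sum>c\<in>UNIV. T $ a $ b * br h (axis a 1) $ c * K (axis c 1) x)"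
      by (simp add: contract1_nth K_ax sum_distrib_left sum_negf mult.assoc)
    also have "\<dots> = - (\<Sum>c\<in>UNIV. (\<Sum>a\<in>UNIV. T $ a $ b * br h (axis a 1) $ c) * K (axis c 1) x)"
      by (subst sum.swap) (simp add: sum_distrib_right)
    also have "\<dots> = (\<Sum>c\<in>UNIV. \<Sum>j\<in>UNIV. T $ c $ j * br h (axis j 1) $ b * K (axis c 1) x)"
      by (simp add: w sum_negf sum_distrib_right)
    also have "\<dots> = (\<Sum>j\<in>UNIV. contract1 br T x $ j * br h (axis j 1) $ b)"
      by (subst sum.swap) (simp add: contract1_nth sum_distrib_right sum_distrib_left mult_ac)
    also have "\<dots> = br h (contract1 br T x) $ b"
      by (rule br_ax[symmetric])
    finally show ?thesis .
  qed
  then show ?thesis by (simp add: vec_eq_iff)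
qed

end

locale killing_lie = lie +
  assumes nondegenerate: "(\<And>y. killing br x y = 0) \<Longrightarrow> x = 0"
begin

lemma K_eqI: "(\<And>y. K x y = K x' y) \<Longrightarrow> x = x'"
  using nondegenerate[of "x - x'"] by (simp add: K_diff_left)

lemma K_eqI2: "(\<And>y. K y x = K y x') \<Longrightarrow> x = x'"
  using K_eqI K_sym by metis

abbreviation "Gram \<equiv> (\<chi> a b. K (axis a 1) (axis b 1))"

lemma matrix_inv:
  assumes "invertible A"
  shows "A ** matrix_inv A = mat 1" "matrix_inv A ** A = mat 1"
  using someI_ex[OF assms[unfolded invertible_def]] by (simp_all add: matrix_inv_def)

lemma Gram_vec: "(Gram *v x) $ a = K (axis a 1) x"
  by (subst K_sym, subst K_expand_left) (simp add: matrix_vector_mult_def K_sym mult_ac)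

lemma invertible_Gram: "invertible Gram"
proof -
  have "x = 0" if "Gram *v x = 0" for x
  proof (rule nondegenerate)
    fix y
    have "K (axis a 1) x = 0" for a
      using Gram_vec[of x a] that by simp
    then show "K x y = 0"
      by (subst K_sym, subst K_expand_left) simp
  qed
  then show ?thesis
    by (metis invertible_left_inverse matrix_left_invertible_ker)
qed

text \<open>The Casimir coefficients invert the Gram matrix, so contracting either leg is the
  identity map. This is why the residue of the kernel \<open>r (q, w - z)\<close> at
  \<open>w = z\<close> returns the loop itself.\<close>

lemma contract2_casimir: "contract2 br (casimir br) x = x"
proof -
  have "contract2 br (casimir br) x = casimir br *v (Gram *v x)"
    by (simp add: vec_eq_iff contract2_nth matrix_vector_mult_def[of "casimir br"] Gram_vec)
  also have "\<dots> = x"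
    using matrix_inv(2)[OF invertible_Gram] by (simp add: matrix_vector_mul_assoc casimir_def)
  finally show ?thesis .
qed

lemma tpair_casimir: "tpair br (casimir br) x y = K x y"
  by (simp add: tpair_contract2 contract2_casimir K_sym)

lemma contract1_casimir: "contract1 br (casimir br) x = x"
  by (rule K_eqI) (simp add: tpair_casimir flip: tpair_contract1)

lemma contract2_eq_0_imp: "(\<And>x. contract2 br T x = 0) \<Longrightarrow> T = 0"
proof -
  assume *: "\<And>x. contract2 br T x = 0"
  have "(T ** Gram) *v y = 0" for y
  proof -
    have "(T *v (Gram *v y)) = contract2 br T y"
      by (simp add: vec_eq_iff contract2_nth matrix_vector_mult_def[of T] Gram_vec)
    then show ?thesis by (simp add: * matrix_vector_mul_assoc)
  qed
  then have "T ** Gram = 0"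
    by (metis matrix_eq matrix_vector_mult_0)
  then have "T ** (Gram ** casimir br) = 0"
    by (simp add: matrix_mul_assoc)
  then show "T = 0"
    using matrix_inv(1)[OF invertible_Gram] by (simp add: casimir_def)
qed

end

text \<open>The radical of the Killing form is an ideal, hence 0 or everything, and the unit vector
  \<open>x\<close> excludes the latter. Members of the orthonormal basis of \<open>h\<close> will
  serve as \<open>x\<close>.\<close>

lemma simple_killing_lie:
  assumes "simple_lie_algebra br" "killing br x x = 1"
  shows "killing_lie br"
proof -
  interpret lie br
    using assms by unfold_locales (simp add: simple_lie_algebra_def)
  define I where "I = {u. \<forall>v. K u v = 0}"
  have "vec.subspace I"
    by (auto simp: I_def vec.subspace_def K_add_left K_scale_left)
  moreover have "br u v \<in> I" if "v \<in> I" for u v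
    using that by (simp add: I_def) (metis K_inv K_swap neg_equal_0_iff_equal K_sym)
  ultimately have "I = {0} \<or> I = UNIV"
    using assms(1) by (auto simp: simple_lie_algebra_def)
  moreover have "x \<notin> I" using assms(2) by (auto simp: I_def intro!: exI[of _ x])
  ultimately have "I = {0}" by auto
  then show ?thesis
    by unfold_locales (auto simp: I_def set_eq_iff)
qed

section \<open>Functions on circles\<close>

text \<open>On the circle, dw = 2 pi i w dt, so this is the contour integral divided by 2 pi i. The
  parameter form on a fixed interval is the one to which continuity in parameters and the Leibniz
  rule apply.\<close>

definition cint :: "real \<Rightarrow> (complex \<Rightarrow> complex) \<Rightarrow> complex" where
  "cint \<rho> F = integral {0..1} (\<lambda>t. F (circlepath 0 \<rho> t) * circlepath 0 \<rho> t)"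

lemma norm_circlepath_0: "0 \<le> \<rho> \<Longrightarrow> circlepath 0 \<rho> t \<in> sphere 0 \<rho>"
  by (simp add: circlepath norm_mult)

lemma continuous_on_circlepath [continuous_intros]: "continuous_on A (circlepath z \<rho>)"
  unfolding circlepath by (intro continuous_intros)

lemma contour_integral_cint: "contour_integral (circlepath 0 \<rho>) F = 2 * pi * \<i> * cint \<rho> F"
  unfolding contour_integral_integral cint_def vector_derivative_circlepath
  by (subst integral_mult_right[symmetric]) (simp add: circlepath mult_ac)

lemma cint_eq: "cint \<rho> F = contour_integral (circlepath 0 \<rho>) F / (2 * pi * \<i>)"
  by (simp add: contour_integral_cint)

lemma cint_cong: "0 \<le> \<rho> \<Longrightarrow> (\<And>w. w \<in> sphere 0 \<rho> \<Longrightarrow> F w = G w) \<Longrightarrow> cint \<rho> F = cint \<rho> G"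
  unfolding cint_def using norm_circlepath_0 by (metis (no_types, lifting))

lemma cint_integrable:
  assumes "0 \<le> \<rho>" "continuous_on (sphere 0 \<rho>) F"
  shows "(\<lambda>t. F (circlepath 0 \<rho> t) * circlepath 0 \<rho> t) integrable_on {0..1}"
  by (intro integrable_continuous_interval continuous_intros continuous_on_compose2[OF assms(2)])
    (use assms(1) norm_circlepath_0 in auto)

lemma cint_add:
  assumes "0 \<le> \<rho>" "continuous_on (sphere 0 \<rho>) F" "continuous_on (sphere 0 \<rho>) G"
  shows "cint \<rho> (\<lambda>w. F w + G w) = cint \<rho> F + cint \<rho> G"
  unfolding cint_def using cint_integrable[OF assms(1,2)] cint_integrable[OF assms(1,3)]
  by (simp add: distrib_right integral_add)

lemma cint_mult_left: "cint \<rho> (\<lambda>w. c * F w) = c * cint \<rho> F"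
  by (simp add: cint_def mult.assoc)

lemma cint_mult_right: "cint \<rho> (\<lambda>w. F w * c) = cint \<rho> F * c"
  using cint_mult_left[of \<rho> c F] by (simp add: mult.commute)

lemma cint_minus: "cint \<rho> (\<lambda>w. - F w) = - cint \<rho> F"
  using cint_mult_left[of \<rho> "-1" F] by simp

lemma cint_0 [simp]: "cint \<rho> (\<lambda>w. 0) = 0"
  by (simp add: cint_def)

lemma cint_sum:
  assumes "0 \<le> \<rho>" "\<And>i. i \<in> I \<Longrightarrow> continuous_on (sphere 0 \<rho>) (F i)"
  shows "cint \<rho> (\<lambda>w. \<Sum>i\<in>I. F i w) = (\<Sum>i\<in>I. cint \<rho> (F i))"
  using assms(2)
  by (induction I rule: infinite_finite_induct) (auto simp: cint_add[OF assms(1)] continuous_on_sum)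

lemma cint_residue:
  assumes "F holomorphic_on ball 0 d - {0}" "0 < \<rho>" "\<rho> < d"
  shows "cint \<rho> F = residue F 0"
  using contour_integral_unique[OF base_residue[of "ball 0 d" 0 \<rho> F]] assms
  by (simp add: cint_eq cball_subset_ball_iff)

lemma cint_swap:
  assumes "0 \<le> \<rho>" "0 \<le> \<sigma>" "continuous_on (sphere 0 \<rho> \<times> sphere 0 \<sigma>) (\<lambda>(w, z). F w z)"
  shows "cint \<rho> (\<lambda>w. cint \<sigma> (F w)) = cint \<sigma> (\<lambda>z. cint \<rho> (\<lambda>w. F w z))"
proof -
  have "contour_integral (circlepath 0 \<rho>) (\<lambda>w. contour_integral (circlepath 0 \<sigma>) (F w)) =
        contour_integral (circlepath 0 \<sigma>) (\<lambda>z. contour_integral (circlepath 0 \<rho>) (\<lambda>w. F w z))"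
    by (rule contour_integral_swap) (use assms in \<open>auto simp: vector_derivative_circlepath intro!: continuous_intros\<close>)
  then show ?thesis
    by (simp add: contour_integral_cint cint_mult_left)
qed

lemma cint_continuous:
  fixes F :: "'a::topological_space \<Rightarrow> complex \<Rightarrow> complex"
  assumes "0 \<le> \<rho>" "continuous_on (A \<times> sphere 0 \<rho>) (\<lambda>(x, w). F x w)"
  shows "continuous_on A (\<lambda>x. cint \<rho> (F x))"
proof -
  have "continuous_on (A \<times> cbox 0 1) (\<lambda>(x, t). F x (circlepath 0 \<rho> t) * circlepath 0 \<rho> t)"
    unfolding split_beta
    by (intro continuous_intros continuous_on_compose2[OF assms(2)[unfolded split_beta], of _ "\<lambda>p. (fst p, circlepath 0 \<rho> (snd p))", simplified]
        continuous_on_compose2[OF continuous_on_circlepath[of UNIV]])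
      (use norm_circlepath_0[OF assms(1)] in auto)
  from integral_continuous_on_param[OF this] show ?thesis
    by (simp add: cint_def cbox_interval)
qed

section \<open>Holomorphic functions of several variables\<close>

abbreviation fder :: "('a::real_normed_vector \<Rightarrow> complex) \<Rightarrow> 'a \<Rightarrow> 'a \<Rightarrow> complex" where
  "fder f x \<equiv> frechet_derivative f (at x)"

lemma holomorphic_wrtD:
  assumes "holomorphic_wrt scl f S" "x \<in> S"
  shows "(f has_derivative fder f x) (at x)" "fder f x (scl c v) = c * fder f x v"
  using assms frechet_derivative_at unfolding holomorphic_wrt_def by (metis)+

lemma holomorphic_wrtI:
  assumes "\<And>x. x \<in> S \<Longrightarrow> (f has_derivative f' x) (at x)" "\<And>x c v. x \<in> S \<Longrightarrow> f' x (scl c v) = c * f' x v"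
  shows "holomorphic_wrt scl f S"
  using assms unfolding holomorphic_wrt_def by blast

lemma holomorphic_wrt_cong:
  assumes "holomorphic_wrt scl f S" "open S" "\<And>x. x \<in> S \<Longrightarrow> f x = g x"
  shows "holomorphic_wrt scl g S"
  using assms has_derivative_transform_within_open[of f _ _ UNIV S g] unfolding holomorphic_wrt_def by metis

lemma holomorphic_wrt_subset: "holomorphic_wrt scl f S \<Longrightarrow> T \<subseteq> S \<Longrightarrow> holomorphic_wrt scl f T"
  unfolding holomorphic_wrt_def by blast

lemma holomorphic_wrt_local:
  "(\<And>x. x \<in> S \<Longrightarrow> \<exists>T. x \<in> T \<and> holomorphic_wrt scl f T) \<Longrightarrow> holomorphic_wrt scl f S"
  unfolding holomorphic_wrt_def by blast

lemma holomorphic_wrt_continuous: "holomorphic_wrt scl f S \<Longrightarrow> continuous_on S f"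
  by (metis continuous_at_imp_continuous_on has_derivative_continuous holomorphic_wrtD(1))

lemma holomorphic_wrt_add:
  assumes "holomorphic_wrt scl f S" "holomorphic_wrt scl g S"
  shows "holomorphic_wrt scl (\<lambda>x. f x + g x) S"
proof (rule holomorphic_wrtI)
  fix x assume "x \<in> S"
  then show "((\<lambda>x. f x + g x) has_derivative (\<lambda>v. fder f x v + fder g x v)) (at x)"
    by (intro has_derivative_add holomorphic_wrtD(1)[OF assms(1)] holomorphic_wrtD(1)[OF assms(2)])
qed (simp add: holomorphic_wrtD(2)[OF assms(1)] holomorphic_wrtD(2)[OF assms(2)] distrib_left)

lemma holomorphic_wrt_mult:
  assumes "holomorphic_wrt scl f S" "holomorphic_wrt scl g S"
  shows "holomorphic_wrt scl (\<lambda>x. f x * g x) S"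
proof (rule holomorphic_wrtI)
  fix x assume "x \<in> S"
  then show "((\<lambda>x. f x * g x) has_derivative (\<lambda>v. f x * fder g x v + fder f x v * g x)) (at x)"
    by (intro has_derivative_mult holomorphic_wrtD(1)[OF assms(1)] holomorphic_wrtD(1)[OF assms(2)])
qed (simp add: holomorphic_wrtD(2)[OF assms(1)] holomorphic_wrtD(2)[OF assms(2)] algebra_simps)

lemma holomorphic_wrt_const: "holomorphic_wrt scl (\<lambda>x. k) S"
  by (rule holomorphic_wrtI[of _ _ "\<lambda>x v. 0"]) auto

lemma holomorphic_wrt_linear:
  assumes "bounded_linear f" "\<And>c v. f (scl c v) = c * f v"
  shows "holomorphic_wrt scl f S"
  by (rule holomorphic_wrtI[of _ _ "\<lambda>x. f"]) (use assms bounded_linear_imp_has_derivative in auto)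

lemma holomorphic_wrt_sum:
  "(\<And>i. i \<in> I \<Longrightarrow> holomorphic_wrt scl (f i) S) \<Longrightarrow> holomorphic_wrt scl (\<lambda>x. \<Sum>i\<in>I. f i x) S"
  by (induction I rule: infinite_finite_induct) (auto intro: holomorphic_wrt_const holomorphic_wrt_add)

lemma holomorphic_wrt_compose_affine:
  assumes f: "holomorphic_wrt scl f S" and L: "bounded_linear L" and scl: "\<And>c v. L (scl' c v) = scl c (L v)"
    and T: "\<And>x. x \<in> T \<Longrightarrow> L x + b \<in> S"
  shows "holomorphic_wrt scl' (\<lambda>x. f (L x + b)) T"
proof (rule holomorphic_wrtI)
  fix x assume x: "x \<in> T"
  have "((\<lambda>x. L x + b) has_derivative L) (at x)"
    by (auto intro!: derivative_eq_intros bounded_linear_imp_has_derivative L)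
  from has_derivative_compose[OF this holomorphic_wrtD(1)[OF f T[OF x]]]
  show "((\<lambda>x. f (L x + b)) has_derivative (\<lambda>v. fder f (L x + b) (L v))) (at x)" .
qed (simp add: scl holomorphic_wrtD(2)[OF f T])

lemma fder_compose_affine:
  assumes f: "holomorphic_wrt scl f S" and L: "bounded_linear L" and x: "L x + b \<in> S"
  shows "fder (\<lambda>x. f (L x + b)) x v = fder f (L x + b) (L v)"
proof -
  have "((\<lambda>x. L x + b) has_derivative L) (at x)"
    by (auto intro!: derivative_eq_intros bounded_linear_imp_has_derivative L)
  from has_derivative_compose[OF this holomorphic_wrtD(1)[OF f x]]
  have "((\<lambda>x. f (L x + b)) has_derivative (\<lambda>v. fder f (L x + b) (L v))) (at x)" .
  from frechet_derivative_at[OF this] show ?thesis by metis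
qed

lemma bounded_linear_scale2_left: "bounded_linear (\<lambda>c. scale2 c (v :: (complex ^ 'l::finite) \<times> complex))"
proof (rule bounded_linear_intro[where K = "norm v"])
  fix c :: complex
  have "norm (c *s fst v) = norm c * norm (fst v)"
    by (simp add: norm_vec_def L2_set_def norm_mult power_mult_distrib sum_distrib_left[symmetric] real_sqrt_mult)
  then show "norm (scale2 c v) \<le> norm c * norm v"
    by (simp add: scale2_def split_beta norm_prod_def norm_mult power_mult_distrib distrib_left[symmetric] real_sqrt_mult)
qed (simp_all add: scale2_def split_beta vec_eq_iff algebra_simps prod_eq_iff)

lemma line_has_field_derivative:
  fixes f :: "(complex ^ 'l::finite) \<times> complex \<Rightarrow> complex"
  assumes "holomorphic_wrt scale2 f S" "x + scale2 t v \<in> S"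
  shows "((\<lambda>t. f (x + scale2 t v)) has_field_derivative fder f (x + scale2 t v) v) (at t)"
proof -
  have "((\<lambda>t. x + scale2 t v) has_derivative (\<lambda>t. scale2 t v)) (at t)"
    by (auto intro!: derivative_eq_intros bounded_linear_imp_has_derivative bounded_linear_scale2_left)
  from has_derivative_compose[OF this holomorphic_wrtD(1)[OF assms]]
  show ?thesis
    unfolding has_field_derivative_def
    by (rule has_derivative_eq_rhs) (simp add: fun_eq_iff holomorphic_wrtD(2)[OF assms] mult.commute)
qed

lemma continuous_on_scale2 [continuous_intros]:
  assumes "continuous_on A f" "continuous_on A g"
  shows "continuous_on A (\<lambda>x. scale2 (f x) (g x :: (complex ^ 'l::finite) \<times> complex))"
  unfolding scale2_def split_beta vector_scalar_mult_def
  by (intro continuous_intros assms)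

text \<open>The Cauchy formula on complex lines expresses the partial derivatives as circle integrals of
  the continuous function itself.\<close>

lemma local_Cauchy:
  fixes f :: "(complex ^ 'l::finite) \<times> complex \<Rightarrow> complex"
  assumes f: "holomorphic_wrt scale2 f S" and S: "open S" and x0: "x0 \<in> S"
  obtains A \<epsilon> where "open A" "x0 \<in> A" "A \<subseteq> S" "\<epsilon> > 0" "\<And>x t. x \<in> A \<Longrightarrow> t \<in> cball 0 \<epsilon> \<Longrightarrow> x + scale2 t v \<in> S"
    "\<And>x. x \<in> A \<Longrightarrow> fder f x v = cint \<epsilon> (\<lambda>t. f (x + scale2 t v) * (1 / t\<^sup>2))"
proof -
  define T where "T = (\<lambda>(x, t). x + scale2 t v) -` S"
  have "open T"
    unfolding T_def split_beta by (intro open_vimage S continuous_intros)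
  moreover have "(x0, 0) \<in> T"
    using x0 by (simp add: T_def scale2_def split_beta zero_prod_def[symmetric])
  ultimately obtain A B where AB: "open A" "open B" "x0 \<in> A" "0 \<in> B" "A \<times> B \<subseteq> T"
    by (metis open_prod_elim mem_Sigma_iff)
  obtain \<epsilon> where \<epsilon>: "\<epsilon> > 0" "cball 0 \<epsilon> \<subseteq> B"
    using AB open_contains_cball by blast
  have in_S: "x + scale2 t v \<in> S" if "x \<in> A" "t \<in> cball 0 \<epsilon>" for x t
  proof -
    have "(x, t) \<in> T"
      using that AB(5) \<epsilon>(2) by blast
    then show ?thesis by (simp add: T_def)
  qed
  have "fder f x v = cint \<epsilon> (\<lambda>t. f (x + scale2 t v) * (1 / t\<^sup>2))" if x: "x \<in> A" for x
  proof -
    let ?g = "\<lambda>t. f (x + scale2 t v)"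
    have der: "(?g has_field_derivative fder f (x + scale2 t v) v) (at t)" if "t \<in> cball 0 \<epsilon>" for t
      by (rule line_has_field_derivative[OF f in_S[OF x that]])
    have "continuous_on (cball 0 \<epsilon>) ?g" "?g holomorphic_on ball 0 \<epsilon>"
      using der by (meson continuous_at_imp_continuous_on DERIV_isCont)
        (use der in \<open>force simp: holomorphic_on_open\<close>)
    from Cauchy_derivative_integral_circlepath(2)[OF this, of 0] \<epsilon>
    have "(?g has_field_derivative (1 / (2 * of_real pi * \<i>) * contour_integral (circlepath 0 \<epsilon>) (\<lambda>u. ?g u / (u - 0)\<^sup>2))) (at 0)"
      by simp
    moreover have "(?g has_field_derivative fder f x v) (at 0)"
      using der[of 0] \<epsilon> by (simp add: scale2_def split_beta zero_prod_def[symmetric])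
    ultimately show ?thesis
      using DERIV_unique by (fastforce simp: cint_eq)
  qed
  moreover have "A \<subseteq> S"
    using in_S[of _ 0] \<epsilon> by (auto simp: scale2_def split_beta zero_prod_def[symmetric])
  ultimately show ?thesis
    using that AB \<epsilon> in_S by blast
qed

text \<open>Holomorphy was defined by mere Frechet differentiability. Differentiation under the
  integral sign needs a continuous derivative, and the Cauchy formula supplies it.\<close>

lemma continuous_on_fder:
  fixes f :: "(complex ^ 'l::finite) \<times> complex \<Rightarrow> complex"
  assumes f: "holomorphic_wrt scale2 f S" and S: "open S"
  shows "continuous_on S (\<lambda>x. fder f x v)"
proof (subst continuous_on_eq_continuous_at[OF S], intro ballI)
  fix x0 assume "x0 \<in> S"
  then obtain A \<epsilon> where A: "open A" "x0 \<in> A" "\<epsilon> > 0" "\<And>x t. x \<in> A \<Longrightarrow> t \<in> cball 0 \<epsilon> \<Longrightarrow> x + scale2 t v \<in> S"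
    "\<And>x. x \<in> A \<Longrightarrow> fder f x v = cint \<epsilon> (\<lambda>t. f (x + scale2 t v) * (1 / t\<^sup>2))"
    by (rule local_Cauchy[OF f S, of x0 v]) blast
  have "continuous_on A (\<lambda>x. cint \<epsilon> (\<lambda>t. f (x + scale2 t v) * (1 / t\<^sup>2)))"
  proof (rule cint_continuous)
    show "continuous_on (A \<times> sphere 0 \<epsilon>) (\<lambda>(x, t). f (x + scale2 t v) * (1 / t\<^sup>2))"
      unfolding split_beta
      by (intro continuous_intros continuous_on_compose2[OF holomorphic_wrt_continuous[OF f]]) (use A in auto)
  qed (use A in auto)
  then have "continuous_on A (\<lambda>x. fder f x v)"
    by (rule continuous_on_eq) (simp add: A(5))
  then show "isCont (\<lambda>x. fder f x v) x0"
    using A continuous_on_eq_continuous_at by blast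
qed

text \<open>The integrand sees \<open>x\<close> only through a translation by
  \<open>\<zeta> w\<close>. This one shape covers the dependence on \<open>q\<close> at fixed
  \<open>w\<close> as well as the dependence on \<open>z\<close> through
  \<open>w - z\<close>.\<close>

proposition cint_has_derivative:
  fixes f :: "(complex ^ 'l::finite) \<times> complex \<Rightarrow> complex"
  assumes f: "holomorphic_wrt scale2 f S" and S: "open S" and T: "open T" "x0 \<in> T" and \<rho>: "0 \<le> \<rho>"
    and \<zeta>: "continuous_on (sphere 0 \<rho>) \<zeta>" and \<phi>: "continuous_on (sphere 0 \<rho>) \<phi>"
    and in_S: "\<And>x w. x \<in> T \<Longrightarrow> w \<in> sphere 0 \<rho> \<Longrightarrow> x + \<zeta> w \<in> S"
  shows "((\<lambda>x. cint \<rho> (\<lambda>w. f (x + \<zeta> w) * \<phi> w)) has_derivative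
           (\<lambda>v. cint \<rho> (\<lambda>w. fder f (x0 + \<zeta> w) v * \<phi> w))) (at x0)"
proof -
  obtain d where d: "d > 0" "ball x0 d \<subseteq> T"
    using T open_contains_ball by blast
  \<comment> \<open>The Leibniz rule asks for a convex parameter set.\<close>
  define U where "U = ball x0 d"
  have UT: "x \<in> U \<Longrightarrow> x \<in> T" for x using d by (auto simp: U_def)
  define c where "c = circlepath 0 \<rho>"
  have c: "c t \<in> sphere 0 \<rho>" for t unfolding c_def by (rule norm_circlepath_0[OF \<rho>])
  have c_cont: "continuous_on A c" for A unfolding c_def by (intro continuous_intros)
  define g where "g x t = f (x + \<zeta> (c t)) * \<phi> (c t) * c t" for x and t :: real
  define g' where "g' x t = Blinfun (\<lambda>v. fder f (x + \<zeta> (c t)) v * \<phi> (c t) * c t)" for x and t :: real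
  have bl: "bounded_linear (\<lambda>v. fder f (x + \<zeta> (c t)) v * \<phi> (c t) * c t)" if "x \<in> T" for x t
    by (intro bounded_linear_mult_const has_derivative_bounded_linear[OF holomorphic_wrtD(1)[OF f in_S[OF that c]]])
  have g'_apply: "blinfun_apply (g' x t) v = fder f (x + \<zeta> (c t)) v * \<phi> (c t) * c t" if "x \<in> T" for x t v
    unfolding g'_def using bounded_linear_Blinfun_apply[OF bl[OF that]] by simp
  have cont_shift: "continuous_on (U \<times> cbox 0 1) (\<lambda>p. fst p + \<zeta> (c (snd p)))"
    by (intro continuous_intros continuous_on_compose2[OF \<zeta>] continuous_on_compose2[OF c_cont[of UNIV]])
      (use c in auto)
  have cont_g': "continuous_on (U \<times> cbox 0 1) (\<lambda>p. fder f (fst p + \<zeta> (c (snd p))) v * \<phi> (c (snd p)) * c (snd p))" for v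
    by (intro continuous_intros continuous_on_compose2[OF continuous_on_fder[OF f S]] cont_shift
        continuous_on_compose2[OF \<phi>] continuous_on_compose2[OF c_cont[of UNIV]])
      (use c in_S UT in auto)
  have "((\<lambda>x. integral (cbox 0 1) (g x)) has_derivative integral (cbox 0 1) (g' x0)) (at x0 within U)"
  proof (rule leibniz_rule)
    fix x t assume "x \<in> U" "t \<in> cbox 0 (1::real)"
    then have "((\<lambda>x. f (x + \<zeta> (c t))) has_derivative fder f (x + \<zeta> (c t))) (at x)"
      using has_derivative_compose[of "\<lambda>x. x + \<zeta> (c t)" "\<lambda>v. v" x UNIV f, OF _ holomorphic_wrtD(1)[OF f in_S[OF UT c]]]
      by (simp add: has_derivative_add_const)
    then have "((\<lambda>x. g x t) has_derivative (\<lambda>v. fder f (x + \<zeta> (c t)) v * \<phi> (c t) * c t)) (at x)"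
      unfolding g_def by (intro has_derivative_mult_left)
    then show "((\<lambda>x. g x t) has_derivative blinfun_apply (g' x t)) (at x within U)"
      unfolding g'_apply[OF UT[OF \<open>x \<in> U\<close>], abs_def] by (rule has_derivative_at_withinI)
  next
    fix x assume "x \<in> U"
    show "g x integrable_on cbox 0 1"
      unfolding g_def
      by (intro integrable_continuous continuous_intros continuous_on_compose2[OF holomorphic_wrt_continuous[OF f]]
          continuous_on_compose2[OF \<zeta>] continuous_on_compose2[OF \<phi>] c_cont)
        (use c in_S[OF UT[OF \<open>x \<in> U\<close>] c] in auto)
  next
    show "continuous_on (U \<times> cbox 0 1) (\<lambda>(x, t). g' x t)"
      unfolding split_beta
    \<comment> \<open>The Leibniz rule wants the derivative continuous in operator norm; in finite
      dimension it is enough to check each direction separately.\<close>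
    proof (rule continuous_on_blinfun_componentwise)
      fix i :: "(complex ^ 'l) \<times> complex"
      show "continuous_on (U \<times> cbox 0 1) (\<lambda>x. blinfun_apply (g' (fst x) (snd x)) i)"
        using cont_g'[of i] by (rule continuous_on_eq) (simp add: mem_Times_iff g'_apply UT)
    qed
  qed (use d in \<open>auto simp: U_def\<close>)
  moreover have "blinfun_apply (integral (cbox 0 1) (g' x0)) = (\<lambda>v. cint \<rho> (\<lambda>w. fder f (x0 + \<zeta> w) v * \<phi> w))"
  proof
    fix v
    have "g' x0 integrable_on cbox 0 1"
    proof (rule integrable_continuous)
      show "continuous_on (cbox 0 1) (g' x0)"
      proof (rule continuous_on_blinfun_componentwise)
        fix i :: "(complex ^ 'l) \<times> complex"
        have "continuous_on (cbox 0 1) (\<lambda>t. fder f (x0 + \<zeta> (c t)) i * \<phi> (c t) * c t)"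
          by (rule continuous_on_compose2[OF cont_g'[of i], of "cbox 0 1" "\<lambda>t. (x0, t)", simplified fst_conv snd_conv])
            (use d in \<open>auto simp: U_def intro!: continuous_intros\<close>)
        then show "continuous_on (cbox 0 1) (\<lambda>x. blinfun_apply (g' x0 x) i)"
          using g'_apply[OF T(2)] by simp
      qed
    qed
    then show "blinfun_apply (integral (cbox 0 1) (g' x0)) v = cint \<rho> (\<lambda>w. fder f (x0 + \<zeta> w) v * \<phi> w)"
      by (simp add: blinfun_apply_integral g'_apply[OF T(2)] cint_def c_def[symmetric] cbox_interval)
  qed
  ultimately have "((\<lambda>x. integral (cbox 0 1) (g x)) has_derivative (\<lambda>v. cint \<rho> (\<lambda>w. fder f (x0 + \<zeta> w) v * \<phi> w))) (at x0)"
    using at_within_open[of x0 U] d by (simp add: U_def)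
  then show ?thesis
    by (simp add: cint_def g_def[abs_def] c_def cbox_interval)
qed

lemma holomorphic_wrt_cint:
  fixes f :: "(complex ^ 'l::finite) \<times> complex \<Rightarrow> complex"
  assumes f: "holomorphic_wrt scale2 f S" and S: "open S" and T: "open T" and \<rho>: "0 \<le> \<rho>"
    and \<zeta>: "continuous_on (sphere 0 \<rho>) \<zeta>" and \<phi>: "continuous_on (sphere 0 \<rho>) \<phi>"
    and in_S: "\<And>x w. x \<in> T \<Longrightarrow> w \<in> sphere 0 \<rho> \<Longrightarrow> x + \<zeta> w \<in> S"
  shows "holomorphic_wrt scale2 (\<lambda>x. cint \<rho> (\<lambda>w. f (x + \<zeta> w) * \<phi> w)) T"
proof (rule holomorphic_wrtI[OF cint_has_derivative[OF f S T _ \<rho> \<zeta> \<phi> in_S]])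
  fix x c v assume "x \<in> T"
  have "cint \<rho> (\<lambda>w. fder f (x + \<zeta> w) (scale2 c v) * \<phi> w) = cint \<rho> (\<lambda>w. c * (fder f (x + \<zeta> w) v * \<phi> w))"
    by (rule cint_cong[OF \<rho>]) (simp add: holomorphic_wrtD(2)[OF f in_S[OF \<open>x \<in> T\<close>]])
  then show "cint \<rho> (\<lambda>w. fder f (x + \<zeta> w) (scale2 c v) * \<phi> w) = c * cint \<rho> (\<lambda>w. fder f (x + \<zeta> w) v * \<phi> w)"
    by (simp add: cint_mult_left)
qed auto

text \<open>The Cauchy integral for the derivative is a contour integral over translates of
  \<open>f\<close>, hence holomorphic in \<open>x\<close> again. Derivatives of \<open>r\<close> in
  \<open>q\<close> can therefore be moved along contours like \<open>r\<close> itself.\<close>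

lemma holomorphic_wrt_fder:
  fixes f :: "(complex ^ 'l::finite) \<times> complex \<Rightarrow> complex"
  assumes f: "holomorphic_wrt scale2 f S" and S: "open S"
  shows "holomorphic_wrt scale2 (\<lambda>x. fder f x v) S"
proof (rule holomorphic_wrt_local)
  fix x0 assume "x0 \<in> S"
  then obtain A \<epsilon> where A: "open A" "x0 \<in> A" "\<epsilon> > 0" "\<And>x t. x \<in> A \<Longrightarrow> t \<in> cball 0 \<epsilon> \<Longrightarrow> x + scale2 t v \<in> S"
    "\<And>x. x \<in> A \<Longrightarrow> fder f x v = cint \<epsilon> (\<lambda>t. f (x + scale2 t v) * (1 / t\<^sup>2))"
    by (rule local_Cauchy[OF f S, of x0 v]) blast
  have "holomorphic_wrt scale2 (\<lambda>x. cint \<epsilon> (\<lambda>t. f (x + scale2 t v) * (1 / t\<^sup>2))) A"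
    by (rule holomorphic_wrt_cint[OF f S A(1)]) (use A in \<open>auto intro!: continuous_intros\<close>)
  then have "holomorphic_wrt scale2 (\<lambda>x. fder f x v) A"
    by (rule holomorphic_wrt_cong) (use A in auto)
  then show "\<exists>T. x0 \<in> T \<and> holomorphic_wrt scale2 (\<lambda>x. fder f x v) T"
    using A by blast
qed

lemma holomorphic_on_slice:
  fixes f :: "(complex ^ 'l::finite) \<times> complex \<Rightarrow> complex"
  assumes f: "holomorphic_wrt scale2 f S" and A: "open A" "\<And>z. z \<in> A \<Longrightarrow> (q, z) \<in> S"
  shows "(\<lambda>z. f (q, z)) holomorphic_on A"
proof -
  have "((\<lambda>t. f (q, t)) has_field_derivative fder f (q, z) (0, 1)) (at z)" if "z \<in> A" for z
    using line_has_field_derivative[OF f, of "(q, 0)" z "(0, 1)"] A(2)[OF that]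
    by (simp add: scale2_def)
  then show ?thesis
    using A(1) holomorphic_on_open by blast
qed

section \<open>Poles of bounded order\<close>

text \<open>Write \<open>f = N / D\<close> near a point with \<open>z = 0\<close> and expand
  \<open>D (q, z)\<close> in powers of \<open>z\<close>. If \<open>k\<close> is the first power
  whose coefficient does not vanish for all \<open>q\<close> nearby, then on the open set where this
  coefficient is nonzero \<open>D\<close> vanishes to order exactly \<open>k\<close>, and
  \<open>z ^ k * f\<close> stays bounded.\<close>

lemma generic_pole_order:
  fixes f :: "(complex ^ 'l::finite) \<times> complex \<Rightarrow> complex"
  assumes f: "meromorphic_wrt scale2 f" and B: "open B" "B \<noteq> {}"
  obtains Z k where "open Z" "Z \<noteq> {}" "Z \<subseteq> B" "\<And>q. q \<in> Z \<Longrightarrow> \<exists>L. ((\<lambda>z. z ^ k * f (q, z)) \<longlongrightarrow> L) (at 0)"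
proof -
  obtain q1 where q1: "q1 \<in> B" using B by blast
  obtain U N D where U: "open U" "(q1, 0) \<in> U" and N: "holomorphic_wrt scale2 N U" and D: "holomorphic_wrt scale2 D U"
    and dense: "\<And>W. open W \<Longrightarrow> W \<subseteq> U \<Longrightarrow> W \<noteq> {} \<Longrightarrow> \<exists>y\<in>W. D y \<noteq> 0"
    and quot: "\<And>y. y \<in> U \<Longrightarrow> D y \<noteq> 0 \<Longrightarrow> f y = N y / D y"
    using f unfolding meromorphic_wrt_def by metis
  obtain A C where AC: "open A" "open C" "q1 \<in> A" "0 \<in> C" "A \<times> C \<subseteq> U"
    using open_prod_elim[OF U] by (metis mem_Sigma_iff)
  obtain \<epsilon> where \<epsilon>: "\<epsilon> > 0" "ball 0 \<epsilon> \<subseteq> C"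
    using AC open_contains_ball by blast
  define A' where "A' = A \<inter> B"
  have A': "open A'" "q1 \<in> A'" "A' \<subseteq> B" using AC B q1 by (auto simp: A'_def)
  have in_U: "(q, z) \<in> U" if "q \<in> A'" "z \<in> ball 0 \<epsilon>" for q z
    using that AC(5) \<epsilon>(2) unfolding A'_def by blast
  have holD: "(\<lambda>z. D (q, z)) holomorphic_on ball 0 \<epsilon>" if "q \<in> A'" for q
    by (rule holomorphic_on_slice[OF D]) (use in_U[OF that] in auto)
  have holN: "(\<lambda>z. N (q, z)) holomorphic_on ball 0 \<epsilon>" if "q \<in> A'" for q
    by (rule holomorphic_on_slice[OF N]) (use in_U[OF that] in auto)
  define \<rho> where "\<rho> = \<epsilon> / 2"
  have \<rho>: "0 < \<rho>" "\<rho> < \<epsilon>" using \<epsilon> by (auto simp: \<rho>_def)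
  \<comment> \<open>The \<open>j\<close>-th Taylor coefficient of \<open>D (q, z)\<close> in
    \<open>z\<close>. As a contour integral it is visibly continuous in \<open>q\<close>.\<close>
  define c where "c j q = cint \<rho> (\<lambda>w. D (q, w) * (1 / w ^ Suc j))" for j q
  have c_deriv: "c j q = (deriv ^^ j) (\<lambda>z. D (q, z)) 0 / fact j" if "q \<in> A'" for j q
  proof -
    have "continuous_on (cball 0 \<rho>) (\<lambda>z. D (q, z))" "(\<lambda>z. D (q, z)) holomorphic_on ball 0 \<rho>"
      using holomorphic_on_subset[OF holD[OF that]] holomorphic_on_imp_continuous_on \<rho>
      by (auto simp: cball_subset_ball_iff subset_ball)
    from Cauchy_has_contour_integral_higher_derivative_circlepath[OF this, of 0 j] \<rho>
    show ?thesis
      by (simp add: c_def cint_eq contour_integral_unique)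
  qed
  have c_cont: "continuous_on A' (c j)" for j
    unfolding c_def
  proof (rule cint_continuous)
    show "continuous_on (A' \<times> sphere 0 \<rho>) (\<lambda>(q, w). D (q, w) * (1 / w ^ Suc j))"
      unfolding split_beta
      by (intro continuous_intros continuous_on_compose2[OF holomorphic_wrt_continuous[OF D]])
        (use \<rho> in_U in auto)
  qed (use \<rho> in auto)
  \<comment> \<open>If every coefficient vanished for every \<open>q\<close>, then \<open>D\<close>
    would vanish on a whole open product, against the condition on denominators.\<close>
  have "\<exists>k. \<exists>q\<in>A'. c k q \<noteq> 0"
  proof -
    have "open (A' \<times> ball (0::complex) \<epsilon>)" "A' \<times> ball (0::complex) \<epsilon> \<noteq> {}"
      using A' \<epsilon> by (auto intro!: open_Times)
    moreover have "A' \<times> ball 0 \<epsilon> \<subseteq> U" using in_U by auto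
    ultimately obtain q z where qz: "q \<in> A'" "z \<in> ball 0 \<epsilon>" "D (q, z) \<noteq> 0"
      using dense[of "A' \<times> ball 0 \<epsilon>"] by auto
    then obtain k where "(deriv ^^ k) (\<lambda>z. D (q, z)) 0 \<noteq> 0"
      using holomorphic_fun_eq_0_on_ball[OF holD[OF qz(1)] qz(2)] by blast
    then show ?thesis using qz(1) c_deriv by (intro exI[of _ k] bexI[of _ q]) auto
  qed
  then obtain k where k: "\<exists>q\<in>A'. c k q \<noteq> 0" and k_min: "\<And>j q. j < k \<Longrightarrow> q \<in> A' \<Longrightarrow> c j q = 0"
    using exists_least_iff[of "\<lambda>k. \<exists>q\<in>A'. c k q \<noteq> 0"] by auto
  define Z where "Z = A' \<inter> c k -` (- {0})"
  show ?thesis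
  proof (rule that[of Z k])
    show "open Z" unfolding Z_def by (rule continuous_open_preimage[OF c_cont A'(1)]) auto
    show "Z \<noteq> {}" "Z \<subseteq> B" using k A' by (auto simp: Z_def)
    fix q assume "q \<in> Z"
    then have q: "q \<in> A'" "c k q \<noteq> 0" by (auto simp: Z_def)
    have d0: "(deriv ^^ j) (\<lambda>z. D (q, z)) 0 = 0" if "j < k" for j
      using k_min[OF that q(1)] c_deriv[OF q(1)] by simp
    have dk: "(deriv ^^ k) (\<lambda>z. D (q, z)) 0 \<noteq> 0"
      using q c_deriv[OF q(1), of k] by auto
    obtain g s where g: "0 < s" "g holomorphic_on ball 0 s" "\<And>w. w \<in> ball 0 s \<Longrightarrow> D (q, w) = w ^ k * g w"
      "\<And>w. w \<in> ball 0 s \<Longrightarrow> g w \<noteq> 0"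
    \<comment> \<open>At order zero there is no zero to factor out: \<open>g\<close> is
      \<open>D (q, z)\<close> itself on a ball where it stays nonzero.\<close>
    proof (cases "k = 0")
      case True
      have "isCont (\<lambda>z. D (q, z)) 0"
        using holomorphic_on_imp_continuous_on[OF holD[OF q(1)]] \<epsilon> by (simp add: continuous_on_eq_continuous_at)
      moreover have "D (q, 0) \<noteq> 0" using dk True by simp
      ultimately have "eventually (\<lambda>z. D (q, z) \<noteq> 0) (nhds 0)"
        using continuous_at_avoid[of 0 "\<lambda>z. D (q, z)" 0] unfolding eventually_nhds_metric by (metis dist_commute)
      then obtain s where "s > 0" "\<forall>z. dist z 0 < s \<longrightarrow> D (q, z) \<noteq> 0"
        unfolding eventually_nhds_metric by blast
      moreover have "(\<lambda>z. D (q, z)) holomorphic_on ball 0 (min s \<epsilon>)"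
        by (rule holomorphic_on_subset[OF holD[OF q(1)]]) (simp add: subset_ball)
      ultimately show ?thesis
        using that[of "min s \<epsilon>" "\<lambda>z. D (q, z)"] True \<epsilon> by auto
    next
      case False
      then have "D (q, 0) = 0" using d0[of 0] by simp
      show ?thesis
        by (rule holomorphic_factor_order_of_zero[OF holD[OF q(1)], of 0 k])
          (use \<open>D (q, 0) = 0\<close> False dk d0 \<epsilon> that in auto)
    qed
    have lim: "((\<lambda>z. N (q, z) / g z) \<longlongrightarrow> N (q, 0) / g 0) (at 0)"
    proof (rule tendsto_divide)
      show "((\<lambda>z. N (q, z)) \<longlongrightarrow> N (q, 0)) (at 0)"
        using holomorphic_on_imp_continuous_on[OF holN[OF q(1)]] \<epsilon>
        by (simp add: continuous_on_eq_continuous_at isCont_def)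
      show "(g \<longlongrightarrow> g 0) (at 0)"
        using holomorphic_on_imp_continuous_on[OF g(2)] g(1)
        by (simp add: continuous_on_eq_continuous_at isCont_def)
    qed (use g in auto)
    have ev: "eventually (\<lambda>z. N (q, z) / g z = z ^ k * f (q, z)) (at 0)"
      unfolding eventually_at
    proof (intro exI[of _ "min s \<epsilon>"] conjI ballI impI)
      fix z :: complex assume z: "z \<noteq> 0 \<and> dist z 0 < min s \<epsilon>"
      then have "D (q, z) = z ^ k * g z" "g z \<noteq> 0" "(q, z) \<in> U"
        using g in_U[OF q(1)] by auto
      then show "N (q, z) / g z = z ^ k * f (q, z)"
        using z quot by simp
    qed (use g \<epsilon> in auto)
    show "\<exists>L. ((\<lambda>z. z ^ k * f (q, z)) \<longlongrightarrow> L) (at 0)"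
      using Lim_transform_eventually[OF lim ev] by blast
  qed
qed

lemma tendsto_pole_mono:
  fixes F :: "complex \<Rightarrow> complex"
  assumes "\<exists>L. ((\<lambda>z. z ^ k * F z) \<longlongrightarrow> L) (at 0)" "k \<le> m"
  shows "\<exists>L. ((\<lambda>z. z ^ m * F z) \<longlongrightarrow> L) (at 0)"
proof -
  obtain L where "((\<lambda>z. z ^ k * F z) \<longlongrightarrow> L) (at 0)" using assms by blast
  then have "((\<lambda>z. z ^ (m - k) * (z ^ k * F z)) \<longlongrightarrow> 0 ^ (m - k) * L) (at 0)"
    by (intro tendsto_intros)
  then show ?thesis
    using assms(2) by (auto simp: mult.assoc[symmetric] power_add[symmetric])
qed

text \<open>The open set is shrunk once for each function and the largest order is kept, so that all
  matrix entries of \<open>r\<close> share one open set and one bound.\<close>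

lemma generic_pole_order_family:
  fixes f :: "'i \<Rightarrow> (complex ^ 'l::finite) \<times> complex \<Rightarrow> complex"
  assumes "finite I" "\<And>i. i \<in> I \<Longrightarrow> meromorphic_wrt scale2 (f i)" and B: "open B" "B \<noteq> {}"
  shows "\<exists>Z k. open Z \<and> Z \<noteq> {} \<and> Z \<subseteq> B \<and> (\<forall>q\<in>Z. \<forall>i\<in>I. \<exists>L. ((\<lambda>z. z ^ k * f i (q, z)) \<longlongrightarrow> L) (at 0))"
  using assms(1,2)
proof (induction I)
  case empty
  then show ?case using B by auto
next
  case (insert i I)
  then obtain Z k where Z: "open Z" "Z \<noteq> {}" "Z \<subseteq> B" "\<forall>q\<in>Z. \<forall>i\<in>I. \<exists>L. ((\<lambda>z. z ^ k * f i (q, z)) \<longlongrightarrow> L) (at 0)"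
    by auto
  obtain Z' k' where Z': "open Z'" "Z' \<noteq> {}" "Z' \<subseteq> Z" "\<And>q. q \<in> Z' \<Longrightarrow> \<exists>L. ((\<lambda>z. z ^ k' * f i (q, z)) \<longlongrightarrow> L) (at 0)"
    by (rule generic_pole_order[of "f i" Z]) (use insert Z in auto)
  have "\<exists>L. ((\<lambda>z. z ^ max k k' * f j (q, z)) \<longlongrightarrow> L) (at 0)" if "q \<in> Z'" "j \<in> insert i I" for q j
  proof (cases "j = i")
    case True
    show ?thesis
      by (rule tendsto_pole_mono[of k']) (use True Z'(4)[OF that(1)] in auto)
  next
    case False
    show ?thesis
      by (rule tendsto_pole_mono[of k]) (use False Z Z' that in auto)
  qed
  then show ?case
    using Z Z' by (intro exI[of _ Z'] exI[of _ "max k k'"]) auto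
qed

lemma removable_extension:
  assumes F: "F holomorphic_on ball 0 d - {0}" and "d > 0" and lim: "(F \<longlongrightarrow> L) (at 0)"
  shows "(\<lambda>z. if z = 0 then L else F z) holomorphic_on ball 0 d"
proof (rule no_isolated_singularity'[of "{0}"])
  have "((\<lambda>z. if z = 0 then L else F z) \<longlongrightarrow> L) (at 0)"
    using lim by (rule Lim_transform_eventually) (auto simp: eventually_at_filter)
  then show "((\<lambda>z. if z = 0 then L else F z) \<longlongrightarrow> (if z = 0 then L else F z)) (at z within ball 0 d)" if "z \<in> {0}" for z
    using that by (auto intro: tendsto_within_subset[OF _ subset_UNIV])
  show "(\<lambda>z. if z = 0 then L else F z) holomorphic_on ball 0 d - {0}"
    using F by (rule holomorphic_transform) auto
qed auto

text \<open>The extension of \<open>z ^ Suc k * F z\<close> vanishes at 0, and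
  \<open>z ^ k * F z\<close> is its difference quotient there.\<close>

lemma tendsto_pole_reduce:
  assumes F: "F holomorphic_on ball 0 d - {0}" and "d > 0" and lim: "((\<lambda>z. z ^ Suc k * F z) \<longlongrightarrow> 0) (at (0 :: complex))"
  shows "\<exists>L. ((\<lambda>z. z ^ k * F z) \<longlongrightarrow> L) (at 0)"
proof -
  let ?h = "\<lambda>z. if z = 0 then 0 else z ^ Suc k * F z"
  have "?h holomorphic_on ball 0 d"
    by (rule removable_extension) (use assms in \<open>auto intro!: holomorphic_intros simp del: power_Suc\<close>)
  then have "?h field_differentiable at 0"
    using holomorphic_on_imp_differentiable_at[of ?h "ball 0 d" 0] \<open>d > 0\<close> by simp
  then obtain L where "(?h has_field_derivative L) (at 0)"
    by (auto simp: field_differentiable_def)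
  then have "((\<lambda>z. (?h z - ?h 0) / (z - 0)) \<longlongrightarrow> L) (at 0)"
    by (simp only: has_field_derivative_iff)
  then have "((\<lambda>z. z ^ k * F z) \<longlongrightarrow> L) (at 0)"
    by (rule Lim_transform_eventually) (auto simp: eventually_at_filter)
  then show ?thesis ..
qed

text \<open>If the limit \<open>z f z \<longlongrightarrow> L\<close> exists for \<open>q\<close> in a dense set, the Cauchy formula for \<open>z f z\<close> extends
  to all \<open>q\<close> by continuity.\<close>

lemma simple_pole_closure:
  fixes f :: "(complex ^ 'l::finite) \<times> complex \<Rightarrow> complex"
  assumes f: "holomorphic_wrt scale2 f (B \<times> (ball 0 d - {0}))" and B: "open B" "q0 \<in> B" and d: "d > 0"
    and dense: "\<And>Z. open Z \<Longrightarrow> q0 \<in> Z \<Longrightarrow> \<exists>q\<in>Z \<inter> B. \<exists>L. ((\<lambda>z. z * f (q, z)) \<longlongrightarrow> L) (at 0)"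
  shows "\<exists>L. ((\<lambda>z. z * f (q0, z)) \<longlongrightarrow> L) (at 0)"
proof -
  define \<rho> where "\<rho> = d / 2"
  have \<rho>: "0 < \<rho>" "\<rho> < d" using d by (auto simp: \<rho>_def)
  define H where "H q z = cint \<rho> (\<lambda>w. w * f (q, w) / (w - z))" for q z
  have cont: "continuous_on (B \<times> ball 0 \<rho>) (\<lambda>p. H (fst p) (snd p))"
    unfolding H_def
  proof (rule cint_continuous)
    show "continuous_on ((B \<times> ball 0 \<rho>) \<times> sphere 0 \<rho>) (\<lambda>(p, w). w * f (fst p, w) / (w - snd p))"
      unfolding split_beta
      by (intro continuous_intros continuous_on_compose2[OF holomorphic_wrt_continuous[OF f]]) (use \<rho> in auto)
  qed (use \<rho> in auto)
  have fcont: "continuous_on B (\<lambda>q. z * f (q, z))" if "z \<in> ball 0 \<rho> - {0}" for z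
    by (intro continuous_intros continuous_on_compose2[OF holomorphic_wrt_continuous[OF f]]) (use \<rho> that in auto)
  have eq: "H q z = z * f (q, z)" if q: "q \<in> B" "((\<lambda>z. z * f (q, z)) \<longlongrightarrow> L) (at 0)" and z: "z \<in> ball 0 \<rho> - {0}" for q z L
  proof -
    have "(\<lambda>z. f (q, z)) holomorphic_on ball 0 d - {0}"
      by (rule holomorphic_on_slice[OF f]) (use q in auto)
    then have hol: "(\<lambda>z. if z = 0 then L else z * f (q, z)) holomorphic_on ball 0 d" (is "?g holomorphic_on _")
      using q d by (intro removable_extension holomorphic_intros)
    have "continuous_on (cball 0 \<rho>) ?g" "?g holomorphic_on ball 0 \<rho>"
      using holomorphic_on_subset[OF hol] holomorphic_on_imp_continuous_on \<rho>
      by (auto simp: cball_subset_ball_iff subset_ball)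
    from Cauchy_integral_circlepath[OF this, of z] z
    have "contour_integral (circlepath 0 \<rho>) (\<lambda>u. ?g u / (u - z)) = 2 * of_real pi * \<i> * ?g z"
      by (simp add: contour_integral_unique)
    then have "cint \<rho> (\<lambda>u. ?g u / (u - z)) = ?g z"
      by (simp add: cint_eq)
    moreover have "cint \<rho> (\<lambda>u. ?g u / (u - z)) = H q z"
      unfolding H_def by (rule cint_cong) (use \<rho> in auto)
    ultimately show ?thesis using z by auto
  qed
  have eq0: "H q0 z = z * f (q0, z)" if z: "z \<in> ball 0 \<rho> - {0}" for z
  proof (rule ccontr)
    assume ne: "H q0 z \<noteq> z * f (q0, z)"
    \<comment> \<open>Both sides are continuous in \<open>q\<close> on all of \<open>B\<close>, so a
      disagreement at \<open>q0\<close> persists on a neighbourhood, where density supplies a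
      \<open>q\<close> at which they agree.\<close>
    have "continuous_on B (\<lambda>q. H q z - z * f (q, z))"
      by (intro continuous_intros fcont z continuous_on_compose2[OF cont, of B "\<lambda>q. (q, z)", simplified]) (use z in auto)
    then have "open (B \<inter> (\<lambda>q. H q z - z * f (q, z)) -` (- {0}))"
      by (rule continuous_open_preimage[OF _ B(1)]) auto
    moreover have "q0 \<in> B \<inter> (\<lambda>q. H q z - z * f (q, z)) -` (- {0})"
      using ne B(2) by simp
    ultimately have "\<exists>q\<in>(B \<inter> (\<lambda>q. H q z - z * f (q, z)) -` (- {0})) \<inter> B. \<exists>L. ((\<lambda>z. z * f (q, z)) \<longlongrightarrow> L) (at 0)"
      by (rule dense)
    then show False using eq[OF _ _ z] by auto
  qed
  have "continuous_on (ball 0 \<rho>) (H q0)"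
    using continuous_on_compose2[OF cont, of "ball 0 \<rho>" "\<lambda>z. (q0, z)"] B by (force intro!: continuous_intros)
  then have "(H q0 \<longlongrightarrow> H q0 0) (at 0)"
    using \<rho> by (simp add: continuous_on_eq_continuous_at isCont_def)
  moreover have "eventually (\<lambda>z. H q0 z = z * f (q0, z)) (at 0)"
    unfolding eventually_at using eq0 \<rho> by (intro exI[of _ \<rho>]) auto
  ultimately have "((\<lambda>z. z * f (q0, z)) \<longlongrightarrow> H q0 0) (at 0)"
    by (rule Lim_transform_eventually)
  then show ?thesis ..
qed

text \<open>The complement is the sum of the closed set \<open>- S\<close> and the compact set of
  all \<open>- \<zeta> w\<close>, hence closed. This provides the open parameter domain for contour
  integrals over translates.\<close>

lemma open_translate_sphere:
  fixes S :: "'a::real_normed_vector set"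
  assumes "open S" "continuous_on (sphere (0::complex) \<rho>) \<zeta>"
  shows "open {x. \<forall>w\<in>sphere 0 \<rho>. x + \<zeta> w \<in> S}"
proof -
  have "compact ((\<lambda>w. - \<zeta> w) ` sphere 0 \<rho>)"
    by (intro compact_continuous_image continuous_intros assms) auto
  then have "closed (\<Union>x\<in>- S. \<Union>y\<in>(\<lambda>w. - \<zeta> w) ` sphere 0 \<rho>. {x + y})"
    using assms(1) by (intro closed_compact_sums) auto
  moreover have "(\<Union>x\<in>- S. \<Union>y\<in>(\<lambda>w. - \<zeta> w) ` sphere 0 \<rho>. {x + y}) = - {x. \<forall>w\<in>sphere 0 \<rho>. x + \<zeta> w \<in> S}"
  proof (intro equalityI subsetI)
    fix x assume "x \<in> - {x. \<forall>w\<in>sphere 0 \<rho>. x + \<zeta> w \<in> S}"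
    then obtain w where "w \<in> sphere 0 \<rho>" "x + \<zeta> w \<notin> S" by blast
    moreover have "x = (x + \<zeta> w) + (- \<zeta> w)" by simp
    ultimately show "x \<in> (\<Union>x\<in>- S. \<Union>y\<in>(\<lambda>w. - \<zeta> w) ` sphere 0 \<rho>. {x + y})" by blast
  next
    fix x assume "x \<in> (\<Union>x\<in>- S. \<Union>y\<in>(\<lambda>w. - \<zeta> w) ` sphere 0 \<rho>. {x + y})"
    then obtain w where "w \<in> sphere 0 \<rho>" "x + \<zeta> w \<notin> S" by auto
    then show "x \<in> - {x. \<forall>w\<in>sphere 0 \<rho>. x + \<zeta> w \<in> S}" by blast
  qed
  ultimately show ?thesis
    by (simp only: open_closed)
qed

lemma holomorphic_wrt_cint_slice:
  fixes f :: "(complex ^ 'l::finite) \<times> complex \<Rightarrow> complex"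
  assumes f: "holomorphic_wrt scale2 f S" and S: "open S" and \<rho>: "0 \<le> \<rho>"
    and \<zeta>: "continuous_on (sphere 0 \<rho>) \<zeta>" and \<phi>: "continuous_on (sphere 0 \<rho>) \<phi>"
    and V: "\<And>q w. q \<in> V \<Longrightarrow> w \<in> sphere 0 \<rho> \<Longrightarrow> (q, \<zeta> w) \<in> S"
  shows "holomorphic_wrt (*s) (\<lambda>q. cint \<rho> (\<lambda>w. f (q, \<zeta> w) * \<phi> w)) V"
proof -
  let ?\<zeta> = "\<lambda>w. (0 :: complex ^ 'l, \<zeta> w)"
  let ?T = "{x. \<forall>w\<in>sphere 0 \<rho>. x + ?\<zeta> w \<in> S}"
  have c: "continuous_on (sphere 0 \<rho>) ?\<zeta>"
    by (intro continuous_intros \<zeta>)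
  have "holomorphic_wrt scale2 (\<lambda>x. cint \<rho> (\<lambda>w. f (x + ?\<zeta> w) * \<phi> w)) ?T"
    by (rule holomorphic_wrt_cint[OF f S open_translate_sphere[OF S c] \<rho> c \<phi>]) blast
  from holomorphic_wrt_compose_affine[OF this, of "\<lambda>q. (q, 0)" "(*s)" V 0]
  show ?thesis
    using V by (simp add: scale2_def bounded_linear_Pair bounded_linear_ident bounded_linear_zero zero_prod_def)
qed

lemma bounded_linear_axis: "bounded_linear (axis i :: complex \<Rightarrow> complex ^ 'n::finite)"
  by (rule linear_conv_bounded_linear[THEN iffD1], rule linearI) (auto simp: axis_def vec_eq_iff)

lemma pderiv_at_eq:
  assumes "holomorphic_wrt (*s) f V" "q \<in> V"
  shows "pderiv_at i f q = fder f q (axis i 1)"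
proof -
  have sc: "axis i t = t *s axis i 1" for t :: complex
    by (simp add: axis_def vec_eq_iff)
  have "((\<lambda>t. q + axis i t) has_derivative axis i) (at 0)"
    by (auto intro!: derivative_eq_intros bounded_linear_imp_has_derivative bounded_linear_axis)
  moreover have "q + axis i 0 = q" by (simp add: axis_def vec_eq_iff)
  ultimately have "((\<lambda>t. f (q + axis i t)) has_derivative (\<lambda>t. fder f q (axis i t))) (at 0)"
    using has_derivative_compose[of "\<lambda>t. q + axis i t" "axis i" 0 UNIV f "fder f q"] holomorphic_wrtD(1)[OF assms]
    by metis
  then have "((\<lambda>t. f (q + axis i t)) has_field_derivative fder f q (axis i 1)) (at 0)"
    unfolding has_field_derivative_def
    by (rule has_derivative_eq_rhs) (metis (no_types, lifting) ext sc holomorphic_wrtD(2)[OF assms] mult.commute)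
  then show ?thesis
    by (simp add: pderiv_at_def DERIV_imp_deriv)
qed

lemma holomorphic_wrt_slice:
  fixes f :: "(complex ^ 'l::finite) \<times> complex \<Rightarrow> complex"
  assumes "holomorphic_wrt scale2 f S" "\<And>q. q \<in> V \<Longrightarrow> (q, z) \<in> S"
  shows "holomorphic_wrt (*s) (\<lambda>q. f (q, z)) V"
  using holomorphic_wrt_compose_affine[OF assms(1), of "\<lambda>q. (q, 0)" "(*s)" V "(0, z)"] assms(2)
  by (simp add: scale2_def bounded_linear_Pair bounded_linear_ident bounded_linear_zero)

lemma fder_slice:
  fixes f :: "(complex ^ 'l::finite) \<times> complex \<Rightarrow> complex"
  assumes "holomorphic_wrt scale2 f S" "(q, z) \<in> S"
  shows "fder (\<lambda>q. f (q, z)) q v = fder f (q, z) (v, 0)"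
  using fder_compose_affine[OF assms(1), of "\<lambda>q. (q, 0)" q "(0, z)" v] assms(2)
  by (simp add: bounded_linear_Pair bounded_linear_ident bounded_linear_zero)

lemma pderiv_at_slice:
  fixes f :: "(complex ^ 'l::finite) \<times> complex \<Rightarrow> complex"
  assumes "holomorphic_wrt scale2 f S" "(q, z) \<in> S"
  shows "pderiv_at i (\<lambda>q. f (q, z)) q = fder f (q, z) (axis i 1, 0)"
  using pderiv_at_eq[of "\<lambda>q. f (q, z)" "{q}" q i] holomorphic_wrt_slice[OF assms(1), of "{q}" z] assms(2)
  by (simp add: fder_slice[OF assms])

lemma pderiv_at_cint_slice:
  fixes f :: "(complex ^ 'l::finite) \<times> complex \<Rightarrow> complex"
  assumes f: "holomorphic_wrt scale2 f S" and S: "open S" and \<rho>: "0 \<le> \<rho>"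
    and \<zeta>: "continuous_on (sphere 0 \<rho>) \<zeta>" and \<phi>: "continuous_on (sphere 0 \<rho>) \<phi>"
    and V: "\<And>w. w \<in> sphere 0 \<rho> \<Longrightarrow> (q, \<zeta> w) \<in> S"
  shows "pderiv_at i (\<lambda>q. cint \<rho> (\<lambda>w. f (q, \<zeta> w) * \<phi> w)) q =
    cint \<rho> (\<lambda>w. fder f (q, \<zeta> w) (axis i 1, 0) * \<phi> w)"
proof -
  let ?\<zeta> = "\<lambda>w. (0 :: complex ^ 'l, \<zeta> w)"
  let ?T = "{x. \<forall>w\<in>sphere 0 \<rho>. x + ?\<zeta> w \<in> S}"
  let ?g = "\<lambda>x. cint \<rho> (\<lambda>w. f (x + ?\<zeta> w) * \<phi> w)"
  have c: "continuous_on (sphere 0 \<rho>) ?\<zeta>"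
    by (intro continuous_intros \<zeta>)
  have T: "(q, 0) \<in> ?T" using V by simp
  have in_S: "\<And>x w. x \<in> ?T \<Longrightarrow> w \<in> sphere 0 \<rho> \<Longrightarrow> x + ?\<zeta> w \<in> S" by blast
  have hol: "holomorphic_wrt scale2 ?g ?T"
    by (rule holomorphic_wrt_cint[OF f S open_translate_sphere[OF S c] \<rho> c \<phi> in_S])
  have "fder ?g (q, 0) (axis i 1, 0) = cint \<rho> (\<lambda>w. fder f ((q, 0) + ?\<zeta> w) (axis i 1, 0) * \<phi> w)"
    by (rule fun_cong[OF frechet_derivative_at[OF cint_has_derivative[OF f S open_translate_sphere[OF S c] T \<rho> c \<phi> in_S]], symmetric])
  then show ?thesis
    using pderiv_at_slice[OF hol T, of i] by simp
qed

lemma holomorphic_on_ball_tendsto: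
  assumes "f holomorphic_on ball 0 d" "d > 0"
  shows "(f \<longlongrightarrow> f 0) (at 0)"
  using holomorphic_on_imp_continuous_on[OF assms(1)] assms(2)
  by (simp add: continuous_on_eq_continuous_at isCont_def)

lemma residue_cong_ball:
  assumes "d > 0" "\<And>z. z \<in> ball 0 d - {0} \<Longrightarrow> f z = g z"
  shows "residue f 0 = residue g 0"
  by (rule residue_cong) (use assms in \<open>auto simp: eventually_at intro!: exI[of _ d]\<close>)

context lie
begin

lemma tendsto_K_br:
  assumes "(F \<longlongrightarrow> u) net" "(G \<longlongrightarrow> v) net"
  shows "((\<lambda>z. K x (br (F z) (G z))) \<longlongrightarrow> K x (br u v)) net"
  unfolding K_sym[of x] K_br_expand by (intro tendsto_intros assms)

lemma holomorphic_on_K_br: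
  fixes F G :: "complex \<Rightarrow> complex ^ 'n"
  assumes "\<And>a. (\<lambda>z. F z $ a) holomorphic_on A" "\<And>a. (\<lambda>z. G z $ a) holomorphic_on A"
  shows "(\<lambda>z. K x (br (F z) (G z))) holomorphic_on A"
  unfolding K_sym[of x] K_br_expand by (intro holomorphic_intros assms)

lemma tendsto_contract:
  fixes T :: "'a \<Rightarrow> complex ^ 'n ^ 'n"
  assumes "\<And>a b. ((\<lambda>z. T z $ a $ b) \<longlongrightarrow> A $ a $ b) net"
  shows "((\<lambda>z. contract1 br (T z) x) \<longlongrightarrow> contract1 br A x) net"
    "((\<lambda>z. contract2 br (T z) x) \<longlongrightarrow> contract2 br A x) net"
  unfolding contract1_def contract2_def by (intro tendsto_vec_lambda tendsto_intros assms)+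

lemma K_br_scale: "K x (br (c *s u) v) = c * K x (br u v)" "K x (br u (c *s v)) = c * K x (br u v)"
  by (simp_all add: br_scale_left br_scale_right K_scale_right)

text \<open>The bracket of two poles of order \<open>k\<close> has order at most
  \<open>2 * k\<close>; the factor \<open>z ^ (2 * k - 1)\<close> leaves a simple pole whose residue
  is the bracket of the leading coefficients.\<close>

lemma cint_K_br_leading:
  fixes F G :: "complex \<Rightarrow> complex ^ 'n"
  assumes k: "0 < k" and \<rho>: "0 < \<rho>" "\<rho> < d"
    and F: "\<And>a. (\<lambda>z. F z $ a) holomorphic_on ball 0 d - {0}" "((\<lambda>z. z ^ k *s F z) \<longlongrightarrow> u) (at 0)"
    and G: "\<And>a. (\<lambda>z. G z $ a) holomorphic_on ball 0 d - {0}" "((\<lambda>z. z ^ k *s G z) \<longlongrightarrow> v) (at 0)"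
  shows "cint \<rho> (\<lambda>z. z ^ (2 * k - 1) * K x (br (F z) (G z))) = K x (br u v)"
proof -
  have hol: "(\<lambda>z. z ^ (2 * k - 1) * K x (br (F z) (G z))) holomorphic_on ball 0 d - {0}"
    by (intro holomorphic_intros holomorphic_on_K_br F G)
  have "z ^ (2 * k - 1) * K x (br (F z) (G z)) * (z - 0) = K x (br (z ^ k *s F z) (z ^ k *s G z))" for z
  proof -
    have "z ^ (2 * k - 1) * z = z ^ k * z ^ k"
      using k by (simp add: power_add[symmetric] mult_2 power_Suc2[symmetric] del: power_Suc)
    then show ?thesis by (simp add: K_br_scale mult_ac)
  qed
  then have "((\<lambda>z. z ^ (2 * k - 1) * K x (br (F z) (G z)) * (z - 0)) \<longlongrightarrow> K x (br u v)) (at 0)"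
    using tendsto_K_br[OF F(2) G(2)] by simp
  from residue_simple'[OF _ _ hol this] cint_residue[OF hol \<rho>] \<rho> show ?thesis by simp
qed

end

section \<open>Dynamical r-matrices\<close>

locale r_matrix =
  fixes br :: "complex ^ 'n::finite \<Rightarrow> complex ^ 'n \<Rightarrow> complex ^ 'n"
    and h :: "(complex ^ 'n) set"
    and e :: "'l::finite \<Rightarrow> complex ^ 'n"
    and r :: "(complex ^ 'l) \<times> complex \<Rightarrow> complex ^ 'n ^ 'n"
  assumes simple: "simple_lie_algebra br"
    and cartan: "cartan_subalgebra br h"
    and orthonormal: "orthonormal_basis br h e"
    and dynamical: "dynamical_r_matrix br h e r"

sublocale r_matrix \<subseteq> killing_lie br
  \<comment> \<open>Index types are nonempty, so \<open>e undefined\<close> is some member of the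
    orthonormal basis and pairs with itself to 1.\<close>
  using simple_killing_lie[OF simple, of "e undefined"] orthonormal by (simp add: orthonormal_basis_def)

context r_matrix
begin

abbreviation "S \<equiv> regular_points r"
abbreviation "c1 p x \<equiv> contract1 br (r p) x"
abbreviation "c2 p x \<equiv> contract2 br (r p) x"

definition tr :: "complex ^ 'n \<Rightarrow> complex ^ 'n \<Rightarrow> (complex ^ 'l) \<times> complex \<Rightarrow> complex" where
  "tr x y p = tpair br (r p) x y"

abbreviation "dtr i x y p \<equiv> fder (tr x y) p (axis i 1, 0)"

lemma open_regular: "open S"
proof (subst open_subopen, intro ballI)
  fix x assume "x \<in> S"
  then obtain U where "open U" "x \<in> U" "\<forall>a b. holomorphic_wrt scale2 (\<lambda>y. r y $ a $ b) U"
    by (auto simp: regular_points_def)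
  then show "\<exists>T. open T \<and> x \<in> T \<and> T \<subseteq> S"
    by (intro exI[of _ U]) (auto simp: regular_points_def)
qed

lemma r_holomorphic: "holomorphic_wrt scale2 (\<lambda>p. r p $ a $ b) S"
  by (rule holomorphic_wrt_local) (auto simp: regular_points_def)

lemma tr_eq: "tr x y p = (\<Sum>a\<in>UNIV. \<Sum>b\<in>UNIV. r p $ a $ b * (K (axis a 1) x * K (axis b 1) y))"
  by (simp add: tr_def tpair_def mult.assoc)

lemma tr_holomorphic: "holomorphic_wrt scale2 (tr x y) S"
  unfolding tr_eq[abs_def] by (intro holomorphic_wrt_sum holomorphic_wrt_mult r_holomorphic holomorphic_wrt_const)

lemma dtr_holomorphic: "holomorphic_wrt scale2 (\<lambda>p. fder (tr x y) p v) S"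
  by (rule holomorphic_wrt_fder[OF tr_holomorphic open_regular])

lemma fder_tr:
  assumes "p \<in> S"
  shows "fder (tr x y) p v = (\<Sum>a\<in>UNIV. \<Sum>b\<in>UNIV. fder (\<lambda>p. r p $ a $ b) p v * (K (axis a 1) x * K (axis b 1) y))"
proof -
  have "(tr x y has_derivative (\<lambda>v. \<Sum>a\<in>UNIV. \<Sum>b\<in>UNIV. fder (\<lambda>p. r p $ a $ b) p v * (K (axis a 1) x * K (axis b 1) y))) (at p)"
    unfolding tr_eq[abs_def]
    by (intro has_derivative_sum has_derivative_mult_left holomorphic_wrtD(1)[OF r_holomorphic assms])
  from fun_cong[OF frechet_derivative_at[OF this]] show ?thesis by simp
qed

lemma r_region:
  assumes "q \<in> r_domain r" "open B" "q \<in> B"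
  obtains d where "d > 0" "ball q d \<subseteq> B" "\<And>q' z. q' \<in> ball q d \<Longrightarrow> z \<in> ball 0 d - {0} \<Longrightarrow> (q', z) \<in> S"
proof -
  obtain U where U: "open U" "(q, 0) \<in> U" "\<And>q' z. (q', z) \<in> U \<Longrightarrow> z \<noteq> 0 \<Longrightarrow> (q', z) \<in> S"
    using assms(1) by (auto simp: r_domain_def)
  obtain A C where AC: "open A" "open C" "q \<in> A" "0 \<in> C" "A \<times> C \<subseteq> U"
    using open_prod_elim[OF U(1,2)] by (metis mem_Sigma_iff)
  obtain d1 where d1: "d1 > 0" "ball q d1 \<subseteq> A \<inter> B"
    using AC assms by (meson IntI open_Int open_contains_ball)
  obtain d2 where d2: "d2 > 0" "ball 0 d2 \<subseteq> C"
    using AC by (meson open_contains_ball)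
  note d = d1 d2
  have "(q', z) \<in> S" if "q' \<in> ball q (min d1 d2)" "z \<in> ball 0 (min d1 d2) - {0}" for q' z
  proof (rule U(3))
    have "q' \<in> A" "z \<in> C" using that d by auto
    then show "(q', z) \<in> U" using AC by auto
  qed (use that in auto)
  moreover have "ball q (min d1 d2) \<subseteq> B" using d by auto
  ultimately show ?thesis using that[of "min d1 d2"] d by auto
qed

lemma open_r_domain: "open (r_domain r)"
proof (subst open_subopen, intro ballI)
  fix q assume "q \<in> r_domain r"
  then obtain U where U: "open U" "(q, 0) \<in> U" "\<And>q' z. (q', z) \<in> U \<Longrightarrow> z \<noteq> 0 \<Longrightarrow> (q', z) \<in> S"
    by (auto simp: r_domain_def)
  obtain A C where AC: "open A" "open C" "q \<in> A" "0 \<in> C" "A \<times> C \<subseteq> U"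
    using open_prod_elim[OF U(1,2)] by (metis mem_Sigma_iff)
  have "A \<subseteq> r_domain r"
    using AC U by (auto simp: r_domain_def intro!: exI[of _ U])
  then show "\<exists>T. open T \<and> q \<in> T \<and> T \<subseteq> r_domain r" using AC by auto
qed

lemma incl_in_h: "incl e p \<in> h"
  using orthonormal unfolding incl_def orthonormal_basis_def
  by (metis (no_types, lifting) rangeI vec.span_base vec.span_scale vec.span_sum)

lemma h_abelian: "x \<in> h \<Longrightarrow> y \<in> h \<Longrightarrow> br x y = 0"
  using cartan by (simp add: cartan_subalgebra_def)

lemma unitarity: "(q, z) \<in> S \<Longrightarrow> (q, - z) \<in> S \<Longrightarrow> tr x y (q, - z) = - tr y x (q, z)"
proof -
  assume "(q, z) \<in> S" "(q, - z) \<in> S"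
  then have "r (q, z) + transpose (r (q, - z)) = 0"
    using dynamical by (auto simp: dynamical_r_matrix_def)
  then have "r (q, z) = - transpose (r (q, - z))"
    by (simp add: eq_neg_iff_add_eq_0)
  then show ?thesis by (simp add: tr_def tpair_linear tpair_transpose)
qed

lemma zero_weight: "p \<in> S \<Longrightarrow> y \<in> h \<Longrightarrow> c1 p (br y x) = br y (c1 p x)"
  using dynamical by (intro contract1_weight) (auto simp: dynamical_r_matrix_def)

lemma sum_triple_product:
  fixes f :: "'n \<Rightarrow> complex" and g :: "'n \<Rightarrow> 'n \<Rightarrow> complex"
  shows "(\<Sum>a\<in>UNIV. \<Sum>b\<in>UNIV. \<Sum>c\<in>UNIV. f a * g b c) = sum f UNIV * (\<Sum>b\<in>UNIV. \<Sum>c\<in>UNIV. g b c)"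
    "(\<Sum>a\<in>UNIV. \<Sum>b\<in>UNIV. \<Sum>c\<in>UNIV. f b * g c a) = sum f UNIV * (\<Sum>c\<in>UNIV. \<Sum>a\<in>UNIV. g c a)"
    "(\<Sum>a\<in>UNIV. \<Sum>b\<in>UNIV. \<Sum>c\<in>UNIV. f c * g a b) = sum f UNIV * (\<Sum>a\<in>UNIV. \<Sum>b\<in>UNIV. g a b)"
proof -
  show 1: "(\<Sum>a\<in>UNIV. \<Sum>b\<in>UNIV. \<Sum>c\<in>UNIV. f a * g b c) = sum f UNIV * (\<Sum>b\<in>UNIV. \<Sum>c\<in>UNIV. g b c)" for g
    by (simp only: sum_distrib_left[symmetric] sum_distrib_right[symmetric])
  show "(\<Sum>a\<in>UNIV. \<Sum>b\<in>UNIV. \<Sum>c\<in>UNIV. f c * g a b) = sum f UNIV * (\<Sum>a\<in>UNIV. \<Sum>b\<in>UNIV. g a b)"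
    by (subst sum_rot3) (rule 1)
  have "(\<Sum>a\<in>UNIV. \<Sum>b\<in>UNIV. \<Sum>c\<in>UNIV. f b * g c a) = (\<Sum>b\<in>UNIV. \<Sum>a\<in>UNIV. \<Sum>c\<in>UNIV. f b * g c a)"
    by (rule sum.swap)
  also have "\<dots> = sum f UNIV * (\<Sum>a\<in>UNIV. \<Sum>c\<in>UNIV. g c a)"
    by (rule 1)
  also have "(\<Sum>a\<in>UNIV. \<Sum>c\<in>UNIV. g c a) = (\<Sum>c\<in>UNIV. \<Sum>a\<in>UNIV. g c a)"
    by (rule sum.swap)
  finally show "(\<Sum>a\<in>UNIV. \<Sum>b\<in>UNIV. \<Sum>c\<in>UNIV. f b * g c a) = sum f UNIV * (\<Sum>c\<in>UNIV. \<Sum>a\<in>UNIV. g c a)" .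
qed

text \<open>The equation depends on the three points only through their differences, which become
  the arguments here. The term with \<open>r\<close> on legs 3 and 1 is evaluated at
  \<open>- z13\<close>, so regularity is asked at that point too.\<close>

lemma Yang_Baxter:
  assumes S: "(q, z12) \<in> S" "(q, z13) \<in> S" "(q, z23) \<in> S" "(q, - z13) \<in> S" and z: "z13 = z12 + z23"
  shows "(\<Sum>i\<in>UNIV. K (e i) x * dtr i y \<xi> (q, z23) + K (e i) y * dtr i \<xi> x (q, - z13) + K (e i) \<xi> * dtr i x y (q, z12))
    + K x (br (c2 (q, z12) y) (c2 (q, z13) \<xi>)) + K y (br (c1 (q, z12) x) (c2 (q, z23) \<xi>))
    + K \<xi> (br (c1 (q, z13) x) (c1 (q, z23) y)) = 0"
proof -
  define k where "k a b c = K (axis a 1) x * K (axis b 1) y * K (axis c 1) \<xi>" for a b c :: 'n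
  \<comment> \<open>The points \<open>z13\<close>, \<open>z23\<close>, 0 realise the prescribed
    differences.\<close>
  have cyb: "alt_d e r q z13 z23 0 a b c + bracket_12_13 br (r (q, z12)) (r (q, z13)) a b c
      + bracket_12_23 br (r (q, z12)) (r (q, z23)) a b c + bracket_13_23 br (r (q, z13)) (r (q, z23)) a b c = 0" for a b c
  proof -
    have "z13 - z23 = z12" "z13 - 0 = z13" "z23 - 0 = z23" "0 - z13 = - z13" using z by auto
    then show ?thesis
      using dynamical S unfolding dynamical_r_matrix_def by metis
  qed
  have alt: "alt_d e r q z13 z23 0 a b c * k a b c = (\<Sum>i\<in>UNIV.
      (e i $ a * K (axis a 1) x) * (fder (\<lambda>p. r p $ b $ c) (q, z23) (axis i 1, 0) * (K (axis b 1) y * K (axis c 1) \<xi>)) +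
      (e i $ b * K (axis b 1) y) * (fder (\<lambda>p. r p $ c $ a) (q, - z13) (axis i 1, 0) * (K (axis c 1) \<xi> * K (axis a 1) x)) +
      (e i $ c * K (axis c 1) \<xi>) * (fder (\<lambda>p. r p $ a $ b) (q, z12) (axis i 1, 0) * (K (axis a 1) x * K (axis b 1) y)))" for a b c
  proof -
    have "z13 - z23 = z12" "z23 - 0 = z23" "0 - z13 = - z13" using z by auto
    then show ?thesis
      unfolding alt_d_def k_def sum_distrib_right
      using S by (intro sum.cong refl) (simp add: pderiv_at_slice[OF r_holomorphic] algebra_simps)
  qed
  have "(\<Sum>a\<in>UNIV. \<Sum>b\<in>UNIV. \<Sum>c\<in>UNIV. alt_d e r q z13 z23 0 a b c * k a b c) =
    (\<Sum>i\<in>UNIV. \<Sum>a\<in>UNIV. \<Sum>b\<in>UNIV. \<Sum>c\<in>UNIV.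
      (e i $ a * K (axis a 1) x) * (fder (\<lambda>p. r p $ b $ c) (q, z23) (axis i 1, 0) * (K (axis b 1) y * K (axis c 1) \<xi>)) +
      (e i $ b * K (axis b 1) y) * (fder (\<lambda>p. r p $ c $ a) (q, - z13) (axis i 1, 0) * (K (axis c 1) \<xi> * K (axis a 1) x)) +
      (e i $ c * K (axis c 1) \<xi>) * (fder (\<lambda>p. r p $ a $ b) (q, z12) (axis i 1, 0) * (K (axis a 1) x * K (axis b 1) y)))"
    unfolding alt by (simp only: sum.swap[of _ "UNIV :: 'l set" "UNIV :: 'n set"])
  also have "\<dots> = (\<Sum>i\<in>UNIV. K (e i) x * dtr i y \<xi> (q, z23) + K (e i) y * dtr i \<xi> x (q, - z13) + K (e i) \<xi> * dtr i x y (q, z12))"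
    unfolding sum.distrib sum_triple_product K_expand_left[of "e _"] fder_tr[OF S(1)] fder_tr[OF S(3)] fder_tr[OF S(4)] ..
  finally have A: "(\<Sum>a\<in>UNIV. \<Sum>b\<in>UNIV. \<Sum>c\<in>UNIV. alt_d e r q z13 z23 0 a b c * k a b c) = \<dots>" .
  have "0 = (\<Sum>a\<in>UNIV. \<Sum>b\<in>UNIV. \<Sum>c\<in>UNIV. (alt_d e r q z13 z23 0 a b c + bracket_12_13 br (r (q, z12)) (r (q, z13)) a b c
      + bracket_12_23 br (r (q, z12)) (r (q, z23)) a b c + bracket_13_23 br (r (q, z13)) (r (q, z23)) a b c) * k a b c)"
    by (simp add: cyb)
  also have "\<dots> = (\<Sum>a\<in>UNIV. \<Sum>b\<in>UNIV. \<Sum>c\<in>UNIV. alt_d e r q z13 z23 0 a b c * k a b c)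
     + (\<Sum>a\<in>UNIV. \<Sum>b\<in>UNIV. \<Sum>c\<in>UNIV. bracket_12_13 br (r (q, z12)) (r (q, z13)) a b c * k a b c)
     + (\<Sum>a\<in>UNIV. \<Sum>b\<in>UNIV. \<Sum>c\<in>UNIV. bracket_12_23 br (r (q, z12)) (r (q, z23)) a b c * k a b c)
     + (\<Sum>a\<in>UNIV. \<Sum>b\<in>UNIV. \<Sum>c\<in>UNIV. bracket_13_23 br (r (q, z13)) (r (q, z23)) a b c * k a b c)"
    by (simp only: distrib_right sum.distrib)
  finally show ?thesis
    unfolding A by (simp only: k_def pair_bracket_12_13 pair_bracket_12_23 pair_bracket_13_23)
qed

end

section \<open>The pole of r at z = 0\<close>

context lie
begin

lemma contract_mult:
  "contract1 br (\<chi> a b. c * T $ a $ b) x = c *s contract1 br T x"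
  "contract2 br (\<chi> a b. c * T $ a $ b) x = c *s contract2 br T x"
  by (simp_all add: vec_eq_iff contract1_nth contract2_nth sum_distrib_left mult.assoc)

lemma tendsto_K:
  assumes "(F \<longlongrightarrow> u) net"
  shows "((\<lambda>z. K x (F z)) \<longlongrightarrow> K x u) net"
proof -
  have *: "K x w = (\<Sum>a\<in>UNIV. w $ a * K (axis a 1) x)" for w
    by (subst K_sym) (rule K_expand_left)
  show ?thesis
    unfolding * by (intro tendsto_intros assms)
qed

end

context r_matrix
begin

lemma holomorphic_on_comp_slice:
  assumes f: "holomorphic_wrt scale2 f S" and g: "g holomorphic_on A" "\<And>s. s \<in> A \<Longrightarrow> (q, g s) \<in> S"
  shows "(\<lambda>s. f (q, g s)) holomorphic_on A"
proof -
  have "{z. (q, z) \<in> S} = Pair q -` S" by auto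
  moreover have "open (Pair q -` S)"
    by (intro open_vimage open_regular continuous_intros)
  ultimately have "(\<lambda>z. f (q, z)) holomorphic_on {z. (q, z) \<in> S}"
    by (intro holomorphic_on_slice[OF f]) auto
  from holomorphic_on_compose_gen[OF g(1) this] g(2) show ?thesis
    by (auto simp: o_def)
qed

lemma c_holomorphic:
  assumes "g holomorphic_on A" "\<And>s. s \<in> A \<Longrightarrow> (q, g s) \<in> S"
  shows "(\<lambda>s. c1 (q, g s) x $ a) holomorphic_on A" "(\<lambda>s. c2 (q, g s) x $ a) holomorphic_on A"
  unfolding contract1_nth contract2_nth
  by (intro holomorphic_intros holomorphic_on_comp_slice[OF r_holomorphic] assms; assumption)+

lemma tr_K: "tr x y p = K x (c2 p y)" "tr x y p = K y (c1 p x)"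
  by (simp_all add: tr_def tpair_contract2 K_sym) (metis tpair_contract1 tpair_contract2 K_sym)

text \<open>The residue condition speaks of single coefficients. One common circle turns residues
  into integrals, which pass through the finite sum, and the Casimir element pairs as
  \<open>K\<close>.\<close>

lemma residue_tr:
  assumes "q \<in> r_domain r" and d: "d > 0" "\<And>z. z \<in> ball 0 d - {0} \<Longrightarrow> (q, z) \<in> S"
  shows "residue (\<lambda>z. tr x y (q, z)) 0 = K x y"
proof -
  define \<rho> where "\<rho> = d / 2"
  have \<rho>: "0 < \<rho>" "\<rho> < d" using d by (auto simp: \<rho>_def)
  have r_hol: "(\<lambda>z. r (q, z) $ a $ b) holomorphic_on ball 0 d - {0}" for a b
    by (rule holomorphic_on_comp_slice[OF r_holomorphic]) (use d in auto)
  have tr_hol: "(\<lambda>z. tr x y (q, z)) holomorphic_on ball 0 d - {0}"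
    by (rule holomorphic_on_comp_slice[OF tr_holomorphic]) (use d in auto)
  have r_cont: "continuous_on (sphere 0 \<rho>) (\<lambda>z. r (q, z) $ a $ b)" for a b
    by (rule continuous_on_subset[OF holomorphic_on_imp_continuous_on[OF r_hol]]) (use \<rho> in auto)
  have r_res: "cint \<rho> (\<lambda>z. r (q, z) $ a $ b) = casimir br $ a $ b" for a b
    using cint_residue[OF r_hol \<rho>] dynamical assms(1) by (simp add: dynamical_r_matrix_def)
  have "residue (\<lambda>z. tr x y (q, z)) 0 = cint \<rho> (\<lambda>z. tr x y (q, z))"
    using cint_residue[OF tr_hol \<rho>] by simp
  also have "\<dots> = (\<Sum>a\<in>UNIV. \<Sum>b\<in>UNIV. casimir br $ a $ b * (K (axis a 1) x * K (axis b 1) y))"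
    unfolding tr_eq using \<rho>
    by (simp add: cint_sum cint_mult_right r_res continuous_on_sum continuous_on_mult_right r_cont)
  also have "\<dots> = K x y"
    using tpair_casimir[of x y] by (simp add: tpair_def mult.assoc)
  finally show ?thesis .
qed

text \<open>\<open>A\<close> is allowed to vanish: the relation bounds the order of the pole by
  \<open>k\<close> and names the coefficient of \<open>z\<close> to the power
  \<open>- k\<close>.\<close>

definition leading :: "nat \<Rightarrow> complex ^ 'l \<Rightarrow> complex ^ 'n ^ 'n \<Rightarrow> bool" where
  "leading k q A \<longleftrightarrow> (\<forall>a b. ((\<lambda>z. z ^ k * r (q, z) $ a $ b) \<longlongrightarrow> A $ a $ b) (at 0))"

lemma leading_contract:
  assumes A: "leading k q A" and c: "c \<noteq> 0"
  shows "((\<lambda>s. s ^ k *s c1 (q, s * c) x) \<longlongrightarrow> (1 / c ^ k) *s contract1 br A x) (at 0)"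
    "((\<lambda>s. s ^ k *s c2 (q, s * c) x) \<longlongrightarrow> (1 / c ^ k) *s contract2 br A x) (at 0)"
proof -
  have "filterlim (\<lambda>s. s * c) (at 0) (at 0)"
    using c by (auto simp: filterlim_at eventually_at_filter intro!: tendsto_eq_intros)
  then have "((\<lambda>s. (s * c) ^ k * r (q, s * c) $ a $ b) \<longlongrightarrow> A $ a $ b) (at 0)" for a b
    by (rule filterlim_compose[OF A[unfolded leading_def, rule_format]])
  then have "((\<lambda>s. (1 / c ^ k) * ((s * c) ^ k * r (q, s * c) $ a $ b)) \<longlongrightarrow> (1 / c ^ k) * A $ a $ b) (at 0)" for a b
    by (intro tendsto_intros)
  then have *: "((\<lambda>s. (\<chi> a b. s ^ k * r (q, s * c) $ a $ b) $ a $ b) \<longlongrightarrow> (\<chi> a b. (1 / c ^ k) * A $ a $ b) $ a $ b) (at 0)" for a b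
    using c by (simp add: power_mult_distrib)
  show "((\<lambda>s. s ^ k *s c1 (q, s * c) x) \<longlongrightarrow> (1 / c ^ k) *s contract1 br A x) (at 0)"
    "((\<lambda>s. s ^ k *s c2 (q, s * c) x) \<longlongrightarrow> (1 / c ^ k) *s contract2 br A x) (at 0)"
    using tendsto_contract[OF *] by (simp_all only: contract_mult)
qed

text \<open>In the Yang--Baxter equation at arguments \<open>u\<close>, \<open>u + v\<close>,
  \<open>v\<close>, multiply by \<open>u ^ k\<close> and let \<open>u\<close> tend to 0. The
  surviving quadratic terms add up to \<open>tr W \<xi> (q, v)\<close>; the only other survivor is a
  derivative term in \<open>u\<close> alone. Hence \<open>tr W \<xi> (q, v)\<close> does not depend
  on \<open>v\<close>, so its residue \<open>K W \<xi>\<close> is zero. Varying \<open>\<xi>\<close>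
  and \<open>x\<close> gives the invariance of \<open>A\<close>.\<close>

lemma leading_invariant:
  assumes q: "q \<in> r_domain r" and d: "d > 0" "\<And>z. z \<in> ball 0 d - {0} \<Longrightarrow> (q, z) \<in> S"
    and A: "leading k q A" and k: "0 < k"
  shows "contract2 br A (br y \<xi>) = br (contract2 br A y) \<xi>"
proof -
  let ?a1 = "contract1 br A" and ?a2 = "contract2 br A"
  have "K (br x (?a2 y) + br y (?a1 x)) \<xi> = 0" for x
  proof -
    define W where "W = br x (?a2 y) + br y (?a1 x)"
    \<comment> \<open>The derivative term at the small argument, the one term with no a priori
      limit. It contains no \<open>v\<close>.\<close>
    define T where "T u = (\<Sum>i\<in>UNIV. K (e i) \<xi> * (u ^ k * dtr i x y (q, u)))" for u
    have lim: "(T \<longlongrightarrow> - tr W \<xi> (q, v)) (at 0)" if v: "v \<in> ball 0 (d / 2) - {0}" for v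
    proof -
      have in_S: "(q, u + v) \<in> S" "(q, - (u + v)) \<in> S" "(q, v) \<in> S" if "u \<in> ball 0 (norm v)" for u
      proof -
        have "u + v \<noteq> 0"
          using that by (auto simp: add_eq_0_iff2)
        moreover have "norm (u + v) < d"
          using that v norm_triangle_ineq[of u v] by auto
        ultimately show "(q, u + v) \<in> S" "(q, - (u + v)) \<in> S" "(q, v) \<in> S"
          using v d(1) by (auto intro!: d(2) simp: norm_minus_commute add_eq_0_iff2 simp flip: minus_add_distrib)
      qed
      have nv: "(0::complex) \<in> ball 0 (norm v)" using v by simp
      have c_lim: "((\<lambda>u. c1 (q, u + v) x) \<longlongrightarrow> c1 (q, v) x) (at 0)" "((\<lambda>u. c2 (q, u + v) x) \<longlongrightarrow> c2 (q, v) x) (at 0)" for x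
      proof -
        have hol: "(\<lambda>u. c1 (q, u + v) x $ a) holomorphic_on ball 0 (norm v)"
          "(\<lambda>u. c2 (q, u + v) x $ a) holomorphic_on ball 0 (norm v)" for a
          using in_S by (intro c_holomorphic holomorphic_intros; simp)+
        have "((\<lambda>u. c1 (q, u + v) x $ a) \<longlongrightarrow> c1 (q, 0 + v) x $ a) (at 0)"
          "((\<lambda>u. c2 (q, u + v) x $ a) \<longlongrightarrow> c2 (q, 0 + v) x $ a) (at 0)" for a
          using holomorphic_on_ball_tendsto[OF hol(1)] holomorphic_on_ball_tendsto[OF hol(2)] nv by auto
        then show "((\<lambda>u. c1 (q, u + v) x) \<longlongrightarrow> c1 (q, v) x) (at 0)" "((\<lambda>u. c2 (q, u + v) x) \<longlongrightarrow> c2 (q, v) x) (at 0)"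
          by (auto intro!: vec_tendstoI)
      qed
      have d_lim: "((\<lambda>u. dtr i \<xi> x (q, - (u + v))) \<longlongrightarrow> dtr i \<xi> x (q, - v)) (at 0)" for i
      proof -
        have "(\<lambda>u. dtr i \<xi> x (q, - (u + v))) holomorphic_on ball 0 (norm v)"
          using in_S by (intro holomorphic_on_comp_slice[OF dtr_holomorphic] holomorphic_intros) simp
        then have "((\<lambda>u. dtr i \<xi> x (q, - (u + v))) \<longlongrightarrow> dtr i \<xi> x (q, - (0 + v))) (at 0)"
          by (rule holomorphic_on_ball_tendsto) (use nv in simp)
        then show ?thesis by simp
      qed
      define G where "G u = - (u ^ k * (\<Sum>i\<in>UNIV. K (e i) x * dtr i y \<xi> (q, v) + K (e i) y * dtr i \<xi> x (q, - (u + v)))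
        + K x (br (u ^ k *s c2 (q, u * 1) y) (c2 (q, u + v) \<xi>)) + K y (br (u ^ k *s c1 (q, u * 1) x) (c2 (q, v) \<xi>))
        + u ^ k * K \<xi> (br (c1 (q, u + v) x) (c1 (q, v) y)))" for u
      have G_lim: "(G \<longlongrightarrow> - (0 ^ k * (\<Sum>i\<in>UNIV. K (e i) x * dtr i y \<xi> (q, v) + K (e i) y * dtr i \<xi> x (q, - v))
        + K x (br ((1 / 1 ^ k) *s ?a2 y) (c2 (q, v) \<xi>)) + K y (br ((1 / 1 ^ k) *s ?a1 x) (c2 (q, v) \<xi>))
        + 0 ^ k * K \<xi> (br (c1 (q, v) x) (c1 (q, v) y)))) (at 0)"
        unfolding G_def
        by (intro tendsto_intros d_lim tendsto_K_br c_lim leading_contract[OF A]) auto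
      have G_eq: "- (0 ^ k * (\<Sum>i\<in>UNIV. K (e i) x * dtr i y \<xi> (q, v) + K (e i) y * dtr i \<xi> x (q, - v))
        + K x (br ((1 / 1 ^ k) *s ?a2 y) (c2 (q, v) \<xi>)) + K y (br ((1 / 1 ^ k) *s ?a1 x) (c2 (q, v) \<xi>))
        + 0 ^ k * K \<xi> (br (c1 (q, v) x) (c1 (q, v) y))) = - tr W \<xi> (q, v)"
        using k by (simp add: tr_K(1) W_def K_add_left K_inv zero_power)
      have ev: "eventually (\<lambda>u. G u = T u) (at 0)"
        unfolding eventually_at
      proof (intro exI[of _ "norm v"] conjI ballI impI)
        fix u :: complex assume u: "u \<noteq> 0 \<and> dist u 0 < norm v"
        then have "norm u < norm v" "2 * norm v < d"
          using v by auto
        then have "norm u < d"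
          using norm_ge_zero[of v] by linarith
        with u have "(q, u) \<in> S" by (intro d(2)) auto
        with in_S[of u] u have "(\<Sum>i\<in>UNIV. K (e i) x * dtr i y \<xi> (q, v) + K (e i) y * dtr i \<xi> x (q, - (u + v)) + K (e i) \<xi> * dtr i x y (q, u))
          + K x (br (c2 (q, u) y) (c2 (q, u + v) \<xi>)) + K y (br (c1 (q, u) x) (c2 (q, v) \<xi>))
          + K \<xi> (br (c1 (q, u + v) x) (c1 (q, v) y)) = 0"
          by (intro Yang_Baxter) auto
        from arg_cong[OF this, of "\<lambda>t. u ^ k * t"]
        have "T u - G u = 0"
          unfolding G_def T_def K_br_scale
          by (simp add: algebra_simps sum.distrib sum_distrib_left)
        then show "G u = T u" by simp
      qed (use v in auto)
      show ?thesis
        by (rule Lim_transform_eventually[OF G_lim[unfolded G_eq] ev])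
    qed
    \<comment> \<open>One and the same function \<open>T\<close> has limit
      \<open>- tr W \<xi> (q, v)\<close> for every \<open>v\<close>.\<close>
    have const: "tr W \<xi> (q, v) = tr W \<xi> (q, of_real d / 4)" if "v \<in> ball 0 (d / 2) - {0}" for v
      using tendsto_unique[OF _ lim[OF that] lim[of "of_real d / 4"]] d(1) by auto
    have "K W \<xi> = residue (\<lambda>z. tr W \<xi> (q, z)) 0"
      using residue_tr[OF q d] by simp
    also have "\<dots> = residue (\<lambda>z. tr W \<xi> (q, of_real d / 4)) 0"
      by (rule residue_cong_ball[of "d / 2"]) (use d(1) in simp, rule const)
    finally show ?thesis by (simp add: residue_const W_def)
  qed
  then have *: "K (br x (?a2 y)) \<xi> = - K (br y (?a1 x)) \<xi>" for x
    by (simp add: K_add_left eq_neg_iff_add_eq_0)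
  show ?thesis
  proof (rule K_eqI2)
    fix x
    have "K x (br (?a2 y) \<xi>) = - K (br y (?a1 x)) \<xi>"
      using *[of x] by (simp add: K_inv)
    also have "\<dots> = K (?a1 x) (br y \<xi>)"
      by (metis K_inv K_swap add.inverse_inverse)
    also have "\<dots> = K x (?a2 (br y \<xi>))"
      by (metis K_sym tpair_contract1 tpair_contract2)
    finally show "K x (?a2 (br y \<xi>)) = K x (br (?a2 y) \<xi>)" ..
  qed
qed

text \<open>For every \<open>q\<close> in the open set, \<open>s ^ m\<close> cancels the pole of
  \<open>tr\<close> along the ray, so the moment of \<open>tr\<close> itself is 0; its derivative in
  \<open>q\<close> is then 0 as well. In this way the derivative terms disappear although no pole
  order of the derivative of \<open>r\<close> has been established.\<close>

lemma dtr_moment_zero: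
  assumes Z: "open Z" "q \<in> Z" and A: "\<And>q. q \<in> Z \<Longrightarrow> leading k q (A q)" and m: "k \<le> m"
    and d: "\<And>q z. q \<in> Z \<Longrightarrow> z \<in> ball 0 d - {0} \<Longrightarrow> (q, z) \<in> S" and \<rho>: "0 < \<rho>" "\<rho> * norm c < d" and c: "c \<noteq> 0"
  shows "cint \<rho> (\<lambda>s. dtr i x y (q, s * c) * s ^ m) = 0"
proof -
  have in_S: "(q', s * c) \<in> S" if "q' \<in> Z" "s \<in> sphere 0 \<rho>" for q' s
    using d[OF that(1), of "s * c"] that(2) \<rho> c by (auto simp: norm_mult)
  have "cint \<rho> (\<lambda>s. dtr i x y (q, s * c) * s ^ m) = pderiv_at i (\<lambda>q. cint \<rho> (\<lambda>s. tr x y (q, s * c) * s ^ m)) q"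
    by (rule pderiv_at_cint_slice[OF tr_holomorphic open_regular, symmetric])
      (use \<rho> in_S Z(2) in \<open>auto intro!: continuous_intros\<close>)
  also have "\<dots> = deriv (\<lambda>t. 0) 0"
    unfolding pderiv_at_def
  proof (rule deriv_cong_ev)
    have "open ((\<lambda>t. q + axis i t) -` Z)"
      by (intro open_vimage Z continuous_intros linear_continuous_on bounded_linear_axis)
    then have "eventually (\<lambda>t. t \<in> (\<lambda>t. q + axis i t) -` Z) (nhds 0)"
      by (rule eventually_nhds_in_open) (use Z in \<open>simp add: axis_eq_0_iff[THEN iffD2]\<close>)
    then show "eventually (\<lambda>t. cint \<rho> (\<lambda>s. tr x y (q + axis i t, s * c) * s ^ m) = 0) (nhds 0)"
    proof eventually_elim
      case (elim t)
      define q' where "q' = q + axis i t"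
      have q': "q' \<in> Z" using elim by (simp add: q'_def)
      define d' where "d' = d / norm c"
      have d': "\<rho> < d'" using \<rho> c by (simp add: d'_def field_simps)
      have hol: "(\<lambda>s. tr x y (q', s * c) * s ^ m) holomorphic_on ball 0 d' - {0}"
      proof (intro holomorphic_intros holomorphic_on_comp_slice[OF tr_holomorphic] d[OF q'])
        fix s :: complex assume "s \<in> ball 0 d' - {0}"
        then show "s * c \<in> ball 0 d - {0}"
          using c by (auto simp: d'_def norm_mult field_simps)
      qed
      have "((\<lambda>s. s ^ (m - k) * s * K x (s ^ k *s c2 (q', s * c) y)) \<longlongrightarrow> 0 ^ (m - k) * 0 * K x ((1 / c ^ k) *s contract2 br (A q') y)) (at 0)"
        by (intro tendsto_intros tendsto_K leading_contract[OF A[OF q'] c])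
      moreover have "s ^ (m - k) * s * K x (s ^ k *s c2 (q', s * c) y) = tr x y (q', s * c) * s ^ m * (s - 0)" for s
        using m by (simp add: tr_K(1) K_scale_right mult_ac power_add[symmetric])
      ultimately have "((\<lambda>s. tr x y (q', s * c) * s ^ m * (s - 0)) \<longlongrightarrow> 0) (at 0)" by simp
      from residue_simple'[OF _ _ hol this] cint_residue[OF hol \<rho>(1) d'] d' \<rho>(1)
      show ?case by (simp add: q'_def)
    qed
  qed auto
  finally show ?thesis by simp
qed

text \<open>Take the arguments \<open>s * u\<close>, \<open>s * v\<close> and
  \<open>s * (u + v)\<close>, multiply by \<open>s ^ (2 * k - 1)\<close> and integrate over a circle
  in \<open>s\<close>. The derivative terms have vanishing moments, and each quadratic term leaves
  its leading coefficients, weighted by powers of the slopes.\<close>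

lemma leading_scaled_Yang_Baxter:
  assumes Z: "open Z" "q \<in> Z" and A: "\<And>q. q \<in> Z \<Longrightarrow> leading k q (A q)" and k: "0 < k" and "d > 0"
    and d: "\<And>q z. q \<in> Z \<Longrightarrow> z \<in> ball 0 d - {0} \<Longrightarrow> (q, z) \<in> S" and uv: "(0::real) < u" "0 < v"
  shows "K x (br (contract2 br (A q) y) (contract2 br (A q) \<xi>)) / (of_real u ^ k * of_real (u + v) ^ k)
    + K y (br (contract1 br (A q) x) (contract2 br (A q) \<xi>)) / (of_real u ^ k * of_real v ^ k)
    + K \<xi> (br (contract1 br (A q) x) (contract1 br (A q) y)) / (of_real (u + v) ^ k * of_real v ^ k) = 0"
proof -
  \<comment> \<open>The largest slope is \<open>u + v\<close>, so all arguments stay in the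
    punctured ball of radius \<open>d\<close>.\<close>
  define d' where "d' = d / (u + v)"
  define \<rho> where "\<rho> = d' / 2"
  have "0 < d'" using \<open>d > 0\<close> uv by (simp add: d'_def)
  then have \<rho>: "0 < \<rho>" "\<rho> < d'" by (simp_all add: \<rho>_def)
  \<comment> \<open>The exponent that makes the quadratic terms simple poles; it is at least
    \<open>k\<close>, as the moments require.\<close>
  define m where "m = 2 * k - 1"
  have m: "k \<le> m" using k by (simp add: m_def)
  have in_ball: "s * of_real c \<in> ball 0 d - {0}" "- (s * of_real c) \<in> ball 0 d - {0}"
    if "s \<in> ball 0 d' - {0}" "0 < c" "c \<le> u + v" for s :: complex and c
  proof -
    have "norm s * c \<le> norm s * (u + v)" using that by (intro mult_left_mono) auto
    also have "\<dots> < d" using that uv by (simp add: d'_def field_simps)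
    finally show "s * of_real c \<in> ball 0 d - {0}" "- (s * of_real c) \<in> ball 0 d - {0}"
      using that by (auto simp: norm_mult)
  qed
  have in_S: "(q, s * of_real c) \<in> S" "(q, - (s * of_real c)) \<in> S" if "s \<in> ball 0 d' - {0}" "0 < c" "c \<le> u + v" for s :: complex and c
    using in_ball[OF that] d[OF Z(2)] by auto
  define f1 where "f1 s = (\<Sum>i\<in>UNIV. K (e i) x * (dtr i y \<xi> (q, s * of_real v) * s ^ m))" for s
  define f2 where "f2 s = (\<Sum>i\<in>UNIV. K (e i) y * (dtr i \<xi> x (q, s * - of_real (u + v)) * s ^ m))" for s
  define f3 where "f3 s = (\<Sum>i\<in>UNIV. K (e i) \<xi> * (dtr i x y (q, s * of_real u) * s ^ m))" for s
  define g1 where "g1 s = s ^ m * K x (br (c2 (q, s * of_real u) y) (c2 (q, s * of_real (u + v)) \<xi>))" for s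
  define g2 where "g2 s = s ^ m * K y (br (c1 (q, s * of_real u) x) (c2 (q, s * of_real v) \<xi>))" for s
  define g3 where "g3 s = s ^ m * K \<xi> (br (c1 (q, s * of_real (u + v)) x) (c1 (q, s * of_real v) y))" for s
  have sph: "s \<in> ball 0 d' - {0}" if "s \<in> sphere 0 \<rho>" for s :: complex
    using that \<rho> by auto
  have hc: "(\<lambda>z. c1 (q, z * of_real c) x $ a) holomorphic_on ball 0 d' - {0}"
     "(\<lambda>z. c2 (q, z * of_real c) x $ a) holomorphic_on ball 0 d' - {0}" if "0 < c" "c \<le> u + v" for c x a
    using that by (intro c_holomorphic holomorphic_intros in_S; simp)+
  have hol: "g1 holomorphic_on ball 0 d' - {0}" "g2 holomorphic_on ball 0 d' - {0}" "g3 holomorphic_on ball 0 d' - {0}"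
    unfolding g1_def g2_def g3_def
    by (intro holomorphic_intros holomorphic_on_K_br hc; use uv in simp)+
  have holf: "(\<lambda>s. dtr i x' y' (q, s * of_real v) * s ^ m) holomorphic_on ball 0 d' - {0}"
    "(\<lambda>s. dtr i x' y' (q, s * - of_real (u + v)) * s ^ m) holomorphic_on ball 0 d' - {0}"
    "(\<lambda>s. dtr i x' y' (q, s * of_real u) * s ^ m) holomorphic_on ball 0 d' - {0}" for i x' y'
    using in_S[of _ v] in_S[of _ u] in_S[of _ "u + v"] uv
    by (intro holomorphic_intros holomorphic_on_comp_slice[OF dtr_holomorphic]; simp del: of_real_add)+
  have cont: "continuous_on (sphere 0 \<rho>) f" if "f holomorphic_on ball 0 d' - {0}" for f
    by (rule continuous_on_subset[OF holomorphic_on_imp_continuous_on[OF that]]) (use sph in auto)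
  have f_int: "cint \<rho> f1 = 0" "cint \<rho> f2 = 0" "cint \<rho> f3 = 0"
  proof -
    have *: "cint \<rho> (\<lambda>s. dtr i x' y' (q, s * c) * s ^ m) = 0" if "c \<noteq> 0" "norm c \<le> u + v" for i x' y' c
    proof (rule dtr_moment_zero[OF Z A m d \<rho>(1) _ that(1)])
      have "\<rho> * norm c \<le> \<rho> * (u + v)" using that \<rho> by (intro mult_left_mono) auto
      also have "\<dots> < d" using \<rho> uv by (simp add: d'_def field_simps)
      finally show "\<rho> * norm c < d" .
    qed
    have pos: "norm (of_real v :: complex) \<le> u + v" "norm (of_real u :: complex) \<le> u + v"
      "norm (- of_real (u + v) :: complex) \<le> u + v" "of_real v \<noteq> (0::complex)" "of_real u \<noteq> (0::complex)"
      "- of_real (u + v) \<noteq> (0::complex)"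
      using uv by (simp_all only: norm_minus_cancel norm_of_real neg_equal_0_iff_equal of_real_eq_0_iff; simp)+
    show "cint \<rho> f1 = 0"
      unfolding f1_def using \<rho>(1)
      by (subst cint_sum) (simp, intro continuous_on_mult_left cont holf, simp only: cint_mult_left *[OF pos(4,1)] mult_zero_right sum.neutral_const)
    show "cint \<rho> f2 = 0"
      unfolding f2_def using \<rho>(1)
      by (subst cint_sum) (simp, intro continuous_on_mult_left cont holf, simp only: cint_mult_left *[OF pos(6,3)] mult_zero_right sum.neutral_const)
    show "cint \<rho> f3 = 0"
      unfolding f3_def using \<rho>(1)
      by (subst cint_sum) (simp, intro continuous_on_mult_left cont holf, simp only: cint_mult_left *[OF pos(5,2)] mult_zero_right sum.neutral_const)
  qed
  have contf: "continuous_on (sphere 0 \<rho>) f1" "continuous_on (sphere 0 \<rho>) f2" "continuous_on (sphere 0 \<rho>) f3"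
    unfolding f1_def f2_def f3_def by (intro continuous_on_sum continuous_on_mult_left cont holf)+
  have "0 = cint \<rho> (\<lambda>s. f1 s + f2 s + f3 s + g1 s + g2 s + g3 s)"
  proof -
    have "f1 s + f2 s + f3 s + g1 s + g2 s + g3 s = 0" if s: "s \<in> sphere 0 \<rho>" for s
    proof -
      have "(\<Sum>i\<in>UNIV. K (e i) x * dtr i y \<xi> (q, s * of_real v) + K (e i) y * dtr i \<xi> x (q, - (s * of_real (u + v))) + K (e i) \<xi> * dtr i x y (q, s * of_real u))
          + K x (br (c2 (q, s * of_real u) y) (c2 (q, s * of_real (u + v)) \<xi>)) + K y (br (c1 (q, s * of_real u) x) (c2 (q, s * of_real v) \<xi>))
          + K \<xi> (br (c1 (q, s * of_real (u + v)) x) (c1 (q, s * of_real v) y)) = 0"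
        by (rule Yang_Baxter) (use in_S sph[OF s] uv in \<open>auto simp: algebra_simps simp del: of_real_add\<close>, simp add: algebra_simps)
      from arg_cong[OF this, of "\<lambda>t. s ^ m * t"] show ?thesis
        unfolding f1_def f2_def f3_def g1_def g2_def g3_def
        by (simp add: algebra_simps sum.distrib sum_distrib_left del: of_real_add)
    qed
    then have "cint \<rho> (\<lambda>s. f1 s + f2 s + f3 s + g1 s + g2 s + g3 s) = cint \<rho> (\<lambda>s. 0)"
      using \<rho> by (intro cint_cong) auto
    then show ?thesis by simp
  qed
  also have "\<dots> = cint \<rho> f1 + cint \<rho> f2 + cint \<rho> f3 + cint \<rho> g1 + cint \<rho> g2 + cint \<rho> g3"
    using \<rho> contf cont[OF hol(1)] cont[OF hol(2)] cont[OF hol(3)]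
    by (simp add: cint_add continuous_on_add)
  finally have sum0: "cint \<rho> g1 + cint \<rho> g2 + cint \<rho> g3 = 0" using f_int by simp
  have ne: "of_real u \<noteq> (0::complex)" "of_real v \<noteq> (0::complex)" "of_real (u + v) \<noteq> (0::complex)"
    using uv by (simp_all only: of_real_eq_0_iff; simp)+
  note lead = leading_contract[OF A[OF Z(2)]]
  have "cint \<rho> g1 = K x (br ((1 / of_real u ^ k) *s contract2 br (A q) y) ((1 / of_real (u + v) ^ k) *s contract2 br (A q) \<xi>))"
    unfolding g1_def m_def by (rule cint_K_br_leading[OF k \<rho> hc(2) lead(2)[OF ne(1)] hc(2) lead(2)[OF ne(3)]]) (use uv in auto)
  moreover have "cint \<rho> g2 = K y (br ((1 / of_real u ^ k) *s contract1 br (A q) x) ((1 / of_real v ^ k) *s contract2 br (A q) \<xi>))"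
    unfolding g2_def m_def by (rule cint_K_br_leading[OF k \<rho> hc(1) lead(1)[OF ne(1)] hc(2) lead(2)[OF ne(2)]]) (use uv in auto)
  moreover have "cint \<rho> g3 = K \<xi> (br ((1 / of_real (u + v) ^ k) *s contract1 br (A q) x) ((1 / of_real v ^ k) *s contract1 br (A q) y))"
    unfolding g3_def m_def by (rule cint_K_br_leading[OF k \<rho> hc(1) lead(1)[OF ne(3)] hc(1) lead(1)[OF ne(2)]]) (use uv in auto)
  ultimately show ?thesis
    using sum0 unfolding K_br_scale by (simp add: mult.commute del: of_real_add)
qed

text \<open>At \<open>k = 1\<close> the two sides are equal, which is why the descent of the pole
  order stops at simple poles.\<close>

lemma power_3_2: "2 \<le> k \<Longrightarrow> 2 * 2 ^ k < 3 ^ k + (1 :: nat)"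
proof (induction k rule: dec_induct)
  case (step k)
  then show ?case by simp
qed auto

text \<open>An invariant leading coefficient \<open>A\<close> of order \<open>k\<close> satisfies the scaled Yang--Baxter equation for
  \<open>(u, v) = (1, 1)\<close> and \<open>(1, 2)\<close> only if \<open>(1 - 2 \<sqdot> 2\<^sup>k + 3\<^sup>k) [A\<^sup>1\<^sup>2, A\<^sup>1\<^sup>3] = 0\<close>; the image of \<open>A\<close> is then an
  abelian ideal.\<close>

lemma leading_zero:
  assumes Z: "open Z" "q \<in> Z" "Z \<subseteq> r_domain r" and A: "\<And>q. q \<in> Z \<Longrightarrow> leading k q (A q)" and k: "2 \<le> k"
  shows "A q = 0"
proof -
  have q: "q \<in> r_domain r" using Z by auto
  obtain d where d: "d > 0" "ball q d \<subseteq> Z" "\<And>q' z. q' \<in> ball q d \<Longrightarrow> z \<in> ball 0 d - {0} \<Longrightarrow> (q', z) \<in> S"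
    using r_region[OF q Z(1,2)] by metis
  have A': "leading k q' (A q')" if "q' \<in> ball q d" for q'
    by (rule A) (use d(2) that in blast)
  have k0: "0 < k" using k by simp
  let ?a1 = "contract1 br (A q)" and ?a2 = "contract2 br (A q)"
  have inv: "?a2 (br y \<xi>) = br (?a2 y) \<xi>" for y \<xi>
    by (rule leading_invariant[OF q d(1) d(3) A[OF Z(2)] k0]) (use d in auto)
  have comm: "br (?a2 y) (?a2 \<xi>) = 0" for y \<xi>
  proof (rule K_eqI2)
    fix x
    define P where "P = K x (br (?a2 y) (?a2 \<xi>))"
    define N where "N = K \<xi> (br (?a1 x) (?a1 y))"
    \<comment> \<open>Invariance extracts one factor of \<open>A\<close>, and the transposed
      contraction carries it over to \<open>x\<close>. Two of the three quadratic terms thus become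
      multiples of the same number.\<close>
    have M: "K y (br (?a1 x) (?a2 \<xi>)) = - P"
    proof -
      have "P = K (?a1 x) (br y (?a2 \<xi>))"
        unfolding P_def inv[symmetric] by (metis K_sym tpair_contract1 tpair_contract2)
      then show ?thesis using K_swap[of y "?a1 x" "?a2 \<xi>"] by simp
    qed
    have YB: "P / (of_real u ^ k * of_real (u + v) ^ k) - P / (of_real u ^ k * of_real v ^ k)
      + N / (of_real (u + v) ^ k * of_real v ^ k) = 0" if "0 < u" "0 < v" for u v
      using leading_scaled_Yang_Baxter[of "ball q d" q k A d u v x y \<xi>] d A' k0 that
      unfolding M by (auto simp: P_def N_def simp del: of_real_add)
    \<comment> \<open>The third term \<open>N\<close> is not computed: it is eliminated between the
      slopes (1, 1) and (1, 2), for which \<open>a\<close> and \<open>b\<close> are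
      \<open>2 ^ k\<close> and \<open>3 ^ k\<close>.\<close>
    have elim: "P - a * P + N = 0 \<Longrightarrow> a * P - b * P + N = 0 \<Longrightarrow> (b + 1) * P = (2 * a) * P" for a b :: complex
      by algebra
    have "P - 2 ^ k * P + N = 0" "2 ^ k * P - 3 ^ k * P + N = 0"
      using YB[of 1 1] YB[of 1 2] by (simp_all add: field_simps)
    from elim[OF this] have "of_nat (3 ^ k + 1) * P = of_nat (2 * 2 ^ k) * P"
      by (simp only: of_nat_add of_nat_mult of_nat_power of_nat_numeral of_nat_1)
    moreover have "of_nat (3 ^ k + 1) \<noteq> (of_nat (2 * 2 ^ k) :: complex)"
      using power_3_2[OF k] by (simp only: of_nat_eq_iff)
    ultimately have "P = 0"
      by (simp only: mult_cancel_right) blast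
    then show "K x (br (?a2 y) (?a2 \<xi>)) = K x 0" by (simp add: P_def)
  qed
  have "vec.subspace (range ?a2)"
  proof (rule vec.subspaceI)
    show "0 \<in> range ?a2"
      using rangeI[of ?a2 0] contract2_linear(3)[of "A q" 0 0] by simp
    fix u v c assume "u \<in> range ?a2"
    then obtain u' where u': "u = ?a2 u'" by blast
    show "c *s u \<in> range ?a2"
      unfolding u' contract2_linear(3)[symmetric] by (rule rangeI)
    assume "v \<in> range ?a2"
    then obtain v' where v': "v = ?a2 v'" by blast
    show "u + v \<in> range ?a2"
      unfolding u' v' contract2_linear(2)[symmetric] by (rule rangeI)
  qed
  moreover have "br x y \<in> range ?a2" if y: "y \<in> range ?a2" for x y
  proof -
    obtain w where w: "y = ?a2 w" using y by blast
    have "br x y = - br (?a2 w) x"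
      unfolding w by (rule br_skew)
    then have "br x y = (- 1) *s ?a2 (br w x)"
      by (simp add: inv vec_eq_iff)
    then have "br x y = ?a2 ((- 1) *s br w x)"
      by (simp only: contract2_linear(3))
    then show ?thesis by blast
  qed
  ultimately have "range ?a2 = {0} \<or> range ?a2 = UNIV"
    using simple by (auto simp: simple_lie_algebra_def)
  moreover have "range ?a2 \<noteq> UNIV"
  proof
    assume *: "range ?a2 = UNIV"
    have "br x y = 0" for x y
    proof -
      obtain u v where "x = ?a2 u" "y = ?a2 v" using * by (metis rangeE UNIV_I)
      then show ?thesis using comm by simp
    qed
    then show False using simple by (auto simp: simple_lie_algebra_def)
  qed
  ultimately have "?a2 x = 0" for x by auto
  then show ?thesis by (rule contract2_eq_0_imp)
qed

text \<open>On an open set where some bound of order at least 2 holds, the leading coefficient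
  vanishes identically, so the bound drops by one on the same set; this repeats down to order
  1.\<close>

lemma generic_simple_pole:
  assumes "q0 \<in> r_domain r" "open Z" "q0 \<in> Z"
  shows "\<exists>q\<in>Z. \<forall>a b. \<exists>L. ((\<lambda>z. z * r (q, z) $ a $ b) \<longlongrightarrow> L) (at 0)"
proof -
  define P where "P k \<longleftrightarrow> (\<exists>Y. open Y \<and> Y \<noteq> {} \<and> Y \<subseteq> Z \<inter> r_domain r \<and>
    (\<forall>q\<in>Y. \<forall>a b. \<exists>L. ((\<lambda>z. z ^ k * r (q, z) $ a $ b) \<longlongrightarrow> L) (at 0)))" for k
  have "\<exists>k. P k"
  proof -
    have "\<exists>Y k. open Y \<and> Y \<noteq> {} \<and> Y \<subseteq> Z \<inter> r_domain r \<and>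
      (\<forall>q\<in>Y. \<forall>i\<in>UNIV. \<exists>L. ((\<lambda>z. z ^ k * (case i of (a, b) \<Rightarrow> \<lambda>p. r p $ a $ b) (q, z)) \<longlongrightarrow> L) (at 0))"
      by (rule generic_pole_order_family)
        (use assms dynamical open_r_domain in \<open>auto simp: dynamical_r_matrix_def\<close>)
    then show ?thesis unfolding P_def by simp blast
  qed
  then obtain k where "P k" ..
  then have "P 1"
  proof (induction k)
    \<comment> \<open>A bound of order 0 is raised to 1, so that the descent has a single end
      point.\<close>
    case 0
    then obtain Y where Y: "open Y" "Y \<noteq> {}" "Y \<subseteq> Z \<inter> r_domain r"
      and Y4: "\<forall>q\<in>Y. \<forall>a b. \<exists>L. ((\<lambda>z. z ^ 0 * r (q, z) $ a $ b) \<longlongrightarrow> L) (at 0)"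
      unfolding P_def by (elim exE conjE)
    have "\<exists>L. ((\<lambda>z. z ^ 1 * r (q, z) $ a $ b) \<longlongrightarrow> L) (at 0)" if "q \<in> Y" for q a b
      by (rule tendsto_pole_mono[OF Y4[rule_format, OF that]]) simp
    then show ?case using Y unfolding P_def by (intro exI[of _ Y] conjI ballI allI)
  next
    case (Suc k)
    then obtain Y where Y: "open Y" "Y \<noteq> {}" "Y \<subseteq> Z \<inter> r_domain r"
      and Y4: "\<forall>q\<in>Y. \<forall>a b. \<exists>L. ((\<lambda>z. z ^ Suc k * r (q, z) $ a $ b) \<longlongrightarrow> L) (at 0)"
      unfolding P_def by (elim exE conjE)
    show ?case
    proof (cases "k = 0")
      case True
      with Suc.prems show ?thesis by simp
    next
      case False
      define A where "A q = (\<chi> a b. SOME L. ((\<lambda>z. z ^ Suc k * r (q, z) $ a $ b) \<longlongrightarrow> L) (at 0))" for q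
      have A: "leading (Suc k) q (A q)" if "q \<in> Y" for q
        using someI_ex[OF Y4[rule_format, OF that]] by (simp add: leading_def A_def)
      have A0: "A q = 0" if "q \<in> Y" for q
        by (rule leading_zero[OF Y(1) that _ A]) (use Y False in auto)
      have "\<exists>L. ((\<lambda>z. z ^ k * r (q, z) $ a $ b) \<longlongrightarrow> L) (at 0)" if q: "q \<in> Y" for q a b
      proof -
        have "q \<in> r_domain r" using q Y by auto
        then obtain d where d: "d > 0" "\<And>z. z \<in> ball 0 d - {0} \<Longrightarrow> (q, z) \<in> S"
          using r_region[of q UNIV] by (metis UNIV_I centre_in_ball open_UNIV)
        show ?thesis
        proof (rule tendsto_pole_reduce[OF _ d(1)])
          show "(\<lambda>z. r (q, z) $ a $ b) holomorphic_on ball 0 d - {0}"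
            by (rule holomorphic_on_comp_slice[OF r_holomorphic]) (use d in auto)
          show "((\<lambda>z. z ^ Suc k * r (q, z) $ a $ b) \<longlongrightarrow> 0) (at 0)"
            using A[OF q] A0[OF q] by (simp add: leading_def)
        qed
      qed
      then have "P k" using Y unfolding P_def by (intro exI[of _ Y] conjI ballI allI)
      then show ?thesis by (rule Suc.IH)
    qed
  qed
  then obtain Y where Y: "Y \<noteq> {}" "Y \<subseteq> Z \<inter> r_domain r"
    and Y4: "\<forall>q\<in>Y. \<forall>a b. \<exists>L. ((\<lambda>z. z ^ 1 * r (q, z) $ a $ b) \<longlongrightarrow> L) (at 0)"
    unfolding P_def by (elim exE conjE)
  then obtain q where "q \<in> Y" by blast
  then show ?thesis
    using Y(2) Y4 by (intro bexI[of _ q]) auto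
qed

text \<open>Density of good parameters gives the limit at every \<open>q\<close> of the domain; the
  residue condition then identifies it.\<close>

proposition simple_pole:
  assumes "q \<in> r_domain r"
  shows "((\<lambda>z. z * r (q, z) $ a $ b) \<longlongrightarrow> casimir br $ a $ b) (at 0)"
proof -
  obtain d where d: "d > 0" "\<And>q' z. q' \<in> ball q d \<Longrightarrow> z \<in> ball 0 d - {0} \<Longrightarrow> (q', z) \<in> S"
    using r_region[OF assms, of UNIV] by (metis UNIV_I open_UNIV)
  have "\<exists>L. ((\<lambda>z. z * r (q, z) $ a $ b) \<longlongrightarrow> L) (at 0)"
  proof (rule simple_pole_closure[where f = "\<lambda>p. r p $ a $ b" and B = "ball q d" and d = d])
    show "holomorphic_wrt scale2 (\<lambda>p. r p $ a $ b) (ball q d \<times> (ball 0 d - {0}))"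
      by (rule holomorphic_wrt_subset[OF r_holomorphic]) (use d(2) in blast)
    fix Z assume "open Z" "q \<in> Z"
    then show "\<exists>q\<in>Z \<inter> ball q d. \<exists>L. ((\<lambda>z. z * r (q, z) $ a $ b) \<longlongrightarrow> L) (at 0)"
      using generic_simple_pole[OF assms, of "Z \<inter> ball q d"] d(1) by (meson IntI centre_in_ball open_Int open_ball)
  qed (use d in auto)
  then obtain L where L: "((\<lambda>z. z * r (q, z) $ a $ b) \<longlongrightarrow> L) (at 0)" ..
  have "(\<lambda>z. r (q, z) $ a $ b) holomorphic_on ball 0 d - {0}"
    by (rule holomorphic_on_comp_slice[OF r_holomorphic]) (use d in auto)
  then have "residue (\<lambda>z. r (q, z) $ a $ b) 0 = L"
    using L d(1) by (intro residue_simple'[of "ball 0 d"]) (auto simp: mult.commute)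
  then have "L = casimir br $ a $ b"
    using dynamical assms by (simp add: dynamical_r_matrix_def)
  then show ?thesis using L by simp
qed

end

section \<open>The principal value on a circle\<close>

text \<open>The principal value leaves out an arc around \<open>z\<close>, so the full circle has to
  start at the angle of \<open>z\<close>.\<close>

lemma has_contour_integral_rotated_circle:
  assumes "(G has_contour_integral I) (circlepath 0 R)" "- pi \<le> \<phi>" "\<phi> \<le> pi"
  shows "(G has_contour_integral I) (part_circlepath 0 R \<phi> (\<phi> + 2 * pi))"
proof -
  \<comment> \<open>The shift of the parameter has to lie in the unit interval, so negative angles
    are moved up by a full turn.\<close>
  define \<phi>' where "\<phi>' = (if \<phi> < 0 then \<phi> + 2 * pi else \<phi>)"
  define a where "a = \<phi>' / (2 * pi)"
  have a: "a \<in> {0..1}" using assms pi_gt_zero by (auto simp: a_def \<phi>'_def field_simps)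
  have exp_eq: "exp (\<i> * of_real \<phi>') = exp (\<i> * of_real \<phi>)"
    using exp_two_pi_i by (auto simp: \<phi>'_def distrib_left exp_add mult_ac)
  have "shiftpath a (circlepath 0 R) x = circlepath 0 R (a + x)" for x
    using circlepath_add1[of 0 R "a + x - 1"] by (simp add: shiftpath_def)
  also have "circlepath 0 R (a + x) = part_circlepath 0 R \<phi> (\<phi> + 2 * pi) x" for x
  proof -
    have "circlepath 0 R (a + x) = R * (exp (\<i> * of_real \<phi>') * exp (2 * of_real pi * \<i> * of_real x))"
      by (simp add: circlepath a_def exp_add[symmetric] distrib_left distrib_right mult_ac)
    also have "\<dots> = part_circlepath 0 R \<phi> (\<phi> + 2 * pi) x"
      unfolding exp_eq
      by (simp add: part_circlepath_def linepath_def exp_add[symmetric] scaleR_conv_of_real algebra_simps)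
    finally show ?thesis .
  qed
  finally have "shiftpath a (circlepath 0 R) = part_circlepath 0 R \<phi> (\<phi> + 2 * pi)" by blast
  then show ?thesis
    using has_contour_integral_shiftpath[OF assms(1) _ a] by simp
qed

text \<open>The modulus of \<open>cis \<theta> - cis \<phi>\<close> is the same at both ends of a
  symmetric arc, so only the change of its argument remains. That change is half the length of the
  arc, which is the source of the one half in the principal value.\<close>

lemma has_integral_symmetric_arc:
  assumes "0 < \<delta>" "\<delta> < pi"
  shows "((\<lambda>\<theta>. \<i> * cis \<theta> / (cis \<theta> - cis \<phi>)) has_integral \<i> * of_real (pi - \<delta>)) {\<phi> + \<delta>..\<phi> + 2 * pi - \<delta>}"
proof -
  \<comment> \<open>Up to constants a logarithm of \<open>cis \<theta> - cis \<phi>\<close>, which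
    is \<open>2 * \<i> * sin ((\<theta> - \<phi>) / 2)\<close> times the unit number at the mean
    angle.\<close>
  define P where "P \<theta> = \<i> * of_real ((\<theta> - \<phi>) / 2) + of_real (ln (sin ((\<theta> - \<phi>) / 2)))" for \<theta>
  have "((\<lambda>\<theta>. \<i> * cis \<theta> / (cis \<theta> - cis \<phi>)) has_integral (P (\<phi> + 2 * pi - \<delta>) - P (\<phi> + \<delta>))) {\<phi> + \<delta>..\<phi> + 2 * pi - \<delta>}"
  proof (rule fundamental_theorem_of_calculus)
    fix \<theta> assume \<theta>: "\<theta> \<in> {\<phi> + \<delta>..\<phi> + 2 * pi - \<delta>}"
    define t where "t = (\<theta> - \<phi>) / 2"
    have t: "0 < t" "t < pi" using \<theta> assms by (auto simp: t_def field_simps)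
    have s: "sin t > 0" using t by (rule sin_gt_zero)
    have "\<theta> = \<phi> + (t + t)" by (simp add: t_def)
    then have cis_\<theta>: "cis \<theta> = cis \<phi> * (cis t * cis t)" by (simp only: cis_mult)
    have "cis t * cis t - 1 = 2 * \<i> * sin t * cis t"
      using sin_cos_squared_add[of t] by (intro complex_eqI) (simp_all add: power2_eq_square)
    then have diff: "cis \<theta> - cis \<phi> = cis \<phi> * (2 * \<i> * sin t * cis t)"
      unfolding cis_\<theta> by (metis mult.right_neutral right_diff_distrib)
    have "\<i> * cis \<theta> / (cis \<theta> - cis \<phi>) = cis t / (2 * sin t)"
      unfolding diff unfolding cis_\<theta> using s by (simp add: field_simps)
    also have "\<dots> = \<i> / 2 + of_real (cos t / (2 * sin t))"
      using s by (simp add: complex_eq_iff)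
    finally have eq: "\<i> * cis \<theta> / (cis \<theta> - cis \<phi>) = \<i> / 2 + of_real (cos t / (2 * sin t))" .
    have "((\<lambda>\<theta>. ln (sin ((\<theta> - \<phi>) / 2))) has_real_derivative cos t / (2 * sin t)) (at \<theta>)"
      using s unfolding t_def by (auto intro!: derivative_eq_intros)
    then have ln: "((\<lambda>\<theta>. of_real (ln (sin ((\<theta> - \<phi>) / 2)))) has_vector_derivative (of_real (cos t / (2 * sin t)) :: complex)) (at \<theta>)"
      by (rule has_vector_derivative_of_real[unfolded o_def])
    have lin: "((\<lambda>\<theta>. \<i> * of_real ((\<theta> - \<phi>) / 2)) has_vector_derivative \<i> / 2) (at \<theta>)"
      by (auto intro!: derivative_eq_intros simp: has_vector_derivative_def scaleR_conv_of_real)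
    show "(P has_vector_derivative \<i> * cis \<theta> / (cis \<theta> - cis \<phi>)) (at \<theta> within {\<phi> + \<delta>..\<phi> + 2 * pi - \<delta>})"
      unfolding eq P_def[abs_def] by (rule has_vector_derivative_at_within[OF has_vector_derivative_add[OF lin ln]])
  qed (use assms in auto)
  moreover have "P (\<phi> + 2 * pi - \<delta>) - P (\<phi> + \<delta>) = \<i> * of_real (pi - \<delta>)"
  proof -
    have "sin ((\<phi> + 2 * pi - \<delta> - \<phi>) / 2) = sin (\<delta> / 2)"
      using sin_pi_minus[of "\<delta> / 2"] by (simp add: field_simps)
    then show ?thesis by (simp add: P_def algebra_simps diff_divide_distrib)
  qed
  ultimately show ?thesis by simp
qed

text \<open>Subtracting \<open>c / (w - z)\<close> leaves a function whose only singularity in the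
  ball is 0. Both the principal value and the step across a pole then concern the explicit fraction
  alone.\<close>

lemma simple_pole_split:
  assumes F: "F holomorphic_on ball 0 d - {0, z}" and lim: "((\<lambda>w. (w - z) * F w) \<longlongrightarrow> c) (at z)" and "z \<noteq> 0"
  obtains G where "G holomorphic_on ball 0 d - {0}" "\<And>w. w \<noteq> z \<Longrightarrow> G w = F w - c / (w - z)"
proof -
  let ?A = "ball 0 d - {0 :: complex}"
  define p where "p w = (if w = z then c else (w - z) * F w)" for w
  have A_minus: "?A - {z} = ball 0 d - {0, z}" by auto
  have "p holomorphic_on ?A"
  proof (rule no_isolated_singularity'[of "{z}"])
    have "(p \<longlongrightarrow> c) (at z)"
      using lim by (rule Lim_transform_eventually) (auto simp: eventually_at_filter p_def)
    then show "(p \<longlongrightarrow> p w) (at w within ?A)" if "w \<in> {z}" for w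
      using that by (auto simp: p_def intro: tendsto_within_subset[OF _ subset_UNIV])
    have "(\<lambda>w. (w - z) * F w) holomorphic_on ?A - {z}"
      unfolding A_minus by (intro holomorphic_intros F)
    then show "p holomorphic_on ?A - {z}"
      by (rule holomorphic_transform) (auto simp: p_def)
  qed auto
  then have "(\<lambda>w. if w = z then deriv p z else F w - p z / (w - z)) holomorphic_on ?A"
    by (rule pole_theorem_open) (auto simp: p_def)
  moreover have "p z = c" by (simp add: p_def)
  ultimately show ?thesis
    using that[of "\<lambda>w. if w = z then deriv p z else F w - p z / (w - z)"] by simp
qed

text \<open>The part without the pole at \<open>z\<close> has the same integral over both circles,
  and \<open>1 / (w - z)\<close> integrates to 1 outside and to 0 inside.\<close>

lemma cint_cross_pole:
  assumes F: "F holomorphic_on ball 0 d - {0, z}" and lim: "((\<lambda>w. (w - z) * F w) \<longlongrightarrow> c) (at z)"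
    and \<rho>: "0 < \<rho>" "\<rho> < norm z" "norm z < \<sigma>" "\<sigma> < d"
  shows "cint \<sigma> F = cint \<rho> F + c"
proof -
  obtain G where G: "G holomorphic_on ball 0 d - {0}" and G_eq: "\<And>w. w \<noteq> z \<Longrightarrow> G w = F w - c / (w - z)"
    using simple_pole_split[OF F lim] \<rho> by (metis norm_zero order.strict_trans less_irrefl)
  have F_eq: "F w = G w + c * (1 / (w - z))" if "norm w \<noteq> norm z" for w
  proof -
    have "w \<noteq> z" using that by blast
    then show ?thesis by (simp add: G_eq)
  qed
  have cont: "continuous_on (sphere 0 s) G" "continuous_on (sphere 0 s) (\<lambda>w. c * (1 / (w - z)))"
    if "0 < s" "s < d" "s \<noteq> norm z" for s
    using that by (auto intro!: continuous_on_subset[OF holomorphic_on_imp_continuous_on[OF G]] continuous_intros)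
  have split: "cint s F = residue G 0 + c * cint s (\<lambda>w. 1 / (w - z))" if "0 < s" "s < d" "s \<noteq> norm z" for s
  proof -
    have "cint s F = cint s (\<lambda>w. G w + c * (1 / (w - z)))"
      by (rule cint_cong) (use that F_eq in auto)
    also have "\<dots> = cint s G + c * cint s (\<lambda>w. 1 / (w - z))"
      unfolding cint_mult_left[symmetric] using that cont[OF that] by (intro cint_add) auto
    finally show ?thesis using cint_residue[OF G that(1,2)] by simp
  qed
  have "cint \<sigma> (\<lambda>w. 1 / (w - z)) = 1"
    using contour_integral_unique[OF Cauchy_integral_circlepath[of 0 \<sigma> "\<lambda>w. 1" z]] \<rho>
    by (simp add: cint_eq)
  moreover have "cint \<rho> (\<lambda>w. 1 / (w - z)) = 0"
  proof -
    have hol: "(\<lambda>w. 1 / (w - z)) holomorphic_on ball 0 (norm z)"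
      by (intro holomorphic_intros) auto
    have "cint \<rho> (\<lambda>w. 1 / (w - z)) = residue (\<lambda>w. 1 / (w - z)) 0"
      by (rule cint_residue[OF holomorphic_on_subset[OF hol]]) (use \<rho> in auto)
    also have "\<dots> = 0"
      by (rule residue_holo[OF _ _ hol]) (use \<rho> in auto)
    finally show ?thesis .
  qed
  ultimately show ?thesis
    using split[of \<sigma>] split[of \<rho>] \<rho> by simp
qed

text \<open>After splitting off \<open>c / (w - z)\<close> the remaining integral converges and is
  governed by the residue at 0, while the fraction contributes
  \<open>c * \<i> * (pi - \<delta>)\<close>, half of a full residue in the limit.\<close>

lemma pv_circle_eq:
  assumes F: "F holomorphic_on ball 0 d - {0, z}" and z: "z \<noteq> 0" "norm z < d"
    and lim: "((\<lambda>w. (w - z) * F w) \<longlongrightarrow> c) (at z)"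
  shows "pv_circle F z = 2 * pi * \<i> * (residue F 0 + c / 2)"
proof -
  obtain G where G: "G holomorphic_on ball 0 d - {0}" and G_eq: "\<And>w. w \<noteq> z \<Longrightarrow> G w = F w - c / (w - z)"
    using simple_pole_split[OF F lim z(1)] by blast
  define R where "R = norm z"
  define \<phi> where "\<phi> = Arg z"
  have R: "0 < R" "R < d" using z by (auto simp: R_def)
  have z_eq: "z = R * cis \<phi>"
    using rcis_cmod_Arg[of z] by (simp add: R_def \<phi>_def rcis_def)
  define g where "g t = G (R * cis t) * R * \<i> * cis t" for t
  have g_cont: "continuous_on B g" for B
    unfolding g_def
    by (intro continuous_intros continuous_on_compose2[OF holomorphic_on_imp_continuous_on[OF G]])
      (use R in \<open>auto simp: norm_mult\<close>)
  \<comment> \<open>The split-off fraction is holomorphic near 0 because \<open>z\<close> is not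
    0.\<close>
  have resG: "residue G 0 = residue F 0"
  proof -
    have hol1: "(\<lambda>w. c / (w - z)) holomorphic_on ball 0 R"
      by (intro holomorphic_intros) (auto simp: R_def)
    have hol2: "G holomorphic_on ball 0 R - {0}"
      by (rule holomorphic_on_subset[OF G]) (use R in auto)
    have "residue F 0 = residue (\<lambda>w. G w + c / (w - z)) 0"
      by (rule residue_cong_ball[OF R(1)]) (use G_eq in \<open>auto simp: R_def\<close>, metis G_eq add.commute diff_add_cancel less_irrefl)
    also have "\<dots> = residue G 0 + residue (\<lambda>w. c / (w - z)) 0"
      by (rule residue_add[of "ball 0 R"]) (use R hol1 hol2 in \<open>auto intro: holomorphic_on_subset\<close>)
    also have "residue (\<lambda>w. c / (w - z)) 0 = 0"
      by (rule residue_holo[OF _ _ hol1]) (use R in auto)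
    finally show ?thesis by simp
  qed
  have "(G has_contour_integral 2 * pi * \<i> * residue G 0) (circlepath 0 R)"
    by (rule base_residue[of "ball 0 d"]) (use R G in \<open>auto simp: cball_subset_ball_iff\<close>)
  from has_contour_integral_rotated_circle[OF this, of \<phi>]
  have int_g: "(g has_integral 2 * pi * \<i> * residue F 0) {\<phi>..\<phi> + 2 * pi}"
    using Arg_bounded[of z] pi_gt_zero
    by (simp add: \<phi>_def resG g_def[abs_def] has_contour_integral_part_circlepath_iff)
  have arc: "contour_integral (part_circlepath 0 (norm z) (Arg z + \<delta>) (Arg z + 2 * pi - \<delta>)) F =
      integral {\<phi> + \<delta>..\<phi> + 2 * pi - \<delta>} g + c * (\<i> * of_real (pi - \<delta>))" if \<delta>: "0 < \<delta>" "\<delta> < pi" for \<delta>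
  proof -
    have "F (R * cis t) * R * \<i> * cis t = g t + c * (\<i> * cis t / (cis t - cis \<phi>))"
      if t: "t \<in> {\<phi> + \<delta>..\<phi> + 2 * pi - \<delta>}" for t
    proof -
      have "cis t \<noteq> cis \<phi>"
      proof
        assume "cis t = cis \<phi>"
        then have "cis (t - \<phi>) = 1" by (simp flip: cis_divide)
        moreover have "sin ((t - \<phi>) / 2) > 0"
          using t \<delta> by (intro sin_gt_zero) (auto simp: field_simps)
        moreover have "cos (t - \<phi>) = 1 - 2 * (sin ((t - \<phi>) / 2))\<^sup>2"
          using cos_double_sin[of "(t - \<phi>) / 2"] by (simp only: nonzero_mult_div_cancel_left times_divide_eq_right zero_neq_numeral not_False_eq_True)
        ultimately show False
          by (simp add: complex_eq_iff)
      qed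
      then have "of_real R * cis t \<noteq> z" "of_real R * cis t - z = of_real R * (cis t - cis \<phi>)" "cis t - cis \<phi> \<noteq> 0"
        using R by (auto simp: z_eq right_diff_distrib)
      then have ne: "of_real R * cis t \<noteq> z" "cis t - cis \<phi> \<noteq> 0"
        and eq: "of_real R * cis t - z = of_real R * (cis t - cis \<phi>)" by blast+
      have frac: "x * y * \<i> * u = (x - c / (y * D)) * y * \<i> * u + c * (\<i> * u / D)"
        if "y \<noteq> 0" "D \<noteq> 0" for x y u D :: complex
        using that by (simp add: field_simps)
      show ?thesis
        unfolding g_def G_eq[OF ne(1)] eq by (rule frac) (use R ne(2) in auto)
    qed
    moreover have "((\<lambda>t. g t + c * (\<i> * cis t / (cis t - cis \<phi>))) has_integral
        integral {\<phi> + \<delta>..\<phi> + 2 * pi - \<delta>} g + c * (\<i> * of_real (pi - \<delta>))) {\<phi> + \<delta>..\<phi> + 2 * pi - \<delta>}"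
      by (intro has_integral_add has_integral_mult_right has_integral_symmetric_arc \<delta> integrable_integral
          integrable_continuous_interval g_cont)
    ultimately have "((\<lambda>t. F (0 + R * cis t) * R * \<i> * cis t) has_integral
        integral {\<phi> + \<delta>..\<phi> + 2 * pi - \<delta>} g + c * (\<i> * of_real (pi - \<delta>))) {\<phi> + \<delta>..\<phi> + 2 * pi - \<delta>}"
      by (subst has_integral_cong) (simp only: add_0_left)
    then show ?thesis
      using \<delta> unfolding R_def[symmetric] \<phi>_def[symmetric]
      by (subst contour_integral_part_circlepath_eq) (auto simp: integral_unique)
  qed
  \<comment> \<open>Continuity of the indefinite integral lets both ends of the arc close up on
    \<phi>.\<close>
  define J where "J x = integral {\<phi>..x} g" for x
  have J: "continuous_on {\<phi>..\<phi> + 2 * pi} J"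
    unfolding J_def by (intro indefinite_integral_continuous_1 integrable_continuous_interval g_cont)
  have J_lim: "((\<lambda>\<delta>. J (\<phi> + 2 * pi - \<delta>) - J (\<phi> + \<delta>)) \<longlongrightarrow> J (\<phi> + 2 * pi - 0) - J (\<phi> + 0)) (at_right 0)"
  proof -
    have "continuous_on {0..2 * pi} (\<lambda>\<delta>. J (\<phi> + 2 * pi - \<delta>) - J (\<phi> + \<delta>))"
      by (intro continuous_intros continuous_on_compose2[OF J]) auto
    then have "((\<lambda>\<delta>. J (\<phi> + 2 * pi - \<delta>) - J (\<phi> + \<delta>)) \<longlongrightarrow> J (\<phi> + 2 * pi - 0) - J (\<phi> + 0)) (at 0 within {0..2 * pi})"
      unfolding continuous_on_def by (rule bspec) simp
    then show ?thesis
      using pi_gt_zero by (simp add: at_within_Icc_at_right)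
  qed
  have J_diff: "J (\<phi> + 2 * pi - \<delta>) - J (\<phi> + \<delta>) = integral {\<phi> + \<delta>..\<phi> + 2 * pi - \<delta>} g" if "0 < \<delta>" "\<delta> < pi" for \<delta>
    unfolding J_def using Henstock_Kurzweil_Integration.integral_combine[where a = \<phi> and c = "\<phi> + \<delta>" and b = "\<phi> + 2 * pi - \<delta>" and f = g] that
    by (simp add: integrable_continuous_interval g_cont algebra_simps)
  have "((\<lambda>\<delta>. J (\<phi> + 2 * pi - \<delta>) - J (\<phi> + \<delta>) + c * (\<i> * of_real (pi - \<delta>))) \<longlongrightarrow>
      J (\<phi> + 2 * pi - 0) - J (\<phi> + 0) + c * (\<i> * of_real (pi - 0))) (at_right 0)"
    by (intro tendsto_add J_lim tendsto_intros)
  moreover have "eventually (\<lambda>\<delta>. J (\<phi> + 2 * pi - \<delta>) - J (\<phi> + \<delta>) + c * (\<i> * of_real (pi - \<delta>)) =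
      contour_integral (part_circlepath 0 (norm z) (Arg z + \<delta>) (Arg z + 2 * pi - \<delta>)) F) (at_right 0)"
    unfolding eventually_at_right_field using pi_gt_zero by (intro exI[of _ pi]) (auto simp: arc J_diff)
  ultimately have "((\<lambda>\<delta>. contour_integral (part_circlepath 0 (norm z) (Arg z + \<delta>) (Arg z + 2 * pi - \<delta>)) F) \<longlongrightarrow>
      J (\<phi> + 2 * pi - 0) - J (\<phi> + 0) + c * (\<i> * of_real (pi - 0))) (at_right 0)"
    by (rule Lim_transform_eventually)
  then have "pv_circle F z = J (\<phi> + 2 * pi - 0) - J (\<phi> + 0) + c * (\<i> * of_real (pi - 0))"
    unfolding pv_circle_def by (intro tendsto_Lim) (simp_all add: trivial_limit_at_right_real)
  also have "\<dots> = 2 * pi * \<i> * (residue F 0 + c / 2)"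
    using integral_unique[OF int_g] by (simp add: J_def algebra_simps)
  finally show ?thesis .
qed

section \<open>Residues against a fixed Laurent series\<close>

text \<open>Only finitely many Taylor coefficients of \<open>H\<close> meet the polar part of
  \<open>\<phi>\<close>. What matters is that \<open>N\<close> and \<open>c\<close> depend on
  \<open>\<phi>\<close> alone: below, \<open>H\<close> varies with a parameter
  \<open>z\<close>.\<close>

lemma residue_laurent_functional:
  assumes "\<phi> has_laurent_expansion \<Phi>"
  shows "\<exists>N c. \<forall>H d. d > 0 \<longrightarrow> H holomorphic_on ball 0 d \<longrightarrow>
    residue (\<lambda>w. H w * \<phi> w) 0 = (\<Sum>k\<le>N. c k * (deriv ^^ k) H 0)"
proof -
  define sd where "sd = fls_subdegree \<Phi>"
  \<comment> \<open>Chosen so that \<open>w ^ Suc N * \<phi> w\<close> extends holomorphically over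
    0; its extension is \<open>\<psi>\<close>. For nonnegative subdegree \<open>N\<close> is
    0.\<close>
  define N where "N = nat (- sd)"
  define \<psi> where "\<psi> w = eval_fps (fls_base_factor_to_fps \<Phi>) w * w ^ nat (sd + int N + 1)" for w
  have rad: "fps_conv_radius (fls_base_factor_to_fps \<Phi>) > 0"
    using assms by (simp add: has_laurent_expansion_def fls_conv_radius_altdef)
  have hol_\<psi>: "\<psi> holomorphic_on eball 0 (fps_conv_radius (fls_base_factor_to_fps \<Phi>))"
    unfolding \<psi>_def by (intro holomorphic_intros) auto
  have "eventually (\<lambda>w. eval_fls \<Phi> w = \<phi> w) (at 0)"
    using assms by (simp add: has_laurent_expansion_def)
  moreover have "eventually (\<lambda>w. w \<noteq> 0) (at (0 :: complex))"
    by (simp add: eventually_at_filter)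
  ultimately have ev: "eventually (\<lambda>w. \<phi> w = \<psi> w / w ^ Suc N) (at 0)"
  proof eventually_elim
    case (elim w)
    have "w powi sd * w ^ Suc N = w powi (sd + int (Suc N))"
      using elim by (simp only: power_int_add[of w] power_int_of_nat simp_thms)
    also have "\<dots> = w ^ nat (sd + int N + 1)"
      by (simp add: power_int_def N_def add_ac)
    finally have "\<phi> w * w ^ Suc N = \<psi> w"
      unfolding elim(1)[symmetric] eval_fls_def \<psi>_def sd_def[symmetric] mult.assoc by (simp only:)
    then show ?case
      using elim(2) by (simp add: nonzero_eq_divide_eq del: power_Suc)
  qed
  show ?thesis
  proof (intro exI[of _ N] exI[of _ "\<lambda>k. of_nat (N choose k) * (deriv ^^ (N - k)) \<psi> 0 / fact N"] allI impI)
    fix H :: "complex \<Rightarrow> complex" and d :: real assume d: "d > 0" "H holomorphic_on ball 0 d"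
    let ?B = "ball 0 d \<inter> eball 0 (fps_conv_radius (fls_base_factor_to_fps \<Phi>))"
    have B: "open ?B" "0 \<in> ?B" using rad d by (auto simp: zero_ereal_def)
    have "residue (\<lambda>w. H w * \<phi> w) 0 = residue (\<lambda>w. (H w * \<psi> w) / w ^ Suc N) 0"
      by (rule residue_cong) (use ev in \<open>auto elim!: eventually_mono\<close>)
    also have "\<dots> = (deriv ^^ N) (\<lambda>w. H w * \<psi> w) 0 / fact N"
      by (rule residue_holomorphic_over_power'[OF B])
        (intro holomorphic_intros holomorphic_on_subset[OF d(2)] holomorphic_on_subset[OF hol_\<psi>]; blast)
    also have "(deriv ^^ N) (\<lambda>w. H w * \<psi> w) 0 = (\<Sum>k\<le>N. of_nat (N choose k) * (deriv ^^ k) H 0 * (deriv ^^ (N - k)) \<psi> 0)"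
      by (subst higher_deriv_mult[OF holomorphic_on_subset[OF d(2)] holomorphic_on_subset[OF hol_\<psi>] B])
        (auto simp: atMost_atLeast0)
    finally show "residue (\<lambda>w. H w * \<phi> w) 0 = (\<Sum>k\<le>N. of_nat (N choose k) * (deriv ^^ (N - k)) \<psi> 0 / fact N * (deriv ^^ k) H 0)"
      by (simp add: sum_divide_distrib mult_ac)
  qed
qed

lemma has_laurent_expansion_higher_deriv:
  "g has_laurent_expansion G \<Longrightarrow> (deriv ^^ k) g has_laurent_expansion (fls_deriv ^^ k) G"
  by (induction k) (auto intro: has_laurent_expansion_deriv)

text \<open>With \<open>H w = g (z - w)\<close> the residue is a fixed combination of derivatives of
  \<open>g\<close> at \<open>z\<close>, and derivatives of a Laurent germ are Laurent germs. This is
  why Q maps Laurent series to Laurent series.\<close>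

lemma residue_convolution_laurent:
  assumes g: "g has_laurent_expansion G" "g holomorphic_on ball 0 d - {0}" and d: "d > 0"
    and \<phi>: "\<phi> has_laurent_expansion \<Phi>"
  shows "\<exists>L. (\<lambda>z. residue (\<lambda>w. g (z - w) * \<phi> w) 0) has_laurent_expansion L"
proof -
  obtain N c where Nc: "\<forall>H d. d > 0 \<longrightarrow> H holomorphic_on ball 0 d \<longrightarrow>
    residue (\<lambda>w. H w * \<phi> w) 0 = (\<Sum>k\<le>N. c k * (deriv ^^ k) H 0)"
    using residue_laurent_functional[OF \<phi>] by (elim exE)
  have "(\<lambda>z. \<Sum>k\<le>N. c k * (- 1) ^ k * (deriv ^^ k) g z) has_laurent_expansion
      (\<Sum>k\<le>N. fls_const (c k * (- 1) ^ k) * (fls_deriv ^^ k) G)"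
    by (intro laurent_expansion_intros has_laurent_expansion_higher_deriv g)
  moreover have ev: "eventually (\<lambda>z. (\<Sum>k\<le>N. c k * (- 1) ^ k * (deriv ^^ k) g z) = residue (\<lambda>w. g (z - w) * \<phi> w) 0) (at 0)"
    unfolding eventually_at
  proof (intro exI[of _ "d / 2"] conjI ballI impI)
    fix z :: complex assume z: "z \<noteq> 0 \<and> dist z 0 < d / 2"
    have in_ball: "- 1 * w + z \<in> ball 0 d - {0}" if "w \<in> ball 0 (norm z)" for w
    proof -
      have "norm (z - w) \<le> norm z + norm w" by (rule norm_triangle_ineq4)
      then show ?thesis using that z by auto
    qed
    have hol: "(\<lambda>w. g (- 1 * w + z)) holomorphic_on ball 0 (norm z)"
      by (rule holomorphic_on_compose_gen[unfolded o_def, OF _ g(2)]) (use in_ball in \<open>auto intro!: holomorphic_intros\<close>)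
    have "(deriv ^^ k) (\<lambda>w. g (- 1 * w + z)) 0 = (- 1) ^ k * (deriv ^^ k) g (- 1 * 0 + z)" for k
      by (rule higher_deriv_compose_linear'[OF g(2), where S = "ball 0 (norm z)"]) (use in_ball z in auto)
    then show "(\<Sum>k\<le>N. c k * (- 1) ^ k * (deriv ^^ k) g z) = residue (\<lambda>w. g (z - w) * \<phi> w) 0"
      using Nc[rule_format, OF _ hol] z by (simp add: mult_ac)
  qed (use d in auto)
  ultimately have "(\<lambda>z. residue (\<lambda>w. g (z - w) * \<phi> w) 0) has_laurent_expansion
      (\<Sum>k\<le>N. fls_const (c k * (- 1) ^ k) * (fls_deriv ^^ k) G)"
    by (simp only: has_laurent_expansion_cong[OF ev refl])
  then show ?thesis ..
qed

section \<open>Loops as germs of functions\<close>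

text \<open>Only the germ on a punctured neighbourhood is recorded. Values at 0 are not constrained;
  in particular \<open>Qf\<close> at \<open>z = 0\<close> is not read off from its Laurent
  series.\<close>

definition represents :: "(complex \<Rightarrow> complex ^ 'n::finite) \<Rightarrow> 'n loop \<Rightarrow> bool" where
  "represents F X \<longleftrightarrow> (\<forall>a. (\<lambda>z. F z $ a) has_laurent_expansion X $ a)"

lemma loop_alg_iff: "X \<in> loop_alg \<longleftrightarrow> represents (leval X) X"
  by (auto simp: loop_alg_def represents_def leval_def has_laurent_expansion_def)

lemma represents_leval: "X \<in> loop_alg \<Longrightarrow> represents (leval X) X"
  by (simp add: loop_alg_iff)

lemma represents_loop: "represents F X \<Longrightarrow> X \<in> loop_alg"
  by (auto simp: loop_alg_def represents_def has_laurent_expansion_def)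

lemma represents_eventually: "represents F X \<Longrightarrow> eventually (\<lambda>z. leval X z = F z) (at 0)"
  by (simp add: represents_def has_laurent_expansion_def leval_def vec_eq_iff eventually_all_finite)

lemma represents_cong:
  assumes "represents F X" "eventually (\<lambda>z. F z = G z) (at 0)"
  shows "represents G X"
  unfolding represents_def
proof
  fix a
  have "eventually (\<lambda>z. F z $ a = G z $ a) (at 0)"
    using assms(2) by eventually_elim simp
  from has_laurent_expansion_cong[OF this refl] assms(1)
  show "(\<lambda>z. G z $ a) has_laurent_expansion X $ a"
    unfolding represents_def by blast
qed

lemma represents_unique:
  assumes "represents F X" "represents F Y"
  shows "X = Y"
  using assms has_laurent_expansion_unique unfolding represents_def vec_eq_iff by blast

text \<open>\<open>R_op\<close> and \<open>r_minus\<close> are both given by descriptions of this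
  shape; a Laurent series is determined by its germ, so any explicit representative resolves
  them.\<close>

lemma represents_THE:
  assumes F: "represents F X" and P: "\<And>z v. P z v \<longleftrightarrow> v = F' z" and ev: "eventually (\<lambda>z. F z = F' z) (at 0)"
  shows "(THE X. X \<in> loop_alg \<and> (\<exists>\<epsilon>>0. \<forall>z. 0 < norm z \<and> norm z < \<epsilon> \<longrightarrow> P z (leval X z))) = X"
proof -
  have F': "represents F' X" by (rule represents_cong[OF F ev])
  have eq: "(\<exists>\<epsilon>>0. \<forall>z. 0 < norm z \<and> norm z < \<epsilon> \<longrightarrow> P z (leval Y z)) \<longleftrightarrow> eventually (\<lambda>z. leval Y z = F' z) (at 0)" for Y
    by (simp add: P eventually_at)
  show ?thesis
    unfolding eq
  proof (rule the_equality)
    show "X \<in> loop_alg \<and> eventually (\<lambda>z. leval X z = F' z) (at 0)"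
      using F' represents_loop represents_eventually by blast
    fix Y assume "Y \<in> loop_alg \<and> eventually (\<lambda>z. leval Y z = F' z) (at 0)"
    then have "represents F' Y"
      using represents_cong[OF represents_leval] by blast
    then show "Y = X" using F' by (rule represents_unique)
  qed
qed

lemma represents_add: "represents F X \<Longrightarrow> represents G Y \<Longrightarrow> represents (\<lambda>z. F z + G z) (X + Y)"
  unfolding represents_def by (auto intro!: laurent_expansion_intros)

lemma represents_minus: "represents F X \<Longrightarrow> represents (\<lambda>z. - F z) (- X)"
  unfolding represents_def by (auto intro!: laurent_expansion_intros)

lemma represents_scale: "represents F X \<Longrightarrow> represents (\<lambda>z. c *s F z) (fls_const c *s X)"
  unfolding represents_def by (auto intro!: laurent_expansion_intros)

lemma represents_const: "represents (\<lambda>z. x) (lconst x)"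
  unfolding represents_def lconst_def by (auto intro!: laurent_expansion_intros)

lemmas loop_alg_add = represents_loop[OF represents_add[OF represents_leval represents_leval]]
  and loop_alg_minus = represents_loop[OF represents_minus[OF represents_leval]]
  and loop_alg_scale = represents_loop[OF represents_scale[OF represents_leval]]
  and loop_alg_const = represents_loop[OF represents_const]

lemma loop_alg_0: "0 \<in> loop_alg"
  by (simp add: loop_alg_def)

lemma represents_holomorphic:
  assumes "represents F X"
  obtains d where "d > 0" "\<And>a. (\<lambda>z. leval X z $ a) holomorphic_on ball 0 d - {0}"
    "\<And>z. z \<in> ball 0 d - {0} \<Longrightarrow> leval X z = F z"
proof -
  have rad: "0 < Min (range (\<lambda>a. fls_conv_radius (X $ a)))"
    using represents_loop[OF assms] by (simp add: loop_alg_def)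
  obtain d1 where d1: "0 < ereal d1" "ereal d1 < Min (range (\<lambda>a. fls_conv_radius (X $ a)))"
    using ereal_dense2[OF rad] by auto
  obtain d2 where d2: "d2 > 0" "\<And>z. z \<noteq> 0 \<Longrightarrow> dist z 0 < d2 \<Longrightarrow> leval X z = F z"
    using represents_eventually[OF assms] unfolding eventually_at by auto
  show ?thesis
  proof (rule that[of "min d1 d2"])
    fix a
    have "ereal d1 < fls_conv_radius (X $ a)"
      using d1(2) by (rule less_le_trans) (intro Min_le; simp)
    then have "ball 0 d1 \<subseteq> eball 0 (fls_conv_radius (X $ a))"
      by (auto simp: eball_def intro: less_trans[of _ "ereal d1"])
    then show "(\<lambda>z. leval X z $ a) holomorphic_on ball 0 (min d1 d2) - {0}"
      unfolding leval_def by (auto intro!: holomorphic_on_eval_fls split: if_splits)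
  qed (use d1 d2 in auto)
qed

context lie
begin

lemma K_expand: "K x y = (\<Sum>a\<in>UNIV. \<Sum>b\<in>UNIV. x $ a * y $ b * K (axis a 1) (axis b 1))"
proof -
  have "K (axis a 1) y = (\<Sum>b\<in>UNIV. y $ b * K (axis a 1) (axis b 1))" for a
    by (subst K_sym, subst K_expand_left) (simp add: K_sym)
  then show ?thesis
    by (subst K_expand_left) (simp add: sum_distrib_left mult.assoc)
qed

text \<open>The Laurent series of the pointwise Killing pairing. It makes \<open>lpair\<close> a
  single coefficient, so that bilinearity becomes algebra of series.\<close>

definition Kfls :: "'n loop \<Rightarrow> 'n loop \<Rightarrow> complex fls" where
  "Kfls X Y = (\<Sum>a\<in>UNIV. \<Sum>b\<in>UNIV. X $ a * Y $ b * fls_const (K (axis a 1) (axis b 1)))"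

lemma Kfls_laurent:
  assumes "represents F X" "represents G Y"
  shows "(\<lambda>z. K (F z) (G z)) has_laurent_expansion Kfls X Y"
  unfolding Kfls_def K_expand[of "F _"] using assms unfolding represents_def
  by (intro laurent_expansion_intros) auto

lemma lpair_residue:
  assumes "represents F X" "represents G Y"
  shows "lpair br X Y = residue (\<lambda>z. K (F z) (G z)) 0"
  unfolding lpair_def
  by (rule residue_cong) (use represents_eventually[OF assms(1)] represents_eventually[OF assms(2)] in \<open>auto elim: eventually_elim2\<close>)

lemma lpair_eq:
  assumes "X \<in> loop_alg" "Y \<in> loop_alg"
  shows "lpair br X Y = fls_residue (Kfls X Y)"
  unfolding lpair_def
  by (rule has_laurent_expansion_residue_0[OF Kfls_laurent[OF represents_leval[OF assms(1)] represents_leval[OF assms(2)]]])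

lemma Kfls_linear:
  "Kfls (X + X') Y = Kfls X Y + Kfls X' Y" "Kfls X (Y + Y') = Kfls X Y + Kfls X Y'"
  "Kfls (fls_const c *s X) Y = fls_const c * Kfls X Y"
  "Kfls (- X) Y = - Kfls X Y" "Kfls X (- Y) = - Kfls X Y"
  by (simp_all add: Kfls_def sum.distrib sum_distrib_left algebra_simps sum_negf)

lemma lpair_add_left:
  "X \<in> loop_alg \<Longrightarrow> X' \<in> loop_alg \<Longrightarrow> Y \<in> loop_alg \<Longrightarrow> lpair br (X + X') Y = lpair br X Y + lpair br X' Y"
  by (simp add: lpair_eq loop_alg_add Kfls_linear)

lemma lpair_add_right:
  "X \<in> loop_alg \<Longrightarrow> Y \<in> loop_alg \<Longrightarrow> Y' \<in> loop_alg \<Longrightarrow> lpair br X (Y + Y') = lpair br X Y + lpair br X Y'"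
  by (simp add: lpair_eq loop_alg_add Kfls_linear)

lemma lpair_scale_left:
  "X \<in> loop_alg \<Longrightarrow> Y \<in> loop_alg \<Longrightarrow> lpair br (fls_const c *s X) Y = c * lpair br X Y"
  by (simp add: lpair_eq loop_alg_scale Kfls_linear)

lemma lpair_minus_left: "X \<in> loop_alg \<Longrightarrow> Y \<in> loop_alg \<Longrightarrow> lpair br (- X) Y = - lpair br X Y"
  by (simp add: lpair_eq loop_alg_minus Kfls_linear)

lemma lpair_minus_right: "X \<in> loop_alg \<Longrightarrow> Y \<in> loop_alg \<Longrightarrow> lpair br X (- Y) = - lpair br X Y"
  by (simp add: lpair_eq loop_alg_minus Kfls_linear)

lemma lpair_sym: "lpair br X Y = lpair br Y X"
  by (simp add: lpair_def K_sym)

lemma represents_br: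
  assumes "represents F X" "represents G Y"
  shows "represents (\<lambda>z. br (F z) (G z)) (lbracket br X Y)"
  unfolding represents_def
proof
  fix c
  show "(\<lambda>z. br (F z) (G z) $ c) has_laurent_expansion lbracket br X Y $ c"
    unfolding br_expand[of "F _"] lbracket_def vec_lambda_beta using assms unfolding represents_def
    by (intro laurent_expansion_intros) auto
qed

lemmas loop_alg_bracket = represents_loop[OF represents_br[OF represents_leval represents_leval]]

lemma lpair_invariant:
  assumes "X \<in> loop_alg" "Y \<in> loop_alg" "Z \<in> loop_alg"
  shows "lpair br (lbracket br X Y) Z = lpair br X (lbracket br Y Z)"
  using lpair_residue[OF represents_br[OF represents_leval[OF assms(1)] represents_leval[OF assms(2)]] represents_leval[OF assms(3)]]
    lpair_residue[OF represents_leval[OF assms(1)] represents_br[OF represents_leval[OF assms(2)] represents_leval[OF assms(3)]]]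
  by (simp add: K_inv)

lemma lbracket_skew:
  assumes "X \<in> loop_alg" "Y \<in> loop_alg"
  shows "lbracket br X Y = - lbracket br Y X"
proof (rule represents_unique)
  show "represents (\<lambda>z. br (leval X z) (leval Y z)) (lbracket br X Y)"
    by (intro represents_br represents_leval assms)
  have "represents (\<lambda>z. - br (leval Y z) (leval X z)) (- lbracket br Y X)"
    by (intro represents_br represents_minus represents_leval assms)
  then show "represents (\<lambda>z. br (leval X z) (leval Y z)) (- lbracket br Y X)"
    by (subst br_skew)
qed

end

context killing_lie
begin

text \<open>Pairing with a monomial loop isolates one coefficient vector of \<open>X\<close>, to
  which nondegeneracy of \<open>K\<close> applies.\<close>

lemma lpair_nondegenerate:
  fixes X :: "'a loop"
  assumes X: "X \<in> loop_alg" and zero: "\<And>Y. Y \<in> loop_alg \<Longrightarrow> lpair br X Y = 0"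
  shows "X = 0"
proof -
  have "(\<chi> a. fls_nth (X $ a) m) = (0 :: complex ^ 'a)" for m
  proof (rule nondegenerate)
    fix y
    \<comment> \<open>The exponent \<open>- 1 - m\<close> moves the coefficient of index
      \<open>m\<close> into the residue.\<close>
    define Y :: "'a loop" where "Y = (\<chi> b. fls_const (y $ b) * fls_X_intpow (- 1 - m))"
    have "fls_conv_radius (fls_const (y $ b) * fls_X_intpow (- 1 - m)) \<ge> 1" for b
      by (intro fls_conv_radius_mult_ge) auto
    then have "Y \<in> loop_alg"
      by (auto simp: loop_alg_def Y_def intro: less_le_trans[of 0 1])
    then have "0 = fls_residue (Kfls X Y)"
      using zero lpair_eq[OF X] by metis
    also have "Kfls X Y = (\<Sum>a\<in>UNIV. \<Sum>b\<in>UNIV. fls_const (y $ b * K (axis a 1) (axis b 1)) * fls_shift (m + 1) (X $ a))"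
      unfolding Kfls_def Y_def vec_lambda_beta
    proof (intro sum.cong refl)
      fix a b
      have "X $ a * (fls_const (y $ b) * fls_X_intpow (- 1 - m)) * fls_const (K (axis a 1) (axis b 1)) =
        (fls_const (y $ b) * fls_const (K (axis a 1) (axis b 1))) * (fls_X_intpow (- 1 - m) * X $ a)"
        by (simp only: mult_ac)
      then show "X $ a * (fls_const (y $ b) * fls_X_intpow (- 1 - m)) * fls_const (K (axis a 1) (axis b 1)) =
        fls_const (y $ b * K (axis a 1) (axis b 1)) * fls_shift (m + 1) (X $ a)"
        unfolding fls_const_mult_const fls_X_intpow_times_conv_shift(1) by (simp add: add.commute)
    qed
    also have "fls_residue \<dots> = K (\<chi> a. fls_nth (X $ a) m) y"
      by (simp add: K_expand[of "vec_lambda _"] fls_nth_sum mult_ac)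
    finally show "K (\<chi> a. fls_nth (X $ a) m) y = 0" ..
  qed
  then show ?thesis
    by (simp add: vec_eq_iff fls_eq_iff)
qed

text \<open>After the identification by the Killing form the coadjoint action is a bracket; the
  order of its arguments comes from the convention that pairs \<open>\<xi>\<close> with
  \<open>[x, y]\<close>. Nondegeneracy of the residue pairing makes the description unique.\<close>

lemma adstar_eq:
  assumes "X \<in> loop_alg" "\<xi> \<in> loop_alg"
  shows "adstar br X \<xi> = lbracket br \<xi> X"
  unfolding adstar_def
proof (rule the_equality)
  show "lbracket br \<xi> X \<in> loop_alg \<and> (\<forall>Y\<in>loop_alg. lpair br (lbracket br \<xi> X) Y = lpair br \<xi> (lbracket br X Y))"
    using assms by (simp add: loop_alg_bracket lpair_invariant)
  fix \<zeta> assume \<zeta>: "\<zeta> \<in> loop_alg \<and> (\<forall>Y\<in>loop_alg. lpair br \<zeta> Y = lpair br \<xi> (lbracket br X Y))"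
  have "\<zeta> + - lbracket br \<xi> X = 0"
    using \<zeta> assms
    by (intro lpair_nondegenerate) (simp_all del: add_uminus_conv_diff add: loop_alg_add loop_alg_minus loop_alg_bracket lpair_add_left lpair_minus_left lpair_invariant)
  then show "\<zeta> = lbracket br \<xi> X" by simp
qed

end

lemma residue_sum_ball:
  assumes "d > 0" "\<And>i. i \<in> I \<Longrightarrow> f i holomorphic_on ball 0 d - {0}"
  shows "residue (\<lambda>z. \<Sum>i\<in>I. f i z) 0 = (\<Sum>i\<in>I. residue (f i) 0)"
  using assms(2)
proof (induction I rule: infinite_finite_induct)
  case (insert i I)
  then show ?case
    using assms(1) by (simp add: residue_add[of "ball 0 d"] holomorphic_on_sum)
qed (auto simp: residue_const)

section \<open>The operators attached to r, acting on Laurent series\<close>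

context r_matrix
begin

text \<open>Holomorphy on a punctured ball would still admit an essential singularity; the simple
  pole is what makes the germ of \<open>r\<close> a Laurent series.\<close>

lemma r_laurent:
  assumes "q \<in> r_domain r"
  shows "\<exists>L. (\<lambda>z. r (q, z) $ a $ b) has_laurent_expansion L"
proof -
  obtain d where d: "d > 0" "\<And>q' z. q' \<in> ball q d \<Longrightarrow> z \<in> ball 0 d - {0} \<Longrightarrow> (q', z) \<in> S"
    using r_region[OF assms, of UNIV] by (metis UNIV_I open_UNIV)
  have "(\<lambda>z. r (q, z) $ a $ b) holomorphic_on ball 0 d - {0}"
    by (rule holomorphic_on_comp_slice[OF r_holomorphic]) (use d in auto)
  then have "(\<lambda>z. if z = 0 then casimir br $ a $ b else z * r (q, z) $ a $ b) holomorphic_on ball 0 d" (is "?h holomorphic_on _")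
    by (intro removable_extension d holomorphic_intros simple_pole assms)
  then have "?h analytic_on {0}"
    using d(1) by (meson analytic_at centre_in_ball open_ball)
  then have "?h has_laurent_expansion fps_to_fls (fps_expansion ?h 0)"
    by (intro has_laurent_expansion_fps analytic_at_imp_has_fps_expansion_0)
  then have L: "(\<lambda>z. ?h z / z) has_laurent_expansion fps_to_fls (fps_expansion ?h 0) / fls_X"
    by (intro laurent_expansion_intros)
  have "eventually (\<lambda>z. ?h z / z = r (q, z) $ a $ b) (at 0)"
    by (auto simp: eventually_at_filter)
  from has_laurent_expansion_cong[OF this refl] L show ?thesis by blast
qed

lemma r_minus_represents:
  assumes "q \<in> r_domain r"
  shows "represents (\<lambda>z. c2 (q, z) \<xi>) (r_minus br r q \<xi>)"
proof -
  obtain L where L: "\<And>a b. (\<lambda>z. r (q, z) $ a $ b) has_laurent_expansion L a b"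
    using r_laurent[OF assms] by metis
  have rep: "represents (\<lambda>z. c2 (q, z) \<xi>) (\<chi> a. \<Sum>b\<in>UNIV. L a b * fls_const (K (axis b 1) \<xi>))"
    unfolding represents_def contract2_nth vec_lambda_beta by (intro allI laurent_expansion_intros L)
  have "(\<forall>\<eta>. K v \<eta> = tpair br (r (q, z)) \<eta> \<xi>) \<longleftrightarrow> v = c2 (q, z) \<xi>" for v z
    unfolding tpair_contract2 using K_eqI by auto
  then have "r_minus br r q \<xi> = (\<chi> a. \<Sum>b\<in>UNIV. L a b * fls_const (K (axis b 1) \<xi>))"
    unfolding r_minus_def by (intro represents_THE[OF rep, where F' = "\<lambda>z. c2 (q, z) \<xi>"]) auto
  then show ?thesis using rep by simp
qed

text \<open>As the residue only sees the circles \<open>\<bar>w\<bar> < \<bar>z\<bar>\<close>, \<open>Qf\<close> is the operator \<open>R - 1 / 2\<close> for \<open>z \<noteq> 0\<close>; it is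
  also meaningful at \<open>z = 0\<close>, where the residue includes the pole of \<open>r\<close>.\<close>

definition Qf :: "complex ^ 'l \<Rightarrow> 'n loop \<Rightarrow> complex \<Rightarrow> complex ^ 'n" where
  "Qf q \<alpha> z = (\<chi> b. residue (\<lambda>w. c1 (q, w - z) (leval \<alpha> w) $ b) 0)"

lemma r_unitarity:
  assumes "(q, z) \<in> S" "(q, - z) \<in> S"
  shows "r (q, - z) $ a $ b = - r (q, z) $ b $ a"
proof -
  have "r (q, z) + transpose (r (q, - z)) = 0"
    using dynamical assms by (auto simp: dynamical_r_matrix_def)
  then have "r (q, z) $ b $ a + r (q, - z) $ a $ b = 0"
    by (simp add: vec_eq_iff transpose_def)
  then show ?thesis by (simp add: eq_neg_iff_add_eq_0 add.commute)
qed

lemma K_component_laurent: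
  assumes "\<alpha> \<in> loop_alg"
  shows "(\<lambda>w. K (axis a 1) (leval \<alpha> w)) has_laurent_expansion Kfls (lconst (axis a 1)) \<alpha>"
  by (rule Kfls_laurent[OF represents_const represents_leval[OF assms]])

text \<open>Unitarity rewrites \<open>r (q, w - z)\<close> through \<open>r (q, z - w)\<close>, so
  that the residue in \<open>w\<close> is a convolution of a Laurent germ with the coefficients of
  \<open>\<alpha>\<close>.\<close>

lemma Qf_represents:
  assumes q: "q \<in> r_domain r" and \<alpha>: "\<alpha> \<in> loop_alg"
  shows "\<exists>X. represents (Qf q \<alpha>) X"
proof -
  obtain d where d: "d > 0" "\<And>q' z. q' \<in> ball q d \<Longrightarrow> z \<in> ball 0 d - {0} \<Longrightarrow> (q', z) \<in> S"
    using r_region[OF q, of UNIV] by (metis UNIV_I open_UNIV)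
  have qS: "(q, z) \<in> S" if "z \<in> ball 0 d - {0}" for z using d that by auto
  obtain d' where d': "d' > 0" "\<And>a. (\<lambda>z. leval \<alpha> z $ a) holomorphic_on ball 0 d' - {0}"
    using represents_holomorphic[OF represents_leval[OF \<alpha>]] by metis
  define k where "k a w = K (axis a 1) (leval \<alpha> w)" for a w
  have k_hol: "k a holomorphic_on ball 0 d' - {0}" for a
    unfolding k_def[abs_def] K_expand[of _ "leval \<alpha> _"] by (intro holomorphic_intros d')
  have r_hol: "(\<lambda>z. - r (q, z) $ b $ a) holomorphic_on ball 0 d - {0}" for a b
    by (intro holomorphic_intros holomorphic_on_comp_slice[OF r_holomorphic]) (use qS in auto)
  have ex: "\<exists>L. (\<lambda>z. residue (\<lambda>w. - r (q, z - w) $ b $ a * k a w) 0) has_laurent_expansion L" for a b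
  proof -
    obtain G where "(\<lambda>z. r (q, z) $ b $ a) has_laurent_expansion G"
      using r_laurent[OF q] by blast
    then have "(\<lambda>z. - r (q, z) $ b $ a) has_laurent_expansion - G"
      by (intro laurent_expansion_intros)
    from residue_convolution_laurent[OF this r_hol d(1) K_component_laurent[OF \<alpha>]]
    show ?thesis by (simp add: k_def[abs_def])
  qed
  define L where "L a b = (SOME L. (\<lambda>z. residue (\<lambda>w. - r (q, z - w) $ b $ a * k a w) 0) has_laurent_expansion L)" for a b
  have L: "(\<lambda>z. residue (\<lambda>w. - r (q, z - w) $ b $ a * k a w) 0) has_laurent_expansion L a b" for a b
    unfolding L_def by (rule someI_ex[OF ex])
  have rep: "represents (\<lambda>z. \<chi> b. \<Sum>a\<in>UNIV. residue (\<lambda>w. - r (q, z - w) $ b $ a * k a w) 0) (\<chi> b. \<Sum>a\<in>UNIV. L a b)"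
    unfolding represents_def vec_lambda_beta by (intro allI laurent_expansion_intros L)
  have ev: "eventually (\<lambda>z. (\<chi> b. \<Sum>a\<in>UNIV. residue (\<lambda>w. - r (q, z - w) $ b $ a * k a w) 0) = Qf q \<alpha> z) (at 0)"
    unfolding eventually_at
  proof (intro exI[of _ "d / 2"] conjI ballI impI)
    fix z :: complex assume z: "z \<noteq> 0 \<and> dist z 0 < d / 2"
    \<comment> \<open>Within this radius \<open>w\<close> stays away from the pole at
      \<open>z\<close> and inside the region where \<open>\<alpha>\<close> converges.\<close>
    define s where "s = min (norm z) d'"
    have s: "s > 0" using z d' by (auto simp: s_def)
    have in_ball: "w - z \<in> ball 0 d - {0}" "z - w \<in> ball 0 d - {0}" if "w \<in> ball 0 s" for w :: complex
    proof -
      have "norm (w - z) \<le> norm w + norm z" by (rule norm_triangle_ineq4)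
      then show "w - z \<in> ball 0 d - {0}" "z - w \<in> ball 0 d - {0}"
        using that z by (auto simp: s_def norm_minus_commute)
    qed
    have "Qf q \<alpha> z $ b = (\<Sum>a\<in>UNIV. residue (\<lambda>w. - r (q, z - w) $ b $ a * k a w) 0)" for b
    proof -
      have "Qf q \<alpha> z $ b = residue (\<lambda>w. \<Sum>a\<in>UNIV. - r (q, z - w) $ b $ a * k a w) 0"
        unfolding Qf_def vec_lambda_beta
      proof (rule residue_cong_ball[OF s])
        fix w :: complex assume w: "w \<in> ball 0 s - {0}"
        have "r (q, w - z) $ a $ b = - r (q, z - w) $ b $ a" for a
          using r_unitarity[OF qS[OF in_ball(2)] , of w a b] qS[OF in_ball(1), of w] w by simp
        then show "c1 (q, w - z) (leval \<alpha> w) $ b = (\<Sum>a\<in>UNIV. - r (q, z - w) $ b $ a * k a w)"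
          by (simp add: contract1_nth k_def)
      qed
      also have "\<dots> = (\<Sum>a\<in>UNIV. residue (\<lambda>w. - r (q, z - w) $ b $ a * k a w) 0)"
      proof (rule residue_sum_ball[OF s])
        fix a
        have "(\<lambda>w. r (q, z - w) $ b $ a) holomorphic_on ball 0 s - {0}"
          by (intro holomorphic_on_comp_slice[OF r_holomorphic] holomorphic_intros qS in_ball) auto
        moreover have "k a holomorphic_on ball 0 s - {0}"
          by (rule holomorphic_on_subset[OF k_hol]) (auto simp: s_def)
        ultimately show "(\<lambda>w. - r (q, z - w) $ b $ a * k a w) holomorphic_on ball 0 s - {0}"
          by (intro holomorphic_intros)
      qed
      finally show ?thesis .
    qed
    then show "(\<chi> b. \<Sum>a\<in>UNIV. residue (\<lambda>w. - r (q, z - w) $ b $ a * k a w) 0) = Qf q \<alpha> z"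
      by (simp add: vec_eq_iff)
  qed (use d in auto)
  show ?thesis
    by (rule exI, rule represents_cong[OF rep ev])
qed

definition Qloop :: "complex ^ 'l \<Rightarrow> 'n loop \<Rightarrow> 'n loop" where
  "Qloop q \<alpha> = (SOME X. represents (Qf q \<alpha>) X)"

lemma Qloop: "q \<in> r_domain r \<Longrightarrow> \<alpha> \<in> loop_alg \<Longrightarrow> represents (Qf q \<alpha>) (Qloop q \<alpha>)"
  unfolding Qloop_def by (rule someI_ex[OF Qf_represents])

text \<open>The principal value takes half of the residue of \<open>\<alpha> w / (w - z)\<close> at \<open>w = z\<close>.\<close>

lemma kernel_pole:
  fixes x :: "complex \<Rightarrow> complex ^ 'n"
  assumes q: "q \<in> r_domain r" and x: "\<And>a. isCont (\<lambda>w. x w $ a) z"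
  shows "((\<lambda>w. (w - z) * c1 (q, w - z) (x w) $ b) \<longlongrightarrow> x z $ b) (at z)"
proof -
  have "((\<lambda>u. u * r (q, u) $ a $ b) \<longlongrightarrow> casimir br $ a $ b) (at 0)" for a
    by (rule simple_pole[OF q])
  moreover have "filterlim (\<lambda>w. w - z) (at 0) (at z)"
    by (auto simp: filterlim_at eventually_at_filter intro!: tendsto_eq_intros)
  ultimately have r_lim: "((\<lambda>w. (w - z) * r (q, w - z) $ a $ b) \<longlongrightarrow> casimir br $ a $ b) (at z)" for a
    by (rule filterlim_compose)
  have "((\<lambda>w. K (axis a 1) (x w)) \<longlongrightarrow> K (axis a 1) (x z)) (at z)" for a
    using x by (intro tendsto_K vec_tendstoI) (simp add: isCont_def)
  then have "((\<lambda>w. \<Sum>a\<in>UNIV. ((w - z) * r (q, w - z) $ a $ b) * K (axis a 1) (x w)) \<longlongrightarrow>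
      (\<Sum>a\<in>UNIV. casimir br $ a $ b * K (axis a 1) (x z))) (at z)"
    by (intro tendsto_intros r_lim)
  also have "(\<Sum>a\<in>UNIV. casimir br $ a $ b * K (axis a 1) (x z)) = x z $ b"
    using contract1_nth[of "casimir br" "x z" b] by (simp add: contract1_casimir)
  finally show ?thesis
    by (simp add: contract1_nth sum_distrib_left mult.assoc)
qed

lemma kernel_holomorphic:
  assumes d: "\<And>z. z \<in> ball 0 d - {0} \<Longrightarrow> (q, z) \<in> S" and \<alpha>: "\<And>a. (\<lambda>z. leval \<alpha> z $ a) holomorphic_on ball 0 s - {0}"
    and s: "s + norm z \<le> d"
  shows "(\<lambda>w. c1 (q, w - z) (leval \<alpha> w) $ b) holomorphic_on ball 0 s - {0, z}"
proof -
  have in_S: "(q, w - z) \<in> S" if "w \<in> ball 0 s - {0, z}" for w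
  proof (rule d)
    have "norm (w - z) \<le> norm w + norm z" by (rule norm_triangle_ineq4)
    then show "w - z \<in> ball 0 d - {0}" using that s by auto
  qed
  show ?thesis
    unfolding contract1_nth K_expand[of _ "leval \<alpha> _"]
    by (intro holomorphic_intros holomorphic_on_comp_slice[OF r_holomorphic] in_S holomorphic_on_subset[OF \<alpha>]) auto
qed

lemma R_op_represents:
  assumes q: "q \<in> r_domain r" and \<alpha>: "\<alpha> \<in> loop_alg"
  shows "represents (\<lambda>z. Qf q \<alpha> z + (1 / 2) *s leval \<alpha> z) (R_op br r q \<alpha>)"
proof -
  obtain d where d: "d > 0" "\<And>q' z. q' \<in> ball q d \<Longrightarrow> z \<in> ball 0 d - {0} \<Longrightarrow> (q', z) \<in> S"
    using r_region[OF q, of UNIV] by (metis UNIV_I open_UNIV)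
  have qS: "(q, z) \<in> S" if "z \<in> ball 0 d - {0}" for z using d that by auto
  obtain d' where d': "d' > 0" "\<And>a. (\<lambda>z. leval \<alpha> z $ a) holomorphic_on ball 0 d' - {0}"
    using represents_holomorphic[OF represents_leval[OF \<alpha>]] by metis
  have rep: "represents (\<lambda>z. Qf q \<alpha> z + (1 / 2) *s leval \<alpha> z) (Qloop q \<alpha> + fls_const (1 / 2) *s \<alpha>)"
    by (intro represents_add represents_scale Qloop represents_leval q \<alpha>)
  define s where "s = min d' (d / 2)"
  have s: "s > 0" using d d' by (auto simp: s_def)
  have \<alpha>_hol: "(\<lambda>z. leval \<alpha> z $ a) holomorphic_on ball 0 s - {0}" for a
    by (rule holomorphic_on_subset[OF d'(2)]) (auto simp: s_def)
  have ev: "eventually (\<lambda>z. Qf q \<alpha> z + (1 / 2) *s leval \<alpha> z =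
      (\<chi> b. 1 / (2 * pi * \<i>) * pv_circle (\<lambda>w. contract1 br (r (q, w - z)) (leval \<alpha> w) $ b) z)) (at 0)"
    unfolding eventually_at
  proof (intro exI[of _ s] conjI ballI impI)
    fix z :: complex assume z: "z \<noteq> 0 \<and> dist z 0 < s"
    have "isCont (\<lambda>w. leval \<alpha> w $ a) z" for a
    proof -
      have "continuous_on (ball 0 s - {0}) (\<lambda>w. leval \<alpha> w $ a)"
        by (rule holomorphic_on_imp_continuous_on[OF \<alpha>_hol])
      then show ?thesis
        by (subst (asm) continuous_on_eq_continuous_at) (use z in \<open>auto intro: open_delete\<close>)
    qed
    then have "pv_circle (\<lambda>w. c1 (q, w - z) (leval \<alpha> w) $ b) z = 2 * pi * \<i> * (Qf q \<alpha> z $ b + leval \<alpha> z $ b / 2)" for b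
      unfolding Qf_def vec_lambda_beta
      by (intro pv_circle_eq[of _ s] kernel_holomorphic[OF qS \<alpha>_hol] kernel_pole q) (use z in \<open>auto simp: s_def\<close>)
    then show "Qf q \<alpha> z + (1 / 2) *s leval \<alpha> z =
        (\<chi> b. 1 / (2 * pi * \<i>) * pv_circle (\<lambda>w. contract1 br (r (q, w - z)) (leval \<alpha> w) $ b) z)"
      by (simp add: vec_eq_iff)
  qed (use s in auto)
  have "R_op br r q \<alpha> = Qloop q \<alpha> + fls_const (1 / 2) *s \<alpha>"
    unfolding R_op_def by (rule represents_THE[OF rep _ ev]) simp
  then show ?thesis using rep by simp
qed

end

section \<open>Iterated circle integrals\<close>

definition cint2 :: "real \<Rightarrow> real \<Rightarrow> (complex \<Rightarrow> complex \<Rightarrow> complex) \<Rightarrow> complex" where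
  "cint2 \<rho> \<sigma> F = cint \<sigma> (\<lambda>z. cint \<rho> (\<lambda>w. F w z))"

abbreviation cont2 :: "real \<Rightarrow> real \<Rightarrow> (complex \<Rightarrow> complex \<Rightarrow> complex) \<Rightarrow> bool" where
  "cont2 \<rho> \<sigma> F \<equiv> continuous_on (sphere 0 \<rho> \<times> sphere 0 \<sigma>) (\<lambda>p. F (fst p) (snd p))"

lemma cont2_slice:
  assumes "cont2 \<rho> \<sigma> F" "z \<in> sphere 0 \<sigma>"
  shows "continuous_on (sphere 0 \<rho>) (\<lambda>w. F w z)"
  by (rule continuous_on_compose2[OF assms(1), of _ "\<lambda>w. (w, z)", simplified fst_conv snd_conv])
    (use assms(2) in \<open>auto intro!: continuous_intros\<close>)

lemma cont2_cint:
  assumes "cont2 \<rho> \<sigma> F" "0 \<le> \<rho>"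
  shows "continuous_on (sphere 0 \<sigma>) (\<lambda>z. cint \<rho> (\<lambda>w. F w z))"
proof (rule cint_continuous[OF assms(2)])
  show "continuous_on (sphere 0 \<sigma> \<times> sphere 0 \<rho>) (\<lambda>(z, w). F w z)"
    unfolding split_beta
    by (rule continuous_on_compose2[OF assms(1), of _ "\<lambda>p. (snd p, fst p)", simplified fst_conv snd_conv])
      (auto intro!: continuous_intros)
qed

lemma cint2_cong:
  "0 \<le> \<rho> \<Longrightarrow> 0 \<le> \<sigma> \<Longrightarrow> (\<And>w z. w \<in> sphere 0 \<rho> \<Longrightarrow> z \<in> sphere 0 \<sigma> \<Longrightarrow> F w z = G w z) \<Longrightarrow> cint2 \<rho> \<sigma> F = cint2 \<rho> \<sigma> G"
  unfolding cint2_def by (intro cint_cong; blast)+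

lemma cint2_add:
  assumes "0 \<le> \<rho>" "0 \<le> \<sigma>" "cont2 \<rho> \<sigma> F" "cont2 \<rho> \<sigma> G"
  shows "cint2 \<rho> \<sigma> (\<lambda>w z. F w z + G w z) = cint2 \<rho> \<sigma> F + cint2 \<rho> \<sigma> G"
proof -
  have "cint2 \<rho> \<sigma> (\<lambda>w z. F w z + G w z) = cint \<sigma> (\<lambda>z. cint \<rho> (\<lambda>w. F w z) + cint \<rho> (\<lambda>w. G w z))"
    unfolding cint2_def
    by (intro cint_cong[OF assms(2)] cint_add[OF assms(1)] cont2_slice[OF assms(3)] cont2_slice[OF assms(4)])
  then show ?thesis
    unfolding cint2_def using cint_add[OF assms(2) cont2_cint[OF assms(3,1)] cont2_cint[OF assms(4,1)]] by simp
qed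

lemma cint2_mult_left: "cint2 \<rho> \<sigma> (\<lambda>w z. c * F w z) = c * cint2 \<rho> \<sigma> F"
  by (simp add: cint2_def cint_mult_left)

lemma cint2_product: "cint2 \<rho> \<sigma> (\<lambda>w z. f w * g z) = cint \<rho> f * cint \<sigma> g"
  by (simp add: cint2_def cint_mult_left cint_mult_right)

lemma cint2_sum:
  assumes "0 \<le> \<rho>" "0 \<le> \<sigma>" "\<And>i. i \<in> I \<Longrightarrow> cont2 \<rho> \<sigma> (F i)"
  shows "cint2 \<rho> \<sigma> (\<lambda>w z. \<Sum>i\<in>I. F i w z) = (\<Sum>i\<in>I. cint2 \<rho> \<sigma> (F i))"
  using assms(3)
proof (induction I rule: infinite_finite_induct)
  case (insert i I)
  then show ?case
    using cint2_add[OF assms(1,2), of "F i" "\<lambda>w z. \<Sum>i\<in>I. F i w z"] by (simp add: continuous_on_sum)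
qed (simp_all add: cint2_def)

lemma pderiv_at_cong:
  assumes "open V" "q \<in> V" "\<And>q. q \<in> V \<Longrightarrow> f q = g q"
  shows "pderiv_at i f q = pderiv_at i g q"
  unfolding pderiv_at_def
proof (rule deriv_cong_ev)
  have "open ((\<lambda>t. q + axis i t) -` V)"
    by (intro open_vimage assms continuous_intros linear_continuous_on bounded_linear_axis)
  then have "eventually (\<lambda>t. t \<in> (\<lambda>t. q + axis i t) -` V) (nhds 0)"
    by (rule eventually_nhds_in_open) (use assms in \<open>simp add: axis_eq_0_iff[THEN iffD2]\<close>)
  then show "eventually (\<lambda>t. f (q + axis i t) = g (q + axis i t)) (nhds 0)"
    by eventually_elim (use assms(3) in auto)
qed auto

lemma fder_eqI: "(f has_derivative f') (at x) \<Longrightarrow> fder f x v = f' v"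
  using frechet_derivative_at by metis

lemma pderiv_at_linear:
  assumes "holomorphic_wrt (*s) f V" "holomorphic_wrt (*s) g V" "q \<in> V"
  shows "pderiv_at i (\<lambda>q. f q + g q) q = pderiv_at i f q + pderiv_at i g q"
    "pderiv_at i (\<lambda>q. f q * c) q = pderiv_at i f q * c"
proof -
  note d = holomorphic_wrtD(1)[OF assms(1,3)] holomorphic_wrtD(1)[OF assms(2,3)]
  show "pderiv_at i (\<lambda>q. f q + g q) q = pderiv_at i f q + pderiv_at i g q"
    by (simp add: pderiv_at_eq[OF assms(1,3)] pderiv_at_eq[OF assms(2,3)]
        pderiv_at_eq[OF holomorphic_wrt_add[OF assms(1,2)] assms(3)] fder_eqI[OF has_derivative_add[OF d]])
  show "pderiv_at i (\<lambda>q. f q * c) q = pderiv_at i f q * c"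
    by (simp add: pderiv_at_eq[OF assms(1,3)]
        pderiv_at_eq[OF holomorphic_wrt_mult[OF assms(1) holomorphic_wrt_const] assms(3)] fder_eqI[OF has_derivative_mult_left[OF d(1)]])
qed

lemma pderiv_at_sum:
  assumes "\<And>k. k \<in> A \<Longrightarrow> holomorphic_wrt (*s) (f k) V" "q \<in> V"
  shows "pderiv_at i (\<lambda>q. \<Sum>k\<in>A. f k q) q = (\<Sum>k\<in>A. pderiv_at i (f k) q)"
  using assms(1)
proof (induction A rule: infinite_finite_induct)
  case (insert k A)
  then show ?case
    using pderiv_at_linear(1)[of "f k" V "\<lambda>q. \<Sum>k\<in>A. f k q" q] assms(2) by (simp add: holomorphic_wrt_sum)
qed (simp_all add: pderiv_at_def)

context lie
begin

lemma continuous_on_K: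
  fixes F G :: "'b::topological_space \<Rightarrow> complex ^ 'n"
  assumes "continuous_on A F" "continuous_on A G"
  shows "continuous_on A (\<lambda>x. K (F x) (G x))"
  unfolding K_expand[of "F _"] continuous_on_def
  using assms unfolding continuous_on_def by (auto intro!: tendsto_intros)

lemma continuous_on_br:
  fixes F G :: "'b::topological_space \<Rightarrow> complex ^ 'n"
  assumes "continuous_on A F" "continuous_on A G"
  shows "continuous_on A (\<lambda>x. br (F x) (G x))"
  unfolding continuous_on_def
proof (intro ballI vec_tendstoI)
  fix x c assume "x \<in> A"
  then show "((\<lambda>x. br (F x) (G x) $ c) \<longlongrightarrow> br (F x) (G x) $ c) (at x within A)"
    unfolding br_expand[of "F _"] using assms unfolding continuous_on_def by (auto intro!: tendsto_intros)
qed

lemma cint_K_left: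
  fixes F :: "complex \<Rightarrow> complex ^ 'n"
  assumes "0 \<le> \<rho>" "\<And>b. continuous_on (sphere 0 \<rho>) (\<lambda>w. F w $ b)"
  shows "cint \<rho> (\<lambda>w. K (F w) y) = K (\<chi> b. cint \<rho> (\<lambda>w. F w $ b)) y"
proof -
  have "cint \<rho> (\<lambda>w. K (F w) y) = cint \<rho> (\<lambda>w. \<Sum>b\<in>UNIV. F w $ b * K (axis b 1) y)"
    by (subst K_expand_left) (rule refl)
  also have "\<dots> = (\<Sum>b\<in>UNIV. cint \<rho> (\<lambda>w. F w $ b) * K (axis b 1) y)"
    using assms by (simp add: cint_sum cint_mult_right continuous_on_mult_right)
  also have "\<dots> = K (\<chi> b. cint \<rho> (\<lambda>w. F w $ b)) y"
    by (subst K_expand_left) simp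
  finally show ?thesis .
qed

lemma holomorphic_on_K:
  fixes F G :: "complex \<Rightarrow> complex ^ 'n"
  assumes "\<And>a. (\<lambda>z. F z $ a) holomorphic_on A" "\<And>a. (\<lambda>z. G z $ a) holomorphic_on A"
  shows "(\<lambda>z. K (F z) (G z)) holomorphic_on A"
  unfolding K_expand[of "F _"] by (intro holomorphic_intros assms)

lemma continuous_on_vecI:
  fixes F :: "complex \<Rightarrow> complex ^ 'n"
  assumes "\<And>a. (\<lambda>z. F z $ a) holomorphic_on A"
  shows "continuous_on A F"
  using holomorphic_on_imp_continuous_on[OF assms] unfolding continuous_on_def by (auto intro!: vec_tendstoI)

end

section \<open>Contour integrals of the kernel r(q, w - z)\<close>

context r_matrix
begin

lemma continuous_on_c:
  fixes F :: "'b::topological_space \<Rightarrow> complex ^ 'n"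
  assumes "continuous_on A g" "\<And>x. x \<in> A \<Longrightarrow> (q, g x) \<in> S" "continuous_on A F"
  shows "continuous_on A (\<lambda>x. c1 (q, g x) (F x))" "continuous_on A (\<lambda>x. c2 (q, g x) (F x))"
proof -
  have rc: "continuous_on A (\<lambda>x. r (q, g x) $ a $ b)" for a b
    by (intro continuous_on_compose2[OF holomorphic_wrt_continuous[OF r_holomorphic]] continuous_intros assms(1))
      (use assms(2) in auto)
  have kc: "continuous_on A (\<lambda>x. K (axis a 1) (F x))" for a
    by (intro continuous_on_K assms continuous_intros)
  have "continuous_on A (\<lambda>x. c1 (q, g x) (F x) $ b)" "continuous_on A (\<lambda>x. c2 (q, g x) (F x) $ b)" for b
    unfolding contract1_nth contract2_nth by (intro continuous_intros rc kc)+
  then show "continuous_on A (\<lambda>x. c1 (q, g x) (F x))" "continuous_on A (\<lambda>x. c2 (q, g x) (F x))"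
    unfolding continuous_on_def by (auto intro!: vec_tendstoI)
qed

lemma continuous_on_tr:
  fixes F G :: "'b::topological_space \<Rightarrow> complex ^ 'n"
  assumes "continuous_on A g" "\<And>x. x \<in> A \<Longrightarrow> (q, g x) \<in> S" "continuous_on A F" "continuous_on A G"
  shows "continuous_on A (\<lambda>x. tr (F x) (G x) (q, g x))"
  unfolding tr_K(1) by (intro continuous_on_K continuous_on_c assms)

lemma continuous_on_dtr:
  fixes F G :: "'b::topological_space \<Rightarrow> complex ^ 'n"
  assumes "continuous_on A g" "\<And>x. x \<in> A \<Longrightarrow> (q, g x) \<in> S" "continuous_on A F" "continuous_on A G"
  shows "continuous_on A (\<lambda>x. dtr i (F x) (G x) (q, g x))"
proof -
  have "continuous_on A (\<lambda>x. fder (\<lambda>p. r p $ a $ b) (q, g x) v)" for a b v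
    by (intro continuous_on_compose2[OF continuous_on_fder[OF r_holomorphic open_regular]] continuous_intros assms(1))
      (use assms(2) in auto)
  then have "continuous_on A (\<lambda>x. \<Sum>a\<in>UNIV. \<Sum>b\<in>UNIV. fder (\<lambda>p. r p $ a $ b) (q, g x) (axis i 1, 0) *
      (K (axis a 1) (F x) * K (axis b 1) (G x)))"
    by (intro continuous_intros continuous_on_K assms)
  then show ?thesis
    by (rule continuous_on_eq) (simp add: fder_tr[OF assms(2)])
qed

lemma dtr_unitarity:
  assumes "(q, z) \<in> S" "(q, - z) \<in> S"
  shows "dtr i x y (q, - z) = - dtr i y x (q, z)"
proof -
  let ?V = "(\<lambda>q. (q, z)) -` S \<inter> (\<lambda>q. (q, - z)) -` S"
  have V: "open ?V" "q \<in> ?V"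
    using assms by (auto intro!: open_Int open_vimage open_regular continuous_intros)
  have hol: "holomorphic_wrt (*s) (\<lambda>q. tr y x (q, z)) ?V"
    by (rule holomorphic_wrt_slice[OF tr_holomorphic]) auto
  have "dtr i x y (q, - z) = pderiv_at i (\<lambda>q. tr x y (q, - z)) q"
    by (rule pderiv_at_slice[OF tr_holomorphic assms(2), symmetric])
  also have "\<dots> = pderiv_at i (\<lambda>q. tr y x (q, z) * (- 1)) q"
    by (rule pderiv_at_cong[OF V]) (simp add: unitarity)
  also have "\<dots> = - dtr i y x (q, z)"
    using pderiv_at_linear(2)[OF hol hol V(2), of i "- 1"] pderiv_at_slice[OF tr_holomorphic assms(1), of i y x] by simp
  finally show ?thesis .
qed

text \<open>\<open>rs a b (q, z)\<close> is the coefficient of \<open>r (q, - z)\<close>, so that \<open>r (q, w - z)\<close> arises by translating the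
  argument of \<open>rs\<close> by \<open>- w\<close>.\<close>

definition rs :: "'n \<Rightarrow> 'n \<Rightarrow> (complex ^ 'l) \<times> complex \<Rightarrow> complex" where
  "rs a b p = r (fst p, - snd p) $ a $ b"

abbreviation "S' \<equiv> {p. (fst p, - snd p) \<in> S}"

lemma open_S': "open S'"
proof -
  have "S' = (\<lambda>p. (fst p, - snd p)) -` S" by auto
  then show ?thesis by (auto intro!: open_vimage open_regular continuous_intros)
qed

lemma bounded_linear_reflect: "bounded_linear (\<lambda>p :: (complex ^ 'l) \<times> complex. (fst p, - snd p))"
  by (intro bounded_linear_Pair bounded_linear_fst bounded_linear_minus bounded_linear_snd)

lemma rs_holomorphic: "holomorphic_wrt scale2 (rs a b) S'"
  unfolding rs_def[abs_def]
  using holomorphic_wrt_compose_affine[OF r_holomorphic bounded_linear_reflect, of scale2 S' 0 a b]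
  by (simp add: scale2_def split_beta)

lemma fder_rs: "p \<in> S' \<Longrightarrow> fder (rs a b) p (v, 0) = fder (\<lambda>p. r p $ a $ b) (fst p, - snd p) (v, 0)"
  unfolding rs_def[abs_def]
  using fder_compose_affine[OF r_holomorphic bounded_linear_reflect, of p 0 a b "(v, 0)"] by simp

lemma translation_continuous: "continuous_on A (\<lambda>w :: complex. (0 :: complex ^ 'l, - w))"
  by (rule linear_continuous_on) (intro bounded_linear_Pair bounded_linear_zero bounded_linear_minus bounded_linear_ident)

text \<open>One coefficient of the kernel integrated against a weight, as a function of
  \<open>q\<close> and \<open>z\<close> jointly. Derivatives in \<open>q\<close> and holomorphy in
  \<open>z\<close> then come from the same statement.\<close>

definition kern :: "real \<Rightarrow> (complex \<Rightarrow> complex ^ 'n) \<Rightarrow> 'n \<Rightarrow> 'n \<Rightarrow> (complex ^ 'l) \<times> complex \<Rightarrow> complex" where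
  "kern \<rho> \<alpha> a b p = cint \<rho> (\<lambda>w. rs a b (p + (0, - w)) * K (axis a 1) (\<alpha> w))"

abbreviation "Tk \<rho> \<equiv> {p. \<forall>w\<in>sphere 0 \<rho>. p + (0, - w) \<in> S'}"

lemma open_Tk: "open (Tk \<rho>)"
  by (rule open_translate_sphere[OF open_S'])
    (rule translation_continuous)

context
  fixes \<rho> :: real and \<alpha> :: "complex \<Rightarrow> complex ^ 'n"
  assumes \<rho>: "0 \<le> \<rho>" and \<alpha>: "continuous_on (sphere 0 \<rho>) \<alpha>"
begin

lemma weight_continuous: "continuous_on (sphere 0 \<rho>) (\<lambda>w. K (axis a 1) (\<alpha> w))"
  by (intro continuous_on_K \<alpha> continuous_intros)

lemma kern_holomorphic: "holomorphic_wrt scale2 (kern \<rho> \<alpha> a b) (Tk \<rho>)"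
  unfolding kern_def[abs_def]
  by (rule holomorphic_wrt_cint[OF rs_holomorphic open_S' open_Tk \<rho> translation_continuous weight_continuous]) blast

lemma fder_kern:
  assumes "(q, z) \<in> Tk \<rho>"
  shows "fder (kern \<rho> \<alpha> a b) (q, z) (v, 0) = cint \<rho> (\<lambda>w. fder (\<lambda>p. r p $ a $ b) (q, w - z) (v, 0) * K (axis a 1) (\<alpha> w))"
proof -
  have in_S': "\<And>x w. x \<in> Tk \<rho> \<Longrightarrow> w \<in> sphere 0 \<rho> \<Longrightarrow> x + (0, - w) \<in> S'" by blast
  have "fder (kern \<rho> \<alpha> a b) (q, z) (v, 0) = cint \<rho> (\<lambda>w. fder (rs a b) ((q, z) + (0, - w)) (v, 0) * K (axis a 1) (\<alpha> w))"
    unfolding kern_def[abs_def]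
    by (rule fder_eqI[OF cint_has_derivative[OF rs_holomorphic open_S' open_Tk assms \<rho> translation_continuous weight_continuous in_S']])
  also have "\<dots> = cint \<rho> (\<lambda>w. fder (\<lambda>p. r p $ a $ b) (q, w - z) (v, 0) * K (axis a 1) (\<alpha> w))"
  proof (rule cint_cong[OF \<rho>])
    fix w :: complex assume "w \<in> sphere 0 \<rho>"
    then have "(q, z) + (0, - w) \<in> S'" using assms by blast
    from fder_rs[OF this] show "fder (rs a b) ((q, z) + (0, - w)) (v, 0) * K (axis a 1) (\<alpha> w) =
        fder (\<lambda>p. r p $ a $ b) (q, w - z) (v, 0) * K (axis a 1) (\<alpha> w)" by simp
  qed
  finally show ?thesis .
qed

lemma kern_eq: "kern \<rho> \<alpha> a b (q, z) = cint \<rho> (\<lambda>w. r (q, w - z) $ a $ b * K (axis a 1) (\<alpha> w))"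
  by (simp add: kern_def rs_def)

lemma cint_tr_kern:
  assumes "\<And>w. w \<in> sphere 0 \<rho> \<Longrightarrow> (q, w - z) \<in> S"
  shows "cint \<rho> (\<lambda>w. tr (\<alpha> w) y (q, w - z)) = (\<Sum>a\<in>UNIV. \<Sum>b\<in>UNIV. kern \<rho> \<alpha> a b (q, z) * K (axis b 1) y)"
    "cint \<rho> (\<lambda>w. c1 (q, w - z) (\<alpha> w) $ b) = (\<Sum>a\<in>UNIV. kern \<rho> \<alpha> a b (q, z))"
    "cint \<rho> (\<lambda>w. dtr i (\<alpha> w) y (q, w - z)) = (\<Sum>a\<in>UNIV. \<Sum>b\<in>UNIV. fder (kern \<rho> \<alpha> a b) (q, z) (axis i 1, 0) * K (axis b 1) y)"
proof -
  have rc: "continuous_on (sphere 0 \<rho>) (\<lambda>w. r (q, w - z) $ a $ b * K (axis a 1) (\<alpha> w))" for a b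
    by (intro continuous_intros weight_continuous continuous_on_compose2[OF holomorphic_wrt_continuous[OF r_holomorphic]])
      (use assms in auto)
  have fc: "continuous_on (sphere 0 \<rho>) (\<lambda>w. fder (\<lambda>p. r p $ a $ b) (q, w - z) v * K (axis a 1) (\<alpha> w))" for a b v
    by (intro continuous_intros weight_continuous continuous_on_compose2[OF continuous_on_fder[OF r_holomorphic open_regular]])
      (use assms in auto)
  have T: "(q, z) \<in> Tk \<rho>" using assms by simp
  have "cint \<rho> (\<lambda>w. tr (\<alpha> w) y (q, w - z)) = cint \<rho> (\<lambda>w. \<Sum>a\<in>UNIV. \<Sum>b\<in>UNIV. (r (q, w - z) $ a $ b * K (axis a 1) (\<alpha> w)) * K (axis b 1) y)"
    by (simp add: tr_eq mult.assoc)
  also have "\<dots> = (\<Sum>a\<in>UNIV. \<Sum>b\<in>UNIV. kern \<rho> \<alpha> a b (q, z) * K (axis b 1) y)"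
    by (simp add: cint_sum[OF \<rho>] continuous_on_sum continuous_on_mult_right rc cint_mult_right kern_eq)
  finally show "cint \<rho> (\<lambda>w. tr (\<alpha> w) y (q, w - z)) = (\<Sum>a\<in>UNIV. \<Sum>b\<in>UNIV. kern \<rho> \<alpha> a b (q, z) * K (axis b 1) y)" .
  show "cint \<rho> (\<lambda>w. c1 (q, w - z) (\<alpha> w) $ b) = (\<Sum>a\<in>UNIV. kern \<rho> \<alpha> a b (q, z))"
    unfolding contract1_nth by (subst cint_sum[OF \<rho> rc]) (simp add: kern_eq)
  have "cint \<rho> (\<lambda>w. dtr i (\<alpha> w) y (q, w - z)) =
      cint \<rho> (\<lambda>w. \<Sum>a\<in>UNIV. \<Sum>b\<in>UNIV. (fder (\<lambda>p. r p $ a $ b) (q, w - z) (axis i 1, 0) * K (axis a 1) (\<alpha> w)) * K (axis b 1) y)"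
    by (rule cint_cong[OF \<rho>]) (simp add: fder_tr[OF assms] mult.assoc)
  also have "\<dots> = (\<Sum>a\<in>UNIV. \<Sum>b\<in>UNIV. fder (kern \<rho> \<alpha> a b) (q, z) (axis i 1, 0) * K (axis b 1) y)"
    by (simp add: cint_sum[OF \<rho>] continuous_on_sum continuous_on_mult_right fc cint_mult_right fder_kern[OF T])
  finally show "cint \<rho> (\<lambda>w. dtr i (\<alpha> w) y (q, w - z)) =
      (\<Sum>a\<in>UNIV. \<Sum>b\<in>UNIV. fder (kern \<rho> \<alpha> a b) (q, z) (axis i 1, 0) * K (axis b 1) y)" .
qed

text \<open>The specialisation of \<open>kern\<close> to \<open>z = 0\<close>, which is the part of
  the kernel paired with the third leg.\<close>

lemma pderiv_cint_tr:
  assumes V: "open V" "q \<in> V" "\<And>q w. q \<in> V \<Longrightarrow> w \<in> sphere 0 \<rho> \<Longrightarrow> (q, w) \<in> S"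
  shows "pderiv_at i (\<lambda>q. cint \<rho> (\<lambda>w. tr (\<alpha> w) y (q, w))) q = cint \<rho> (\<lambda>w. dtr i (\<alpha> w) y (q, w))"
    "holomorphic_wrt (*s) (\<lambda>q. cint \<rho> (\<lambda>w. c1 (q, w) (\<alpha> w) $ b)) V"
proof -
  have hol: "holomorphic_wrt (*s) (\<lambda>q. kern \<rho> \<alpha> a b (q, 0)) V" for a b
    by (rule holomorphic_wrt_slice[OF kern_holomorphic]) (use V in auto)
  have hol': "holomorphic_wrt (*s) (\<lambda>q. kern \<rho> \<alpha> a b (q, 0) * c) V" for a b c
    by (intro holomorphic_wrt_mult holomorphic_wrt_const hol)
  have T: "(q, 0) \<in> Tk \<rho>" using V by auto
  have "pderiv_at i (\<lambda>q. cint \<rho> (\<lambda>w. tr (\<alpha> w) y (q, w))) q =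
      pderiv_at i (\<lambda>q. \<Sum>a\<in>UNIV. \<Sum>b\<in>UNIV. kern \<rho> \<alpha> a b (q, 0) * K (axis b 1) y) q"
    by (rule pderiv_at_cong[OF V(1,2)]) (use cint_tr_kern(1)[of _ 0] V(3) in simp)
  also have "\<dots> = (\<Sum>a\<in>UNIV. \<Sum>b\<in>UNIV. fder (kern \<rho> \<alpha> a b) (q, 0) (axis i 1, 0) * K (axis b 1) y)"
    by (simp add: pderiv_at_sum[OF _ V(2)] holomorphic_wrt_sum hol' pderiv_at_linear(2)[OF hol hol V(2)]
        pderiv_at_slice[OF kern_holomorphic T])
  also have "\<dots> = cint \<rho> (\<lambda>w. dtr i (\<alpha> w) y (q, w))"
    using cint_tr_kern(3)[of q 0] V by simp
  finally show "pderiv_at i (\<lambda>q. cint \<rho> (\<lambda>w. tr (\<alpha> w) y (q, w))) q = cint \<rho> (\<lambda>w. dtr i (\<alpha> w) y (q, w))" .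
  have "holomorphic_wrt (*s) (\<lambda>q. \<Sum>a\<in>UNIV. kern \<rho> \<alpha> a b (q, 0)) V"
    by (intro holomorphic_wrt_sum hol)
  moreover have "cint \<rho> (\<lambda>w. c1 (q, w) (\<alpha> w) $ b) = (\<Sum>a\<in>UNIV. kern \<rho> \<alpha> a b (q, 0))" if "q \<in> V" for q
    using cint_tr_kern(2)[of q 0] V(3)[OF that] by simp
  ultimately show "holomorphic_wrt (*s) (\<lambda>q. cint \<rho> (\<lambda>w. c1 (q, w) (\<alpha> w) $ b)) V"
    using V(1) by (elim holomorphic_wrt_cong) auto
qed

text \<open>Coordinates separate the weights in \<open>w\<close> from those in \<open>z\<close>. The
  inner integral is then jointly holomorphic, and the outer one can be differentiated by the same
  rule.\<close>

lemma pderiv_cint2_tr: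
  assumes V: "open V" "q \<in> V" "\<And>q w z. q \<in> V \<Longrightarrow> w \<in> sphere 0 \<rho> \<Longrightarrow> z \<in> sphere 0 \<sigma> \<Longrightarrow> (q, w - z) \<in> S"
    and \<sigma>: "0 \<le> \<sigma>" and \<eta>: "continuous_on (sphere 0 \<sigma>) \<eta>"
  shows "pderiv_at i (\<lambda>q. cint2 \<rho> \<sigma> (\<lambda>w z. tr (\<alpha> w) (\<eta> z) (q, w - z))) q =
    cint2 \<rho> \<sigma> (\<lambda>w z. dtr i (\<alpha> w) (\<eta> z) (q, w - z))"
proof -
  have wc: "continuous_on (sphere 0 \<sigma>) (\<lambda>z. K (axis b 1) (\<eta> z))" for b
    by (intro continuous_on_K \<eta> continuous_intros)
  have T: "(q, z) \<in> Tk \<rho>" if "q \<in> V" "z \<in> sphere 0 \<sigma>" for q z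
    using V(3)[OF that(1) _ that(2)] by auto
  have zc: "continuous_on (sphere 0 \<sigma>) (\<lambda>z. z)" by (intro continuous_intros)
  have kc: "continuous_on (sphere 0 \<sigma>) (\<lambda>z. kern \<rho> \<alpha> a b (q, z) * K (axis b 1) (\<eta> z))" if "q \<in> V" for a b q
    by (intro continuous_intros wc continuous_on_compose2[OF holomorphic_wrt_continuous[OF kern_holomorphic]])
      (use T[OF that] in auto)
  have fc: "continuous_on (sphere 0 \<sigma>) (\<lambda>z. fder (kern \<rho> \<alpha> a b) (q, z) v * K (axis b 1) (\<eta> z))" for a b v
    by (intro continuous_intros wc continuous_on_compose2[OF continuous_on_fder[OF kern_holomorphic open_Tk]])
      (use T[OF V(2)] in auto)
  let ?G = "\<lambda>a b q. cint \<sigma> (\<lambda>z. kern \<rho> \<alpha> a b (q, z) * K (axis b 1) (\<eta> z))"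
  have G: "cint2 \<rho> \<sigma> (\<lambda>w z. tr (\<alpha> w) (\<eta> z) (q, w - z)) = (\<Sum>a\<in>UNIV. \<Sum>b\<in>UNIV. ?G a b q)" if "q \<in> V" for q
  proof -
    have "cint2 \<rho> \<sigma> (\<lambda>w z. tr (\<alpha> w) (\<eta> z) (q, w - z)) =
        cint \<sigma> (\<lambda>z. \<Sum>a\<in>UNIV. \<Sum>b\<in>UNIV. kern \<rho> \<alpha> a b (q, z) * K (axis b 1) (\<eta> z))"
      unfolding cint2_def by (rule cint_cong[OF \<sigma>], rule cint_tr_kern(1)) (use V(3)[OF that] in auto)
    also have "\<dots> = (\<Sum>a\<in>UNIV. \<Sum>b\<in>UNIV. ?G a b q)"
      by (simp add: cint_sum[OF \<sigma>] continuous_on_sum kc[OF that])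
    finally show ?thesis .
  qed
  have hol: "holomorphic_wrt (*s) (?G a b) V" for a b
    by (rule holomorphic_wrt_cint_slice[OF kern_holomorphic open_Tk \<sigma> zc wc T])
  have "pderiv_at i (\<lambda>q. cint2 \<rho> \<sigma> (\<lambda>w z. tr (\<alpha> w) (\<eta> z) (q, w - z))) q = pderiv_at i (\<lambda>q. \<Sum>a\<in>UNIV. \<Sum>b\<in>UNIV. ?G a b q) q"
    by (rule pderiv_at_cong[OF V(1,2) G])
  also have "\<dots> = (\<Sum>a\<in>UNIV. \<Sum>b\<in>UNIV. pderiv_at i (?G a b) q)"
    by (simp add: pderiv_at_sum[OF _ V(2)] holomorphic_wrt_sum hol)
  also have "\<dots> = (\<Sum>a\<in>UNIV. \<Sum>b\<in>UNIV. cint \<sigma> (\<lambda>z. fder (kern \<rho> \<alpha> a b) (q, z) (axis i 1, 0) * K (axis b 1) (\<eta> z)))"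
    by (intro sum.cong refl pderiv_at_cint_slice[OF kern_holomorphic open_Tk \<sigma> zc wc T[OF V(2)]])
  also have "\<dots> = cint \<sigma> (\<lambda>z. \<Sum>a\<in>UNIV. \<Sum>b\<in>UNIV. fder (kern \<rho> \<alpha> a b) (q, z) (axis i 1, 0) * K (axis b 1) (\<eta> z))"
    by (simp add: cint_sum[OF \<sigma>] continuous_on_sum fc)
  also have "\<dots> = cint2 \<rho> \<sigma> (\<lambda>w z. dtr i (\<alpha> w) (\<eta> z) (q, w - z))"
    unfolding cint2_def by (rule cint_cong[OF \<sigma>], rule cint_tr_kern(3)[symmetric]) (use V(3)[OF V(2)] in auto)
  finally show ?thesis .
qed

end

text \<open>For \<open>z\<close> off 0 the circle must not reach the pole at \<open>w = z\<close>;
  for \<open>z = 0\<close> both singularities sit at the centre and any circle in the region will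
  do.\<close>

lemma Qf_cint:
  assumes d: "\<And>z. z \<in> ball 0 d - {0} \<Longrightarrow> (q, z) \<in> S" and \<alpha>: "\<And>a. (\<lambda>z. leval \<alpha> z $ a) holomorphic_on ball 0 D - {0}"
    and z: "2 * D \<le> d" "norm z < D" and \<rho>: "0 < \<rho>" "\<rho> < norm z \<or> z = 0 \<and> \<rho> < D"
  shows "Qf q \<alpha> z $ b = cint \<rho> (\<lambda>w. c1 (q, w - z) (leval \<alpha> w) $ b)"
proof -
  have hol: "(\<lambda>w. c1 (q, w - z) (leval \<alpha> w) $ b) holomorphic_on ball 0 D - {0, z}"
    by (rule kernel_holomorphic[OF d \<alpha>]) (use z in auto)
  define D' where "D' = (if z = 0 then D else norm z)"
  have "(\<lambda>w. c1 (q, w - z) (leval \<alpha> w) $ b) holomorphic_on ball 0 D' - {0}"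
    by (rule holomorphic_on_subset[OF hol]) (use z in \<open>auto simp: D'_def\<close>)
  moreover have "\<rho> < D'" using \<rho> by (auto simp: D'_def)
  ultimately show ?thesis
    using cint_residue[OF _ \<rho>(1)] by (simp add: Qf_def)
qed

text \<open>Near \<open>z0\<close> the circle of half the radius of \<open>z0\<close> is a contour
  valid for all \<open>z\<close> at once, and the integral over a fixed contour is holomorphic in
  \<open>z\<close>.\<close>

lemma Qf_holomorphic:
  assumes d: "\<And>z. z \<in> ball 0 d - {0} \<Longrightarrow> (q, z) \<in> S" and \<alpha>: "\<And>a. (\<lambda>z. leval \<alpha> z $ a) holomorphic_on ball 0 D - {0}"
    and D: "2 * D \<le> d"
  shows "(\<lambda>z. Qf q \<alpha> z $ b) holomorphic_on ball 0 D - {0}"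
proof -
  have "(\<lambda>z. Qf q \<alpha> z $ b) field_differentiable at z0" if z0: "z0 \<in> ball 0 D - {0}" for z0
  proof -
    define \<rho> where "\<rho> = norm z0 / 2"
    have "0 < norm z0" "norm z0 < D" using z0 by auto
    then have "norm z0 / 2 < D" by linarith
    with \<open>0 < norm z0\<close> have \<rho>: "0 < \<rho>" "\<rho> < norm z0" "\<rho> < D" by (auto simp: \<rho>_def)
    let ?A = "ball 0 D - cball (0 :: complex) \<rho>"
    have cont: "continuous_on (sphere 0 \<rho>) (leval \<alpha>)"
      by (rule continuous_on_subset[OF continuous_on_vecI[OF \<alpha>]]) (use \<rho> in auto)
    have in_S: "(q, w - z) \<in> S" if "z \<in> ?A" "w \<in> sphere 0 \<rho>" for w z
    proof (rule d)
      have "norm (w - z) \<le> norm w + norm z" by (rule norm_triangle_ineq4)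
      then show "w - z \<in> ball 0 d - {0}" using that \<rho> D by auto
    qed
    have "(\<lambda>z. \<Sum>a\<in>UNIV. kern \<rho> (leval \<alpha>) a b (q, z)) holomorphic_on ?A"
      by (intro holomorphic_on_sum holomorphic_on_slice[OF kern_holomorphic[OF _ cont]]) (use \<rho> in_S in auto)
    then have "(\<lambda>z. Qf q \<alpha> z $ b) holomorphic_on ?A"
    proof (rule holomorphic_transform)
      fix z assume z: "z \<in> ?A"
      show "(\<Sum>a\<in>UNIV. kern \<rho> (leval \<alpha>) a b (q, z)) = Qf q \<alpha> z $ b"
        using Qf_cint[OF d \<alpha> D, of z \<rho> b] cint_tr_kern(2)[OF less_imp_le[OF \<rho>(1)] cont in_S[OF z], of b] z \<rho> by auto
    qed
    then show ?thesis
      by (rule holomorphic_on_imp_differentiable_at) (use z0 \<rho> in auto)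
  qed
  then show ?thesis
    by (intro holomorphic_onI) (blast intro: field_differentiable_at_within)
qed

lemma residue_K_Qf:
  fixes G :: "complex \<Rightarrow> complex ^ 'n"
  assumes d: "\<And>z. z \<in> ball 0 d - {0} \<Longrightarrow> (q, z) \<in> S" and D: "2 * D \<le> d"
    and \<alpha>: "\<And>a. (\<lambda>z. leval \<alpha> z $ a) holomorphic_on ball 0 D - {0}"
    and G: "\<And>a. (\<lambda>z. G z $ a) holomorphic_on ball 0 D - {0}"
    and \<rho>: "0 < \<rho>" "\<rho> < \<sigma>" "\<sigma> < D"
  shows "residue (\<lambda>z. K (Qf q \<alpha> z) (G z)) 0 = cint2 \<rho> \<sigma> (\<lambda>w z. K (c1 (q, w - z) (leval \<alpha> w)) (G z))"
proof -
  have hol: "(\<lambda>z. K (Qf q \<alpha> z) (G z)) holomorphic_on ball 0 D - {0}"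
    by (intro holomorphic_on_K Qf_holomorphic[OF d \<alpha> D] G)
  have "residue (\<lambda>z. K (Qf q \<alpha> z) (G z)) 0 = cint \<sigma> (\<lambda>z. K (Qf q \<alpha> z) (G z))"
    using cint_residue[OF hol, of \<sigma>] \<rho> by simp
  also have "\<dots> = cint2 \<rho> \<sigma> (\<lambda>w z. K (c1 (q, w - z) (leval \<alpha> w)) (G z))"
    unfolding cint2_def
  proof (rule cint_cong)
    fix z :: complex assume z: "z \<in> sphere 0 \<sigma>"
    have "(\<lambda>w. c1 (q, w - z) (leval \<alpha> w) $ b) holomorphic_on ball 0 D - {0, z}" for b
      by (rule kernel_holomorphic[OF d \<alpha>]) (use z D \<rho> in auto)
    then have "continuous_on (sphere 0 \<rho>) (\<lambda>w. c1 (q, w - z) (leval \<alpha> w) $ b)" for b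
      by (rule continuous_on_subset[OF holomorphic_on_imp_continuous_on]) (use z \<rho> in auto)
    then have "cint \<rho> (\<lambda>w. K (c1 (q, w - z) (leval \<alpha> w)) (G z)) = K (\<chi> b. cint \<rho> (\<lambda>w. c1 (q, w - z) (leval \<alpha> w) $ b)) (G z)"
      using \<rho> by (intro cint_K_left) auto
    moreover have "(\<chi> b. cint \<rho> (\<lambda>w. c1 (q, w - z) (leval \<alpha> w) $ b)) = Qf q \<alpha> z"
      using Qf_cint[OF d \<alpha> D, of z \<rho>] z \<rho> by (simp add: vec_eq_iff)
    ultimately show "K (Qf q \<alpha> z) (G z) = cint \<rho> (\<lambda>w. K (c1 (q, w - z) (leval \<alpha> w)) (G z))" by simp
  qed (use \<rho> in auto)
  finally show ?thesis .
qed

text \<open>Loops are used within radius \<open>D\<close> and \<open>r\<close> within radius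
  \<open>d\<close>; the factor 2 keeps the differences \<open>w - z\<close> of two points of the
  smaller ball inside the larger one.\<close>

lemma loop_regions:
  fixes X Y Z :: "'n loop"
  assumes q: "q \<in> r_domain r" and "open V" "q \<in> V" and X: "X \<in> loop_alg" "Y \<in> loop_alg" "represents F Z"
  obtains d D where "d > 0" "D > 0" "2 * D \<le> d" "ball q d \<subseteq> V" "\<And>q' z. q' \<in> ball q d \<Longrightarrow> z \<in> ball 0 d - {0} \<Longrightarrow> (q', z) \<in> S"
    "\<And>a. (\<lambda>z. leval X z $ a) holomorphic_on ball 0 D - {0}" "\<And>a. (\<lambda>z. leval Y z $ a) holomorphic_on ball 0 D - {0}"
    "\<And>a. (\<lambda>z. leval Z z $ a) holomorphic_on ball 0 D - {0}" "\<And>z. z \<in> ball 0 D - {0} \<Longrightarrow> leval Z z = F z"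
proof -
  obtain d where d: "d > 0" "ball q d \<subseteq> V" "\<And>q' z. q' \<in> ball q d \<Longrightarrow> z \<in> ball 0 d - {0} \<Longrightarrow> (q', z) \<in> S"
    using r_region[OF q assms(2,3)] by metis
  obtain d1 where d1: "d1 > 0" "\<And>a. (\<lambda>z. leval X z $ a) holomorphic_on ball 0 d1 - {0}"
    using represents_holomorphic[OF represents_leval[OF X(1)]] by metis
  obtain d2 where d2: "d2 > 0" "\<And>a. (\<lambda>z. leval Y z $ a) holomorphic_on ball 0 d2 - {0}"
    using represents_holomorphic[OF represents_leval[OF X(2)]] by metis
  obtain d3 where d3: "d3 > 0" "\<And>a. (\<lambda>z. leval Z z $ a) holomorphic_on ball 0 d3 - {0}" "\<And>z. z \<in> ball 0 d3 - {0} \<Longrightarrow> leval Z z = F z"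
    using represents_holomorphic[OF X(3)] by metis
  define D where "D = min (min (d / 2) d1) (min d2 d3)"
  have D: "D > 0" "2 * D \<le> d" "D \<le> d1" "D \<le> d2" "D \<le> d3"
    using d d1 d2 d3 by (auto simp: D_def)
  show ?thesis
  proof (rule that[of d D])
    fix a
    show "(\<lambda>z. leval X z $ a) holomorphic_on ball 0 D - {0}"
      by (rule holomorphic_on_subset[OF d1(2)]) (use D in auto)
    show "(\<lambda>z. leval Y z $ a) holomorphic_on ball 0 D - {0}"
      by (rule holomorphic_on_subset[OF d2(2)]) (use D in auto)
    show "(\<lambda>z. leval Z z $ a) holomorphic_on ball 0 D - {0}"
      by (rule holomorphic_on_subset[OF d3(2)]) (use D in auto)
    show "leval Z z = F z" if "z \<in> ball 0 D - {0}" for z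
      using d3(3) that D by auto
  qed (use d D in auto)
qed

section \<open>Skew-symmetry of R and its pairing with the Yang--Baxter equation\<close>

lemma R_op_loop: "q \<in> r_domain r \<Longrightarrow> \<alpha> \<in> loop_alg \<Longrightarrow> R_op br r q \<alpha> \<in> loop_alg"
  by (rule represents_loop[OF R_op_represents])

lemma r_minus_loop: "q \<in> r_domain r \<Longrightarrow> r_minus br r q \<xi> \<in> loop_alg"
  by (rule represents_loop[OF r_minus_represents])

lemma R_op_eq:
  assumes "q \<in> r_domain r" "\<alpha> \<in> loop_alg"
  shows "R_op br r q \<alpha> = Qloop q \<alpha> + fls_const (1 / 2) *s \<alpha>"
  by (rule represents_unique[OF R_op_represents[OF assms]])
    (intro represents_add represents_scale Qloop represents_leval assms)

lemma Qloop_loop: "q \<in> r_domain r \<Longrightarrow> \<alpha> \<in> loop_alg \<Longrightarrow> Qloop q \<alpha> \<in> loop_alg"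
  by (rule represents_loop[OF Qloop])

lemma lpair_R_op:
  assumes "q \<in> r_domain r" "\<alpha> \<in> loop_alg" "\<eta> \<in> loop_alg"
  shows "lpair br \<eta> (R_op br r q \<alpha>) = lpair br \<eta> (Qloop q \<alpha>) + lpair br \<eta> \<alpha> / 2"
  using assms by (simp add: R_op_eq lpair_add_right Qloop_loop loop_alg_scale)
    (simp add: lpair_sym[of \<eta> "_ *s _"] lpair_scale_left lpair_sym[of \<alpha>])

lemma lpair_Qloop:
  assumes q: "q \<in> r_domain r" "\<alpha> \<in> loop_alg" "\<eta> \<in> loop_alg"
    and d: "\<And>z. z \<in> ball 0 d - {0} \<Longrightarrow> (q, z) \<in> S" and D: "2 * D \<le> d"
    and \<alpha>: "\<And>a. (\<lambda>z. leval \<alpha> z $ a) holomorphic_on ball 0 D - {0}"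
    and \<eta>: "\<And>a. (\<lambda>z. leval \<eta> z $ a) holomorphic_on ball 0 D - {0}"
    and \<rho>: "0 < \<rho>" "\<rho> < \<sigma>" "\<sigma> < D"
  shows "lpair br \<eta> (Qloop q \<alpha>) = cint2 \<rho> \<sigma> (\<lambda>w z. tr (leval \<alpha> w) (leval \<eta> z) (q, w - z))"
proof -
  have "lpair br \<eta> (Qloop q \<alpha>) = residue (\<lambda>z. K (Qf q \<alpha> z) (leval \<eta> z)) 0"
    using lpair_residue[OF represents_leval[OF q(3)] Qloop[OF q(1,2)]] by (simp add: K_sym)
  then show ?thesis
    using residue_K_Qf[OF d D \<alpha> \<eta> \<rho>] by (simp add: tr_K(2) K_sym)
qed

text \<open>Pairing \<open>\<eta>\<close> with Q of \<open>\<alpha>\<close> integrates the kernel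
  over \<open>\<bar>w\<bar> < \<bar>z\<bar>\<close>. Exchanging the loops gives, by unitarity, minus
  the same integrand over \<open>\<bar>w\<bar> > \<bar>z\<bar>\<close>. The two regions differ by
  the residue at \<open>w = z\<close>, which is the pairing of \<open>\<eta>\<close> with
  \<open>\<alpha>\<close> and is absorbed by the halves in R.\<close>

proposition R_op_skew:
  assumes q: "q \<in> r_domain r" and al: "\<alpha> \<in> loop_alg" "\<eta> \<in> loop_alg"
  shows "lpair br \<eta> (R_op br r q \<alpha>) = - lpair br \<alpha> (R_op br r q \<eta>)"
proof -
  obtain d D where D: "d > 0" "D > 0" "2 * D \<le> d" "ball q d \<subseteq> UNIV"
    and dS: "\<And>q' z. q' \<in> ball q d \<Longrightarrow> z \<in> ball 0 d - {0} \<Longrightarrow> (q', z) \<in> S"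
    and \<alpha>: "\<And>a. (\<lambda>z. leval \<alpha> z $ a) holomorphic_on ball 0 D - {0}"
    and \<eta>: "\<And>a. (\<lambda>z. leval \<eta> z $ a) holomorphic_on ball 0 D - {0}"
    by (rule loop_regions[OF q open_UNIV UNIV_I al represents_leval[OF al(1)]]) blast
  have qS: "(q, z) \<in> S" if "z \<in> ball 0 d - {0}" for z using dS[of q] D(1) that by auto
  \<comment> \<open>\<open>z\<close> runs over the middle circle, \<open>w\<close> over the inner or
    the outer one.\<close>
  define \<rho> \<sigma> \<tau> where "\<rho> = D / 4" and "\<sigma> = D / 3" and "\<tau> = D / 2"
  have rad: "0 < \<rho>" "\<rho> < \<sigma>" "0 < \<sigma>" "\<sigma> < \<tau>" "\<tau> < D" "\<sigma> < D" "\<rho> < D" using D(2) by (auto simp: \<rho>_def \<sigma>_def \<tau>_def)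
  let ?T = "\<lambda>w z. tr (leval \<alpha> w) (leval \<eta> z) (q, w - z)"
  have diff_S: "(q, w - z) \<in> S" if "w \<in> ball 0 D" "z \<in> ball 0 D" "w \<noteq> z" for w z
  proof (rule qS)
    have "norm (w - z) \<le> norm w + norm z" by (rule norm_triangle_ineq4)
    then show "w - z \<in> ball 0 d - {0}" using that D by auto
  qed
  have A: "lpair br \<eta> (Qloop q \<alpha>) = cint2 \<rho> \<sigma> ?T"
    by (rule lpair_Qloop[OF q al qS D(3) \<alpha> \<eta> rad(1,2,6)])
  have ac: "continuous_on B (\<lambda>p. leval \<alpha> (fst p))" "continuous_on B (\<lambda>p. leval \<eta> (snd p))"
    if "\<And>p. p \<in> B \<Longrightarrow> fst p \<in> ball 0 D - {0} \<and> snd p \<in> ball 0 D - {0}" for B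
    using that by (auto intro!: continuous_on_compose2[OF continuous_on_vecI[OF \<alpha>]] continuous_on_compose2[OF continuous_on_vecI[OF \<eta>]] continuous_intros)
  have T_cont: "cont2 s \<sigma> ?T" if "0 < s" "s < D" "s \<noteq> \<sigma>" for s
    by (intro continuous_on_tr ac continuous_intros) (use that rad in \<open>auto intro!: diff_S\<close>)
  have "lpair br \<alpha> (Qloop q \<eta>) = cint2 \<sigma> \<tau> (\<lambda>z w. tr (leval \<eta> z) (leval \<alpha> w) (q, z - w))"
    by (rule lpair_Qloop[OF q al(2,1) qS D(3) \<eta> \<alpha> rad(3,4,5)])
  also have "\<dots> = cint2 \<sigma> \<tau> (\<lambda>z w. - ?T w z)"
  proof (rule cint2_cong)
    fix z w :: complex assume "z \<in> sphere 0 \<sigma>" "w \<in> sphere 0 \<tau>"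
    then have "(q, w - z) \<in> S" "(q, - (w - z)) \<in> S"
      using rad diff_S[of w z] diff_S[of z w] by auto
    from unitarity[OF this] show "tr (leval \<eta> z) (leval \<alpha> w) (q, z - w) = - ?T w z" by simp
  qed (use rad in auto)
  also have "\<dots> = - cint \<tau> (\<lambda>w. cint \<sigma> (\<lambda>z. ?T w z))"
    by (simp add: cint2_def cint_minus)
  also have "cint \<tau> (\<lambda>w. cint \<sigma> (\<lambda>z. ?T w z)) = cint2 \<tau> \<sigma> ?T"
    unfolding cint2_def by (rule cint_swap) (use rad T_cont[of \<tau>] in \<open>auto simp: split_beta\<close>)
  \<comment> \<open>With \<open>z\<close> fixed on the middle circle, shrinking the circle of
    \<open>w\<close> crosses only the pole at \<open>w = z\<close>.\<close>
  also have "cint2 \<tau> \<sigma> ?T = cint \<sigma> (\<lambda>z. cint \<rho> (\<lambda>w. ?T w z) + K (leval \<eta> z) (leval \<alpha> z))"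
    unfolding cint2_def
  proof (rule cint_cong)
    fix z :: complex assume z: "z \<in> sphere 0 \<sigma>"
    have T_eq: "?T w z = (\<Sum>b\<in>UNIV. c1 (q, w - z) (leval \<alpha> w) $ b * K (axis b 1) (leval \<eta> z))" for w
      unfolding tr_K(2) by (subst K_sym, subst K_expand_left) (rule refl)
    have hol: "(\<lambda>w. c1 (q, w - z) (leval \<alpha> w) $ b) holomorphic_on ball 0 D - {0, z}" for b
      by (rule kernel_holomorphic[OF qS \<alpha>]) (use z D rad in auto)
    have "isCont (\<lambda>w. leval \<alpha> w $ a) z" for a
    proof -
      have "continuous_on (ball 0 D - {0}) (\<lambda>w. leval \<alpha> w $ a)"
        by (rule holomorphic_on_imp_continuous_on[OF \<alpha>])
      then show ?thesis
        by (subst (asm) continuous_on_eq_continuous_at) (use z rad in \<open>auto intro: open_delete\<close>)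
    qed
    then have "((\<lambda>w. \<Sum>b\<in>UNIV. ((w - z) * c1 (q, w - z) (leval \<alpha> w) $ b) * K (axis b 1) (leval \<eta> z)) \<longlongrightarrow>
        (\<Sum>b\<in>UNIV. leval \<alpha> z $ b * K (axis b 1) (leval \<eta> z))) (at z)"
      by (intro tendsto_intros kernel_pole[OF q])
    then have "((\<lambda>w. (w - z) * ?T w z) \<longlongrightarrow> K (leval \<alpha> z) (leval \<eta> z)) (at z)"
      by (simp add: T_eq sum_distrib_left mult.assoc K_expand_left[of "leval \<alpha> z"])
    moreover have "(\<lambda>w. ?T w z) holomorphic_on ball 0 D - {0, z}"
      unfolding T_eq by (intro holomorphic_intros hol)
    ultimately show "cint \<tau> (\<lambda>w. ?T w z) = cint \<rho> (\<lambda>w. ?T w z) + K (leval \<eta> z) (leval \<alpha> z)"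
      using z rad by (subst cint_cross_pole[of _ D z "K (leval \<alpha> z) (leval \<eta> z)" \<rho>]) (auto simp: K_sym)
  qed (use rad in auto)
  also have "\<dots> = cint2 \<rho> \<sigma> ?T + cint \<sigma> (\<lambda>z. K (leval \<eta> z) (leval \<alpha> z))"
  proof -
    have "continuous_on (sphere 0 \<sigma>) (leval \<eta>)" "continuous_on (sphere 0 \<sigma>) (leval \<alpha>)"
      by (rule continuous_on_subset[OF continuous_on_vecI[OF \<eta>]], use rad in force,
          rule continuous_on_subset[OF continuous_on_vecI[OF \<alpha>]], use rad in force)
    then show ?thesis
      unfolding cint2_def using rad T_cont[of \<rho>]
      by (intro cint_add cont2_cint continuous_on_K) auto
  qed
  also have "cint \<sigma> (\<lambda>z. K (leval \<eta> z) (leval \<alpha> z)) = lpair br \<eta> \<alpha>"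
    unfolding lpair_def by (rule cint_residue[OF holomorphic_on_K[OF \<eta> \<alpha>] rad(3,6)])
  finally have "lpair br \<alpha> (Qloop q \<eta>) = - (lpair br \<eta> (Qloop q \<alpha>) + lpair br \<eta> \<alpha>)"
    using A by simp
  \<comment> \<open>Here \<open>c\<close> is the pairing of the two loops: the defect of skewness of
    Q is made good by adding half of it on each side.\<close>
  moreover have "x = - y" if "x = a + c / 2" "y = b + c / 2" "b = - (a + c)" for x y a b c :: complex
  proof -
    have "x + y = (a + b) + (c / 2 + c / 2)" unfolding that(1,2) by (simp only: add_ac)
    then show ?thesis unfolding field_sum_of_halves that(3) by (simp add: eq_neg_iff_add_eq_0)
  qed
  ultimately show ?thesis
    using lpair_R_op[OF q al] lpair_R_op[OF q al(2,1)] lpair_sym[of \<alpha> \<eta>] by metis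
qed

lemma pderiv_at_add_const: "pderiv_at i (\<lambda>q. f q + c) q = pderiv_at i f q"
proof -
  have "((\<lambda>t. f (q + axis i t) + c) has_field_derivative D) (at 0) \<longleftrightarrow> ((\<lambda>t. f (q + axis i t)) has_field_derivative D) (at 0)" for D
    by (simp add: has_field_derivative_iff)
  then show ?thesis by (simp add: pderiv_at_def deriv_def)
qed

lemma lpair_r_minus:
  assumes q: "q \<in> r_domain r" and \<alpha>: "\<alpha> \<in> loop_alg"
    and d: "\<And>z. z \<in> ball 0 d - {0} \<Longrightarrow> (q, z) \<in> S" and D: "2 * D \<le> d"
    and hol: "\<And>a. (\<lambda>z. leval \<alpha> z $ a) holomorphic_on ball 0 D - {0}" and \<rho>: "0 < \<rho>" "\<rho> < D"
  shows "lpair br \<alpha> (r_minus br r q \<xi>) = cint \<rho> (\<lambda>w. tr (leval \<alpha> w) \<xi> (q, w))"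
    "K (Qf q \<alpha> 0) \<xi> = cint \<rho> (\<lambda>w. tr (leval \<alpha> w) \<xi> (q, w))"
proof -
  have c1_hol: "(\<lambda>w. c1 (q, w) (leval \<alpha> w) $ b) holomorphic_on ball 0 D - {0}" for b
  proof -
    have "D + norm (0 :: complex) \<le> d" using D \<rho> by simp
    from kernel_holomorphic[OF d hol this] show ?thesis by simp
  qed
  have tr_hol: "(\<lambda>w. tr (leval \<alpha> w) \<xi> (q, w)) holomorphic_on ball 0 D - {0}"
    unfolding tr_K(2) by (intro holomorphic_on_K c1_hol holomorphic_intros)
  show "lpair br \<alpha> (r_minus br r q \<xi>) = cint \<rho> (\<lambda>w. tr (leval \<alpha> w) \<xi> (q, w))"
    using lpair_residue[OF represents_leval[OF \<alpha>] r_minus_represents[OF q]] cint_residue[OF tr_hol \<rho>]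
    by (simp add: tr_K(1))
  have "continuous_on (sphere 0 \<rho>) (\<lambda>w. c1 (q, w) (leval \<alpha> w) $ b)" for b
    by (rule continuous_on_subset[OF holomorphic_on_imp_continuous_on[OF c1_hol]]) (use \<rho> in auto)
  then have "cint \<rho> (\<lambda>w. K (c1 (q, w) (leval \<alpha> w)) \<xi>) = K (\<chi> b. cint \<rho> (\<lambda>w. c1 (q, w) (leval \<alpha> w) $ b)) \<xi>"
    using \<rho> by (intro cint_K_left) auto
  moreover have "Qf q \<alpha> 0 = (\<chi> b. cint \<rho> (\<lambda>w. c1 (q, w) (leval \<alpha> w) $ b))"
    using Qf_cint[OF d hol D, of 0 \<rho>] \<rho> by (simp add: vec_eq_iff)
  ultimately show "K (Qf q \<alpha> 0) \<xi> = cint \<rho> (\<lambda>w. tr (leval \<alpha> w) \<xi> (q, w))"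
    by (simp add: tr_K(2) K_sym)
qed

text \<open>\<open>r_minus\<close> is the transpose of Q followed by evaluation at
  \<open>z = 0\<close>; both sides are the same integral over a small circle. Hence Q at 0 in the
  pulled back linear functions.\<close>

lemma lpair_r_minus_eq:
  assumes q: "q \<in> r_domain r" and \<alpha>: "\<alpha> \<in> loop_alg"
  shows "lpair br \<alpha> (r_minus br r q \<xi>) = K (Qf q \<alpha> 0) \<xi>"
proof -
  obtain d D where D: "d > 0" "D > 0" "2 * D \<le> d" "ball q d \<subseteq> UNIV"
    and dS: "\<And>q' z. q' \<in> ball q d \<Longrightarrow> z \<in> ball 0 d - {0} \<Longrightarrow> (q', z) \<in> S"
    and hol: "\<And>a. (\<lambda>z. leval \<alpha> z $ a) holomorphic_on ball 0 D - {0}"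
    by (rule loop_regions[OF q open_UNIV UNIV_I \<alpha> \<alpha> represents_leval[OF \<alpha>]]) blast
  have qS: "(q, z) \<in> S" if "z \<in> ball 0 d - {0}" for z using dS[of q] D(1) that by auto
  show ?thesis
    using lpair_r_minus[OF q \<alpha> qS D(3) hol, of "D / 2"] D(2) by simp
qed

lemma lrestr_cint:
  assumes \<alpha>: "\<alpha> \<in> loop_alg" and hol: "\<And>a. (\<lambda>z. leval \<alpha> z $ a) holomorphic_on ball 0 D - {0}" and \<rho>: "0 < \<rho>" "\<rho> < D"
  shows "lrestr br e \<alpha> $ i = cint \<rho> (\<lambda>w. K (e i) (leval \<alpha> w))"
proof -
  have "(\<lambda>w. K (e i) (leval \<alpha> w)) holomorphic_on ball 0 D - {0}"
    by (intro holomorphic_on_K hol holomorphic_intros)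
  then show ?thesis
    using lpair_residue[OF represents_leval[OF \<alpha>] represents_const[of "e i"]] cint_residue[OF _ \<rho>]
    by (simp add: lrestr_def K_sym)
qed

text \<open>One circle serves all nearby \<open>q\<close>, because the radius of the region around
  \<open>(q, 0)\<close> is locally uniform.\<close>

lemma Qf_0_holomorphic:
  assumes "V \<subseteq> r_domain r" "open V" "\<alpha> \<in> loop_alg"
  shows "holomorphic_wrt (*s) (\<lambda>q. Qf q \<alpha> 0 $ b) V"
proof (rule holomorphic_wrt_local)
  fix q assume q: "q \<in> V"
  obtain d D where D: "d > 0" "D > 0" "2 * D \<le> d" "ball q d \<subseteq> V"
    and dS: "\<And>q' z. q' \<in> ball q d \<Longrightarrow> z \<in> ball 0 d - {0} \<Longrightarrow> (q', z) \<in> S"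
    and hol: "\<And>a. (\<lambda>z. leval \<alpha> z $ a) holomorphic_on ball 0 D - {0}"
    by (rule loop_regions[of q V \<alpha> \<alpha> "leval \<alpha>" \<alpha>]) (use assms q represents_leval[OF assms(3)] in blast)+
  have cont: "continuous_on (sphere 0 (D / 2)) (leval \<alpha>)"
    by (rule continuous_on_subset[OF continuous_on_vecI[OF hol]]) (use D in auto)
  have "holomorphic_wrt (*s) (\<lambda>q. cint (D / 2) (\<lambda>w. c1 (q, w) (leval \<alpha> w) $ b)) (ball q d)"
  proof (rule pderiv_cint_tr(2)[OF _ cont, of "ball q d" q])
    fix q' and w :: complex assume "q' \<in> ball q d" "w \<in> sphere 0 (D / 2)"
    moreover have "D / 2 < d" using D by linarith
    ultimately show "(q', w) \<in> S" using D by (intro dS) auto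
  qed (use D in auto)
  moreover have "cint (D / 2) (\<lambda>w. c1 (q', w) (leval \<alpha> w) $ b) = Qf q' \<alpha> 0 $ b" if "q' \<in> ball q d" for q'
    using Qf_cint[OF dS[OF that] hol D(3), of 0 "D / 2" b] D(2) by simp
  ultimately have "holomorphic_wrt (*s) (\<lambda>q. Qf q \<alpha> 0 $ b) (ball q d)"
    by (elim holomorphic_wrt_cong) auto
  then show "\<exists>T. q \<in> T \<and> holomorphic_wrt (*s) (\<lambda>q. Qf q \<alpha> 0 $ b) T"
    using D(1) by (intro exI[of _ "ball q d"]) auto
qed

text \<open>Pair the equation at \<open>(z\<^sub>1, z\<^sub>2, z\<^sub>3) = (w, z, 0)\<close> with \<open>\<alpha> w \<otimes> \<eta> z \<otimes> \<xi>\<close> and integrate over circles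
  \<open>\<bar>w\<bar> < \<bar>z\<bar>\<close>.\<close>

proposition integrated_Yang_Baxter:
  assumes q: "q \<in> r_domain r" and al: "\<alpha> \<in> loop_alg" "\<eta> \<in> loop_alg"
  shows "(\<Sum>i\<in>UNIV. lrestr br e \<alpha> $ i * pderiv_at i (\<lambda>q. K (Qf q \<eta> 0) \<xi>) q
      - lrestr br e \<eta> $ i * pderiv_at i (\<lambda>q. K (Qf q \<alpha> 0) \<xi>) q
      + K (e i) \<xi> * pderiv_at i (\<lambda>q. lpair br \<eta> (R_op br r q \<alpha>)) q)
    + K \<xi> (br (Qf q \<alpha> 0) (Qf q \<eta> 0))
    + lpair br \<eta> (lbracket br (R_op br r q \<alpha>) (r_minus br r q \<xi>))
    - lpair br \<alpha> (lbracket br (R_op br r q \<eta>) (r_minus br r q \<xi>)) = 0"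
proof -
  define Y where "Y = r_minus br r q \<xi>"
  \<comment> \<open>Invariance moves the factor \<open>c2 (q, w) \<xi>\<close> of the fourth term
    onto \<open>\<alpha>\<close>, so that the term becomes Q applied to this loop.\<close>
  define X where "X = lbracket br Y \<alpha>"
  have Y: "Y \<in> loop_alg" unfolding Y_def by (rule r_minus_loop[OF q])
  have X: "X \<in> loop_alg" unfolding X_def by (rule loop_alg_bracket[OF Y al(1)])
  have X_rep: "represents (\<lambda>w. br (c2 (q, w) \<xi>) (leval \<alpha> w)) X"
    unfolding X_def Y_def by (intro represents_br r_minus_represents q represents_leval al)
  obtain d D where D: "d > 0" "D > 0" "2 * D \<le> d" "ball q d \<subseteq> r_domain r"
    and dS: "\<And>q' z. q' \<in> ball q d \<Longrightarrow> z \<in> ball 0 d - {0} \<Longrightarrow> (q', z) \<in> S"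
    and \<alpha>: "\<And>a. (\<lambda>z. leval \<alpha> z $ a) holomorphic_on ball 0 D - {0}"
    and \<eta>: "\<And>a. (\<lambda>z. leval \<eta> z $ a) holomorphic_on ball 0 D - {0}"
    and X_hol: "\<And>a. (\<lambda>z. leval X z $ a) holomorphic_on ball 0 D - {0}"
    and X_eq: "\<And>z. z \<in> ball 0 D - {0} \<Longrightarrow> leval X z = br (c2 (q, z) \<xi>) (leval \<alpha> z)"
    by (rule loop_regions[OF q open_r_domain q al X_rep]) blast
  have qS: "(q, z) \<in> S" if "z \<in> ball 0 d - {0}" for z using dS[of q] D(1) that by auto
  define \<rho> \<sigma> where "\<rho> = D / 3" and "\<sigma> = D / 2"
  have rad: "0 < \<rho>" "\<rho> < \<sigma>" "\<sigma> < D" "0 < \<sigma>" "\<rho> < D" "0 \<le> \<rho>" "0 \<le> \<sigma>" using D(2) by (auto simp: \<rho>_def \<sigma>_def)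
  have in_S: "(q', w) \<in> S" "(q', - w) \<in> S" "(q', z) \<in> S" "(q', w - z) \<in> S"
    if "q' \<in> ball q d" "w \<in> sphere 0 \<rho>" "z \<in> sphere 0 \<sigma>" for q' w z
  proof -
    have "norm (w - z) \<le> norm w + norm z" by (rule norm_triangle_ineq4)
    then have "norm w < d" "norm z < d" "norm (w - z) < d"
      using that(2,3) D(1-3) rad by (simp_all only: mem_sphere_0)
    then show "(q', w) \<in> S" "(q', - w) \<in> S" "(q', z) \<in> S" "(q', w - z) \<in> S"
      using that(2,3) rad by (auto intro!: dS[OF that(1)])
  qed
  have q_ball: "q \<in> ball q d" using D(1) by simp
  note in_Sq = in_S[OF q_ball]
  have cont_\<alpha>: "continuous_on (sphere 0 \<rho>) (leval \<alpha>)" and cont_\<eta>: "continuous_on (sphere 0 \<sigma>) (leval \<eta>)"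
    by (rule continuous_on_subset[OF continuous_on_vecI[OF \<alpha>]], use rad in force,
        rule continuous_on_subset[OF continuous_on_vecI[OF \<eta>]], use rad in force)
  have \<alpha>2: "continuous_on (sphere 0 \<rho> \<times> sphere 0 \<sigma>) (\<lambda>p. leval \<alpha> (fst p))"
    and \<eta>2: "continuous_on (sphere 0 \<rho> \<times> sphere 0 \<sigma>) (\<lambda>p. leval \<eta> (snd p))"
    by (rule continuous_on_compose2[OF cont_\<alpha>], intro continuous_intros, force,
        rule continuous_on_compose2[OF cont_\<eta>], intro continuous_intros, force)
  have c2_hol: "(\<lambda>z. c2 (q, z) \<xi> $ a) holomorphic_on ball 0 D - {0}" for a
    by (intro c_holomorphic qS holomorphic_intros) (use D in auto)
  have c1_hol: "(\<lambda>z. c1 (q, z) (leval \<eta> z) $ b) holomorphic_on ball 0 D - {0}"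
    "(\<lambda>z. c1 (q, z) (leval \<alpha> z) $ b) holomorphic_on ball 0 D - {0}" for b
  proof -
    have "D + norm (0 :: complex) \<le> d" using D by simp
    from kernel_holomorphic[OF qS \<eta> this] kernel_holomorphic[OF qS \<alpha> this]
    show "(\<lambda>z. c1 (q, z) (leval \<eta> z) $ b) holomorphic_on ball 0 D - {0}"
      "(\<lambda>z. c1 (q, z) (leval \<alpha> z) $ b) holomorphic_on ball 0 D - {0}" by simp_all
  qed
  define t1 where "t1 i w z = K (e i) (leval \<alpha> w) * dtr i (leval \<eta> z) \<xi> (q, z)" for i w z
  define t2 where "t2 i w z = K (e i) (leval \<eta> z) * dtr i \<xi> (leval \<alpha> w) (q, - w)" for i w z
  define t3 where "t3 i w z = K (e i) \<xi> * dtr i (leval \<alpha> w) (leval \<eta> z) (q, w - z)" for i w z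
  define t4 where "t4 w z = K (leval \<alpha> w) (br (c2 (q, w - z) (leval \<eta> z)) (c2 (q, w) \<xi>))" for w z
  define t5 where "t5 w z = K (leval \<eta> z) (br (c1 (q, w - z) (leval \<alpha> w)) (c2 (q, z) \<xi>))" for w z
  define t6 where "t6 w z = K \<xi> (br (c1 (q, w) (leval \<alpha> w)) (c1 (q, z) (leval \<eta> z)))" for w z
  have cont: "cont2 \<rho> \<sigma> (t1 i)" "cont2 \<rho> \<sigma> (t2 i)" "cont2 \<rho> \<sigma> (t3 i)" "cont2 \<rho> \<sigma> t4" "cont2 \<rho> \<sigma> t5" "cont2 \<rho> \<sigma> t6" for i
    unfolding t1_def t2_def t3_def t4_def t5_def t6_def
    by (intro continuous_intros continuous_on_K continuous_on_br continuous_on_c continuous_on_dtr \<alpha>2 \<eta>2; use in_Sq in force)+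
  have sum0: "cint2 \<rho> \<sigma> (\<lambda>w z. (\<Sum>i\<in>UNIV. t1 i w z) + (\<Sum>i\<in>UNIV. t2 i w z) + (\<Sum>i\<in>UNIV. t3 i w z) + t4 w z + t5 w z + t6 w z) = 0"
  proof -
    have "(\<Sum>i\<in>UNIV. t1 i w z) + (\<Sum>i\<in>UNIV. t2 i w z) + (\<Sum>i\<in>UNIV. t3 i w z) + t4 w z + t5 w z + t6 w z = 0"
      if "w \<in> sphere 0 \<rho>" "z \<in> sphere 0 \<sigma>" for w z
      using Yang_Baxter[OF in_Sq(4)[OF that] in_Sq(1)[OF that] in_Sq(3)[OF that] in_Sq(2)[OF that], of "leval \<alpha> w" "leval \<eta> z" \<xi>]
      by (simp add: t1_def t2_def t3_def t4_def t5_def t6_def sum.distrib)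
    then have "cint2 \<rho> \<sigma> (\<lambda>w z. (\<Sum>i\<in>UNIV. t1 i w z) + (\<Sum>i\<in>UNIV. t2 i w z) + (\<Sum>i\<in>UNIV. t3 i w z) + t4 w z + t5 w z + t6 w z) = cint2 \<rho> \<sigma> (\<lambda>w z. 0)"
      using rad by (intro cint2_cong) auto
    then show ?thesis by (simp add: cint2_def)
  qed
  have sum1: "(\<Sum>i\<in>UNIV. cint2 \<rho> \<sigma> (t1 i)) + (\<Sum>i\<in>UNIV. cint2 \<rho> \<sigma> (t2 i)) + (\<Sum>i\<in>UNIV. cint2 \<rho> \<sigma> (t3 i))
      + cint2 \<rho> \<sigma> t4 + cint2 \<rho> \<sigma> t5 + cint2 \<rho> \<sigma> t6 = 0"
    using sum0 rad by (simp add: cint2_add cint2_sum cont continuous_on_add continuous_on_sum)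
  have beta: "pderiv_at i (\<lambda>q. K (Qf q \<beta> 0) \<xi>) q = cint s (\<lambda>w. dtr i (leval \<beta> w) \<xi> (q, w))"
    if \<beta>: "\<beta> \<in> loop_alg" "\<And>a. (\<lambda>z. leval \<beta> z $ a) holomorphic_on ball 0 D - {0}" and s: "0 < s" "s < D" for \<beta> i s
  proof -
    have cont_\<beta>: "continuous_on (sphere 0 s) (leval \<beta>)"
      by (rule continuous_on_subset[OF continuous_on_vecI[OF \<beta>(2)]]) (use s in auto)
    have "pderiv_at i (\<lambda>q. K (Qf q \<beta> 0) \<xi>) q = pderiv_at i (\<lambda>q. cint s (\<lambda>w. tr (leval \<beta> w) \<xi> (q, w))) q"
    proof (rule pderiv_at_cong[OF open_ball q_ball])
      fix q' assume "q' \<in> ball q d"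
      then show "K (Qf q' \<beta> 0) \<xi> = cint s (\<lambda>w. tr (leval \<beta> w) \<xi> (q', w))"
        using D(4) by (intro lpair_r_minus(2)[OF _ \<beta>(1) dS D(3) \<beta>(2) s]) auto
    qed
    also have "\<dots> = cint s (\<lambda>w. dtr i (leval \<beta> w) \<xi> (q, w))"
    proof (rule pderiv_cint_tr(1)[OF _ cont_\<beta> open_ball q_ball])
      fix q' and w :: complex assume "q' \<in> ball q d" "w \<in> sphere 0 s"
      moreover have "s < d" using D s by linarith
      ultimately show "(q', w) \<in> S" using s by (intro dS) auto
    qed (use s in auto)
    finally show ?thesis .
  qed
  have I1: "cint2 \<rho> \<sigma> (t1 i) = lrestr br e \<alpha> $ i * pderiv_at i (\<lambda>q. K (Qf q \<eta> 0) \<xi>) q" for i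
    unfolding t1_def[abs_def] cint2_product beta[OF al(2) \<eta> rad(4,3)] lrestr_cint[OF al(1) \<alpha> rad(1,5)] ..
  \<comment> \<open>The derivative of \<open>r\<close> on legs 3 and 1 sits at \<open>- w\<close>;
    unitarity brings it to \<open>w\<close>, exchanging the legs and changing the sign.\<close>
  have I2: "cint2 \<rho> \<sigma> (t2 i) = - lrestr br e \<eta> $ i * pderiv_at i (\<lambda>q. K (Qf q \<alpha> 0) \<xi>) q" for i
  proof -
    have "cint2 \<rho> \<sigma> (t2 i) = cint2 \<rho> \<sigma> (\<lambda>w z. - dtr i (leval \<alpha> w) \<xi> (q, w) * K (e i) (leval \<eta> z))"
      by (rule cint2_cong[OF rad(6,7)]) (simp add: t2_def dtr_unitarity[OF in_Sq(1,2)])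
    then show ?thesis
      unfolding cint2_product cint_minus beta[OF al(1) \<alpha> rad(1,5)] lrestr_cint[OF al(2) \<eta> rad(4,3)] by simp
  qed
  \<comment> \<open>R and Q differ by half the identity, which does not depend on
    \<open>q\<close>.\<close>
  have I3: "cint2 \<rho> \<sigma> (t3 i) = K (e i) \<xi> * pderiv_at i (\<lambda>q. lpair br \<eta> (R_op br r q \<alpha>)) q" for i
  proof -
    have "pderiv_at i (\<lambda>q. lpair br \<eta> (R_op br r q \<alpha>)) q =
        pderiv_at i (\<lambda>q. cint2 \<rho> \<sigma> (\<lambda>w z. tr (leval \<alpha> w) (leval \<eta> z) (q, w - z)) + lpair br \<eta> \<alpha> / 2) q"
    proof (rule pderiv_at_cong[OF open_ball q_ball])
      fix q' assume q': "q' \<in> ball q d"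
      then have "q' \<in> r_domain r" using D(4) by auto
      then show "lpair br \<eta> (R_op br r q' \<alpha>) = cint2 \<rho> \<sigma> (\<lambda>w z. tr (leval \<alpha> w) (leval \<eta> z) (q', w - z)) + lpair br \<eta> \<alpha> / 2"
        using lpair_R_op[OF _ al] lpair_Qloop[OF _ al dS[OF q'] D(3) \<alpha> \<eta> rad(1,2,3)] by simp
    qed
    also have "\<dots> = cint2 \<rho> \<sigma> (\<lambda>w z. dtr i (leval \<alpha> w) (leval \<eta> z) (q, w - z))"
      unfolding pderiv_at_add_const by (rule pderiv_cint2_tr[OF rad(6) cont_\<alpha> open_ball q_ball in_S(4) rad(7) cont_\<eta>])
    finally show ?thesis by (simp add: t3_def[abs_def] cint2_mult_left)
  qed
  have I4: "cint2 \<rho> \<sigma> t4 = lpair br \<eta> (Qloop q X)"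
  proof -
    have "cint2 \<rho> \<sigma> t4 = cint2 \<rho> \<sigma> (\<lambda>w z. tr (leval X w) (leval \<eta> z) (q, w - z))"
    proof (rule cint2_cong[OF rad(6,7)])
      fix w z :: complex assume "w \<in> sphere 0 \<rho>" "z \<in> sphere 0 \<sigma>"
      then have "leval X w = br (c2 (q, w) \<xi>) (leval \<alpha> w)" using rad by (intro X_eq) auto
      then show "t4 w z = tr (leval X w) (leval \<eta> z) (q, w - z)"
        unfolding t4_def tr_K(1) by (metis K_rot K_sym)
    qed
    then show ?thesis
      using lpair_Qloop[OF q X al(2) qS D(3) X_hol \<eta> rad(1,2,3)] by simp
  qed
  have I5: "cint2 \<rho> \<sigma> t5 = lpair br \<eta> (lbracket br (Qloop q \<alpha>) Y)"
  proof -
    have rot: "K y (br u v) = K u (br v y)" for y u v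
      by (metis K_rot)
    have "lpair br \<eta> (lbracket br (Qloop q \<alpha>) Y) = residue (\<lambda>z. K (leval \<eta> z) (br (Qf q \<alpha> z) (c2 (q, z) \<xi>))) 0"
      unfolding Y_def by (rule lpair_residue) (intro represents_leval represents_br Qloop r_minus_represents q al)+
    also have "\<dots> = residue (\<lambda>z. K (Qf q \<alpha> z) (br (c2 (q, z) \<xi>) (leval \<eta> z))) 0"
      by (subst rot) (rule refl)
    also have "\<dots> = cint2 \<rho> \<sigma> (\<lambda>w z. K (c1 (q, w - z) (leval \<alpha> w)) (br (c2 (q, z) \<xi>) (leval \<eta> z)))"
    proof (rule residue_K_Qf[OF qS D(3) \<alpha> _ rad(1,2,3)])
      show "(\<lambda>z. br (c2 (q, z) \<xi>) (leval \<eta> z) $ a) holomorphic_on ball 0 D - {0}" for a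
        unfolding br_expand[of "c2 _ _"] by (intro holomorphic_intros c2_hol \<eta>)
    qed
    also have "\<dots> = cint2 \<rho> \<sigma> t5"
      unfolding t5_def[abs_def] by (subst rot) (rule refl)
    finally show ?thesis ..
  qed
  \<comment> \<open>The two factors depend on \<open>w\<close> and \<open>z\<close> separately, so
    the circles decouple and each produces a value of Q at 0.\<close>
  have I6: "cint2 \<rho> \<sigma> t6 = K \<xi> (br (Qf q \<alpha> 0) (Qf q \<eta> 0))"
  proof -
    have Q0: "Qf q \<alpha> 0 = (\<chi> b. cint \<rho> (\<lambda>w. c1 (q, w) (leval \<alpha> w) $ b))" "Qf q \<eta> 0 = (\<chi> b. cint \<sigma> (\<lambda>w. c1 (q, w) (leval \<eta> w) $ b))"
      using Qf_cint[OF qS \<alpha> D(3), of 0 \<rho>] Qf_cint[OF qS \<eta> D(3), of 0 \<sigma>] rad by (simp_all add: vec_eq_iff)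
    have c1c: "continuous_on (sphere 0 \<rho>) (\<lambda>w. c1 (q, w) (leval \<alpha> w) $ b)" "continuous_on (sphere 0 \<sigma>) (\<lambda>w. c1 (q, w) (leval \<eta> w) $ b)" for b
      by (rule continuous_on_subset[OF holomorphic_on_imp_continuous_on[OF c1_hol(2)]], use rad in force,
          rule continuous_on_subset[OF holomorphic_on_imp_continuous_on[OF c1_hol(1)]], use rad in force)
    have rot: "K \<xi> (br u v) = K u (br v \<xi>)" "K \<xi> (br u v) = K v (br \<xi> u)" for u v
      by (metis K_rot)+
    have "cint2 \<rho> \<sigma> t6 = cint \<sigma> (\<lambda>z. K (Qf q \<alpha> 0) (br (c1 (q, z) (leval \<eta> z)) \<xi>))"
      unfolding cint2_def t6_def rot(1) Q0(1) cint_K_left[OF rad(6) c1c(1)] ..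
    also have "\<dots> = cint \<sigma> (\<lambda>z. K (c1 (q, z) (leval \<eta> z)) (br \<xi> (Qf q \<alpha> 0)))"
      by (simp only: rot(1)[symmetric] rot(2))
    also have "\<dots> = K (Qf q \<eta> 0) (br \<xi> (Qf q \<alpha> 0))"
      unfolding Q0(2) cint_K_left[OF rad(7) c1c(2)] ..
    finally show ?thesis by (simp only: rot(2))
  qed
  \<comment> \<open>Skewness replaces R of \<open>\<eta>\<close>, paired with \<open>X\<close>, by
    minus R of \<open>X\<close>, paired with \<open>\<eta>\<close>. Writing R as Q plus one half
    leaves two half terms, the pairings of \<open>\<eta>\<close> with \<open>[\<alpha>, Y]\<close>
    and with \<open>[Y, \<alpha>]\<close>, which cancel.\<close>
  have halves: "lpair br \<eta> (lbracket br (R_op br r q \<alpha>) Y) - lpair br \<alpha> (lbracket br (R_op br r q \<eta>) Y) =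
      lpair br \<eta> (lbracket br (Qloop q \<alpha>) Y) + lpair br \<eta> (Qloop q X)"
  proof -
    have "lpair br \<alpha> (lbracket br (R_op br r q \<eta>) Y) = lpair br X (R_op br r q \<eta>)"
      unfolding X_def
      using lpair_residue[OF represents_leval[OF al(1)] represents_br[OF represents_leval[OF R_op_loop[OF q al(2)]] represents_leval[OF Y]]]
        lpair_residue[OF represents_br[OF represents_leval[OF Y] represents_leval[OF al(1)]] represents_leval[OF R_op_loop[OF q al(2)]]]
      by (metis (no_types, lifting) K_rot K_sym ext)
    also have "\<dots> = - lpair br \<eta> (R_op br r q X)"
      using R_op_skew[OF q X al(2)] by simp
    finally have 1: "lpair br \<alpha> (lbracket br (R_op br r q \<eta>) Y) = - (lpair br \<eta> (Qloop q X) + lpair br \<eta> X / 2)"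
      using lpair_R_op[OF q X al(2)] by simp
    have inv: "lpair br \<eta> (lbracket br Z Y) = lpair br (lbracket br \<eta> Z) Y" if "Z \<in> loop_alg" for Z
      using lpair_invariant[OF al(2) that Y] by simp
    have "lpair br \<eta> (lbracket br (R_op br r q \<alpha>) Y) = lpair br (lbracket br Y \<eta>) (R_op br r q \<alpha>)"
      using lpair_residue[OF represents_leval[OF al(2)] represents_br[OF represents_leval[OF R_op_loop[OF q al(1)]] represents_leval[OF Y]]]
        lpair_residue[OF represents_br[OF represents_leval[OF Y] represents_leval[OF al(2)]] represents_leval[OF R_op_loop[OF q al(1)]]]
      by (metis (no_types, lifting) K_rot K_sym ext)
    also have "\<dots> = lpair br (lbracket br Y \<eta>) (Qloop q \<alpha>) + lpair br (lbracket br Y \<eta>) \<alpha> / 2"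
      by (rule lpair_R_op[OF q al(1) loop_alg_bracket[OF Y al(2)]])
    also have "lpair br (lbracket br Y \<eta>) (Qloop q \<alpha>) = lpair br \<eta> (lbracket br (Qloop q \<alpha>) Y)"
      using lpair_residue[OF represents_leval[OF al(2)] represents_br[OF represents_leval[OF Qloop_loop[OF q al(1)]] represents_leval[OF Y]]]
        lpair_residue[OF represents_br[OF represents_leval[OF Y] represents_leval[OF al(2)]] represents_leval[OF Qloop_loop[OF q al(1)]]]
      by (metis (no_types, lifting) K_rot K_sym ext)
    also have "lpair br (lbracket br Y \<eta>) \<alpha> = - lpair br \<eta> X"
      unfolding X_def using lbracket_skew[OF Y al(2)] lpair_invariant[OF al(2) Y al(1)]
        lpair_minus_left[OF loop_alg_bracket[OF al(2) Y] al(1)] by simp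
    finally show ?thesis using 1 by simp
  qed
  show ?thesis
    using sum1 halves unfolding I1 I2 I3 I4 I5 I6 Y_def[symmetric]
    by (simp add: sum.distrib sum_subtractf sum_negf algebra_simps)
qed

end

section \<open>Equivariance under the Cartan subalgebra\<close>

context killing_lie
begin

lemma cint_br:
  fixes F :: "complex \<Rightarrow> complex ^ 'a"
  assumes "0 \<le> \<rho>" "continuous_on (sphere 0 \<rho>) F"
  shows "(\<chi> b. cint \<rho> (\<lambda>w. br x (F w) $ b)) = br x (\<chi> b. cint \<rho> (\<lambda>w. F w $ b))"
proof (rule K_eqI)
  fix y
  have comp: "continuous_on (sphere 0 \<rho>) (\<lambda>w. G w $ b)" if "continuous_on (sphere 0 \<rho>) G" for G :: "complex \<Rightarrow> complex ^ 'a" and b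
    using that unfolding continuous_on_def by (auto intro: tendsto_vec_nth)
  have swap: "K (br x u) y = K u (- br x y)" for u
    by (metis K_inv K_minus_right K_swap K_sym)
  have "K (\<chi> b. cint \<rho> (\<lambda>w. br x (F w) $ b)) y = cint \<rho> (\<lambda>w. K (br x (F w)) y)"
    by (rule cint_K_left[OF assms(1), symmetric]) (intro comp continuous_on_br assms continuous_intros)
  also have "\<dots> = K (\<chi> b. cint \<rho> (\<lambda>w. F w $ b)) (- br x y)"
    unfolding swap by (rule cint_K_left[OF assms(1)]) (intro comp assms)
  finally show "K (\<chi> b. cint \<rho> (\<lambda>w. br x (F w) $ b)) y = K (br x (\<chi> b. cint \<rho> (\<lambda>w. F w $ b))) y"
    by (simp only: swap)
qed

lemma lpair_lconst:
  assumes "\<alpha> \<in> loop_alg"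
  shows "lpair br \<alpha> (lconst x) = K (\<chi> a. fls_residue (\<alpha> $ a)) x"
  unfolding lpair_eq[OF assms loop_alg_const]
  by (simp add: Kfls_def lconst_def K_expand[of "vec_lambda _"] fls_nth_sum mult_ac)

end

context r_matrix
begin

text \<open>The zero weight condition lets \<open>ad x\<close> pass through the kernel under the
  integral. The germ off 0, which enters R, and the value at 0, which enters the pulled back
  functions, are recorded separately.\<close>

lemma Qf_weight:
  assumes q: "q \<in> r_domain r" and \<alpha>: "\<alpha> \<in> loop_alg" and x: "x \<in> h"
  shows "eventually (\<lambda>z. Qf q (lbracket br (lconst x) \<alpha>) z = br x (Qf q \<alpha> z)) (at 0)"
    "Qf q (lbracket br (lconst x) \<alpha>) 0 = br x (Qf q \<alpha> 0)"
proof -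
  define X where "X = lbracket br (lconst x) \<alpha>"
  have X: "X \<in> loop_alg" unfolding X_def by (intro loop_alg_bracket loop_alg_const \<alpha>)
  have X_rep: "represents (\<lambda>w. br x (leval \<alpha> w)) X"
    unfolding X_def by (intro represents_br represents_const represents_leval \<alpha>)
  obtain d D where D: "d > 0" "D > 0" "2 * D \<le> d" "ball q d \<subseteq> UNIV"
    and dS: "\<And>q' z. q' \<in> ball q d \<Longrightarrow> z \<in> ball 0 d - {0} \<Longrightarrow> (q', z) \<in> S"
    and \<alpha>_hol: "\<And>a. (\<lambda>z. leval \<alpha> z $ a) holomorphic_on ball 0 D - {0}"
    and X_hol: "\<And>a. (\<lambda>z. leval X z $ a) holomorphic_on ball 0 D - {0}"
    and X_eq: "\<And>z. z \<in> ball 0 D - {0} \<Longrightarrow> leval X z = br x (leval \<alpha> z)"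
    by (rule loop_regions[OF q open_UNIV UNIV_I \<alpha> \<alpha> X_rep]) blast
  have qS: "(q, z) \<in> S" if "z \<in> ball 0 d - {0}" for z using dS[of q] D(1) that by auto
  have main: "Qf q X z = br x (Qf q \<alpha> z)" if z: "norm z < D" for z
  proof -
    define \<rho> where "\<rho> = (if z = 0 then D / 2 else norm z / 2)"
    have \<rho>: "0 < \<rho>" "\<rho> < norm z \<or> z = 0 \<and> \<rho> < D" "\<rho> < D"
    proof -
      have "norm z / 2 < D" using z D(2) by linarith
      then show "0 < \<rho>" "\<rho> < norm z \<or> z = 0 \<and> \<rho> < D" "\<rho> < D"
        using D(2) by (auto simp: \<rho>_def)
    qed
    have in_S: "(q, w - z) \<in> S" if w: "w \<in> sphere 0 \<rho>" for w
    proof (rule qS)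
      have "norm (w - z) \<le> norm w + norm z" by (rule norm_triangle_ineq4)
      moreover have "w \<noteq> z" using w \<rho> by auto
      ultimately show "w - z \<in> ball 0 d - {0}" using w \<rho>(3) z D(3) by auto
    qed
    have \<alpha>_cont: "continuous_on (sphere 0 \<rho>) (leval \<alpha>)"
      by (rule continuous_on_subset[OF continuous_on_vecI[OF \<alpha>_hol]]) (use \<rho> in auto)
    have "Qf q X z = (\<chi> b. cint \<rho> (\<lambda>w. c1 (q, w - z) (leval X w) $ b))"
      using Qf_cint[OF qS X_hol D(3) z \<rho>(1,2)] by (simp add: vec_eq_iff)
    also have "\<dots> = (\<chi> b. cint \<rho> (\<lambda>w. br x (c1 (q, w - z) (leval \<alpha> w)) $ b))"
    proof -
      have "c1 (q, w - z) (leval X w) = br x (c1 (q, w - z) (leval \<alpha> w))" if w: "w \<in> sphere 0 \<rho>" for w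
        using X_eq[of w] zero_weight[OF in_S[OF w] x] w \<rho> by auto
      then show ?thesis using \<rho> by (simp add: vec_eq_iff) (intro allI cint_cong; simp)
    qed
    also have "\<dots> = br x (\<chi> b. cint \<rho> (\<lambda>w. c1 (q, w - z) (leval \<alpha> w) $ b))"
      using \<rho> in_S by (intro cint_br continuous_on_c \<alpha>_cont continuous_intros) auto
    also have "(\<chi> b. cint \<rho> (\<lambda>w. c1 (q, w - z) (leval \<alpha> w) $ b)) = Qf q \<alpha> z"
      using Qf_cint[OF qS \<alpha>_hol D(3) z \<rho>(1,2)] by (simp add: vec_eq_iff)
    finally show ?thesis .
  qed
  show "eventually (\<lambda>z. Qf q (lbracket br (lconst x) \<alpha>) z = br x (Qf q \<alpha> z)) (at 0)"
    unfolding eventually_at X_def[symmetric] using main D(2) by (intro exI[of _ D]) auto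
  show "Qf q (lbracket br (lconst x) \<alpha>) 0 = br x (Qf q \<alpha> 0)"
    using main[of 0] D(2) by (simp add: X_def)
qed

lemma R_op_weight:
  assumes q: "q \<in> r_domain r" and \<alpha>: "\<alpha> \<in> loop_alg" and x: "x \<in> h"
  shows "R_op br r q (lbracket br (lconst x) \<alpha>) = lbracket br (lconst x) (R_op br r q \<alpha>)"
proof (rule represents_unique)
  have X: "lbracket br (lconst x) \<alpha> \<in> loop_alg" by (intro loop_alg_bracket loop_alg_const \<alpha>)
  show "represents (\<lambda>z. Qf q (lbracket br (lconst x) \<alpha>) z + (1 / 2) *s leval (lbracket br (lconst x) \<alpha>) z)
      (R_op br r q (lbracket br (lconst x) \<alpha>))"
    by (rule R_op_represents[OF q X])
  have "represents (\<lambda>z. br x (Qf q \<alpha> z + (1 / 2) *s leval \<alpha> z)) (lbracket br (lconst x) (R_op br r q \<alpha>))"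
    by (intro represents_br represents_const R_op_represents q \<alpha>)
  moreover have "eventually (\<lambda>z. br x (Qf q \<alpha> z + (1 / 2) *s leval \<alpha> z) =
      Qf q (lbracket br (lconst x) \<alpha>) z + (1 / 2) *s leval (lbracket br (lconst x) \<alpha>) z) (at 0)"
    using Qf_weight(1)[OF assms] represents_eventually[OF represents_br[OF represents_const represents_leval[OF \<alpha>], of x]]
    by eventually_elim (simp add: br_add_right br_scale_right)
  ultimately show "represents (\<lambda>z. Qf q (lbracket br (lconst x) \<alpha>) z + (1 / 2) *s leval (lbracket br (lconst x) \<alpha>) z)
      (lbracket br (lconst x) (R_op br r q \<alpha>))"
    by (rule represents_cong)
qed

text \<open>R is skew and commutes with \<open>ad x\<close>. The two R terms of the loop bracket
  therefore contribute equally when paired with the constant loop of \<open>p\<close>, and their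
  difference does not see \<open>p\<close>.\<close>

lemma R_op_bracket_const:
  assumes q: "q \<in> r_domain r" and al: "\<alpha> \<in> loop_alg" "\<eta> \<in> loop_alg" and x: "x \<in> h"
  shows "lpair br \<eta> (lbracket br (R_op br r q \<alpha>) (lconst x)) = lpair br \<alpha> (lbracket br (R_op br r q \<eta>) (lconst x))"
proof -
  note c = loop_alg_const[of x]
  note R = R_op_loop[OF q al(1)] R_op_loop[OF q al(2)]
  have X: "lbracket br (lconst x) \<alpha> \<in> loop_alg" by (intro loop_alg_bracket loop_alg_const al)
  have "lpair br \<eta> (lbracket br (R_op br r q \<alpha>) (lconst x)) = - lpair br \<eta> (R_op br r q (lbracket br (lconst x) \<alpha>))"
    unfolding R_op_weight[OF q al(1) x] lbracket_skew[OF R(1) c]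
    by (intro lpair_minus_right al loop_alg_bracket c R)
  also have "\<dots> = lpair br (lbracket br (lconst x) \<alpha>) (R_op br r q \<eta>)"
    using R_op_skew[OF q X al(2)] by simp
  also have "\<dots> = - lpair br (lbracket br \<alpha> (lconst x)) (R_op br r q \<eta>)"
    unfolding lbracket_skew[OF c al(1)] by (intro lpair_minus_left al loop_alg_bracket c R)
  also have "\<dots> = - lpair br \<alpha> (lbracket br (lconst x) (R_op br r q \<eta>))"
    by (simp add: lpair_invariant[OF al(1) c R(2)])
  also have "\<dots> = lpair br \<alpha> (lbracket br (R_op br r q \<eta>) (lconst x))"
    unfolding lbracket_skew[OF R(2) c] by (intro lpair_minus_right[symmetric] al loop_alg_bracket c R)
  finally show ?thesis .
qed

lemma lpair_bracket_const:
  assumes q: "q \<in> r_domain r" and \<eta>: "\<eta> \<in> loop_alg" and x: "x \<in> h"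
  shows "lpair br \<eta> (lbracket br (lconst x) (r_minus br r q \<xi>)) = - K \<xi> (br x (Qf q \<eta> 0))"
proof -
  note c = loop_alg_const[of x]
  have "lpair br \<eta> (lbracket br (lconst x) (r_minus br r q \<xi>)) = lpair br (lbracket br \<eta> (lconst x)) (r_minus br r q \<xi>)"
    by (rule lpair_invariant[symmetric, OF \<eta> c r_minus_loop[OF q]])
  also have "\<dots> = - lpair br (lbracket br (lconst x) \<eta>) (r_minus br r q \<xi>)"
    unfolding lbracket_skew[OF \<eta> c] by (intro lpair_minus_left loop_alg_bracket c \<eta> r_minus_loop q)
  also have "\<dots> = - K (br x (Qf q \<eta> 0)) \<xi>"
    by (simp add: lpair_r_minus_eq[OF q loop_alg_bracket[OF c \<eta>]] Qf_weight(2)[OF q \<eta> x])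
  finally show ?thesis by (simp add: K_sym)
qed

lemma lpair_lconst_incl:
  assumes "\<alpha> \<in> loop_alg"
  shows "lpair br \<alpha> (lconst (incl e p)) = (\<Sum>i\<in>UNIV. p $ i * lrestr br e \<alpha> $ i)"
  by (simp add: lpair_lconst[OF assms] lrestr_def incl_def K_sum_right K_scale_right)

section \<open>The bracket on the source\<close>

abbreviation "S3 \<equiv> scale3 :: complex \<Rightarrow> ('l, 'n) source \<Rightarrow> ('l, 'n) source"

definition clin :: "(('l, 'n) source \<Rightarrow> complex) \<Rightarrow> bool" where
  "clin f \<longleftrightarrow> (\<forall>u v. f (u + v) = f u + f v) \<and> (\<forall>c v. f (S3 c v) = c * f v)"

definition grad :: "(('l, 'n) source \<Rightarrow> complex) \<Rightarrow> complex ^ 'n" where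
  "grad f = (THE y. \<forall>\<eta>. K \<eta> y = f (0, 0, \<eta>))"

lemma grad_eqI:
  assumes "\<And>\<eta>. K \<eta> y = f (0, 0, \<eta>)"
  shows "grad f = y"
  unfolding grad_def by (rule the_equality) (use assms K_eqI2 in auto)

text \<open>The inverse Gram matrix turns the values of a linear form on the basis of g into the
  vector that represents it.\<close>

lemma grad_spec:
  assumes "clin f"
  shows "K \<eta> (grad f) = f (0, 0, \<eta>)"
proof -
  define L where "L \<eta> = f (0, 0, \<eta>)" for \<eta>
  have add: "L (u + v) = L u + L v" for u v
  proof -
    have "f ((0, 0, u) + (0, 0, v)) = f (0, 0, u) + f (0, 0, v)"
      using assms unfolding clin_def by blast
    then show ?thesis by (simp add: L_def)
  qed
  have scale: "L (c *s v) = c * L v" for v c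
  proof -
    have "f (S3 c (0, 0, v)) = c * f (0, 0, v)"
      using assms unfolding clin_def by blast
    then show ?thesis by (simp add: L_def scale3_def)
  qed
  have "L 0 = 0" using scale[of 0 0] by simp
  then have sum: "L (sum g A) = (\<Sum>a\<in>A. L (g a))" for g and A :: "'n set"
    by (induction A rule: infinite_finite_induct) (auto simp: add)
  define y where "y = casimir br *v (\<chi> a. L (axis a 1))"
  have "Gram *v y = (\<chi> a. L (axis a 1))"
    unfolding y_def matrix_vector_mul_assoc casimir_def matrix_inv(1)[OF invertible_Gram] by simp
  then have y: "K (axis a 1) y = L (axis a 1)" for a
    using Gram_vec[of y a] by simp
  have "K \<eta> y = L \<eta>" for \<eta>
  proof -
    have "K \<eta> y = (\<Sum>a\<in>UNIV. \<eta> $ a * L (axis a 1))"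
      by (subst K_expand_left) (simp add: y)
    also have "\<dots> = L (\<Sum>a\<in>UNIV. \<eta> $ a *s axis a 1)"
      by (simp add: sum scale)
    finally show ?thesis by (simp flip: vec_eq_sum_axis)
  qed
  then show ?thesis
    using grad_eqI[of y f] by (simp add: L_def)
qed

text \<open>The Poisson tensor at a point, as a bilinear form in the two differentials. The
  derivation rules of the source bracket reduce to its linearity.\<close>

definition pb :: "complex ^ 'n \<Rightarrow> (('l, 'n) source \<Rightarrow> complex) \<Rightarrow> (('l, 'n) source \<Rightarrow> complex) \<Rightarrow> complex" where
  "pb \<xi> f g = (\<Sum>i\<in>UNIV. f (0, axis i 1, 0) * g (axis i 1, 0, 0) - f (axis i 1, 0, 0) * g (0, axis i 1, 0))
    + K \<xi> (br (grad f) (grad g))"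

lemma pb_skew: "pb \<xi> g f = - pb \<xi> f g"
  unfolding pb_def by (subst br_skew) (simp add: K_minus_right sum_subtractf sum_negf[symmetric] mult.commute)

lemma pb_linear:
  assumes "clin g" "clin g'"
  shows "pb \<xi> f (\<lambda>v. a * g v + b * g' v) = a * pb \<xi> f g + b * pb \<xi> f g'"
proof -
  have "grad (\<lambda>v. a * g v + b * g' v) = a *s grad g + b *s grad g'"
    by (rule grad_eqI) (simp add: K_add_right K_scale_right grad_spec assms)
  then show ?thesis
    by (simp add: pb_def br_add_right br_scale_right K_add_right K_scale_right algebra_simps sum.distrib sum_subtractf sum_distrib_left)
qed

lemma bounded_linear_scale3_left: "bounded_linear (\<lambda>c. S3 c v)"
proof -
  have lin: "linear (\<lambda>c. c *s w)" for w :: "complex ^ 'b::finite"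
    by (rule linearI) (simp_all add: vec_eq_iff algebra_simps)
  have bl: "bounded_linear (\<lambda>c. c *s w)" for w :: "complex ^ 'b::finite"
    using lin linear_conv_bounded_linear by blast
  show ?thesis
    unfolding scale3_def split_beta by (intro bounded_linear_Pair bl)
qed

lemma line3:
  assumes "holomorphic_wrt S3 A M" "x \<in> M"
  shows "((\<lambda>t. A (x + S3 t v)) has_field_derivative fder A x v) (at 0)"
proof -
  have x0: "x + S3 0 v = x" by (simp add: scale3_def split_beta prod_eq_iff vec_eq_iff)
  have "((\<lambda>t. x + S3 t v) has_derivative (\<lambda>t. S3 t v)) (at 0)"
    by (auto intro!: derivative_eq_intros bounded_linear_imp_has_derivative bounded_linear_scale3_left)
  from has_derivative_compose[OF this, of A "fder A x"] holomorphic_wrtD(1)[OF assms] x0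
  have "((\<lambda>t. A (x + S3 t v)) has_derivative (\<lambda>t. fder A x (S3 t v))) (at 0)" by simp
  then show ?thesis
    unfolding has_field_derivative_def
    by (rule has_derivative_eq_rhs) (simp add: fun_eq_iff holomorphic_wrtD(2)[OF assms] mult.commute)
qed

lemma clin_fder:
  assumes "holomorphic_wrt S3 A M" "x \<in> M"
  shows "clin (fder A x)"
  unfolding clin_def
  using linear_add[OF bounded_linear.linear[OF has_derivative_bounded_linear[OF holomorphic_wrtD(1)[OF assms]]]]
    holomorphic_wrtD(2)[OF assms]
  by simp

lemma axis_scale: "axis i t = t *s axis i (1 :: complex)"
  by (simp add: axis_def vec_eq_iff)

lemma source_bracket_eq:
  assumes "holomorphic_wrt S3 A M" "holomorphic_wrt S3 B M" "(q, p, \<xi>) \<in> M"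
  shows "source_bracket br A B (q, p, \<xi>) = pb \<xi> (fder A (q, p, \<xi>)) (fder B (q, p, \<xi>))"
proof -
  have *: "pderiv_at i (\<lambda>p'. A (q, p', \<xi>)) p = fder A (q, p, \<xi>) (0, axis i 1, 0)"
    "pderiv_at i (\<lambda>q'. A (q', p, \<xi>)) q = fder A (q, p, \<xi>) (axis i 1, 0, 0)"
    "kgrad br (\<lambda>\<xi>'. A (q, p, \<xi>')) \<xi> = grad (fder A (q, p, \<xi>))"
    if "holomorphic_wrt S3 A M" for A i
  proof -
    note line = DERIV_imp_deriv[OF line3[OF that assms(3)]]
    show "pderiv_at i (\<lambda>p'. A (q, p', \<xi>)) p = fder A (q, p, \<xi>) (0, axis i 1, 0)"
      "pderiv_at i (\<lambda>q'. A (q', p, \<xi>)) q = fder A (q, p, \<xi>) (axis i 1, 0, 0)"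
      using line[of "(0, axis i 1, 0)"] line[of "(axis i 1, 0, 0)"]
      by (simp_all add: pderiv_at_def scale3_def axis_scale[of i "_ :: complex", symmetric])
    have "deriv (\<lambda>t. A (q, p, \<xi> + t *s \<eta>)) 0 = fder A (q, p, \<xi>) (0, 0, \<eta>)" for \<eta>
      using line[of "(0, 0, \<eta>)"] by (simp add: scale3_def)
    then show "kgrad br (\<lambda>\<xi>'. A (q, p, \<xi>')) \<xi> = grad (fder A (q, p, \<xi>))"
      by (simp add: kgrad_def grad_def)
  qed
  show ?thesis
    by (simp add: source_bracket_def pb_def *[OF assms(1)] *[OF assms(2)])
qed

lemma Qf_zero: "Qf q 0 z = 0"
  by (simp add: Qf_def leval_def contract1_def residue_const vec_eq_iff flip: zero_vec_def)

lemma lrestr_zero: "lrestr br e 0 = (0 :: complex ^ 'l)"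
  by (simp add: lrestr_def vec_eq_iff lpair_def leval_def residue_const flip: zero_vec_def)

lemma incl_zero: "incl e 0 = 0"
  by (simp add: incl_def)

section \<open>Pull-backs of test functions along the map\<close>

context
  fixes V :: "(complex ^ 'l) set"
  assumes V: "open V" "V \<subseteq> r_domain r"
begin

abbreviation "M \<equiv> V \<times> (UNIV :: (complex ^ 'l) set) \<times> (UNIV :: (complex ^ 'n) set)"
abbreviation "pull F x \<equiv> F (rho br e r x)"

text \<open>Values of the algebroid bracket leave \<open>sections V\<close>, as they depend on
  \<open>q\<close> through R. This weaker property survives all the rules and suffices for linear
  functions to be additive in the section.\<close>

definition loop_valued :: "('l, 'n) sect \<Rightarrow> bool" where
  "loop_valued s \<longleftrightarrow> (\<forall>q\<in>V. snd (s q) \<in> loop_alg)"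

lemma open_M: "open M"
  by (intro open_Times V open_UNIV)

lemma rho_M: "x \<in> M \<Longrightarrow> fst (rho br e r x) = fst x" "x \<in> M \<Longrightarrow> snd (snd (rho br e r x)) \<in> loop_alg"
  using V(2) by (auto simp: rho_def intro!: loop_alg_add loop_alg_const r_minus_loop)

lemma pull_lin:
  assumes "loop_valued s" "q \<in> V"
  shows "pull (lin_fun br s) (q, p, \<xi>) =
    - K \<xi> (incl e (fst (s q))) + (\<Sum>i\<in>UNIV. p $ i * lrestr br e (snd (s q)) $ i) + K (Qf q (snd (s q)) 0) \<xi>"
proof -
  have q: "q \<in> r_domain r" and s: "snd (s q) \<in> loop_alg"
    using assms V by (auto simp: loop_valued_def)
  have "(\<Sum>i\<in>UNIV. fst (s q) $ i * (- restr br e \<xi>) $ i) = - K \<xi> (incl e (fst (s q)))"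
    by (simp add: restr_def incl_def K_sum_right K_scale_right sum_negf)
  moreover have "lpair br (snd (s q)) (lconst (incl e p) + r_minus br r q \<xi>) =
      (\<Sum>i\<in>UNIV. p $ i * lrestr br e (snd (s q)) $ i) + K (Qf q (snd (s q)) 0) \<xi>"
    by (simp add: lpair_add_right[OF s loop_alg_const r_minus_loop[OF q]] lpair_lconst_incl[OF s] lpair_r_minus_eq[OF q s])
  ultimately show ?thesis by (simp add: lin_fun_def rho_def)
qed

lemma pull_lin_add:
  assumes "loop_valued s" "loop_valued t" "x \<in> M"
  shows "pull (lin_fun br (\<lambda>q. s q + t q)) x = pull (lin_fun br s) x + pull (lin_fun br t) x"
proof -
  obtain q y X where x: "rho br e r x = (q, y, X)" by (metis prod_cases3)
  have "q \<in> V" "X \<in> loop_alg" using rho_M[OF assms(3)] assms(3) x by auto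
  then show ?thesis
    using assms by (simp add: x lin_fun_def loop_valued_def lpair_add_left algebra_simps sum.distrib)
qed

lemma pull_lin_scale:
  assumes "loop_valued s" "x \<in> M"
  shows "pull (lin_fun br (\<lambda>q. fscale (f q) (s q))) x = f (fst x) * pull (lin_fun br s) x"
proof -
  obtain q y X where x: "rho br e r x = (q, y, X)" by (metis prod_cases3)
  have "q \<in> V" "X \<in> loop_alg" "q = fst x" using rho_M[OF assms(2)] assms(2) x by auto
  then show ?thesis
    using assms by (simp add: x lin_fun_def loop_valued_def fscale_def split_beta lpair_scale_left algebra_simps sum_distrib_left)
qed

lemma pull_lin_minus:
  assumes "loop_valued s" "x \<in> M"
  shows "pull (lin_fun br (\<lambda>q. - s q)) x = - pull (lin_fun br s) x"
proof -
  obtain q y X where x: "rho br e r x = (q, y, X)" by (metis prod_cases3)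
  have "q \<in> V" "X \<in> loop_alg" using rho_M[OF assms(2)] assms(2) x by auto
  then show ?thesis
    using assms by (simp add: x lin_fun_def loop_valued_def lpair_minus_left sum_negf)
qed

lemma loop_valued_add: "loop_valued s \<Longrightarrow> loop_valued t \<Longrightarrow> loop_valued (\<lambda>q. s q + t q)"
  and loop_valued_scale: "loop_valued s \<Longrightarrow> loop_valued (\<lambda>q. fscale (f q) (s q))"
  and loop_valued_minus: "loop_valued s \<Longrightarrow> loop_valued (\<lambda>q. - s q)"
  and loop_valued_const: "\<alpha> \<in> loop_alg \<Longrightarrow> loop_valued (\<lambda>q. (\<omega> q, \<alpha>))"
  by (auto simp: loop_valued_def fscale_def split_beta loop_alg_add loop_alg_scale loop_alg_minus)

abbreviation "holM A \<equiv> holomorphic_wrt S3 A M"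

lemma holM_base:
  assumes "holomorphic_wrt (*s) f V"
  shows "holM (\<lambda>x. f (fst x))"
  using holomorphic_wrt_compose_affine[OF assms bounded_linear_fst, of S3 M 0]
  by (simp add: scale3_def split_beta mem_Times_iff)

lemma holM_K: "holM (\<lambda>x. K (snd (snd x)) y)"
proof (rule holomorphic_wrt_linear)
  have "bounded_linear (\<lambda>x. \<Sum>a\<in>UNIV. snd (snd x) $ a * K (axis a 1) y)"
    for x :: "('l, 'n) source"
    by (intro bounded_linear_sum bounded_linear_mult_const bounded_linear_compose[OF bounded_linear_vec_nth]
        bounded_linear_compose[OF bounded_linear_snd] bounded_linear_snd)
  then show "bounded_linear (\<lambda>x :: ('l, 'n) source. K (snd (snd x)) y)"
    by (subst K_expand_left)
qed (simp add: scale3_def split_beta K_scale_left)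

lemma holM_p: "holM (\<lambda>x. fst (snd x) $ i)"
  by (rule holomorphic_wrt_linear)
    (auto simp: scale3_def split_beta intro!: bounded_linear_compose[OF bounded_linear_vec_nth]
        bounded_linear_compose[OF bounded_linear_fst] bounded_linear_snd)

lemma holM_lin:
  fixes \<omega> :: "complex ^ 'l \<Rightarrow> complex ^ 'l"
  assumes \<omega>: "\<And>i. holomorphic_wrt (*s) (\<lambda>q. \<omega> q $ i) V" and \<alpha>: "\<alpha> \<in> loop_alg"
  shows "holM (pull (lin_fun br (\<lambda>q. (\<omega> q, \<alpha>))))"
proof (rule holomorphic_wrt_cong[OF _ open_M])
  show "holM (\<lambda>x. - 1 * (\<Sum>i\<in>UNIV. \<omega> (fst x) $ i * K (snd (snd x)) (e i)) + (\<Sum>i\<in>UNIV. fst (snd x) $ i * lrestr br e \<alpha> $ i)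
      + (\<Sum>b\<in>UNIV. Qf (fst x) \<alpha> 0 $ b * K (snd (snd x)) (axis b 1)))"
    by (intro holomorphic_wrt_add holomorphic_wrt_mult holomorphic_wrt_sum holomorphic_wrt_const holM_K holM_p
        holM_base[OF \<omega>] holM_base[OF Qf_0_holomorphic[OF V(2,1) \<alpha>]])
next
  fix x assume "x \<in> M"
  then obtain q p \<xi> where x: "x = (q, p, \<xi>)" "q \<in> V" by auto
  show "- 1 * (\<Sum>i\<in>UNIV. \<omega> (fst x) $ i * K (snd (snd x)) (e i)) + (\<Sum>i\<in>UNIV. fst (snd x) $ i * lrestr br e \<alpha> $ i)
      + (\<Sum>b\<in>UNIV. Qf (fst x) \<alpha> 0 $ b * K (snd (snd x)) (axis b 1)) = pull (lin_fun br (\<lambda>q. (\<omega> q, \<alpha>))) x"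
    unfolding x(1) pull_lin[OF loop_valued_const[OF \<alpha>] x(2)]
    by (simp add: incl_def K_sum_right K_scale_right K_expand_left[of "Qf q \<alpha> 0"] K_sym[of \<xi>])
qed

lemma pull_section_holomorphic:
  assumes "s \<in> sections V"
  shows "loop_valued s \<and> holM (pull (lin_fun br s))"
  using assms
proof induction
  case (const \<xi> p)
  then show ?case using holM_lin[of "\<lambda>_. p"] by (simp add: loop_valued_const holomorphic_wrt_const)
next
  case (add s t)
  then have "holM (\<lambda>x. pull (lin_fun br s) x + pull (lin_fun br t) x)" by (intro holomorphic_wrt_add) auto
  then have "holM (pull (lin_fun br (\<lambda>q. s q + t q)))"
    by (rule holomorphic_wrt_cong[OF _ open_M]) (use add in \<open>simp add: pull_lin_add\<close>)
  with add show ?case by (simp add: loop_valued_add)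
next
  case (scale f s)
  then have "holM (\<lambda>x. f (fst x) * pull (lin_fun br s) x)" by (intro holomorphic_wrt_mult holM_base) auto
  then have "holM (pull (lin_fun br (\<lambda>q. fscale (f q) (s q))))"
    by (rule holomorphic_wrt_cong[OF _ open_M]) (use scale in \<open>simp add: pull_lin_scale\<close>)
  with scale show ?case by (simp add: loop_valued_scale)
qed

lemma pull_poly_holomorphic:
  assumes "F \<in> poly_functions br V"
  shows "holM (pull F)"
  using assms
proof induction
  case (base f)
  show ?case
    by (rule holomorphic_wrt_cong[OF holM_base[OF base] open_M]) (simp only: rho_M)
next
  case (lin s)
  then show ?case using pull_section_holomorphic by blast
next
  case (add F K)
  then show ?case by (intro holomorphic_wrt_add)
next
  case (mult F K)
  then show ?case by (intro holomorphic_wrt_mult)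
qed

lemma source_bracket_pb:
  assumes "holM A" "holM B" "x \<in> M"
  shows "source_bracket br A B x = pb (snd (snd x)) (fder A x) (fder B x)"
  using source_bracket_eq[OF assms(1,2), of "fst x" "fst (snd x)" "snd (snd x)"] assms(3) by simp

lemma source_bracket_skew:
  assumes "holM A" "holM B" "x \<in> M"
  shows "source_bracket br B A x = - source_bracket br A B x"
  unfolding source_bracket_pb[OF assms] source_bracket_pb[OF assms(2,1,3)] by (rule pb_skew)

lemma fder_cong:
  assumes "holM A" "x \<in> M" "\<And>x. x \<in> M \<Longrightarrow> A x = B x"
  shows "fder B x = fder A x"
  by (rule ext, rule fder_eqI, rule has_derivative_transform_within_open[OF holomorphic_wrtD(1)[OF assms(1,2)] open_M assms(2)])
    (rule assms(3))

text \<open>Formulas for pulled back functions hold on \<open>M\<close> only; \<open>M\<close> is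
  open, so the derivatives in the bracket see nothing beyond it. The other argument is reached
  through skew-symmetry.\<close>

lemma source_bracket_cong:
  assumes "holM A" "holM B" "x \<in> M" "\<And>x. x \<in> M \<Longrightarrow> B x = B' x"
  shows "source_bracket br A B' x = source_bracket br A B x"
  using source_bracket_pb[OF assms(1,2,3)] source_bracket_pb[OF assms(1) holomorphic_wrt_cong[OF assms(2) open_M assms(4)] assms(3)]
    fder_cong[OF assms(2,3,4)] by simp

lemma source_bracket_add:
  assumes "holM A" "holM B" "holM B'" "x \<in> M"
  shows "source_bracket br A (\<lambda>x. B x + B' x) x = source_bracket br A B x + source_bracket br A B' x"
proof -
  have "fder (\<lambda>x. B x + B' x) x = (\<lambda>v. 1 * fder B x v + 1 * fder B' x v)"
    by (rule ext, rule fder_eqI)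
      (simp add: has_derivative_add[OF holomorphic_wrtD(1)[OF assms(2,4)] holomorphic_wrtD(1)[OF assms(3,4)]])
  then show ?thesis
    using pb_linear[OF clin_fder[OF assms(2,4)] clin_fder[OF assms(3,4)], of "snd (snd x)" "fder A x" 1 1]
    unfolding source_bracket_pb[OF assms(1,2,4)] source_bracket_pb[OF assms(1,3,4)] source_bracket_pb[OF assms(1) holomorphic_wrt_add[OF assms(2,3)] assms(4)]
    by simp
qed

lemma source_bracket_mult:
  assumes "holM A" "holM B" "holM B'" "x \<in> M"
  shows "source_bracket br A (\<lambda>x. B x * B' x) x = source_bracket br A B x * B' x + B x * source_bracket br A B' x"
proof -
  have "fder (\<lambda>x. B x * B' x) x = (\<lambda>v. B' x * fder B x v + B x * fder B' x v)"
    by (rule ext, rule fder_eqI)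
      (use has_derivative_mult[OF holomorphic_wrtD(1)[OF assms(2,4)] holomorphic_wrtD(1)[OF assms(3,4)]] in
        \<open>simp add: mult.commute add.commute\<close>)
  then show ?thesis
    using pb_linear[OF clin_fder[OF assms(2,4)] clin_fder[OF assms(3,4)], of "snd (snd x)" "fder A x" "B' x" "B x"]
    unfolding source_bracket_pb[OF assms(1,2,4)] source_bracket_pb[OF assms(1,3,4)] source_bracket_pb[OF assms(1) holomorphic_wrt_mult[OF assms(2,3)] assms(4)]
    by (simp add: mult.commute)
qed

text \<open>Pulled back linear functions are affine along directions of \<open>p\<close> and of
  \<open>\<xi>\<close>, so their derivatives there can be read off exactly.\<close>

lemma DERIV_line:
  fixes a b D :: complex
  assumes "(f has_field_derivative D) (at 0)" "\<And>t. f t = a + t * b"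
  shows "D = b"
proof -
  have "((\<lambda>t. a + t * b) has_field_derivative b) (at 0)"
    by (auto intro!: derivative_eq_intros)
  moreover have "f = (\<lambda>t. a + t * b)" using assms(2) by (rule ext)
  ultimately show ?thesis using DERIV_unique[OF assms(1)] by simp
qed

context
  fixes s :: "('l, 'n) sect" and q p :: "complex ^ 'l" and \<xi> :: "complex ^ 'n"
  assumes s: "loop_valued s" "holM (pull (lin_fun br s))" and q: "q \<in> V"
begin

lemma fder_lin_p: "fder (pull (lin_fun br s)) (q, p, \<xi>) (0, axis i 1, 0) = lrestr br e (snd (s q)) $ i"
proof (rule DERIV_line[OF line3[OF s(2)]])
  show "(q, p, \<xi>) \<in> M" using q by simp
next
  fix t :: complex
  have "(\<Sum>j\<in>UNIV. axis i 1 $ j * lrestr br e (snd (s q)) $ j) = lrestr br e (snd (s q)) $ i"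
    by (simp add: axis_def if_distrib if_distribR cong: if_cong)
  then have "(\<Sum>j\<in>UNIV. (p + t *s axis i 1) $ j * lrestr br e (snd (s q)) $ j) =
      (\<Sum>j\<in>UNIV. p $ j * lrestr br e (snd (s q)) $ j) + t * lrestr br e (snd (s q)) $ i"
    by (simp add: distrib_right sum.distrib mult.assoc flip: sum_distrib_left)
  then show "pull (lin_fun br s) ((q, p, \<xi>) + S3 t (0, axis i 1, 0)) =
      pull (lin_fun br s) (q, p, \<xi>) + t * lrestr br e (snd (s q)) $ i"
    by (simp add: scale3_def pull_lin[OF s(1) q] del: vector_add_component vector_smult_component)
qed

lemma grad_lin: "grad (fder (pull (lin_fun br s)) (q, p, \<xi>)) = Qf q (snd (s q)) 0 - incl e (fst (s q))"
proof (rule grad_eqI, rule sym, rule DERIV_line[OF line3[OF s(2)]])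
  show "(q, p, \<xi>) \<in> M" using q by simp
next
  fix \<eta> :: "complex ^ 'n" and t :: complex
  show "pull (lin_fun br s) ((q, p, \<xi>) + S3 t (0, 0, \<eta>)) =
      pull (lin_fun br s) (q, p, \<xi>) + t * K \<eta> (Qf q (snd (s q)) 0 - incl e (fst (s q)))"
    by (simp add: scale3_def pull_lin[OF s(1) q] K_add_left K_add_right K_scale_left K_scale_right K_diff_right
        K_sym[of _ \<eta>] algebra_simps)
qed

end

text \<open>Only the Q term varies with \<open>q\<close> for a constant section; variable
  coefficients are left to the Leibniz rule.\<close>

lemma fder_lin_q:
  assumes \<alpha>: "\<alpha> \<in> loop_alg" and q: "q \<in> V"
  shows "fder (pull (lin_fun br (\<lambda>q. (p0, \<alpha>)))) (q, p, \<xi>) (axis i 1, 0, 0) = pderiv_at i (\<lambda>q. K (Qf q \<alpha> 0) \<xi>) q"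
proof -
  have hol: "holM (pull (lin_fun br (\<lambda>q. (p0, \<alpha>))))"
    using holM_lin[of "\<lambda>_. p0", OF holomorphic_wrt_const \<alpha>] .
  have "fder (pull (lin_fun br (\<lambda>q. (p0, \<alpha>)))) (q, p, \<xi>) (axis i 1, 0, 0) =
      pderiv_at i (\<lambda>q. pull (lin_fun br (\<lambda>q. (p0, \<alpha>))) (q, p, \<xi>)) q"
    using DERIV_imp_deriv[OF line3[OF hol], of "(q, p, \<xi>)" "(axis i 1, 0, 0)"] q
    by (simp add: pderiv_at_def scale3_def axis_scale[of i "_ :: complex", symmetric])
  also have "\<dots> = pderiv_at i (\<lambda>q. K (Qf q \<alpha> 0) \<xi> + (- K \<xi> (incl e p0) + (\<Sum>i\<in>UNIV. p $ i * lrestr br e \<alpha> $ i))) q"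
    by (rule pderiv_at_cong[OF V(1) q]) (simp add: pull_lin[OF loop_valued_const[OF \<alpha>]])
  finally show ?thesis by (simp only: pderiv_at_add_const)
qed

lemma fder_base:
  assumes "holomorphic_wrt (*s) f V" "x \<in> M"
  shows "fder (\<lambda>x. f (fst x)) x v = fder f (fst x) (fst v)"
  using fder_compose_affine[OF assms(1) bounded_linear_fst, of x 0 v] assms(2) by (simp add: mem_Times_iff)

lemma fder_base_0:
  assumes "holomorphic_wrt (*s) f V" "x \<in> M"
  shows "fder (\<lambda>x. f (fst x)) x (0, v) = 0"
  unfolding fder_base[OF assms] using holomorphic_wrtD(2)[OF assms(1), of "fst x" 0 0] assms(2) by (simp add: mem_Times_iff)

lemma grad_base:
  assumes "holomorphic_wrt (*s) f V" "x \<in> M"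
  shows "grad (fder (\<lambda>x. f (fst x)) x) = 0"
  by (rule grad_eqI) (simp add: fder_base_0[OF assms] K_expand[of _ 0])

text \<open>A function of \<open>q\<close> pairs only with the \<open>p\<close> derivative of the
  linear function, and that derivative is the anchor of the section.\<close>

lemma source_bracket_lin_base:
  assumes s: "loop_valued s" "holM (pull (lin_fun br s))" and f: "holomorphic_wrt (*s) f V" and x: "x \<in> M"
  shows "source_bracket br (pull (lin_fun br s)) (\<lambda>x. f (fst x)) x = anchor br e s f (fst x)"
proof -
  obtain q p \<xi> where xe: "x = (q, p, \<xi>)" "q \<in> V" using x by auto
  show ?thesis
    unfolding source_bracket_pb[OF s(2) holM_base[OF f] x] pb_def grad_base[OF f x] anchor_def
    using fder_lin_p[OF s xe(2)] fder_base[OF f x] fder_base_0[OF f x] pderiv_at_eq[OF f xe(2)]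
    by (simp add: xe(1))
qed

lemma source_bracket_base_base:
  assumes "holomorphic_wrt (*s) f V" "holomorphic_wrt (*s) g V" "x \<in> M"
  shows "source_bracket br (\<lambda>x. f (fst x)) (\<lambda>x. g (fst x)) x = 0"
  unfolding source_bracket_pb[OF holM_base[OF assms(1)] holM_base[OF assms(2)] assms(3)] pb_def
    grad_base[OF assms(1,3)] grad_base[OF assms(2,3)]
  by (simp add: fder_base_0[OF assms(1,3)] fder_base_0[OF assms(2,3)])

section \<open>The map is Poisson\<close>

lemma lbracket_lconst:
  assumes "br x y = 0"
  shows "lbracket br (lconst x) (lconst y) = 0"
proof (rule represents_unique)
  show "represents (\<lambda>z. br x y) (lbracket br (lconst x) (lconst y))"
    by (intro represents_br represents_const)
  show "represents (\<lambda>z. br x y) 0"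
  proof -
    have "leval 0 = (\<lambda>z. 0 :: complex ^ 'n)" by (simp add: fun_eq_iff leval_def flip: zero_vec_def)
    moreover have "represents (leval 0) (0 :: 'n loop)" by (rule represents_leval[OF loop_alg_0])
    ultimately show ?thesis by (simp add: assms)
  qed
qed

text \<open>Without a loop part only the bracket of two elements of \<open>h\<close> is left, and
  \<open>h\<close> is abelian.\<close>

lemma source_bracket_forms:
  fixes \<omega> \<theta> :: "complex ^ 'l \<Rightarrow> complex ^ 'l"
  assumes "\<forall>i. holomorphic_wrt (*s) (\<lambda>q. \<omega> q $ i) V" "\<forall>i. holomorphic_wrt (*s) (\<lambda>q. \<theta> q $ i) V" "x \<in> M"
  shows "source_bracket br (pull (lin_fun br (\<lambda>q. (\<omega> q, 0)))) (pull (lin_fun br (\<lambda>q. (\<theta> q, 0)))) x = 0"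
proof -
  obtain q p \<xi> where x: "x = (q, p, \<xi>)" "q \<in> V" using assms(3) by auto
  have \<omega>: "loop_valued (\<lambda>q. (\<omega> q, 0))" "holM (pull (lin_fun br (\<lambda>q. (\<omega> q, 0))))"
    using loop_valued_const[OF loop_alg_0] holM_lin[OF assms(1)[rule_format] loop_alg_0] .
  have \<theta>: "loop_valued (\<lambda>q. (\<theta> q, 0))" "holM (pull (lin_fun br (\<lambda>q. (\<theta> q, 0))))"
    using loop_valued_const[OF loop_alg_0] holM_lin[OF assms(2)[rule_format] loop_alg_0] .
  show ?thesis
    unfolding source_bracket_pb[OF \<omega>(2) \<theta>(2) assms(3)]
    unfolding x(1) pb_def grad_lin[OF \<omega> x(2)] grad_lin[OF \<theta> x(2)]
      fder_lin_p[OF \<omega> x(2)] fder_lin_p[OF \<theta> x(2)]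
    by (simp add: Qf_zero lrestr_zero br_minus_left br_minus_right h_abelian incl_in_h)
qed

text \<open>The differential of the form has only a g component, minus \<open>incl e p0\<close>, so
  the source bracket is one term in Q of \<open>\<eta>\<close> at 0. Zero weight identifies it with
  the pairing with \<open>r_minus\<close>.\<close>

lemma source_bracket_form_loop:
  assumes \<eta>: "\<eta> \<in> loop_alg" and x: "x \<in> M"
  shows "source_bracket br (pull (lin_fun br (\<lambda>q. (p0, 0)))) (pull (lin_fun br (\<lambda>q. (0, \<eta>)))) x =
    pull (lin_fun br (\<lambda>q. (0, adstar br (lconst (incl e p0)) \<eta>))) x"
proof -
  obtain q p \<xi> where xe: "x = (q, p, \<xi>)" "q \<in> V" using x by auto
  have q: "q \<in> r_domain r" using xe V by auto
  note c = loop_alg_const[of "incl e p0"]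
  have s: "loop_valued (\<lambda>q. (p0, 0))" "holM (pull (lin_fun br (\<lambda>q. (p0, 0))))"
    using loop_valued_const[OF loop_alg_0] holM_lin[of "\<lambda>_. p0", OF holomorphic_wrt_const loop_alg_0] .
  have t: "loop_valued (\<lambda>q. (0, \<eta>))" "holM (pull (lin_fun br (\<lambda>q. (0, \<eta>))))"
    using loop_valued_const[OF \<eta>] holM_lin[of "\<lambda>_. 0", OF holomorphic_wrt_const \<eta>] .
  have "source_bracket br (pull (lin_fun br (\<lambda>q. (p0, 0)))) (pull (lin_fun br (\<lambda>q. (0, \<eta>)))) x
      = - K \<xi> (br (incl e p0) (Qf q \<eta> 0))"
    unfolding source_bracket_pb[OF s(2) t(2) x]
    unfolding xe(1) pb_def grad_lin[OF s xe(2)] grad_lin[OF t xe(2)]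
      fder_lin_p[OF s xe(2)] fder_lin_p[OF t xe(2)] fder_lin_q[OF loop_alg_0 xe(2)]
    by (simp add: Qf_zero lrestr_zero incl_zero br_minus_left K_minus_right pderiv_at_def)
  \<comment> \<open>The first pairing is zero, as \<open>h\<close> is abelian; it is inserted to
    complete the loop component of the map.\<close>
  also have "\<dots> = lpair br \<eta> (lbracket br (lconst (incl e p0)) (lconst (incl e p)))
      + lpair br \<eta> (lbracket br (lconst (incl e p0)) (r_minus br r q \<xi>))"
    unfolding lbracket_lconst[OF h_abelian[OF incl_in_h incl_in_h]] lpair_bracket_const[OF q \<eta> incl_in_h]
    by (simp add: lpair_def leval_def residue_const flip: zero_vec_def)
  also have "\<dots> = lpair br (lbracket br \<eta> (lconst (incl e p0))) (lconst (incl e p) + r_minus br r q \<xi>)"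
    unfolding lpair_invariant[OF \<eta> c loop_alg_const, symmetric] lpair_invariant[OF \<eta> c r_minus_loop[OF q], symmetric]
    by (rule lpair_add_right[symmetric]) (intro loop_alg_bracket loop_alg_const r_minus_loop q \<eta>)+
  finally show ?thesis
    by (simp add: adstar_eq[OF c \<eta>] xe(1) lin_fun_def rho_def)
qed

text \<open>The source bracket produces two derivative terms and one quadratic term of the
  integrated Yang--Baxter equation; the remaining terms are the fibre coordinate paired with the
  derivative of R and \<open>r_minus\<close> paired with the two coadjoint terms.\<close>

lemma source_bracket_loops:
  assumes \<alpha>: "\<alpha> \<in> loop_alg" and \<eta>: "\<eta> \<in> loop_alg" and x: "x \<in> M"
  shows "source_bracket br (pull (lin_fun br (\<lambda>q. (0, \<alpha>)))) (pull (lin_fun br (\<lambda>q. (0, \<eta>)))) x =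
    pull (lin_fun br (\<lambda>q. (\<chi> i. pderiv_at i (\<lambda>q'. lpair br \<eta> (R_op br r q' \<alpha>)) q,
             - adstar br (R_op br r q \<alpha>) \<eta> + adstar br (R_op br r q \<eta>) \<alpha>))) x"
proof -
  obtain q p \<xi> where xe: "x = (q, p, \<xi>)" "q \<in> V" using x by auto
  have q: "q \<in> r_domain r" using xe V by auto
  note R = R_op_loop[OF q \<alpha>] R_op_loop[OF q \<eta>]
  note c = loop_alg_const[of "incl e p"] and rm = r_minus_loop[OF q, of \<xi>]
  define Y where "Y = lconst (incl e p) + r_minus br r q \<xi>"
  have Y: "Y \<in> loop_alg" unfolding Y_def by (intro loop_alg_add c rm)
  have s: "loop_valued (\<lambda>q. (0, \<alpha>))" "holM (pull (lin_fun br (\<lambda>q. (0, \<alpha>))))"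
    using loop_valued_const[OF \<alpha>] holM_lin[of "\<lambda>_. 0", OF holomorphic_wrt_const \<alpha>] .
  have t: "loop_valued (\<lambda>q. (0, \<eta>))" "holM (pull (lin_fun br (\<lambda>q. (0, \<eta>))))"
    using loop_valued_const[OF \<eta>] holM_lin[of "\<lambda>_. 0", OF holomorphic_wrt_const \<eta>] .
  have split: "lpair br \<beta> (lbracket br X Y) = lpair br \<beta> (lbracket br X (lconst (incl e p))) + lpair br \<beta> (lbracket br X (r_minus br r q \<xi>))"
    if "\<beta> \<in> loop_alg" "X \<in> loop_alg" for \<beta> X
    unfolding lpair_invariant[OF that Y, symmetric] lpair_invariant[OF that c, symmetric] lpair_invariant[OF that rm, symmetric]
    unfolding Y_def by (intro lpair_add_right loop_alg_bracket that c rm)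
  have "source_bracket br (pull (lin_fun br (\<lambda>q. (0, \<alpha>)))) (pull (lin_fun br (\<lambda>q. (0, \<eta>)))) x
      = (\<Sum>i\<in>UNIV. lrestr br e \<alpha> $ i * pderiv_at i (\<lambda>q. K (Qf q \<eta> 0) \<xi>) q
          - pderiv_at i (\<lambda>q. K (Qf q \<alpha> 0) \<xi>) q * lrestr br e \<eta> $ i)
        + K \<xi> (br (Qf q \<alpha> 0) (Qf q \<eta> 0))"
    unfolding source_bracket_pb[OF s(2) t(2) x]
    unfolding xe(1) pb_def grad_lin[OF s xe(2)] grad_lin[OF t xe(2)]
      fder_lin_p[OF s xe(2)] fder_lin_p[OF t xe(2)] fder_lin_q[OF \<alpha> xe(2)] fder_lin_q[OF \<eta> xe(2)]
    by (simp add: incl_zero)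
  also have "\<dots> = - (\<Sum>i\<in>UNIV. K (e i) \<xi> * pderiv_at i (\<lambda>q. lpair br \<eta> (R_op br r q \<alpha>)) q)
      - lpair br \<eta> (lbracket br (R_op br r q \<alpha>) (r_minus br r q \<xi>))
      + lpair br \<alpha> (lbracket br (R_op br r q \<eta>) (r_minus br r q \<xi>))"
    using integrated_Yang_Baxter[OF q \<alpha> \<eta>, of \<xi>]
    by (simp add: sum.distrib sum_subtractf algebra_simps eq_neg_iff_add_eq_0)
  \<comment> \<open>Passing from \<open>r_minus\<close> to the full loop \<open>Y\<close> adds two
    terms in \<open>p\<close>, which cancel.\<close>
  also have "\<dots> = - (\<Sum>i\<in>UNIV. K (e i) \<xi> * pderiv_at i (\<lambda>q. lpair br \<eta> (R_op br r q \<alpha>)) q)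
      - lpair br \<eta> (lbracket br (R_op br r q \<alpha>) Y) + lpair br \<alpha> (lbracket br (R_op br r q \<eta>) Y)"
    unfolding split[OF \<eta> R(1)] split[OF \<alpha> R(2)] R_op_bracket_const[OF q \<alpha> \<eta> incl_in_h] by simp
  also have "\<dots> = - (\<Sum>i\<in>UNIV. K (e i) \<xi> * pderiv_at i (\<lambda>q. lpair br \<eta> (R_op br r q \<alpha>)) q)
      + lpair br (- lbracket br \<eta> (R_op br r q \<alpha>) + lbracket br \<alpha> (R_op br r q \<eta>)) Y"
    by (simp add: lpair_add_left lpair_minus_left lpair_invariant loop_alg_minus loop_alg_bracket \<alpha> \<eta> R Y
        del: add_uminus_conv_diff uminus_add_conv_diff)
  finally show ?thesis
    by (simp add: adstar_eq \<alpha> \<eta> R xe(1) lin_fun_def rho_def restr_def K_sym[of \<xi>] sum_negf mult.commute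
        flip: Y_def del: add_uminus_conv_diff uminus_add_conv_diff)
qed

text \<open>The bracket identity alone would not survive the induction: the sum and Leibniz rules
  differentiate the arguments, so their holomorphy is carried along. The value \<open>u\<close> is
  evaluated but never differentiated, so being loop-valued is enough for it.\<close>

lemma algebroid_bracket_pull:
  assumes "algebroid_bracket br e r V s t u"
  shows "loop_valued s \<and> loop_valued t \<and> loop_valued u \<and> holM (pull (lin_fun br s)) \<and> holM (pull (lin_fun br t)) \<and>
    (\<forall>x\<in>M. source_bracket br (pull (lin_fun br s)) (pull (lin_fun br t)) x = pull (lin_fun br u) x)"
  using assms
proof induction
  case (forms \<omega> \<theta>)
  have "loop_valued (\<lambda>q. 0)" by (simp add: loop_valued_def loop_alg_0)
  moreover have "pull (lin_fun br (\<lambda>q. 0)) x = 0" for x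
    by (simp add: lin_fun_def split_beta lpair_def leval_def residue_const flip: zero_vec_def)
  ultimately show ?case
    using forms by (simp add: loop_valued_const loop_alg_0 holM_lin source_bracket_forms del: mem_Times_iff UNIV_Times_UNIV)
next
  case (form_loop \<xi> p)
  then have "loop_valued (\<lambda>q. (0, adstar br (lconst (incl e p)) \<xi>))"
    by (simp add: loop_valued_def adstar_eq loop_alg_bracket loop_alg_const)
  then show ?case
    using form_loop source_bracket_form_loop[OF form_loop] holM_lin[of "\<lambda>_. p"] holM_lin[of "\<lambda>_. 0"]
    by (simp add: loop_valued_const loop_alg_0 holomorphic_wrt_const del: mem_Times_iff UNIV_Times_UNIV)
next
  case (loops \<xi> \<eta>)
  have "loop_valued (\<lambda>q. (\<chi> i. pderiv_at i (\<lambda>q'. lpair br \<eta> (R_op br r q' \<xi>)) q,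
             - adstar br (R_op br r q \<xi>) \<eta> + adstar br (R_op br r q \<eta>) \<xi>))"
    unfolding loop_valued_def
  proof (intro ballI)
    fix q assume "q \<in> V"
    then have q: "q \<in> r_domain r" using V(2) by auto
    show "snd ((\<chi> i. pderiv_at i (\<lambda>q'. lpair br \<eta> (R_op br r q' \<xi>)) q,
             - adstar br (R_op br r q \<xi>) \<eta> + adstar br (R_op br r q \<eta>) \<xi>)) \<in> loop_alg"
      unfolding snd_conv adstar_eq[OF R_op_loop[OF q loops(1)] loops(2)] adstar_eq[OF R_op_loop[OF q loops(2)] loops(1)]
      by (intro loop_alg_add loop_alg_minus loop_alg_bracket R_op_loop q loops)
  qed
  then show ?case
    using loops source_bracket_loops[OF loops] holM_lin[of "\<lambda>_. 0"]
    by (simp add: loop_valued_const holomorphic_wrt_const del: mem_Times_iff UNIV_Times_UNIV)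
next
  case (skew s t u)
  then have "source_bracket br (pull (lin_fun br t)) (pull (lin_fun br s)) x =
      - source_bracket br (pull (lin_fun br s)) (pull (lin_fun br t)) x" if "x \<in> M" for x
    using source_bracket_skew that by blast
  with skew show ?case by (simp add: loop_valued_minus pull_lin_minus del: mem_Times_iff UNIV_Times_UNIV)
next
  case (add s t u t' u')
  have "holM (\<lambda>x. pull (lin_fun br t) x + pull (lin_fun br t') x)"
    using add by (intro holomorphic_wrt_add) auto
  moreover from this have "holM (pull (lin_fun br (\<lambda>q. t q + t' q)))"
    by (rule holomorphic_wrt_cong[OF _ open_M]) (use add in \<open>simp add: pull_lin_add\<close>)
  moreover have "source_bracket br (pull (lin_fun br s)) (pull (lin_fun br (\<lambda>q. t q + t' q))) x =
      source_bracket br (pull (lin_fun br s)) (\<lambda>x. pull (lin_fun br t) x + pull (lin_fun br t') x) x" if "x \<in> M" for x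
    by (rule source_bracket_cong) (use add calculation(1) that in \<open>simp_all add: pull_lin_add\<close>)
  ultimately show ?case
    using add by (simp add: loop_valued_add source_bracket_add pull_lin_add del: mem_Times_iff UNIV_Times_UNIV)
next
  case (leibniz s t u f)
  have f: "holM (\<lambda>x. f (fst x))" by (rule holM_base[OF leibniz.hyps(2)])
  have prod: "holM (\<lambda>x. f (fst x) * pull (lin_fun br t) x)"
    using leibniz by (intro holomorphic_wrt_mult f) auto
  then have "holM (pull (lin_fun br (\<lambda>q. fscale (f q) (t q))))"
    by (rule holomorphic_wrt_cong[OF _ open_M]) (use leibniz in \<open>simp add: pull_lin_scale\<close>)
  moreover have "source_bracket br (pull (lin_fun br s)) (pull (lin_fun br (\<lambda>q. fscale (f q) (t q)))) x =
      pull (lin_fun br (\<lambda>q. fscale (f q) (u q) + fscale (anchor br e s f q) (t q))) x" if x: "x \<in> M" for x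
  proof -
    have "source_bracket br (pull (lin_fun br s)) (pull (lin_fun br (\<lambda>q. fscale (f q) (t q)))) x =
      source_bracket br (pull (lin_fun br s)) (\<lambda>x. f (fst x) * pull (lin_fun br t) x) x"
      by (rule source_bracket_cong) (use leibniz prod x in \<open>simp_all add: pull_lin_scale\<close>)
    also have "\<dots> = anchor br e s f (fst x) * pull (lin_fun br t) x + f (fst x) * pull (lin_fun br u) x"
    proof -
      have s: "loop_valued s" "holM (pull (lin_fun br s))" and t: "holM (pull (lin_fun br t))"
        and st: "source_bracket br (pull (lin_fun br s)) (pull (lin_fun br t)) x = pull (lin_fun br u) x"
        using leibniz.IH x by auto
      show ?thesis
        unfolding source_bracket_mult[OF s(2) f t x] source_bracket_lin_base[OF s leibniz.hyps(2) x] st ..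
    qed
    finally show ?thesis
      using leibniz x by (simp add: pull_lin_add pull_lin_scale loop_valued_scale del: mem_Times_iff UNIV_Times_UNIV)
  qed
  ultimately show ?case
    using leibniz by (simp add: loop_valued_add loop_valued_scale del: mem_Times_iff UNIV_Times_UNIV)
qed

lemma lie_poisson_pull:
  assumes "lie_poisson br e r V F H G"
  shows "holM (pull F) \<and> holM (pull H) \<and> (\<forall>x\<in>M. source_bracket br (pull F) (pull H) x = pull G x)"
  using assms
proof induction
  case (lin_lin s t u)
  then show ?case using algebroid_bracket_pull by blast
next
  case (lin_base s f)
  have eq: "f (fst x) = f (fst (rho br e r x))" if "x \<in> M" for x by (simp only: rho_M(1)[OF that])
  have s: "loop_valued s" "holM (pull (lin_fun br s))" using pull_section_holomorphic[OF lin_base(1)] by auto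
  note f = holM_base[OF lin_base(2)]
  show ?case
    using s holomorphic_wrt_cong[OF f open_M eq] source_bracket_cong[OF s(2) f _ eq] source_bracket_lin_base[OF s lin_base(2)]
    by (simp add: rho_M del: mem_Times_iff UNIV_Times_UNIV)
next
  case (base_base f g)
  have eq: "f (fst x) = f (fst (rho br e r x))" "g (fst x) = g (fst (rho br e r x))" if "x \<in> M" for x
    by (simp_all only: rho_M(1)[OF that])
  note fg = holM_base[OF base_base(1)] holM_base[OF base_base(2)]
  note fg' = holomorphic_wrt_cong[OF fg(1) open_M eq(1)] holomorphic_wrt_cong[OF fg(2) open_M eq(2)]
  \<comment> \<open>Replacing functions by equal ones on \<open>M\<close> works in the second
    argument, so the first is treated by two uses of skew-symmetry.\<close>
  have "source_bracket br (pull (\<lambda>x. f (fst x))) (pull (\<lambda>x. g (fst x))) x = 0" if x: "x \<in> M" for x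
  proof -
    have "source_bracket br (pull (\<lambda>x. f (fst x))) (pull (\<lambda>x. g (fst x))) x =
        source_bracket br (pull (\<lambda>x. f (fst x))) (\<lambda>x. g (fst x)) x"
      by (rule source_bracket_cong[OF fg'(1) fg(2) x eq(2)])
    also have "\<dots> = - source_bracket br (\<lambda>x. g (fst x)) (pull (\<lambda>x. f (fst x))) x"
      by (rule source_bracket_skew[OF fg(2) fg'(1) x])
    also have "\<dots> = - source_bracket br (\<lambda>x. g (fst x)) (\<lambda>x. f (fst x)) x"
      by (simp only: source_bracket_cong[OF fg(2,1) x eq(1)])
    finally show ?thesis by (simp only: source_bracket_base_base[OF base_base(2,1) x] minus_zero)
  qed
  with fg' show ?case by (simp del: mem_Times_iff UNIV_Times_UNIV)
next
  case (skew F H G)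
  then have "source_bracket br (pull H) (pull F) x = - source_bracket br (pull F) (pull H) x" if "x \<in> M" for x
    using source_bracket_skew that by blast
  with skew show ?case by (simp del: mem_Times_iff UNIV_Times_UNIV)
next
  case (add F H G H' G')
  then show ?case by (simp add: source_bracket_add holomorphic_wrt_add del: mem_Times_iff UNIV_Times_UNIV)
next
  case (mult F H G H' G')
  then show ?case by (simp add: source_bracket_mult holomorphic_wrt_mult del: mem_Times_iff UNIV_Times_UNIV)
qed

end

text \<open>The additive and Leibniz rules act on the second argument only. Skew-symmetry exchanges
  the arguments, so each in turn is reduced to constant sections, and these are split into a form
  and a loop.\<close>

lemma algebroid_bracket_exists:
  assumes "s \<in> sections V" "t \<in> sections V"
  shows "\<exists>u. algebroid_bracket br e r V s t u"
proof -
  let ?B = "\<lambda>s t. \<exists>u. algebroid_bracket br e r V s t u"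
  have skew: "?B t s" if "?B s t" for s t using that algebroid_bracket.skew by blast
  have add: "?B s (\<lambda>q. (p, \<xi>))" if B: "?B s (\<lambda>q. (p, 0))" "?B s (\<lambda>q. (0, \<xi>))" for s p \<xi>
  proof -
    obtain u u' where "algebroid_bracket br e r V s (\<lambda>q. (p, 0)) u" "algebroid_bracket br e r V s (\<lambda>q. (0, \<xi>)) u'"
      using B by blast
    from algebroid_bracket.add[OF this] show ?thesis by auto
  qed
  have const: "?B (\<lambda>q. (p, \<xi>)) (\<lambda>q. (p', \<xi>'))" if \<xi>: "\<xi> \<in> loop_alg" "\<xi>' \<in> loop_alg" for p \<xi> p' \<xi>'
  proof -
    have "?B (\<lambda>q. (p', \<xi>')) (\<lambda>q. (p, 0))"
      by (rule skew, rule add)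
        (use algebroid_bracket.forms[of "\<lambda>_. p" V "\<lambda>_. p'"] algebroid_bracket.form_loop[OF \<xi>(2)] holomorphic_wrt_const in blast)+
    moreover have "?B (\<lambda>q. (p', \<xi>')) (\<lambda>q. (0, \<xi>))"
      by (rule skew, rule add, rule skew)
        (use algebroid_bracket.form_loop[OF \<xi>(1)] algebroid_bracket.loops[OF \<xi>] in blast)+
    ultimately show ?thesis by (rule skew[OF add])
  qed
  have step: "?B s t" if t: "t \<in> sections V" and "\<And>p \<xi>. \<xi> \<in> loop_alg \<Longrightarrow> ?B s (\<lambda>q. (p, \<xi>))" for s t
    using t
  proof induction
    case (const \<xi> p)
    then show ?case by (rule that(2))
  next
    case (add t t')
    then show ?case using algebroid_bracket.add by blast
  next
    case (scale f t)
    then show ?case using algebroid_bracket.leibniz by blast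
  qed
  show ?thesis
    by (rule step[OF assms(2)], rule skew, rule step[OF assms(1)], rule const)
qed

lemma lie_poisson_exists:
  assumes "F \<in> poly_functions br V" "H \<in> poly_functions br V"
  shows "\<exists>G. lie_poisson br e r V F H G"
proof -
  let ?B = "\<lambda>F H. \<exists>G. lie_poisson br e r V F H G"
  have skew: "?B H F" if "?B F H" for F H using that lie_poisson.skew by blast
  have step: "?B F H" if H: "H \<in> poly_functions br V"
    and base: "\<And>f. holomorphic_wrt (*s) f V \<Longrightarrow> ?B F (\<lambda>x. f (fst x))"
    and lin: "\<And>s. s \<in> sections V \<Longrightarrow> ?B F (lin_fun br s)" for F H
    using H
  proof induction
    case (base f)
    then show ?case by (rule that(2))
  next
    case (lin s)
    then show ?case by (rule that(3))
  next
    case (add H H')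
    then show ?case using lie_poisson.add by blast
  next
    case (mult H H')
    then show ?case using lie_poisson.mult by blast
  qed
  have base: "?B F (\<lambda>x. f (fst x))" if F: "F \<in> poly_functions br V" and f: "holomorphic_wrt (*s) f V" for F f
    \<comment> \<open>The first argument \<open>F\<close> is itself decomposed after a flip, since
      the generating rules need both arguments to be generators.\<close>
    by (rule skew, rule step[OF F]) (use f lie_poisson.base_base lie_poisson.lin_base in \<open>blast intro: skew\<close>)+
  have lin: "?B F (lin_fun br s)" if F: "F \<in> poly_functions br V" and s: "s \<in> sections V" for F s
  proof (rule skew, rule step[OF F])
    show "?B (lin_fun br s) (\<lambda>x. f (fst x))" if "holomorphic_wrt (*s) f V" for f
      using lie_poisson.lin_base[OF s that] by blast
    show "?B (lin_fun br s) (lin_fun br t)" if t: "t \<in> sections V" for t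
      using algebroid_bracket_exists[OF s t] lie_poisson.lin_lin[OF s t] by blast
  qed
  show ?thesis by (rule step[OF assms(2)]) (use assms(1) base lin in auto)
qed

end

theorem proposition3p2:
  fixes br :: "complex ^ 'n::finite \<Rightarrow> complex ^ 'n \<Rightarrow> complex ^ 'n"
    and h :: "(complex ^ 'n) set"
    and e :: "'l::finite \<Rightarrow> complex ^ 'n"
    and r :: "(complex ^ 'l) \<times> complex \<Rightarrow> complex ^ 'n ^ 'n"
    and V :: "(complex ^ 'l) set"
  assumes "simple_lie_algebra br"
    and "cartan_subalgebra br h"
    and "orthonormal_basis br h e"
    and "dynamical_r_matrix br h e r"
    and "open V" and "V \<subseteq> r_domain r"
  shows "poisson_map
           (V \<times> UNIV \<times> UNIV) {A. holomorphic_wrt scale3 A (V \<times> UNIV \<times> UNIV)} (source_bracket br)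
           (V \<times> UNIV \<times> loop_alg) (poly_functions br V) (lie_poisson br e r V)
           (rho br e r)"
proof -
  interpret r_matrix br h e r
    using assms by unfold_locales
  have "rho br e r ` (V \<times> UNIV \<times> UNIV) \<subseteq> V \<times> UNIV \<times> loop_alg"
    by (rule image_subsetI) (use rho_M[OF assms(5,6)] in \<open>simp add: mem_Times_iff del: UNIV_Times_UNIV\<close>)
  then show ?thesis
    unfolding poisson_map_def
    using pull_poly_holomorphic[OF assms(5,6)] lie_poisson_pull[OF assms(5,6)] lie_poisson_exists
    by (simp add: o_def del: mem_Times_iff UNIV_Times_UNIV)
qed

end
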